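(* Let $(M^n,g)$ be a compact, connected, oriented Riemannian manifold without boundary of dimension $n\ge2$ and let $f\in L^1(M)$. Then $$\lim_{r\to0^+}Q_f(r)=k_nV[f],$$ where both sides may equal $+\infty$.
   Context: Integration over $M$ is with respect to the Riemannian volume. $\sigma_k$ is the $k$-dimensional volume of the Euclidean unit sphere $S^k$; $S_xM=\{w\in T_xM:\|w\|_{g_x}=1\}$ with surface measure $dS_x$ induced by $g_x$. The mean geodesic difference quotient of $f\in L^1(M)$ is, for $r>0$, $$Q_f(r)=\int_M\frac1{\sigma_{n-1}}\int_{S_xM}\left|\frac{f(\exp_x(rw))-f(x)}{r}\right|dS_x(w)\,dx .$$ The total variation is $V[f]=\sup\{\int_M f\operatorname{div}(X)\,d\mathrm{vol}_M: X$ a smooth vector field on $M$ with $\|X(x)\|_{g_x}\le1$ for all $x\in M\}\in[0,\infty]$. The constant is $k_n=\frac{2}{n-1}\frac{\sigma_{n-2}}{\sigma_{n-1}}$. *)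

theory Defs
  imports "HOL-Analysis.Analysis"
begin

subsection \<open>Smooth maps\<close>

text \<open>Meaningful for open sets \<open>S\<close> only, which is the only way these notions are used.\<close>

primrec Ck_on :: "nat \<Rightarrow> 'e::real_normed_vector set \<Rightarrow> ('e \<Rightarrow> 'f::real_normed_vector) \<Rightarrow> bool" where
  "Ck_on 0 S f \<longleftrightarrow> continuous_on S f"
| "Ck_on (Suc k) S f \<longleftrightarrow>
     (\<forall>x\<in>S. f differentiable (at x)) \<and> (\<forall>v. Ck_on k S (\<lambda>x. frechet_derivative f (at x) v))"

definition smooth_on :: "'e::real_normed_vector set \<Rightarrow> ('e \<Rightarrow> 'f::real_normed_vector) \<Rightarrow> bool" where
  "smooth_on S f \<longleftrightarrow> (\<forall>k. Ck_on k S f)"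

definition partial :: "'n::finite \<Rightarrow> (real^'n \<Rightarrow> real) \<Rightarrow> real^'n \<Rightarrow> real" where
  "partial i h u = frechet_derivative h (at u) (axis i 1)"


subsection \<open>Manifolds\<close>

text \<open>The point set of the manifold is the type \<open>'a\<close> with its class topology; the dimension is
  \<open>CARD('n)\<close>. A chart is its domain together with the coordinate map, whose values outside the
  domain are irrelevant.\<close>

type_synonym ('a, 'n) chart = "'a set \<times> ('a \<Rightarrow> real^'n)"

abbreviation chart_dom :: "('a, 'n) chart \<Rightarrow> 'a set" where
  "chart_dom c \<equiv> fst c"

abbreviation chart_map :: "('a, 'n) chart \<Rightarrow> 'a \<Rightarrow> real^'n" where
  "chart_map c \<equiv> snd c"

definition chart_inv :: "('a, 'n) chart \<Rightarrow> real^'n \<Rightarrow> 'a" where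
  "chart_inv c = inv_into (chart_dom c) (chart_map c)"

definition transition :: "('a, 'n) chart \<Rightarrow> ('a, 'n) chart \<Rightarrow> real^'n \<Rightarrow> real^'n" where
  "transition c d = chart_map d \<circ> chart_inv c"

definition smooth_atlas :: "('a::topological_space, 'n::finite) chart set \<Rightarrow> bool" where
  "smooth_atlas A \<longleftrightarrow>
     (\<Union>c\<in>A. chart_dom c) = UNIV \<and>
     (\<forall>c\<in>A. open (chart_dom c) \<and> open (chart_map c ` chart_dom c) \<and>
        homeomorphism (chart_dom c) (chart_map c ` chart_dom c) (chart_map c) (chart_inv c)) \<and>
     (\<forall>c\<in>A. \<forall>d\<in>A. smooth_on (chart_map c ` (chart_dom c \<inter> chart_dom d)) (transition c d))"

definition oriented_atlas :: "('a::topological_space, 'n::finite) chart set \<Rightarrow> bool" where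
  "oriented_atlas A \<longleftrightarrow>
     smooth_atlas A \<and>
     (\<forall>c\<in>A. \<forall>d\<in>A. \<forall>u\<in>chart_map c ` (chart_dom c \<inter> chart_dom d).
        det (matrix (frechet_derivative (transition c d) (at u))) > 0)"


subsection \<open>Tangent spaces\<close>

text \<open>Every point \<open>x\<close> gets a preferred chart \<open>chart_at A x\<close>, and the tangent space at \<open>x\<close> is
  \<open>real^'n\<close>, a vector being recorded by its components in the preferred chart. The components
  of the same vector in any other chart are obtained by the derivative of the transition map;
  every notion of smoothness below refers to the components in the charts of the atlas, never to
  the (in general discontinuous) choice of preferred charts.\<close>

definition chart_at :: "('a, 'n) chart set \<Rightarrow> 'a \<Rightarrow> ('a, 'n) chart" where
  "chart_at A x = (SOME c. c \<in> A \<and> x \<in> chart_dom c)"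

definition tangent_to_coords ::
    "('a, 'n::finite) chart set \<Rightarrow> ('a, 'n) chart \<Rightarrow> 'a \<Rightarrow> real^'n \<Rightarrow> real^'n" where
  "tangent_to_coords A c x w =
     frechet_derivative (transition (chart_at A x) c) (at (chart_map (chart_at A x) x)) w"

definition tangent_of_coords ::
    "('a, 'n::finite) chart set \<Rightarrow> ('a, 'n) chart \<Rightarrow> 'a \<Rightarrow> real^'n \<Rightarrow> real^'n" where
  "tangent_of_coords A c x v =
     frechet_derivative (transition c (chart_at A x)) (at (chart_map c x)) v"

definition field_coords ::
    "('a, 'n::finite) chart set \<Rightarrow> ('a, 'n) chart \<Rightarrow> ('a \<Rightarrow> real^'n) \<Rightarrow> real^'n \<Rightarrow> real^'n" where
  "field_coords A c X u = tangent_to_coords A c (chart_inv c u) (X (chart_inv c u))"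

definition smooth_vector_field :: "('a, 'n::finite) chart set \<Rightarrow> ('a \<Rightarrow> real^'n) \<Rightarrow> bool" where
  "smooth_vector_field A X \<longleftrightarrow>
     (\<forall>c\<in>A. smooth_on (chart_map c ` chart_dom c) (field_coords A c X))"


subsection \<open>Riemannian metrics\<close>

type_synonym ('a, 'n) metric_tensor = "'a \<Rightarrow> real^'n \<Rightarrow> real^'n \<Rightarrow> real"

text \<open>The matrix \<open>g\<^sub>i\<^sub>j\<close> of the metric in the chart \<open>c\<close>, as a function of the coordinates.\<close>

definition metric_coords ::
    "('a, 'n::finite) chart set \<Rightarrow> ('a, 'n) metric_tensor \<Rightarrow> ('a, 'n) chart \<Rightarrow> real^'n \<Rightarrow> real^'n^'n" where
  "metric_coords A g c u =
     (\<chi> i j. g (chart_inv c u) (tangent_of_coords A c (chart_inv c u) (axis i 1))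
                               (tangent_of_coords A c (chart_inv c u) (axis j 1)))"

definition riemannian_metric ::
    "('a, 'n::finite) chart set \<Rightarrow> ('a, 'n) metric_tensor \<Rightarrow> bool" where
  "riemannian_metric A g \<longleftrightarrow>
     (\<forall>x. bilinear (g x) \<and> (\<forall>v w. g x v w = g x w v) \<and> (\<forall>v. v \<noteq> 0 \<longrightarrow> g x v v > 0)) \<and>
     (\<forall>c\<in>A. smooth_on (chart_map c ` chart_dom c) (metric_coords A g c))"

definition tangent_norm :: "('a, 'n) metric_tensor \<Rightarrow> 'a \<Rightarrow> real^'n \<Rightarrow> real" where
  "tangent_norm g x w = sqrt (g x w w)"

text \<open>The Borel measure that is \<open>sqrt (det g\<^sub>i\<^sub>j) dx\<close> in every chart.\<close>

definition riemannian_volume ::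
    "('a::topological_space, 'n::finite) chart set \<Rightarrow> ('a, 'n) metric_tensor \<Rightarrow> 'a measure" where
  "riemannian_volume A g =
     (THE \<mu>. sets \<mu> = sets borel \<and>
        (\<forall>c\<in>A. \<forall>B\<in>sets borel. B \<subseteq> chart_dom c \<longrightarrow>
           emeasure \<mu> B =
             (\<integral>\<^sup>+u\<in>chart_map c ` B. ennreal (sqrt (det (metric_coords A g c u))) \<partial>lborel)))"

definition divergence ::
    "('a, 'n::finite) chart set \<Rightarrow> ('a, 'n) metric_tensor \<Rightarrow> ('a \<Rightarrow> real^'n) \<Rightarrow> 'a \<Rightarrow> real" where
  "divergence A g X x =
     (let c = chart_at A x; u = chart_map c x; \<rho> = (\<lambda>v. sqrt (det (metric_coords A g c v)))
      in (\<Sum>i\<in>UNIV. partial i (\<lambda>v. \<rho> v * field_coords A c X v $ i) u) / \<rho> u)"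


subsection \<open>Geodesics and the exponential map\<close>

definition christoffel ::
    "('a, 'n::finite) chart set \<Rightarrow> ('a, 'n) metric_tensor \<Rightarrow> ('a, 'n) chart \<Rightarrow>
     'n \<Rightarrow> 'n \<Rightarrow> 'n \<Rightarrow> real^'n \<Rightarrow> real" where
  "christoffel A g c k i j u =
     (let G = metric_coords A g c in
      (\<Sum>l\<in>UNIV. matrix_inv (G u) $ k $ l *
         (partial i (\<lambda>v. G v $ j $ l) u + partial j (\<lambda>v. G v $ i $ l) u
            - partial l (\<lambda>v. G v $ i $ j) u)) / 2)"

definition geodesic_on ::
    "('a::topological_space, 'n::finite) chart set \<Rightarrow> ('a, 'n) metric_tensor \<Rightarrow> real set \<Rightarrow>
     (real \<Rightarrow> 'a) \<Rightarrow> bool" where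
  "geodesic_on A g I \<gamma> \<longleftrightarrow>
     continuous_on I \<gamma> \<and>
     (\<forall>c\<in>A. \<forall>t\<in>I. \<gamma> t \<in> chart_dom c \<longrightarrow>
        (\<exists>u' u''. (\<forall>\<^sub>F s in nhds t. ((chart_map c \<circ> \<gamma>) has_vector_derivative u' s) (at s)) \<and>
           (u' has_vector_derivative u'') (at t) \<and>
           (\<forall>k. u'' $ k +
              (\<Sum>i\<in>UNIV. \<Sum>j\<in>UNIV.
                 christoffel A g c k i j (chart_map c (\<gamma> t)) * u' t $ i * u' t $ j) = 0)))"

definition exp_map ::
    "('a::topological_space, 'n::finite) chart set \<Rightarrow> ('a, 'n) metric_tensor \<Rightarrow> 'a \<Rightarrow> real^'n \<Rightarrow> 'a" where
  "exp_map A g x w =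
     (THE y. \<exists>I \<gamma>. open I \<and> is_interval I \<and> {0..1} \<subseteq> I \<and> geodesic_on A g I \<gamma> \<and>
        \<gamma> 0 = x \<and> ((chart_map (chart_at A x) \<circ> \<gamma>) has_vector_derivative w) (at 0) \<and> \<gamma> 1 = y)"


subsection \<open>Unit tangent spheres\<close>

text \<open>Surface measure of a Borel subset \<open>B\<close> of the \<open>g\<^sub>x\<close>-unit sphere is \<open>n\<close> times the
  \<open>g\<^sub>x\<close>-volume of the cone \<open>{t w. 0 < t \<le> 1, w \<in> B}\<close>. Equivalently, it is the image of \<open>n\<close> times
  the \<open>g\<^sub>x\<close>-volume on the punctured unit ball under radial projection. The measure lives on the
  whole tangent space and is concentrated on the sphere.\<close>

definition sphere_measure :: "('a, 'n::finite) metric_tensor \<Rightarrow> 'a \<Rightarrow> (real^'n) measure" where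
  "sphere_measure g x =
     distr
       (density lborel
          (\<lambda>w. ennreal (real CARD('n) * sqrt (det (\<chi> i j. g x (axis i 1) (axis j 1)))) *
               indicator {w. 0 < tangent_norm g x w \<and> tangent_norm g x w \<le> 1} w))
       borel
       (\<lambda>w. w /\<^sub>R tangent_norm g x w)"

text \<open>The \<open>k\<close>-dimensional volume of the Euclidean unit sphere \<open>S\<^sup>k\<close>, by the same cone formula
  in dimension \<open>k + 1\<close>.\<close>

definition sphere_vol :: "nat \<Rightarrow> real" where
  "sphere_vol k = real (k + 1) * unit_ball_vol (real (k + 1))"


subsection \<open>Mean geodesic difference quotient and total variation\<close>

definition mean_geodesic_quotient ::
    "('a::topological_space, 'n::finite) chart set \<Rightarrow> ('a, 'n) metric_tensor \<Rightarrow> ('a \<Rightarrow> real) \<Rightarrow>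
     real \<Rightarrow> ennreal" where
  "mean_geodesic_quotient A g f r =
     (\<integral>\<^sup>+x. ennreal (1 / sphere_vol (CARD('n) - 1)) *
        (\<integral>\<^sup>+w. ennreal \<bar>(f (exp_map A g x (r *\<^sub>R w)) - f x) / r\<bar> \<partial>sphere_measure g x)
      \<partial>riemannian_volume A g)"

definition total_variation ::
    "('a::topological_space, 'n::finite) chart set \<Rightarrow> ('a, 'n) metric_tensor \<Rightarrow> ('a \<Rightarrow> real) \<Rightarrow> ereal" where
  "total_variation A g f =
     (SUP X \<in> {X. smooth_vector_field A X \<and> (\<forall>x. tangent_norm g x (X x) \<le> 1)}.
        ereal (\<integral>x. f x * divergence A g X x \<partial>riemannian_volume A g))"

definition variation_const :: "nat \<Rightarrow> real" where
  "variation_const n = 2 / (real n - 1) * (sphere_vol (n - 2) / sphere_vol (n - 1))"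

end

(* The inequalities are proved in charts and glued with a partition of unity. In a chart x \<mapsto> exp_x(rw) is,
 for a fixed direction w, a map T_r at distance O(r) from the identity; it distorts Lebesgue measure by a
 factor 1 + O(r). The average of |<p,w>| over the unit sphere is k_n |p|.
 Upper bound: for smooth h, h o T_r - h is the integral of dh along the geodesic, so the quotient of h is at
 most (1 + O(r)) k_n times its variation; a general f is mollified.
 Lower bound: pair f o T_r - f with m(w), where |m| <= 1 + e. Changing variables moves the difference to the
 test function, and in the limit the pairing is k_n times the integral of f div Y, as m is chosen such that
 m(w) w has mean k_n Y: m is sgn<Y,w>, mollified in Y since it has to be Lipschitz.
 Spheres never occur in charts: their averages are integrals over R^n in polar coordinates with weight
 max 0 (1 - |w|^2). *)

theory Submission imports Defs begin

subsection \<open>Calculus of \<open>Ck_on\<close>\<close>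

text \<open>The unit sphere of \<open>g_x\<close> moves with x. A direction is therefore labelled by
  a nonzero th in R^n, which stands for the unit vector \<open>th / |th|_{g_x}\<close>: the domain
  of integration no longer depends on x, and the weight takes over the dependence. Both bounds move
  the weight along T_r, so it has to be Lipschitz in x; hence 1 - |w|^2 rather than the indicator of
  the unit ball. Maps of all of R^n are obtained by composing the metric with the projection to a
  ball. That destroys smoothness, so the local estimates rest on Lipschitz bounds; a Lipschitz
  perturbation of the identity distorts volume by a controlled factor without any Jacobian. The
  local bounds must add up without loss. In the upper bound each chart admits test fields of norm up
  to eta + O(r), where eta is the function of the partition; fields chosen independently in the
  charts add up to a global field of norm at most 1 + O(r), so the sum of the local suprema is at
  most (1 + O(r)) V[f]. In the lower bound a global test field X is cut into the pieces zeta
  X.\<close>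

hide_fact (open) Henstock_Kurzweil_Integration.integrable_add Henstock_Kurzweil_Integration.integrable_bound
 Henstock_Kurzweil_Integration.integrable_diff Henstock_Kurzweil_Integration.integral_add
 Henstock_Kurzweil_Integration.integral_cong Henstock_Kurzweil_Integration.integral_diff
 Henstock_Kurzweil_Integration.integral_nonneg Henstock_Kurzweil_Integration.integral_norm_bound_integral
 Henstock_Kurzweil_Integration.integral_sum

abbreviation "Dv f x \<equiv> frechet_derivative f (at x)"

abbreviation nn_lborel :: "('a::euclidean_space => ennreal) => ennreal" (binder "NN" [60] 60) where
 "nn_lborel f \<equiv> nn_integral lborel f"

abbreviation int_lborel :: "('a::euclidean_space => 'b::{banach,second_countable_topology}) => 'b" (binder "LB" [60] 60) where
 "int_lborel f \<equiv> integral\<^sup>L lborel f"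

lemma Ck_on_continuous: "Ck_on k S f ==> continuous_on S f"
 by (cases k) (auto intro!: continuous_at_imp_continuous_on dest: bspec differentiable_imp_continuous_within)

lemma Ck_on_pred: "Ck_on (Suc k) S f ==> Ck_on k S f"
proof (induction k arbitrary: f)
 case 0
 then show ?case
  using Ck_on_continuous[OF 0] by simp
next
 case (Suc k)
 have d: "\<forall>x\<in>S. f differentiable (at x)" and "!!v. Ck_on (Suc k) S (%x. Dv f x v)"
  using Suc.prems unfolding Ck_on.simps(2)[of "Suc k"] by auto
 then have "!!v. Ck_on k S (%x. Dv f x v)"
  using Suc.IH by blast
 with d show ?case by simp
qed

lemma Ck_on_subset: "Ck_on k S f ==> T \<subseteq> S ==> Ck_on k T f"
 by (induction k arbitrary: f) (auto intro: continuous_on_subset)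

lemma Ck_on_cong:
 assumes "open S" "!!x. x \<in> S ==> f x = g x" "Ck_on k S f"
 shows "Ck_on k S g"
 using assms(2,3)
proof (induction k arbitrary: f g)
 case 0
 then show ?case by (simp cong: continuous_on_cong)
next
 case (Suc k)
 have der: "(g has_derivative Dv f x) (at x)" if "x \<in> S" for x
 proof (rule has_derivative_transform_within_open[OF _ assms(1) that])
  show "(f has_derivative Dv f x) (at x)"
   using Suc.prems that by (simp add: frechet_derivative_works[symmetric])
 qed (use Suc.prems in auto)
 then have eq: "Dv g x = Dv f x" if "x \<in> S" for x
  using frechet_derivative_at that by metis
 show ?case
 proof (simp, intro conjI allI ballI)
  show "g differentiable at x" if "x \<in> S" for x
   using der[OF that] by (auto simp: differentiable_def)
  show "Ck_on k S (%x. Dv g x v)" for v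
  proof (rule Suc.IH)
   show "Dv f x v = Dv g x v" if "x \<in> S" for x
    by (simp only: eq[OF that])
   show "Ck_on k S (%x. Dv f x v)"
    using Suc.prems(2) by simp
  qed
 qed
qed

lemma Ck_on_local:
 assumes "!!x. x \<in> S ==> \<exists>U. open U \<and> x \<in> U \<and> Ck_on k U f"
 shows "Ck_on k S f"
 using assms
proof (induction k arbitrary: f)
 case 0
 show ?case
 proof (simp, rule continuous_at_imp_continuous_on, rule ballI)
  fix x assume "x \<in> S"
  then obtain U where "open U" "x \<in> U" "Ck_on 0 U f" using 0 by blast
  then show "isCont f x" by (simp add: continuous_on_eq_continuous_at)
 qed
next
 case (Suc k)
 show ?case
 proof (simp, intro conjI allI ballI)
  show "f differentiable at x" if "x \<in> S" for x
   using Suc.prems[OF that] by auto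
  show "Ck_on k S (%x. Dv f x v)" for v
   by (rule Suc.IH) (use Suc.prems in "metis Ck_on.simps(2)")
 qed
qed

text \<open>Admits an explicit formula for the derivative in place of
  \<open>frechet_derivative\<close>, so that the closure properties below become inductions on k
  that differentiate once.\<close>

lemma Ck_on_SucI:
 assumes "open S" "!!x. x \<in> S ==> (f has_derivative f' x) (at x)" "!!v. Ck_on k S (%x. f' x v)"
 shows "Ck_on (Suc k) S f"
proof (simp, intro conjI allI ballI)
 show "f differentiable at x" if "x \<in> S" for x
  using assms(2)[OF that] by (auto simp: differentiable_def)
 show "Ck_on k S (%x. Dv f x v)" for v
  by (rule Ck_on_cong[OF assms(1) _ assms(3)[of v]])
   (simp add: fun_cong[OF frechet_derivative_at[OF assms(2)]])
qed

lemma Ck_on_SucD: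
 assumes "Ck_on (Suc k) S f"
 shows "x \<in> S ==> (f has_derivative Dv f x) (at x)"
  and "Ck_on k S (%x. Dv f x v)"
 using assms by (auto simp: frechet_derivative_works[symmetric])

lemma Ck_on_const: "open S ==> Ck_on k S (%x. c)"
proof (induction k arbitrary: c)
 case (Suc k)
 show ?case by (rule Ck_on_SucI[where f'="%x v. 0"]) (use Suc in auto)
qed simp

lemma Ck_on_add:
 assumes "open S" "Ck_on k S f" "Ck_on k S g"
 shows "Ck_on k S (%x. f x + g x)"
 using assms(2,3)
proof (induction k arbitrary: f g)
 case (Suc k)
 show ?case
  by (rule Ck_on_SucI[OF assms(1) has_derivative_add[OF Ck_on_SucD(1)[OF Suc.prems(1)] Ck_on_SucD(1)[OF Suc.prems(2)]]])
   (use Suc Ck_on_SucD(2) in blast)+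
qed (auto intro: continuous_intros)

lemma Ck_on_bounded_linear:
 assumes "open S" "bounded_linear L" "Ck_on k S f"
 shows "Ck_on k S (%x. L (f x))"
 using assms(3)
proof (induction k arbitrary: f)
 case 0
 then show ?case by (auto intro: bounded_linear.continuous_on[OF assms(2)])
next
 case (Suc k)
 show ?case
  by (rule Ck_on_SucI[OF assms(1) bounded_linear.has_derivative[OF assms(2) Ck_on_SucD(1)[OF Suc.prems]]])
   (use Suc Ck_on_SucD(2) in blast)+
qed

lemma Ck_on_id: "open S ==> Ck_on k S (%x. x)"
proof (induction k)
 case (Suc k)
 show ?case by (rule Ck_on_SucI[where f'="%x v. v"]) (use Suc Ck_on_const in auto)
qed simp

lemma Ck_on_bounded_bilinear:
 assumes "open S" "bounded_bilinear b" "Ck_on k S f" "Ck_on k S g"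
 shows "Ck_on k S (%x. b (f x) (g x))"
 using assms(3,4)
proof (induction k arbitrary: f g)
 case 0
 then show ?case by (auto intro: bounded_bilinear.continuous_on[OF assms(2)])
next
 case (Suc k)
 show ?case
 proof (rule Ck_on_SucI[OF assms(1)])
  show "((%x. b (f x) (g x)) has_derivative
    (%h. b (f x) (Dv g x h) + b (Dv f x h) (g x))) (at x)"
   if "x \<in> S" for x
   using bounded_bilinear.FDERIV[OF assms(2) Ck_on_SucD(1)[OF Suc.prems(1) that] Ck_on_SucD(1)[OF Suc.prems(2) that]] .
  show "Ck_on k S (%x. b (f x) (Dv g x v) + b (Dv f x v) (g x))" for v
   by (rule Ck_on_add[OF assms(1) Suc.IH[OF Ck_on_pred[OF Suc.prems(1)] Ck_on_SucD(2)[OF Suc.prems(2)]]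
      Suc.IH[OF Ck_on_SucD(2)[OF Suc.prems(1)] Ck_on_pred[OF Suc.prems(2)]]])
 qed
qed

lemmas Ck_on_mult = Ck_on_bounded_bilinear[OF _ bounded_bilinear_mult]
lemmas Ck_on_scaleR = Ck_on_bounded_bilinear[OF _ bounded_bilinear_scaleR]
lemmas Ck_on_inner = Ck_on_bounded_bilinear[OF _ bounded_bilinear_inner]

lemma Ck_on_minus: "open S ==> Ck_on k S f ==> Ck_on k S (%x. - f x)"
 by (rule Ck_on_bounded_linear[OF _ bounded_linear_minus[OF bounded_linear_ident]])

lemma Ck_on_diff: "open S ==> Ck_on k S f ==> Ck_on k S g ==> Ck_on k S (%x. f x - g x)"
 using Ck_on_add[of S k f "%x. - g x"] Ck_on_minus[of S k g] by simp

lemma Ck_on_sum: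
 "open S ==> (!!i. i \<in> I ==> Ck_on k S (f i)) ==> Ck_on k S (%x. \<Sum>i\<in>I. f i x)"
 by (induction I rule: infinite_finite_induct) (auto intro: Ck_on_const Ck_on_add)

lemma Ck_on_prod:
 fixes f :: "'i => 'e::real_normed_vector => real"
 shows "open S ==> (!!i. i \<in> I ==> Ck_on k S (f i)) ==> Ck_on k S (%x. \<Prod>i\<in>I. f i x)"
 by (induction I rule: infinite_finite_induct) (auto intro: Ck_on_const Ck_on_mult)

lemma Ck_on_inverse:
 fixes f :: "'e::real_normed_vector => real"
 assumes "open S" "Ck_on k S f" "!!x. x \<in> S ==> f x ~= 0"
 shows "Ck_on k S (%x. inverse (f x))"
 using assms(2)
proof (induction k)
 case 0
 then show ?case using assms(3) by (auto intro!: continuous_intros)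
next
 case (Suc k)
 show ?case
 proof (rule Ck_on_SucI[OF assms(1)])
  show "((%x. inverse (f x)) has_derivative
    (%h. - (inverse (f x) * Dv f x h * inverse (f x)))) (at x)"
   if "x \<in> S" for x
   using Deriv.has_derivative_inverse[OF assms(3)[OF that] Ck_on_SucD(1)[OF Suc.prems that]] .
  show "Ck_on k S (%x. - (inverse (f x) * Dv f x v * inverse (f x)))" for v
   using Suc Ck_on_pred by (intro Ck_on_minus Ck_on_mult assms(1) Ck_on_SucD(2)) auto
 qed
qed

lemma Ck_on_divide:
 fixes f g :: "'e::real_normed_vector => real"
 assumes "open S" "Ck_on k S f" "Ck_on k S g" "!!x. x \<in> S ==> g x ~= 0"
 shows "Ck_on k S (%x. f x / g x)"
 unfolding divide_inverse using assms by (intro Ck_on_mult Ck_on_inverse)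

lemma Ck_on_sqrt:
 fixes f :: "'e::real_normed_vector => real"
 assumes "open S" "Ck_on k S f" "!!x. x \<in> S ==> f x > 0"
 shows "Ck_on k S (%x. sqrt (f x))"
 using assms(2)
proof (induction k)
 case 0
 then show ?case by (auto intro!: continuous_intros)
next
 case (Suc k)
 show ?case
 proof (rule Ck_on_SucI[OF assms(1)])
  show "((%x. sqrt (f x)) has_derivative (%h. Dv f x h * (inverse (sqrt (f x)) / 2))) (at x)"
   if "x \<in> S" for x
   using has_derivative_real_sqrt[OF assms(3)[OF that] Ck_on_SucD(1)[OF Suc.prems that]] .
  show "Ck_on k S (%x. Dv f x v * (inverse (sqrt (f x)) / 2))" for v
   using Suc Ck_on_pred assms(3)
   by (intro Ck_on_divide Ck_on_mult Ck_on_inverse assms(1) Ck_on_SucD(2) Ck_on_const)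
    (auto simp: less_imp_neq[symmetric] simp del: Ck_on.simps)
 qed
qed

text \<open>\<open>Ck_on\<close> controls a derivative in constant directions only. A direction that
  depends on the point is expanded in the basis by this identity, which moves the dependence into
  scalar coefficients.\<close>

lemma has_derivative_sum_Basis:
 fixes f :: "'a::euclidean_space => 'b::real_normed_vector"
 assumes "(f has_derivative f') F"
 shows "f' h = (\<Sum>b\<in>Basis. (h \<bullet> b) *\<^sub>R f' b)"
proof -
 interpret linear f' using has_derivative_linear[OF assms] .
 show ?thesis by (subst euclidean_representation[symmetric, of h], simp add: sum scale)
qed

text \<open>The chain rule differentiates g in the direction \<open>Dv f x h\<close>, which moves
  with x; after the expansion in the basis the induction hypothesis applies to the derivative of g
  in each basis direction.\<close>

lemma Ck_on_compose:
 fixes g :: "'b::euclidean_space => 'c::real_normed_vector"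
 assumes "open S" "open T" "Ck_on k S f" "Ck_on k T g" "f ` S \<subseteq> T"
 shows "Ck_on k S (%x. g (f x))"
 using assms(3,4)
proof (induction k arbitrary: g)
 case 0
 then show ?case using assms(5) by (auto intro: continuous_on_compose2)
next
 case (Suc k)
 let ?Df = "%x. Dv f x" and ?Dg = "%x. Dv g x"
 show ?case
 proof (rule Ck_on_SucI[OF assms(1)])
  fix x assume "x \<in> S"
  then have f: "(f has_derivative ?Df x) (at x)" and g: "(g has_derivative ?Dg (f x)) (at (f x))"
   using Suc.prems assms(5) by (auto simp: frechet_derivative_works[symmetric])
  have "((%x. g (f x)) has_derivative (%h. ?Dg (f x) (?Df x h))) (at x)"
   using has_derivative_compose[OF f g] .
  then show "((%x. g (f x)) has_derivative (%h. \<Sum>b\<in>Basis. (?Df x h \<bullet> b) *\<^sub>R ?Dg (f x) b)) (at x)"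
   by (simp flip: has_derivative_sum_Basis[OF g])
 next
  fix v
  show "Ck_on k S (%x. \<Sum>b\<in>Basis. (?Df x v \<bullet> b) *\<^sub>R ?Dg (f x) b)"
   by (rule Ck_on_sum[OF assms(1) Ck_on_scaleR[OF assms(1) Ck_on_inner[OF assms(1)
      Ck_on_SucD(2)[OF Suc.prems(1)] Ck_on_const[OF assms(1)]]
      Suc.IH[OF Ck_on_pred[OF Suc.prems(1)] Ck_on_SucD(2)[OF Suc.prems(2)]]]])
 qed
qed

lemma Ck_on_vec_iff:
 fixes f :: "'e::real_normed_vector => 'v::real_normed_vector ^ 'n"
 assumes "open S"
 shows "Ck_on k S f \<longleftrightarrow> (\<forall>i. Ck_on k S (%x. f x $ i))"
proof
 assume *: "\<forall>i. Ck_on k S (%x. f x $ i)"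
 have "bounded_linear (%x. axis i x :: 'v^'n)" for i
  by (rule bounded_linear_intro[where K=1])
   (auto simp: axis_def vec_eq_iff norm_vec_def L2_set_def if_distrib[of norm] if_distrib[of "%x. x^2"] cong: if_cong)
 then have "Ck_on k S (%x. \<Sum>i\<in>UNIV. axis i (f x $ i))"
  using * by (intro Ck_on_sum assms Ck_on_bounded_linear[where L="axis _"]) auto
 moreover have "(\<Sum>i\<in>UNIV. axis i (f x $ i)) = f x" for x
  by (simp add: vec_eq_iff axis_def)
 ultimately show "Ck_on k S f" by simp
qed (auto intro: Ck_on_bounded_linear[OF assms bounded_linear_vec_nth])

lemma Ck_on_matrix_nth:
 fixes G :: "'e::real_normed_vector => real^'n^'m"
 shows "open S ==> Ck_on k S G ==> Ck_on k S (%x. G x $ i $ j)"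
 by (metis Ck_on_vec_iff)

lemma Ck_on_det:
 fixes G :: "'e::real_normed_vector => real^'n^'n"
 shows "open S ==> Ck_on k S G ==> Ck_on k S (%x. det (G x))"
 unfolding det_def by (intro Ck_on_sum Ck_on_mult Ck_on_const Ck_on_prod Ck_on_matrix_nth)

lemma frechet_derivative_eq_0:
 assumes "open S" "x \<in> S" "!!y. y \<in> S ==> f y = 0"
 shows "Dv f x = (%_. 0)"
proof -
 have "(f has_derivative (%_. 0)) (at x)"
  by (rule has_derivative_transform_within_open[OF has_derivative_const assms(1,2)]) (simp add: assms(3))
 then show ?thesis by (rule frechet_derivative_at[symmetric])
qed

lemma Ck1_lipschitz:
 fixes h :: "'a::euclidean_space => 'b::real_normed_vector"
 assumes h: "Ck_on (Suc 0) S h" and C: "convex C" "C \<subseteq> S" and B: "!!b z. z \<in> C ==> norm (Dv h z b) <= B b"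
 shows "x \<in> C ==> norm (Dv h x v) <= (\<Sum>b\<in>Basis. B b) * norm v"
  and "x \<in> C ==> y \<in> C ==> norm (h x - h y) <= (\<Sum>b\<in>Basis. B b) * norm (x - y)"
proof -
 have der: "(h has_derivative Dv h z) (at z)" if "z \<in> C" for z using Ck_on_SucD(1)[OF h] that C(2) by blast
 show le: "norm (Dv h z v) <= (\<Sum>b\<in>Basis. B b) * norm v" if z: "z \<in> C" for z v
 proof -
  have "norm (Dv h z v) <= (\<Sum>b\<in>Basis. norm v * B b)"
   by (subst has_derivative_sum_Basis[OF der[OF z]], rule sum_norm_le) (use B[OF z] in "auto intro!: mult_mono Basis_le_norm")
  then show ?thesis by (simp only: sum_distrib_right mult.commute[of "norm v"])
 qed
 show "x \<in> C ==> y \<in> C ==> norm (h x - h y) <= (\<Sum>b\<in>Basis. B b) * norm (x - y)"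
  by (rule differentiable_bound[OF C(1) has_derivative_at_withinI[OF der] onorm_le[OF le]])
qed

lemma Ck1_bounded_lipschitz:
 fixes h :: "'a::euclidean_space => 'b::real_normed_vector"
 assumes h: "Ck_on (Suc 0) S h" and C: "compact C" "convex C" "C \<subseteq> S"
 shows "\<exists>K>0. (\<forall>x\<in>C. norm (h x) <= K) \<and> (\<forall>x\<in>C. \<forall>y\<in>C. norm (h x - h y) <= K * norm (x - y))"
proof -
 have bd: "\<exists>B. \<forall>x\<in>C. norm (f x) <= B" if "continuous_on S f" for f :: "'a => 'b"
  using compact_imp_bounded[OF compact_continuous_image[OF continuous_on_subset[OF that C(3)] C(1)]] unfolding bounded_iff by blast
 have "\<forall>b. \<exists>B. \<forall>x\<in>C. norm (Dv h x b) <= B" using h by (auto intro!: bd)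
 then obtain B where B: "!!b x. x \<in> C ==> norm (Dv h x b) <= B b" by metis
 obtain M where M: "!!x. x \<in> C ==> norm (h x) <= M" using bd[OF Ck_on_continuous[OF h]] by blast
 define K where "K = 1 + \<bar>M\<bar> + \<bar>\<Sum>b\<in>Basis. B b\<bar>"
 have "norm (h x - h y) <= K * norm (x - y)" if "x \<in> C" "y \<in> C" for x y
  by (rule order_trans[OF Ck1_lipschitz(2)[OF h C(2,3) B that] mult_right_mono]) (simp_all add: K_def)
 moreover have "norm (h x) <= K" if "x \<in> C" for x using M[OF that] by (simp add: K_def)
 moreover have "0 < K" by (simp add: K_def add_pos_nonneg)
 ultimately show ?thesis by blast
qed

text \<open>The nearest point map of a closed convex set does not increase distances, so it carries
  the bounds on C over to the whole space while keeping h on C.\<close>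

lemma Ck1_cutoff:
 fixes h :: "'a::euclidean_space => 'b::real_normed_vector"
 assumes h: "Ck_on (Suc 0) S h" and C: "compact C" "convex C" "C \<subseteq> S" "C ~= {}"
 shows "\<exists>K>0. (\<forall>x. norm (h (closest_point C x)) <= K) \<and> (\<forall>x y. norm (h (closest_point C x) - h (closest_point C y)) <= K * norm (x - y))"
proof -
 let ?p = "closest_point C"
 obtain K where K: "K > 0" "!!x. x \<in> C ==> norm (h x) <= K" "!!x y. x \<in> C ==> y \<in> C ==> norm (h x - h y) <= K * norm (x - y)"
  using Ck1_bounded_lipschitz[OF h C(1-3)] by blast
 have p: "?p x \<in> C" "norm (?p x - ?p y) <= norm (x - y)" for x y
  using closest_point_in_set[OF compact_imp_closed[OF C(1)] C(4)] closest_point_lipschitz[OF C(2) compact_imp_closed[OF C(1)] C(4), of x y]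
  by (auto simp: dist_norm)
 then show ?thesis using K order_trans[OF K(3)[OF p(1) p(1)] mult_left_mono[OF p(2)]] by (intro exI[of _ K]) auto
qed

subsection \<open>A smooth bump function\<close>

text \<open>For p = 1 this is the classical smooth function exp (-1/t), continued by 0. The
  polynomial factor makes the family closed under differentiation, which turns smoothness into an
  induction.\<close>

definition exp_tail :: "real poly => real => real" where
 "exp_tail p t = (if t > 0 then poly p (1 / t) * exp (- (1 / t)) else 0)"

lemma poly_times_exp_minus_tendsto_0:
 "((%x. poly p x * exp (- x)) \<longlongrightarrow> (0::real)) at_top"
proof -
 have "((%x. \<Sum>i\<le>degree p. coeff p i * (x ^ i / exp x)) \<longlongrightarrow> (\<Sum>i\<le>degree p. coeff p i * 0)) at_top"
  by (intro tendsto_intros tendsto_power_div_exp_0)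
 then show ?thesis
  by (simp add: poly_altdef exp_minus sum_distrib_right divide_inverse mult.assoc)
qed

lemma exp_tail_tendsto_0: "(exp_tail p \<longlongrightarrow> 0) (at 0)"
proof (rule filterlim_split_at)
 show "(exp_tail p \<longlongrightarrow> 0) (at_left 0)"
  by (rule tendsto_eventually) (auto simp: eventually_at_filter exp_tail_def)
 have "((%t. poly p (inverse t) * exp (- inverse t)) \<longlongrightarrow> 0) (at_right 0)"
  using filterlim_compose[OF poly_times_exp_minus_tendsto_0 filterlim_inverse_at_top_right] by simp
 then show "(exp_tail p \<longlongrightarrow> 0) (at_right 0)"
  by (rule Lim_transform_eventually)
   (auto simp: eventually_at_filter exp_tail_def inverse_eq_divide)
qed

lemma exp_tail_has_derivative:
 "(exp_tail p has_field_derivative exp_tail ([:0, 0, 1:] * (p - pderiv p)) t) (at t)"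
proof -
 consider "t < 0" | "t = 0" | "t > 0" by linarith
 then show ?thesis
 proof cases
  case 1
  have "(exp_tail p has_field_derivative 0) (at t)"
   by (rule has_field_derivative_transform_within_open[where S="{..<0}" and f="%_. 0"])
    (use 1 in "auto simp: exp_tail_def")
  then show ?thesis using 1 by (simp add: exp_tail_def)
 next
  case 2
  \<comment> \<open>Division by h multiplies p by the variable, so the difference quotient at 0
    belongs to the same family.\<close>
  have "((%h. exp_tail p h / h) \<longlongrightarrow> 0) (at 0)"
   by (rule Lim_transform_eventually[OF exp_tail_tendsto_0[of "[:0,1:] * p"]])
    (auto simp: exp_tail_def eventually_at_filter)
  then show ?thesis using 2 by (simp add: has_field_derivative_iff exp_tail_def)
 next
  case 3
  have "((%t. poly p (1 / t) * exp (- (1 / t))) has_field_derivative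
    exp_tail ([:0, 0, 1:] * (p - pderiv p)) t) (at t)"
   using 3 by (auto intro!: derivative_eq_intros DERIV_chain2[OF poly_DERIV]
     simp: exp_tail_def field_simps power2_eq_square)
  then show ?thesis
   by (rule has_field_derivative_transform_within_open[where S="{0<..}"])
    (use 3 in "auto simp: exp_tail_def")
 qed
qed

lemma Ck_on_exp_tail: "Ck_on k UNIV (exp_tail p)"
proof (induction k arbitrary: p)
 case 0
 have "isCont (exp_tail p) t" for t
  using exp_tail_has_derivative DERIV_isCont by blast
 then show ?case by (auto intro: continuous_at_imp_continuous_on)
next
 case (Suc k)
 show ?case
  by (rule Ck_on_SucI[where f'="%t h. exp_tail ([:0, 0, 1:] * (p - pderiv p)) t * h"])
   (use Suc exp_tail_has_derivative[unfolded has_field_derivative_def] in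
    "auto intro!: Ck_on_mult Ck_on_const simp del: mult_pCons_left")
qed

definition bump :: "real => 'a::euclidean_space => real" where
 "bump e x = exp_tail 1 (e\<^sup>2 - x \<bullet> x)"

lemma Ck_on_bump: "Ck_on k UNIV (bump e)"
 unfolding bump_def
 by (rule Ck_on_compose[OF open_UNIV open_UNIV _ Ck_on_exp_tail])
  (auto intro!: Ck_on_diff Ck_on_const Ck_on_inner Ck_on_id)

lemma bump_pos_iff: "0 < e ==> bump e x > 0 \<longleftrightarrow> norm x < e"
 by (simp add: bump_def exp_tail_def dot_square_norm abs_square_less_1 power2_less_imp_less
   flip: abs_less_iff) (metis abs_norm_cancel abs_of_pos power2_less_eq_zero_iff abs_le_square_iff not_le)

lemma bump_nonneg: "bump e x >= 0"
 by (simp add: bump_def exp_tail_def)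

lemma bump_eq_0: "0 < e ==> e <= norm x ==> bump e x = 0"
 using bump_pos_iff[of e x] bump_nonneg[of e x] by linarith

lemma bump_uminus: "bump e (- x) = bump e x"
 by (simp add: bump_def)

lemma continuous_on_bump: "continuous_on S (bump e)"
 using Ck_on_continuous[OF Ck_on_bump] continuous_on_subset by blast

definition mollifier :: "real => 'a::euclidean_space => real" where
 "mollifier e x = bump e x / (LB y. bump e (y::'a))"

lemma sets_borel_cball [measurable]: "cball a r \<in> sets borel"
 by simp

lemma integrable_continuous_bounded_support:
 fixes f :: "'a::euclidean_space => 'b::{banach,second_countable_topology}"
 assumes "continuous_on UNIV f" "!!x. R < norm x ==> f x = 0"
 shows "integrable lborel f"
proof -
 have "integrable lborel (%x. indicator (cball 0 R) x *\<^sub>R f x)"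
  by (rule borel_integrable_compact) (auto intro: continuous_on_subset[OF assms(1)])
 also have "(%x. indicator (cball 0 R) x *\<^sub>R f x) = f"
  using assms(2) by (auto simp: fun_eq_iff indicator_def)
 finally show ?thesis .
qed

lemma integral_bump_pos:
 assumes "0 < e"
 shows "0 < (LB y. bump e (y::'a::euclidean_space))"
proof -
 have int: "integrable lborel (bump e :: 'a => real)"
  by (rule integrable_continuous_bounded_support[of _ e]) (auto intro: continuous_on_bump bump_eq_0 assms)
 have "(LB y. bump e (y::'a)) ~= 0"
 proof
  assume "(LB y. bump e (y::'a)) = 0"
  then have "AE y in lborel. bump e (y::'a) = 0"
   using integral_nonneg_eq_0_iff_AE[OF int] bump_nonneg by auto
  then have "AE y in lborel. y \<notin> ball (0::'a) e"
   by eventually_elim (use assms bump_pos_iff in "auto simp: dist_norm less_le")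
  then have "emeasure lborel (ball (0::'a) e) = 0"
   by (subst (asm) AE_iff_measurable[of "ball (0::'a) e"]) auto
  then show False
   using assms content_ball_pos[of e "0::'a"] by (simp add: measure_def)
 qed
 then show ?thesis
  by (simp add: less_le bump_nonneg)
qed

lemma Ck_on_mollifier: "Ck_on k UNIV (mollifier e)"
 unfolding mollifier_def divide_inverse by (intro Ck_on_mult Ck_on_bump Ck_on_const) auto

lemma continuous_on_mollifier: "continuous_on S (mollifier e)"
 using Ck_on_continuous[OF Ck_on_mollifier] continuous_on_subset by blast

lemma mollifier_eq_0: "0 < e ==> e <= norm x ==> mollifier e x = 0"
 by (simp add: mollifier_def bump_eq_0)

lemma mollifier_nonneg: "0 < e ==> mollifier e x >= 0"
 by (simp add: mollifier_def bump_nonneg integral_bump_pos less_imp_le)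

lemma mollifier_uminus: "mollifier e (- x) = mollifier e x"
 by (simp add: mollifier_def bump_uminus)

lemma integrable_mollifier: "0 < e ==> integrable lborel (mollifier e)"
 by (rule integrable_continuous_bounded_support[of _ e]) (auto intro: continuous_on_mollifier mollifier_eq_0)

lemma integral_mollifier: "0 < e ==> (LB y. mollifier e (y::'a::euclidean_space)) = 1"
 using integral_bump_pos[of e, where 'a='a] by (simp add: mollifier_def)


subsection \<open>Convolution with smooth kernels\<close>

text \<open>The kernel is scalar and f may be vector valued, so that vector fields are mollified
  like functions.\<close>

definition convolve :: "('a::euclidean_space => real) => ('a => 'b::euclidean_space) => 'a => 'b" where
 "convolve \<phi> f x = (LB y. \<phi> (x - y) *\<^sub>R f y)"

lemma bounded_continuous_support:
 fixes \<phi> :: "'a::euclidean_space => 'b::real_normed_vector"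
 assumes "continuous_on UNIV \<phi>" "!!x. R < norm x ==> \<phi> x = 0"
 obtains B where "0 < B" "!!x. norm (\<phi> x) <= B"
proof -
 have "compact (\<phi> ` cball 0 R)"
  by (intro compact_continuous_image continuous_on_subset[OF assms(1)]) auto
 then obtain B where B: "0 < B" "!!y. y \<in> \<phi> ` cball 0 R ==> norm y <= B"
  using compact_imp_bounded bounded_pos by metis
 show ?thesis
 proof (rule that[OF B(1)])
  show "norm (\<phi> x) <= B" for x
  proof (cases "norm x <= R")
   case True
   then show ?thesis by (intro B(2)) (auto simp: dist_norm)
  next
   case False
   then show ?thesis using assms(2)[of x] B(1) by simp
  qed
 qed
qed

lemma uniformly_continuous_bounded_support:
 fixes \<phi> :: "'a::euclidean_space => 'b::real_normed_vector"
 assumes "continuous_on UNIV \<phi>" "!!x. R < norm x ==> \<phi> x = 0" "0 < e"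
 obtains d where "0 < d" "!!x y. dist x y < d ==> dist (\<phi> x) (\<phi> y) < e"
proof -
 have "uniformly_continuous_on (cball 0 (R + 1)) \<phi>"
  by (intro compact_uniformly_continuous continuous_on_subset[OF assms(1)]) auto
 then obtain d where d: "0 < d"
   "!!x y. x \<in> cball 0 (R+1) ==> y \<in> cball 0 (R+1) ==> dist y x < d ==> dist (\<phi> y) (\<phi> x) < e"
  using assms(3) unfolding uniformly_continuous_on_def by metis
 show ?thesis
 proof (rule that[of "min d 1"])
  fix x y :: 'a
  assume xy: "dist x y < min d 1"
  show "dist (\<phi> x) (\<phi> y) < e"
  proof (cases "norm x <= R + 1 \<and> norm y <= R + 1")
   case True
   then show ?thesis using d(2)[of y x] xy by (auto simp: dist_norm)
  next
   case False
   have "norm x - norm y < 1" "norm y - norm x < 1"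
    using xy norm_triangle_ineq2[of x y] norm_triangle_ineq2[of y x] by (auto simp: dist_norm norm_minus_commute)
   then have "\<phi> x = 0" "\<phi> y = 0" using False by (auto intro!: assms(2))
   then show ?thesis using assms(3) by simp
  qed
 qed (use d in auto)
qed

lemma integrable_kernel:
 fixes f :: "'a::euclidean_space => 'b::euclidean_space"
 assumes "continuous_on UNIV \<phi>" "!!x. R < norm x ==> \<phi> x = (0::real)" "integrable lborel f"
 shows "integrable lborel (%y. \<phi> (x - y) *\<^sub>R f y)"
proof -
 obtain B where B: "0 < B" "!!x. norm (\<phi> x) <= B" using bounded_continuous_support[OF assms(1,2)] by blast
 have "continuous_on UNIV (%y. \<phi> (x - y))"
  by (rule continuous_on_compose2[OF assms(1)]) (auto intro: continuous_intros)
 from borel_measurable_continuous_onI[OF this]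
 have [measurable]: "(%y. \<phi> (x - y)) \<in> borel_measurable lborel" by simp
 note [measurable] = borel_measurable_integrable[OF assms(3)]
 show ?thesis
  by (rule integrable_bound[of _ "%y. B *\<^sub>R f y"])
   (use assms(3) B in "auto intro!: mult_right_mono AE_I2 simp: less_imp_le")
qed

lemma Dv_bounded_support:
 fixes \<phi> :: "'a::euclidean_space => 'b::real_normed_vector"
 assumes "!!x. R < norm x ==> \<phi> x = 0" "R < norm x"
 shows "Dv \<phi> x v = 0"
proof -
 have "open {x :: 'a. R < norm x}" by (intro open_Collect_less continuous_intros)
 from frechet_derivative_eq_0[OF this, of x \<phi>] show ?thesis using assms by simp
qed

text \<open>Dominated convergence along sequences of increments: after division by the norm of the
  increment, the first order remainder of the kernel tends to 0 pointwise, and it is at most 2M,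
  once M for the difference and once M for the derivative.\<close>

lemma convolve_has_derivative:
 fixes f :: "'a::euclidean_space => 'b::euclidean_space"
 assumes C1: "Ck_on (Suc 0) UNIV \<phi>" and supp: "!!x. R < norm x ==> \<phi> x = (0::real)" and f: "integrable lborel f"
 shows "(convolve \<phi> f has_derivative (%v. convolve (%z. Dv \<phi> z v) f x)) (at x)"
proof -
 have der: "(\<phi> has_derivative Dv \<phi> z) (at z)" for z using Ck_on_SucD(1)[OF C1] by simp
 have cD: "continuous_on UNIV (%z. Dv \<phi> z v)" for v using C1 by simp
 have "\<exists>B. \<forall>z. norm (Dv \<phi> z v) <= B" for v
  by (rule bounded_continuous_support[OF cD Dv_bounded_support[OF supp]]) blast+
 then obtain B where B: "!!v z. norm (Dv \<phi> z v) <= B v" by metis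
 define M where "M = (\<Sum>b\<in>Basis. B b)"
 note L = Ck1_lipschitz[OF C1 convex_UNIV subset_UNIV B, folded M_def, OF UNIV_I]
 have i: "integrable lborel (%y. \<phi> (x - y) *\<^sub>R f y)" "integrable lborel (%y. Dv \<phi> (x - y) v *\<^sub>R f y)" for x v
  by (rule integrable_kernel[OF Ck_on_continuous[OF C1] supp f], assumption, rule integrable_kernel[OF cD Dv_bounded_support[OF supp] f])
 let ?E = "%v. convolve (%z. Dv \<phi> z v) f x"
 let ?q = "%h y. (\<phi> (x - y + h) - \<phi> (x - y) - Dv \<phi> (x - y) h) *\<^sub>R f y"
 have iq: "integrable lborel (?q h)" for h
  using i(1)[of "x + h"] i by (simp add: scaleR_diff_left algebra_simps)
 have eq: "convolve \<phi> f (x + h) - convolve \<phi> f x - ?E h = (LB y. ?q h y)" for h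
  unfolding convolve_def using i(1)[of "x + h"] i by (simp add: scaleR_diff_left algebra_simps)
 show ?thesis
  unfolding has_derivative_at
 proof
  show "bounded_linear ?E"
  proof (subst has_derivative_sum_Basis[OF der])
   have "(LB y. (\<Sum>b\<in>Basis. (v \<bullet> b) *\<^sub>R Dv \<phi> (x - y) b) *\<^sub>R f y) = (\<Sum>b\<in>Basis. (v \<bullet> b) *\<^sub>R (LB y. Dv \<phi> (x - y) b *\<^sub>R f y))" for v
    using i(2) by (simp add: scaleR_sum_left integral_sum flip: scaleR_scaleR)
   then show "bounded_linear (%v. convolve (%z. \<Sum>b\<in>Basis. (v \<bullet> b) *\<^sub>R Dv \<phi> z b) f x)"
    unfolding convolve_def by (simp add: bounded_linear_sum bounded_linear_scaleR_const bounded_linear_inner_left)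
  qed
  show "((%h. norm (convolve \<phi> f (x + h) - convolve \<phi> f x - ?E h) / norm h) \<longlongrightarrow> 0) (at 0)"
   unfolding eq tendsto_at_iff_sequentially o_def
  proof (intro allI impI)
   fix X :: "nat => 'a" assume X: "\<forall>i. X i \<in> UNIV - {0}" "X \<longlonglongrightarrow> 0"
   have "(%i. LB y. ?q (X i) y /\<^sub>R norm (X i)) \<longlonglongrightarrow> (LB (y::'a). 0)"
   proof (rule integral_dominated_convergence[where w="%y. 2 * M * norm (f y)"])
    show "AE y in lborel. (%i. ?q (X i) y /\<^sub>R norm (X i)) \<longlonglongrightarrow> 0"
    proof (rule AE_I2, rule tendsto_norm_zero_cancel)
     fix y
     have "(%i. norm (\<phi> (x - y + X i) - \<phi> (x - y) - Dv \<phi> (x - y) (X i)) / norm (X i)) \<longlonglongrightarrow> 0"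
      using der[of "x - y"] X unfolding has_derivative_at tendsto_at_iff_sequentially o_def by blast
     from tendsto_mult_left_zero[OF this, of "norm (f y)"]
     show "(%i. norm (?q (X i) y /\<^sub>R norm (X i))) \<longlonglongrightarrow> 0" by (simp add: divide_inverse abs_mult mult_ac)
    qed
    show "AE y in lborel. norm (?q (X i) y /\<^sub>R norm (X i)) <= 2 * M * norm (f y)" for i
    proof (rule AE_I2)
     fix y
     have "norm (\<phi> (x - y + X i) - \<phi> (x - y) - Dv \<phi> (x - y) (X i)) <= 2 * M * norm (X i)"
      using norm_triangle_ineq4[of "\<phi> (x - y + X i) - \<phi> (x - y)" "Dv \<phi> (x - y) (X i)"] L(2)[OF UNIV_I, of "x - y + X i" "x - y"] L(1)[of "x - y" "X i"] by simp
     then have "norm (?q (X i) y) <= 2 * M * norm (X i) * norm (f y)" unfolding norm_scaleR real_norm_def by (intro mult_right_mono) auto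
     moreover have key: "norm (u /\<^sub>R c) <= k * z" if "norm u <= k * c * z" "0 < c" for u :: 'b and c k z :: real
      using that by (simp add: field_simps)
     ultimately show "norm (?q (X i) y /\<^sub>R norm (X i)) <= 2 * M * norm (f y)" using X(1) by (intro key) auto
    qed
   qed (use f integrable_scaleR_right[OF iq, THEN borel_measurable_integrable] in simp_all)
   from tendsto_norm_zero[OF this[unfolded integral_zero]]
   show "(%i. norm (LB y. ?q (X i) y) / norm (X i)) \<longlonglongrightarrow> 0"
    by (simp add: divide_inverse mult.commute del: scaleR_scaleR)
  qed
 qed
qed

lemma Ck_on_convolve:
 fixes f :: "'a::euclidean_space => 'b::euclidean_space"
 assumes "!!k. Ck_on k UNIV \<phi>" "!!x. R < norm x ==> \<phi> x = (0::real)" "integrable lborel f"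
 shows "Ck_on k UNIV (convolve \<phi> f)"
 using assms(1,2)
proof (induction k arbitrary: \<phi>)
 case 0
 then show ?case
  using has_derivative_continuous[OF convolve_has_derivative[OF 0(1,2) assms(3)]] by (simp add: continuous_at_imp_continuous_on)
next
 case (Suc k)
 have "Ck_on k UNIV (convolve (%z. Dv \<phi> z v) f)" for v
  by (rule Suc.IH[OF Ck_on_SucD(2)[OF Suc.prems(1)] Dv_bounded_support[OF Suc.prems(2)]])
 then show ?case by (intro Ck_on_SucI[OF open_UNIV convolve_has_derivative[OF Suc.prems assms(3)]])
qed

subsection \<open>Near-identity maps almost preserve Lebesgue measure\<close>

text \<open>The preimage of a ball of radius s lies in a ball of radius L s, because S is a
  Lipschitz left inverse of T. Vitali's theorem fills B by disjoint balls up to a null set, and all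
  of them stay in an open set of almost the same measure. Disjoint balls are essential: they carry
  the constant L^n from balls to Borel sets without a covering factor. The null remainder has a null
  preimage, which lies in its image under S.\<close>

lemma emeasure_vimage_lipschitz:
 fixes T S :: "'a::euclidean_space => 'a"
 assumes T [measurable]: "T \<in> borel_measurable borel" and B [measurable]: "B \<in> sets borel"
  and S: "!!x. S (T x) = x" "!!x y. norm (S x - S y) <= L * norm (x - y)" "0 <= L"
 shows "emeasure lborel (T -` B) <= ennreal (L ^ DIM('a)) * emeasure lborel B"
proof -
 have vim [measurable]: "T -` D \<in> sets borel" if "D \<in> sets borel" for D
  using measurable_sets[OF T that] by simp
 have le: "emeasure lborel (T -` B) <= ennreal (L ^ DIM('a)) * emeasure lborel U" if U: "open U" "B \<subseteq> U" for U
 proof -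
  let ?b = "%i. cball (fst i :: 'a) (snd i)" let ?K = "{i. 0 < snd i \<and> ?b i \<subseteq> U}"
  obtain C where C: "countable C" "C \<subseteq> ?K" "pairwise (%i j. disjnt (?b i) (?b j)) C" "negligible (B - (\<Union>i\<in>C. ?b i))"
  proof (rule Vitali_covering_theorem_cballs[of ?K snd B fst])
   fix i :: "'a \<times> real" assume "i \<in> ?K"
   then show "0 < snd i" by auto
  next
   fix x and d :: real assume x: "x \<in> B" "0 < d"
   then obtain e where "0 < e" "cball x e \<subseteq> U" using U open_contains_cball by blast
   then show "\<exists>i. i \<in> ?K \<and> x \<in> ?b i \<and> snd i < d"
    using x by (intro exI[of _ "(x, min e (d / 2))"]) auto
  qed (rule that; assumption)
  let ?N = "B - (\<Union>i\<in>C. ?b i)"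
  have [measurable]: "?N \<in> sets borel" using C(1) by (intro sets.Diff B sets.countable_UN') auto
  have "negligible (S ` ?N)"
   by (rule negligible_locally_Lipschitz_image[OF order_refl C(4)]) (use S(2) in blast)
  then have "negligible (T -` ?N)"
  proof (rule negligible_subset, intro subsetI)
   fix x assume "x \<in> T -` ?N"
   then have "S (T x) \<in> S ` ?N" by (rule imageI[OF vimageD])
   then show "x \<in> S ` ?N" unfolding S(1) .
  qed
  then have null: "emeasure lborel (T -` ?N) = 0"
   using vim[of ?N] by (simp add: negligible_iff_null_sets null_sets_def)
  have disj: "disjoint_family_on ?b C" "disjoint_family_on (%i. T -` ?b i) C"
   using C(3) unfolding pairwise_def disjoint_family_on_def disjnt_def by blast+
  have "emeasure lborel (T -` B) <= emeasure lborel (T -` ?N \<union> (\<Union>i\<in>C. T -` ?b i))"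
   using C(1) by (intro emeasure_mono) (auto intro!: sets.countable_UN' vim)
  also have "... <= emeasure lborel (T -` ?N) + emeasure lborel (\<Union>i\<in>C. T -` ?b i)"
   using C(1) by (intro emeasure_subadditive) (auto intro!: sets.countable_UN' vim)
  also have "... = (\<integral>\<^sup>+i. emeasure lborel (T -` ?b i) \<partial>count_space C)"
   using C(1) disj(2) by (simp add: null emeasure_UN_countable vim)
  also have "... <= (\<integral>\<^sup>+i. ennreal (L ^ DIM('a)) * emeasure lborel (?b i) \<partial>count_space C)"
  proof (rule nn_integral_mono)
   fix i assume "i \<in> space (count_space C)"
   then have r: "0 <= snd i" using C(2) by force
   have "T -` ?b i \<subseteq> cball (S (fst i)) (L * snd i)"
    using order_trans[OF S(2) mult_left_mono[OF _ S(3)]] S(1) by (force simp: dist_norm)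
   then have "emeasure lborel (T -` ?b i) <= emeasure lborel (cball (S (fst i)) (L * snd i))"
    by (intro emeasure_mono) auto
   then show "emeasure lborel (T -` ?b i) <= ennreal (L ^ DIM('a)) * emeasure lborel (?b i)"
    using r S(3) by (simp add: emeasure_cball power_mult_distrib ennreal_mult mult_ac)
  qed
  also have "... = ennreal (L ^ DIM('a)) * emeasure lborel (\<Union>i\<in>C. ?b i)"
   using C(1) disj(1) by (simp add: nn_integral_cmult emeasure_UN_countable)
  also have "... <= ennreal (L ^ DIM('a)) * emeasure lborel U"
   using C(2) U(1) by (intro mult_left_mono emeasure_mono UN_least) auto
  finally show ?thesis .
 qed
 show ?thesis
 proof (rule ennreal_le_epsilon)
  fix e :: real assume e: "0 < e"
  define e' where "e' = e / (L ^ DIM('a) + 1)"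
  have Lp: "0 <= L ^ DIM('a)" using S(3) by simp
  then have e': "0 < e'" "L ^ DIM('a) * e' <= e" using e by (simp_all add: e'_def add_nonneg_pos field_simps)
  obtain U where U: "open U" "B \<subseteq> U" "emeasure lborel (U - B) < ennreal e'" using outer_regular_lborel[OF B e'(1)] by blast
  have "emeasure lborel U = emeasure lborel (B \<union> (U - B))" using U(2) by (simp add: Un_absorb1)
  also have "... <= emeasure lborel B + ennreal e'"
   using U by (intro order_trans[OF emeasure_subadditive] add_left_mono) auto
  finally have "ennreal (L ^ DIM('a)) * emeasure lborel U <= ennreal (L ^ DIM('a)) * (emeasure lborel B + ennreal e')"
   by (rule mult_left_mono) simp
  also have "... <= ennreal (L ^ DIM('a)) * emeasure lborel B + ennreal e"
   using e' Lp by (simp add: distrib_left ennreal_mult[symmetric] ennreal_leI del: ennreal_mult)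
  finally show "emeasure lborel (T -` B) <= ennreal (L ^ DIM('a)) * emeasure lborel B + ennreal e"
   using le[OF U(1,2)] by (rule order_trans[rotated])
 qed
qed

lemma nn_integral_lipschitz_le:
 fixes T S :: "'a::euclidean_space => 'a"
 assumes T [measurable]: "T \<in> borel_measurable borel"
  and S: "!!x. S (T x) = x" "!!x y. norm (S x - S y) <= L * norm (x - y)" "0 <= L" "L ^ DIM('a) <= c"
  and h [measurable]: "h \<in> borel_measurable borel"
 shows "(NN x. h (T x)) <= ennreal c * (NN x. h x)"
proof -
 have "(NN x. h (T x)) = (\<integral>\<^sup>+x. h x \<partial>distr lborel borel T)" by (simp add: nn_integral_distr)
 also have "... <= (\<integral>\<^sup>+x. h x \<partial>scale_measure (ennreal c) lborel)"
 proof (rule nn_integral_mono_measure)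
  show "distr lborel borel T <= scale_measure (ennreal c) lborel"
  proof (subst le_measure)
   have "emeasure lborel (T -` B) <= ennreal c * emeasure lborel B" if "B \<in> sets borel" for B
    by (rule order_trans[OF emeasure_vimage_lipschitz[OF T that S(1-3)] mult_right_mono[OF ennreal_leI[OF S(4)]]]) simp
   then show "\<forall>B\<in>sets (distr lborel borel T). emeasure (distr lborel borel T) B <= emeasure (scale_measure (ennreal c) lborel) B"
    by (simp add: emeasure_distr)
  qed simp
 qed simp
 finally show ?thesis by (simp add: nn_integral_scale_measure)
qed

text \<open>T minus the identity is Lipschitz with constant \<kappa>. For \<kappa> < 1 this alone
  makes T a bi-Lipschitz bijection.\<close>

definition near_identity :: "real => ('a::euclidean_space => 'a) => bool" where
 "near_identity \<kappa> T \<longleftrightarrow> (\<forall>x y. norm (T x - T y - (x - y)) <= \<kappa> * norm (x - y))"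

lemma near_identity_bij_lipschitz:
 fixes T :: "'a::euclidean_space => 'a"
 assumes T: "near_identity \<kappa> T" and \<kappa>: "0 <= \<kappa>" "\<kappa> < 1"
 shows "bij T" "norm (T x - T y) <= (1 + \<kappa>) * norm (x - y)"
  "norm (inv T x - inv T y) <= 1 / (1 - \<kappa>) * norm (x - y)"
  "T \<in> borel_measurable borel"  "inv T \<in> borel_measurable borel"
proof -
 have near: "norm (T x - T y - (x - y)) <= \<kappa> * norm (x - y)" for x y using T by (simp add: near_identity_def)
 show L: "norm (T x - T y) <= (1 + \<kappa>) * norm (x - y)" for x y
  using near[of x y] norm_triangle_sub[of "T x - T y" "x - y"] by (simp add: algebra_simps)
 have lo: "(1 - \<kappa>) * norm (x - y) <= norm (T x - T y)" for x y
  using near[of x y] norm_triangle_sub[of "x - y" "T x - T y"] by (simp add: norm_minus_commute algebra_simps)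
 have "inj T"
 proof (rule injI)
  fix x y assume "T x = T y"
  then have "(1 - \<kappa>) * norm (x - y) <= 0" using lo[of x y] by simp
  then show "x = y" using \<kappa> by (simp add: mult_le_0_iff)
 qed
 moreover have "\<exists>x. T x = y" for y
 proof -
  \<comment> \<open>T x = y holds exactly when x is a fixed point of the contraction x - T x +
    y.\<close>
  have "\<exists>!x. (x - T x + y) = x"
   by (rule banach_fix_type[where c=\<kappa>]) (use \<kappa> near in "auto simp: dist_norm norm_minus_commute algebra_simps")
  then show ?thesis by (metis add_diff_cancel_left' diff_add_cancel eq_iff_diff_eq_0 add.commute diff_diff_eq2)
 qed
 ultimately show bij: "bij T" by (metis bij_def surj_def)
 show L': "norm (inv T x - inv T y) <= 1 / (1 - \<kappa>) * norm (x - y)" for x y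
  using lo[of "inv T x" "inv T y"] \<kappa> bij by (simp add: bij_is_surj surj_f_inv_f field_simps)
 show "T \<in> borel_measurable borel" "inv T \<in> borel_measurable borel"
  by (intro borel_measurable_continuous_onI lipschitz_on_continuous_on[OF lipschitz_onI], unfold dist_norm, rule L L', use \<kappa> in simp)+
qed

text \<open>T and its inverse have the Lipschitz constants 1 + \<kappa> and 1 / (1 - \<kappa>).
  Their n-th powers are at most 1 / (1 - n \<kappa>) by Bernoulli's inequality, and this is at most
  1 + 4 n \<kappa> as long as 2 n \<kappa> <= 1.\<close>

lemma near_identity_nn_integral:
 fixes T :: "'a::euclidean_space => 'a" and h :: "'a => ennreal"
 assumes T: "near_identity \<kappa> T" and \<kappa>: "0 <= \<kappa>" "2 * real DIM('a) * \<kappa> <= 1"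
  and h [measurable]: "h \<in> borel_measurable borel"
 shows "(NN x. h (T x)) <= ennreal (1 + 4 * real DIM('a) * \<kappa>) * (NN x. h x)"
  and "(NN x. h x) <= ennreal (1 + 4 * real DIM('a) * \<kappa>) * (NN x. h (T x))"
  and "T \<in> borel_measurable borel"
proof -
 let ?D = "DIM('a)"
 define m where "m = real ?D * \<kappa>"
 have m: "m <= 1 / 2" "0 <= m" using \<kappa> by (auto simp: m_def)
 have "\<kappa> * 1 <= \<kappa> * real ?D" using DIM_positive[where 'a='a] \<kappa>(1) by (intro mult_left_mono) (simp_all add: Suc_le_eq)
 then have k: "\<kappa> <= 1 / 2" "\<kappa> < 1" using m by (simp_all add: m_def mult.commute)
 note T' = near_identity_bij_lipschitz[OF T \<kappa>(1) k(2)]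
 note [measurable] = T'(4,5)
 show "T \<in> borel_measurable borel" by (rule T'(4))
 have surj: "T (inv T x) = x" and inj: "inv T (T x) = x" for x
  using T'(1) by (auto simp: bij_is_surj surj_f_inv_f bij_is_inj)
 have c1: "(1 / (1 - \<kappa>)) ^ ?D <= 1 + 4 * real ?D * \<kappa>"
 proof -
  have "(1 / (1 - \<kappa>)) ^ ?D <= 1 / (1 - m)"
   using Bernoulli_inequality[of "- \<kappa>" ?D] k m by (auto simp: m_def power_one_over intro!: divide_left_mono mult_pos_pos zero_less_power)
  moreover have "1 <= (1 + 4 * m) * (1 - m)" using mult_left_mono[OF m] m by (simp add: algebra_simps)
  moreover have "1 / (1 - m) <= 1 + 4 * m" using m calculation(2) by (simp add: pos_divide_le_eq)
  ultimately show ?thesis unfolding m_def by simp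
 qed
 have "1 + \<kappa> <= 1 / (1 - \<kappa>)" using k \<kappa> by (simp add: field_simps)
 then have c2: "(1 + \<kappa>) ^ ?D <= 1 + 4 * real ?D * \<kappa>" using \<kappa> by (intro order_trans[OF power_mono c1]) auto
 show "(NN x. h (T x)) <= ennreal (1 + 4 * real ?D * \<kappa>) * (NN x. h x)"
  by (rule nn_integral_lipschitz_le[OF T'(4) inj T'(3) _ c1 h]) (use k in simp)
 have "(NN x. h (T (inv T x))) <= ennreal (1 + 4 * real ?D * \<kappa>) * (NN x. h (T x))"
  by (rule nn_integral_lipschitz_le[OF T'(5) surj T'(2) _ c2]) (use \<kappa> in simp_all)
 then show "(NN x. h x) <= ennreal (1 + 4 * real ?D * \<kappa>) * (NN x. h (T x))" by (simp add: surj)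
qed

text \<open>For nonnegative functions the two comparisons of
  \<open>near_identity_nn_integral\<close> are symmetric, and a <= (1 + c) b together with b <= (1 +
  c) a gives |a - b| <= c b. A general h is split into its positive and negative parts.\<close>

lemma near_identity_integral:
 fixes T :: "'a::euclidean_space => 'a" and h :: "'a => real"
 assumes T: "near_identity \<kappa> T" and \<kappa>: "0 <= \<kappa>" "2 * real DIM('a) * \<kappa> <= 1"
  and h: "integrable lborel h"
 defines "c \<equiv> 4 * real DIM('a) * \<kappa>"
 shows "integrable lborel (%x. h (T x))"
  and "(LB x. \<bar>h (T x)\<bar>) <= (1 + c) * (LB x. \<bar>h x\<bar>)"
  and "\<bar>(LB x. h (T x)) - (LB x. h x)\<bar> <= c * (LB x. \<bar>h x\<bar>)"
proof -
 note nn = near_identity_nn_integral[OF T \<kappa>, folded c_def]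
 have [measurable]: "T \<in> borel_measurable borel" by (rule nn(3)[of "%_. 0"]) simp
 have c: "0 <= c" "0 <= 1 + c" using \<kappa> by (simp_all add: c_def)
 have key: "\<bar>a - b\<bar> <= c * b" if "a <= (1 + c) * b" "b <= (1 + c) * a" for a b
  using that mult_left_mono[OF _ c(1), of a b] by (cases "a <= b") (auto simp: distrib_right)
 have pos: "integrable lborel (%x. g (T x))" "(LB x. g (T x)) <= (1 + c) * (LB x. g x)"
  "\<bar>(LB x. g (T x)) - (LB x. g x)\<bar> <= c * (LB x. g x)"
  if g: "integrable lborel g" "!!x. g x >= 0" for g :: "'a => real"
 proof -
  have [measurable]: "g \<in> borel_measurable borel" using g(1) by auto
  have eq: "(NN x. ennreal (g x)) = ennreal (LB x. g x)"
   using g by (intro nn_integral_eq_integral) auto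
  have le: "(NN x. ennreal (g (T x))) <= ennreal ((1 + c) * (LB x. g x))"
   using nn(1)[of "%x. ennreal (g x)"] eq c by (simp add: ennreal_mult g)
  show int: "integrable lborel (%x. g (T x))"
   by (rule integrableI_nonneg) (use g le in "auto intro: le_less_trans")
  have eqT: "(NN x. ennreal (g (T x))) = ennreal (LB x. g (T x))"
   using g int by (intro nn_integral_eq_integral) auto
  have "ennreal (LB x. g x) <= ennreal ((1 + c) * (LB x. g (T x)))"
   using nn(2)[of "%x. ennreal (g x)"] eq eqT c by (simp add: ennreal_mult g)
  then show "(LB x. g (T x)) <= (1 + c) * (LB x. g x)"
   "\<bar>(LB x. g (T x)) - (LB x. g x)\<bar> <= c * (LB x. g x)"
   using le eqT c g by (auto simp: ennreal_le_iff intro!: key)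
 qed
 define p m where "p = (%x. max 0 (h x))" and "m = (%x. max 0 (- h x))"
 have pm: "integrable lborel p" "integrable lborel m" "!!x. p x >= 0" "!!x. m x >= 0"
  using h by (auto simp: p_def m_def)
 have hpm: "h x = p x - m x" "\<bar>h x\<bar> = p x + m x" for x by (auto simp: p_def m_def)
 note P = pos[OF pm(1,3)] and M = pos[OF pm(2,4)]
 show "integrable lborel (%x. h (T x))" unfolding hpm using P M by auto
 show "(LB x. \<bar>h (T x)\<bar>) <= (1 + c) * (LB x. \<bar>h x\<bar>)" using pos[of "%x. \<bar>h x\<bar>"] h by auto
 show "\<bar>(LB x. h (T x)) - (LB x. h x)\<bar> <= c * (LB x. \<bar>h x\<bar>)"
  using P M pm unfolding hpm(2) by (simp add: hpm(1) distrib_left)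
qed

subsection \<open>Flows of globally Lipschitz vector fields\<close>

text \<open>Gronwall's inequality: exp (-2 L t) |x - y|^2 does not increase. The square keeps the
  function differentiable where the two solutions meet.\<close>

lemma ode_dist_le:
 fixes x y :: "real => 'e::real_inner"
 assumes F: "!!u v. norm (F u - F v) <= L * norm (u - v)"
  and x: "!!t. t \<in> {0..r} ==> (x has_vector_derivative F (x t)) (at t)"
  and y: "!!t. t \<in> {0..r} ==> (y has_vector_derivative F (y t)) (at t)"
  and r: "0 <= r"
 shows "norm (x r - y r) <= exp (L * r) * norm (x 0 - y 0)"
proof -
 define N where "N = (%t. exp (- 2 * L * t) * ((x t - y t) \<bullet> (x t - y t)))"
 have "N r <= N 0"
 proof (rule DERIV_nonpos_imp_nonincreasing[OF r])
  fix t assume t: "0 <= t" "t <= r"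
  let ?D = "x t - y t" and ?F = "F (x t) - F (y t)"
  have "((%t. x t - y t) has_vector_derivative ?F) (at t)" using x y t by (intro has_vector_derivative_diff) auto
  from bounded_bilinear.has_vector_derivative[OF bounded_bilinear_inner this this]
  have "((%t. (x t - y t) \<bullet> (x t - y t)) has_real_derivative (2 * (?D \<bullet> ?F))) (at t)"
   by (simp add: has_real_derivative_iff_has_vector_derivative inner_commute)
  moreover have "((%t. exp (- 2 * L * t)) has_real_derivative exp (- 2 * L * t) * (- 2 * L)) (at t)"
   by (auto intro!: derivative_eq_intros)
  ultimately have "(N has_real_derivative exp (- 2 * L * t) * (2 * (?D \<bullet> ?F) - 2 * L * (?D \<bullet> ?D))) (at t)"
   unfolding N_def by (intro DERIV_cong[OF DERIV_mult]) (assumption | simp add: right_diff_distrib)+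
  moreover have "?D \<bullet> ?F <= L * (?D \<bullet> ?D)"
  proof -
   have "?D \<bullet> ?F <= norm ?D * norm ?F" by (rule norm_cauchy_schwarz)
   also have "... <= norm ?D * (L * norm ?D)" by (intro mult_left_mono F norm_ge_zero)
   finally show ?thesis by (simp add: dot_square_norm power2_eq_square mult_ac)
  qed
  ultimately show "\<exists>d. (N has_real_derivative d) (at t) \<and> d <= 0"
   by (intro exI conjI) (auto simp: mult_le_0_iff)
 qed
 then have "exp (- 2 * L * r) * (norm (x r - y r))\<^sup>2 <= (norm (x 0 - y 0))\<^sup>2" by (simp add: N_def dot_square_norm)
 then have "exp (2 * L * r) * (exp (- 2 * L * r) * (norm (x r - y r))\<^sup>2) <= exp (2 * L * r) * (norm (x 0 - y 0))\<^sup>2" by (intro mult_left_mono) auto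
 also have "exp (2 * L * r) * (exp (- 2 * L * r) * (norm (x r - y r))\<^sup>2) = (norm (x r - y r))\<^sup>2"
  by (simp add: exp_minus)
 also have "exp (2 * L * r) * (norm (x 0 - y 0))\<^sup>2 = (exp (L * r) * norm (x 0 - y 0))\<^sup>2"
  by (simp add: power_mult_distrib mult.assoc flip: exp_double)
 finally show ?thesis by (rule power2_le_imp_le) simp
qed

text \<open>Picard-Lindelof through the contraction principle on the bounded continuous functions of
  the whole line; times are clamped to [-h, h]. Two integrals over intervals of length at most 2h
  enter, so the contraction constant is 4 L h <= 1/2.\<close>

lemma ode_exists:
 fixes F :: "'e::euclidean_space => 'e"
 assumes F: "!!u v. norm (F u - F v) <= L * norm (u - v)"
  and M: "!!u. norm (F u) <= M" and h: "0 < h" "L * h <= 1 / 8" "0 <= L"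
 shows "\<exists>x. x 0 = z \<and> (\<forall>t. \<bar>t\<bar> < h --> (x has_vector_derivative F (x t)) (at t))"
proof -
 have contF: "continuous_on UNIV F"
  by (rule lipschitz_on_continuous_on[OF lipschitz_onI[of _ _ L]]) (use F h in "auto simp: dist_norm")
 define c where "c = (%t::real. max (- h) (min h t))"
 have c: "c t \<in> {- h..h}" for t using h by (auto simp: c_def)
 \<comment> \<open>The integral starts at -h, so that only forward intervals occur; subtracting its
   value at time 0 restores the initial condition.\<close>
 define J where "J = (%x t. integral {- h..c t} (%s. F (apply_bcontfun x s)))"
 define P where "P = (%x t. z + J x t - J x 0)"
 have contFx: "continuous_on S (%s. F (apply_bcontfun x s))" for x S
  by (rule continuous_on_compose2[OF contF]) auto
 have int: "(%s. F (apply_bcontfun x s)) integrable_on {a..b}" for x and a b :: real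
  by (rule integrable_continuous_interval[OF contFx])
 have contJ: "continuous_on UNIV (J x)" for x
 proof -
  have "continuous_on {- h..h} (%t. integral {- h..t} (%s. F (apply_bcontfun x s)))"
   by (rule indefinite_integral_continuous_1[OF int])
  then show ?thesis unfolding J_def
   by (rule continuous_on_compose2) (use c in "auto simp: c_def intro!: continuous_intros")
 qed
 have bJ: "norm (J x t) <= M * (2 * h)" for x t
 proof -
  have "norm (J x t) <= M * (c t - (- h))"
   unfolding J_def by (rule integral_bound) (use c[of t] contFx M in auto)
  also have "... <= M * (2 * h)" using c[of t] order_trans[OF norm_ge_zero M] by (intro mult_left_mono) auto
  finally show ?thesis .
 qed
 have PB: "P x \<in> bcontfun" for x
 proof (rule bcontfun_normI)
  show "continuous_on UNIV (P x)" unfolding P_def by (intro continuous_intros contJ)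
  show "norm (P x t) <= norm z + M * (2 * h) + M * (2 * h)" for t
   unfolding P_def using bJ[of x t] bJ[of x 0] norm_triangle_ineq4[of "z + J x t" "J x 0"] norm_triangle_ineq[of z "J x t"] by linarith
 qed
 have Jd: "norm (J x t - J y t) <= L * dist x y * (2 * h)" for x y t
 proof -
  have "J x t - J y t = integral {- h..c t} (%s. F (apply_bcontfun x s) - F (apply_bcontfun y s))"
   unfolding J_def using int by (simp add: Henstock_Kurzweil_Integration.integral_diff)
  also have "norm ... <= (L * dist x y) * (c t - (- h))"
  proof (rule integral_bound)
   show "norm (F (apply_bcontfun x s) - F (apply_bcontfun y s)) <= L * dist x y" for s
   proof -
    have "L * norm (apply_bcontfun x s - apply_bcontfun y s) <= L * dist x y"
     using dist_bounded[of x s y] h(3) unfolding dist_norm[of "apply_bcontfun x s"] by (rule mult_left_mono)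
    with F show ?thesis by (rule order_trans)
   qed
  qed (use c[of t] continuous_on_diff[OF contFx contFx] in auto)
  also have "... <= (L * dist x y) * (2 * h)" using c[of t] h by (intro mult_left_mono) auto
  finally show ?thesis .
 qed
 have "\<exists>!x. Bcontfun (P x) = x"
 proof (rule banach_fix_type[where f="%x. Bcontfun (P x)" and c="1/2"])
  show "\<forall>x y. dist (Bcontfun (P x)) (Bcontfun (P y)) <= 1 / 2 * dist x y"
  proof (intro allI dist_bound)
   fix x y t
   have "dist (apply_bcontfun (Bcontfun (P x)) t) (apply_bcontfun (Bcontfun (P y)) t) = norm ((J x t - J y t) - (J x 0 - J y 0))"
    unfolding Bcontfun_inverse[OF PB] by (simp add: P_def dist_norm algebra_simps)
   also have "... <= L * dist x y * (2 * h) + L * dist x y * (2 * h)"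
    using norm_triangle_ineq4 Jd by (meson add_mono order_trans)
   also have "... = (L * h) * (4 * dist x y)" by simp
   also have "... <= 1/8 * (4 * dist x y)" using h by (intro mult_right_mono) auto
   finally show "dist (apply_bcontfun (Bcontfun (P x)) t) (apply_bcontfun (Bcontfun (P y)) t) <= 1/2 * dist x y" by simp
  qed
 qed auto
 then obtain x where "Bcontfun (P x) = x" by blast
 then have x: "apply_bcontfun x t = P x t" for t using PB by (metis Bcontfun_inverse)
 have "(apply_bcontfun x has_vector_derivative F (apply_bcontfun x t)) (at t)" if t: "\<bar>t\<bar> < h" for t
 proof -
  have "((%t. integral {- h..t} (%s. F (apply_bcontfun x s))) has_vector_derivative F (apply_bcontfun x t)) (at t within {- h..h})"
   by (rule integral_has_vector_derivative[OF contFx]) (use t in auto)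
  then have "((%t. integral {- h..t} (%s. F (apply_bcontfun x s))) has_vector_derivative F (apply_bcontfun x t)) (at t)"
   using t by (subst (asm) at_within_interior) (auto simp: interior_atLeastAtMost_real)
  then have "((%t. z + integral {- h..t} (%s. F (apply_bcontfun x s)) - J x 0) has_vector_derivative F (apply_bcontfun x t)) (at t)"
   by (auto intro!: derivative_eq_intros)
  then show ?thesis
  proof (rule has_vector_derivative_transform_within_open[where S="{- h<..<h}"])
   show "z + integral {- h..s} (%s. F (apply_bcontfun x s)) - J x 0 = apply_bcontfun x s" if "s \<in> {- h<..<h}" for s
    using that x[of s] by (simp add: P_def J_def c_def)
  qed (use t in auto)
 qed
 moreover have "apply_bcontfun x 0 = z" using x[of 0] by (simp add: P_def)
 ultimately show ?thesis by blast
qed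

text \<open>By Gronwall two trajectories separate by at most the factor exp (L t) <= 2, so the
  difference of their velocities is at most 2 L times the initial distance. Integrated in time, this
  makes the time t map a perturbation of the identity with constant 2 L t. Joint continuity holds
  because the flow is Lipschitz in time and in the starting point.\<close>

lemma flow_exists:
 fixes F :: "'e::euclidean_space => 'e"
 assumes F: "!!u v. norm (F u - F v) <= L * norm (u - v)"
  and M: "!!u. norm (F u) <= M" and h: "0 < h" "L * h <= 1 / 8" "0 <= L"
 obtains \<phi> where "!!z. \<phi> 0 z = z"
  "!!z t. \<bar>t\<bar> < h ==> ((%t. \<phi> t z) has_vector_derivative F (\<phi> t z)) (at t)"
  "!!z w t. 0 <= t ==> t < h ==> norm (\<phi> t z - \<phi> t w - (z - w)) <= 2 * L * t * norm (z - w)"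
  "!!z t. \<bar>t\<bar> < h ==> norm (\<phi> t z - z) <= M * \<bar>t\<bar>"
  "continuous_on ({0..<h} \<times> UNIV) (%(t, z). \<phi> t z)"
proof -
 have "\<forall>z. \<exists>x. x 0 = z \<and> (\<forall>t. \<bar>t\<bar> < h --> (x has_vector_derivative F (x t)) (at t))"
  using ode_exists[OF F M h] by blast
 then obtain \<psi> where \<psi>: "!!z. \<psi> z 0 = z" "!!z t. \<bar>t\<bar> < h ==> (\<psi> z has_vector_derivative F (\<psi> z t)) (at t)"
  by metis
 define \<phi> where "\<phi> = (%t z. \<psi> z t)"
 have d: "((%t. \<phi> t z) has_vector_derivative F (\<phi> t z)) (at t)" if "\<bar>t\<bar> < h" for z t
  using \<psi>(2)[OF that] by (simp add: \<phi>_def)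
 have lip: "norm (\<phi> t z - \<phi> t w) <= 2 * norm (z - w)" if t: "0 <= t" "t < h" for z w t
 proof -
  have "norm (\<phi> t z - \<phi> t w) <= exp (L * t) * norm (\<phi> 0 z - \<phi> 0 w)"
   by (rule ode_dist_le[OF F d d t(1)]) (use t in auto)
  also have "... <= 2 * norm (z - w)"
  proof -
   have m: "0 <= L * t" "L * t <= 1 / 8" using h t mult_left_mono[of t h L] by auto
   then have "exp (L * t) <= 2" using exp_bound[of "L * t"] mult_left_le[of "L * t" "L * t"] by (simp add: power2_eq_square)
   then show ?thesis by (intro mult_mono) (auto simp: \<phi>_def \<psi>)
  qed
  finally show ?thesis .
 qed
 have near: "norm (\<phi> t z - \<phi> t w - (z - w)) <= 2 * L * t * norm (z - w)" if t: "0 <= t" "t < h" for z w t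
 proof -
  have "norm ((\<phi> t z - \<phi> t w) - (\<phi> 0 z - \<phi> 0 w)) <= (2 * L * norm (z - w)) * norm (t - 0)"
  proof (rule differentiable_bound[where S="{0..t}" and f="%t. \<phi> t z - \<phi> t w"])
   fix u assume u: "u \<in> {0..t}"
   then have "\<bar>u\<bar> < h" using t by auto
   from has_vector_derivative_diff[OF d[OF this, of z] d[OF this, of w]]
   show "((%t. \<phi> t z - \<phi> t w) has_derivative (%h. h *\<^sub>R (F (\<phi> u z) - F (\<phi> u w)))) (at u within {0..t})"
    unfolding has_vector_derivative_def by (rule has_derivative_at_withinI)
   show "onorm (%h. h *\<^sub>R (F (\<phi> u z) - F (\<phi> u w))) <= 2 * L * norm (z - w)"
    using order_trans[OF F mult_left_mono[OF lip h(3)], of u z w] u t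
    by (subst onorm_scaleR_left[OF bounded_linear_ident]) (simp add: onorm_id mult_ac)
  qed (use t in auto)
  then show ?thesis using t by (simp add: \<phi>_def \<psi> mult_ac)
 qed
 have speed: "norm (\<phi> t z - \<phi> s z) <= M * \<bar>t - s\<bar>" if t: "\<bar>t\<bar> < h" "\<bar>s\<bar> < h" for t s z
 proof -
  have "norm (\<phi> t z - \<phi> s z) <= M * norm (t - s)"
  proof (rule differentiable_bound[where S="{-h<..<h}"])
   fix u assume u: "u \<in> {-h<..<h}"
   show "((%t. \<phi> t z) has_derivative (%h. h *\<^sub>R F (\<phi> u z))) (at u within {-h<..<h})"
    using d[of u z] u by (auto simp: has_vector_derivative_def intro: has_derivative_at_withinI)
   show "onorm (%h. h *\<^sub>R F (\<phi> u z)) <= M"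
    using M by (subst onorm_scaleR_left[OF bounded_linear_ident]) (simp add: onorm_id)
  qed (use t in auto)
  then show ?thesis by simp
 qed
 have M0: "0 <= M" using order_trans[OF norm_ge_zero M] .
 have "continuous_on ({0..<h} \<times> UNIV) (%(t, z). \<phi> t z)"
 proof (rule lipschitz_on_continuous_on[OF lipschitz_onI])
  fix p q :: "real \<times> 'e" assume pq: "p \<in> {0..<h} \<times> UNIV" "q \<in> {0..<h} \<times> UNIV"
  obtain t z s w where e: "p = (t, z)" "q = (s, w)" by (cases p, cases q)
  have "norm (\<phi> t z - \<phi> s w) <= norm (\<phi> t z - \<phi> s z) + norm (\<phi> s z - \<phi> s w)"
   using norm_triangle_ineq[of "\<phi> t z - \<phi> s z" "\<phi> s z - \<phi> s w"] by simp
  also have "... <= M * \<bar>t - s\<bar> + 2 * norm (z - w)" using pq e by (intro add_mono speed lip) auto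
  also have "... <= M * dist p q + 2 * dist p q"
   using dist_fst_le[of p q] dist_snd_le[of p q] M0
   by (intro add_mono mult_left_mono) (auto simp: e dist_norm)
  finally show "dist (case p of (t, z) => \<phi> t z) (case q of (t, z) => \<phi> t z) <= (M + 2) * dist p q"
   by (simp add: e dist_norm algebra_simps)
 qed (use M0 in auto)
 moreover have "norm (\<phi> t z - z) <= M * \<bar>t\<bar>" if "\<bar>t\<bar> < h" for z t
  using speed[of t 0 z] that h by (simp add: \<phi>_def \<psi>)
 moreover have "\<phi> 0 z = z" for z by (simp add: \<phi>_def \<psi>)
 ultimately show ?thesis using d near by (intro that[of \<phi>])
qed

subsection \<open>Mollification in \<open>L\<^sup>1\<close>\<close>

lemma integrable_indicator_cball:
 "integrable lborel (indicator (cball a r) :: 'a::euclidean_space => real)"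
 using emeasure_lborel_cball_finite[of a r] by (intro integrable_real_indicator) auto

text \<open>Truncation in value by \<open>c m\<close> and in space by the continuous cutoff
  \<open>q m\<close> makes f bounded with bounded support at a small cost in L^1. The continuous
  functions that converge to f almost everywhere are truncated in the same way, and then dominated
  convergence applies to them.\<close>

lemma integrable_approx_continuous:
 fixes f :: "'a::euclidean_space => real"
 assumes f: "integrable lborel f" and e: "0 < e"
 obtains g R where "continuous_on UNIV g" "!!x. R < norm x ==> g x = 0" "(LB x. \<bar>f x - g x\<bar>) < e"
proof -
 have fm [measurable]: "f \<in> borel_measurable borel" using f by auto
 then have "f \<in> borel_measurable lebesgue" by (simp add: measurable_completion)
 then have "f measurable_on UNIV" by (intro lebesgue_measurable_imp_measurable_on) auto
 then obtain N g where N: "negligible N" and gc: "!!n. continuous_on UNIV (g n)" and lim: "!!x. x \<notin> N ==> (%n. g n x) \<longlonglongrightarrow> f x"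
  unfolding measurable_on_def by auto
 have [measurable]: "g n \<in> borel_measurable borel" for n by (rule borel_measurable_continuous_onI[OF gc])
 have AE: "AE x in lborel. x \<notin> N"
  using AE_not_in[of N lebesgue] N by (simp add: negligible_iff_null_sets AE_completion_iff)
 define c where "c m y = max (- real m) (min (real m) y)" for m y
 define q where "q m x = max 0 (min 1 (real m + 1 - norm (x::'a)))" for m x
 have q: "0 <= q m x" "q m x <= 1" "real m + 1 < norm x ==> q m x = 0" for m x by (auto simp: q_def)
 have c_le: "\<bar>c m y\<bar> <= real m" for m y by (auto simp: c_def)
 have [measurable]: "q m \<in> borel_measurable borel" "c m \<in> borel_measurable borel" for m unfolding q_def c_def by measurable
 have "(%m. LB x. \<bar>f x - q m x * c m (f x)\<bar>) \<longlonglongrightarrow> (LB (x::'a). 0)"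
 proof (rule integral_dominated_convergence[where w="%x. \<bar>f x\<bar>"])
  show "AE x in lborel. (%m. \<bar>f x - q m x * c m (f x)\<bar>) \<longlonglongrightarrow> 0"
  proof (intro AE_I2 tendsto_eventually)
   fix x
   show "\<forall>\<^sub>F m in sequentially. \<bar>f x - q m x * c m (f x)\<bar> = 0"
    using eventually_ge_at_top[of "nat \<lceil>max \<bar>f x\<bar> (norm x)\<rceil>"]
   proof eventually_elim
    case (elim m)
    then have "\<bar>f x\<bar> <= real m" "norm x <= real m" by (simp_all add: nat_le_iff ceiling_le_iff)
    then have "q m x = 1" "c m (f x) = f x" by (auto simp: q_def c_def max_def min_def abs_le_iff)
    then show ?case by simp
   qed
  qed
  have "\<bar>y - t * c m y\<bar> <= \<bar>y\<bar>" if "0 <= t" "t <= 1" for t y m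
  proof (cases "0 <= y")
   case True
   then have "0 <= c m y" "c m y <= y" by (auto simp: c_def)
   then show ?thesis using that mult_right_mono[of t 1 "c m y"] mult_nonneg_nonneg[of t "c m y"] by linarith
  next
   case False
   then have "c m y <= 0" "y <= c m y" by (auto simp: c_def)
   then show ?thesis using that mult_right_mono_neg[of t 1 "c m y"] mult_nonneg_nonpos[of t "c m y"] by linarith
  qed
  then show "AE x in lborel. norm \<bar>f x - q m x * c m (f x)\<bar> <= \<bar>f x\<bar>" for m using q by simp
 qed (use f in auto)
 from order_tendstoD(2)[OF this, of "e / 2"] obtain m where m: "(LB x. \<bar>f x - q m x * c m (f x)\<bar>) < e / 2"
  using e by (auto simp: eventually_sequentially)
 let ?g = "%n x. q m x * c m (g n x)"
 have ic: "integrable lborel (%x. q m x * c m (k x))" if [measurable]: "k \<in> borel_measurable borel" for k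
 proof (rule integrable_bound[OF integrable_mult_right[OF integrable_indicator_cball[of 0 "real m + 1"], of "real m"]])
  show "AE x in lborel. norm (q m x * c m (k x)) <= norm (real m * indicator (cball 0 (real m + 1)) x)"
   using mult_mono[OF q(2) c_le] q by (intro AE_I2) (auto simp: abs_mult indicator_def)
 qed simp
 have "(%n. LB x. \<bar>q m x * c m (f x) - ?g n x\<bar>) \<longlonglongrightarrow> (LB (x::'a). 0)"
 proof (rule integral_dominated_convergence[where w="%x. 2 * real m * indicator (cball 0 (real m + 1)) x"])
  show "AE x in lborel. (%n. \<bar>q m x * c m (f x) - ?g n x\<bar>) \<longlonglongrightarrow> 0"
   using AE
  proof eventually_elim
   case (elim x)
   have "(%n. \<bar>q m x * c m (f x) - ?g n x\<bar>) \<longlonglongrightarrow> \<bar>q m x * c m (f x) - q m x * c m (f x)\<bar>"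
    unfolding c_def by (intro tendsto_intros lim[OF elim])
   then show ?case by simp
  qed
  show "AE x in lborel. norm \<bar>q m x * c m (f x) - ?g n x\<bar> <= 2 * real m * indicator (cball 0 (real m + 1)) x" for n
  proof (rule AE_I2)
   fix x
   have "\<bar>c m (f x) - c m (g n x)\<bar> <= 2 * real m" using c_le[of m "f x"] c_le[of m "g n x"] by linarith
   then have "q m x * \<bar>c m (f x) - c m (g n x)\<bar> <= 1 * (2 * real m)" using q by (intro mult_mono) auto
   then show "norm \<bar>q m x * c m (f x) - ?g n x\<bar> <= 2 * real m * indicator (cball 0 (real m + 1)) x"
    using q by (auto simp: abs_mult indicator_def simp flip: right_diff_distrib)
  qed
 qed (auto intro: integrable_indicator_cball)
 from order_tendstoD(2)[OF this, of "e / 2"] obtain n where n: "(LB x. \<bar>q m x * c m (f x) - ?g n x\<bar>) < e / 2"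
  using e by (auto simp: eventually_sequentially)
 have i: "integrable lborel (%x. q m x * c m (f x))" "integrable lborel (?g n)" by (rule ic; measurable)+
 have "(LB x. \<bar>f x - ?g n x\<bar>) <= (LB x. \<bar>f x - q m x * c m (f x)\<bar> + \<bar>q m x * c m (f x) - ?g n x\<bar>)"
  by (rule integral_mono) (use f i in auto)
 also have "... < e" using m n f i by simp
 finally show ?thesis
  by (intro that[of "?g n" "real m + 1"]) (auto simp: q(3) c_def q_def intro!: continuous_intros continuous_on_subset[OF gc])
qed

lemma nn_integral_lborel_translate:
 fixes h :: "'a::euclidean_space => ennreal"
 assumes [measurable]: "h \<in> borel_measurable borel"
 shows "(NN x. h (x - y)) = (NN x. h x)" "(NN x. h (x + y)) = (NN x. h x)"
proof -
 show "(NN x. h (x - y)) = (NN x. h x)"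
  by (subst (2) lborel_distr_plus[of "- y", symmetric]) (simp add: nn_integral_distr)
 show "(NN x. h (x + y)) = (NN x. h x)"
  by (subst (2) lborel_distr_plus[of y, symmetric]) (simp add: nn_integral_distr add.commute)
qed

lemma integral_lborel_translate:
 fixes h :: "'a::euclidean_space => real"
 assumes "integrable lborel h"
 shows "integrable lborel (%x. h (x + y))" "(LB x. h (x + y)) = (LB x. h x)"
proof -
 have [measurable]: "h \<in> borel_measurable borel" using assms by auto
 have "integrable (distr lborel borel ((+) y)) h" using assms by (simp add: lborel_distr_plus)
 then show "integrable lborel (%x. h (x + y))" by (subst (asm) integrable_distr_eq) (auto simp: add.commute)
 show "(LB x. h (x + y)) = (LB x. h x)"
  by (subst (2) lborel_distr_plus[of y, symmetric]) (simp add: integral_distr add.commute)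
qed

lemma integral_lborel_reflect:
 fixes h :: "'a::euclidean_space => real"
 assumes [measurable]: "h \<in> borel_measurable borel"
 shows "(LB x. h (- x)) = (LB x. h x)"
proof -
 have "lborel = distr lborel borel (uminus :: 'a => 'a)" using lborel_affine[of "-1" "0::'a"] by (simp add: density_1)
 then have "(LB x. h x) = (LINT x|distr lborel borel uminus. h x)" by simp
 then show ?thesis by (simp add: integral_distr)
qed

text \<open>Young's inequality, by exchanging the two integrals of the absolute values and the
  translation invariance of Lebesgue measure.\<close>

lemma convolve_L1:
 fixes f :: "'a::euclidean_space => real"
 assumes "continuous_on UNIV \<phi>" "!!x. R < norm x ==> \<phi> x = 0" "integrable lborel f"
 shows "integrable lborel (convolve \<phi> f)"
  and "(LB x. \<bar>convolve \<phi> f x\<bar>) <= (LB x. \<bar>\<phi> x\<bar>) * (LB x. \<bar>f x\<bar>)"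
proof -
 have [measurable]: "\<phi> \<in> borel_measurable borel" by (rule borel_measurable_continuous_onI[OF assms(1)])
 have [measurable]: "f \<in> borel_measurable borel" using assms(3) by auto
 have i\<phi>: "integrable lborel \<phi>" by (rule integrable_continuous_bounded_support[OF assms(1,2)])
 have [measurable]: "convolve \<phi> f \<in> borel_measurable borel"
  unfolding convolve_def by measurable
 have "(NN x. ennreal \<bar>convolve \<phi> f x\<bar>) <= (NN x. (NN y. ennreal \<bar>\<phi> (x - y)\<bar> * ennreal \<bar>f y\<bar>))"
 proof (rule nn_integral_mono)
  fix x
  have "ennreal (norm (LB y. \<phi> (x - y) *\<^sub>R f y)) <= (NN y. ennreal (norm (\<phi> (x - y) *\<^sub>R f y)))"
   by (rule integral_norm_bound_ennreal[OF integrable_kernel[OF assms]])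
  then show "ennreal \<bar>convolve \<phi> f x\<bar> <= (NN y. ennreal \<bar>\<phi> (x - y)\<bar> * ennreal \<bar>f y\<bar>)"
   by (simp add: convolve_def abs_mult ennreal_mult)
 qed
 also have "... = (NN y. (NN x. ennreal \<bar>\<phi> (x - y)\<bar> * ennreal \<bar>f y\<bar>))"
  by (rule lborel_pair.Fubini') measurable
 also have "... = (NN y. (NN x. ennreal \<bar>\<phi> x\<bar>) * ennreal \<bar>f y\<bar>)"
  by (simp add: nn_integral_multc nn_integral_lborel_translate(1)[where h="%x. ennreal \<bar>\<phi> x\<bar>"])
 also have "... = ennreal ((LB x. \<bar>\<phi> x\<bar>) * (LB x. \<bar>f x\<bar>))"
  using i\<phi> assms(3) by (simp add: nn_integral_cmult nn_integral_eq_integral ennreal_mult)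
 finally have le: "(NN x. ennreal \<bar>convolve \<phi> f x\<bar>) <= ennreal ((LB x. \<bar>\<phi> x\<bar>) * (LB x. \<bar>f x\<bar>))" .
 then show int: "integrable lborel (convolve \<phi> f)"
  by (intro integrableI_bounded) (auto intro: le_less_trans)
 show "(LB x. \<bar>convolve \<phi> f x\<bar>) <= (LB x. \<bar>\<phi> x\<bar>) * (LB x. \<bar>f x\<bar>)"
  using le int by (subst (asm) nn_integral_eq_integral) (auto simp: ennreal_le_iff)
qed

lemma convolve_mollifier_eq_0:
 assumes "0 < s" "!!x. x \<notin> S ==> f x = 0" "!!y. y \<in> S ==> s <= dist x y"
 shows "convolve (mollifier s) f x = 0"
proof -
 have "mollifier s (x - y) *\<^sub>R f y = 0" for y
  using assms by (cases "y \<in> S") (auto simp: dist_norm mollifier_eq_0)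
 then have "(%y. mollifier s (x - y) *\<^sub>R f y) = (%y. 0)" by blast
 then show ?thesis by (simp add: convolve_def)
qed

lemma integral_mollifier_shift:
 assumes "0 < s"
 shows "integrable lborel (%y. mollifier s (x - y))" "(LB y. mollifier s (x - y)) = 1"
proof -
 have *: "mollifier s (x - y) = mollifier s (y + (- x))" for y
  using mollifier_uminus[of s "x - y"] by simp
 show "integrable lborel (%y. mollifier s (x - y))" "(LB y. mollifier s (x - y)) = 1"
  unfolding * using integral_lborel_translate[OF integrable_mollifier[OF assms], of "- x"] integral_mollifier[OF assms, where 'a='a] by auto
qed

text \<open>For a continuous g of bounded support the mollification is uniformly close to g and
  lives in a ball of fixed radius R + 1. Mollification does not increase the L^1 norm, so the
  estimate passes from g to f.\<close>

lemma convolve_mollifier_L1: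
 fixes f :: "'a::euclidean_space => real"
 assumes f: "integrable lborel f" and e: "0 < e"
 shows "\<exists>d>0. \<forall>s. 0 < s \<and> s < d --> (LB x. \<bar>convolve (mollifier s) f x - f x\<bar>) < e"
proof -
 obtain g R0 where g: "continuous_on UNIV g" "!!x. R0 < norm x ==> g x = 0" "(LB x. \<bar>f x - g x\<bar>) < e / 4"
  by (rule integrable_approx_continuous[OF f, of "e/4"]) (use e in auto)
 define R where "R = max R0 0"
 have gR: "g x = 0" if "R < norm x" for x using g(2) that by (auto simp: R_def)
 have gi: "integrable lborel g" using integrable_continuous_bounded_support g by blast
 define v where "v = measure lborel (cball (0::'a) (R + 1)) + 1"
 have v: "v > 0" by (simp add: v_def add_nonneg_pos)
 obtain d where d: "0 < d" "!!x y. dist x y < d ==> dist (g x) (g y) < e / (4 * v)"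
  by (rule uniformly_continuous_bounded_support[OF g(1) gR, where e="e / (4 * v)"]) (use e v in auto)
 show ?thesis
 proof (intro exI[of _ "min d 1"] conjI allI impI)
  fix s assume s: "0 < s \<and> s < min d 1"
  let ?k = "mollifier s :: 'a => real"
  have supp: "?k x = 0" if "s < norm x" for x using s that by (intro mollifier_eq_0) auto
  have intf: "integrable lborel (%y. ?k (x - y) *\<^sub>R h y)" if "integrable lborel h" for x and h :: "'a => real"
   by (rule integrable_kernel[OF continuous_on_mollifier supp that])
  have near: "\<bar>convolve ?k g x - g x\<bar> <= e / (4 * v) * indicator (cball 0 (R + 1)) x" for x
  proof (cases "norm x <= R + 1")
   case True
   have "convolve ?k g x - g x = (LB y. ?k (x - y) *\<^sub>R g y - ?k (x - y) *\<^sub>R g x)"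
    unfolding convolve_def using intf[OF gi] integral_mollifier_shift[of s x] s by simp
   also have "\<bar>...\<bar> <= (LB y. e / (4 * v) * ?k (x - y))"
    unfolding real_norm_def[symmetric]
   proof (rule integral_norm_bound_integral)
    show "integrable lborel (%y. ?k (x - y) *\<^sub>R g y - ?k (x - y) *\<^sub>R g x)"
     using intf[OF gi] integral_mollifier_shift(1)[of s x] s by auto
    show "integrable lborel (%y. e / (4 * v) * ?k (x - y))" using integral_mollifier_shift(1)[of s x] s by auto
    fix y
    show "norm (?k (x - y) *\<^sub>R g y - ?k (x - y) *\<^sub>R g x) <= e / (4 * v) * ?k (x - y)"
    proof (cases "norm (x - y) < s")
     case True
     then have "\<bar>g y - g x\<bar> <= e / (4 * v)" using d(2)[of y x] s by (simp add: dist_norm norm_minus_commute)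
     then have "?k (x - y) * \<bar>g y - g x\<bar> <= ?k (x - y) * (e / (4 * v))"
      using s by (intro mult_left_mono mollifier_nonneg) auto
     then show ?thesis using mollifier_nonneg[of s "x - y"] s
      unfolding scaleR_diff_right[symmetric] norm_scaleR by (simp add: mult.commute)
    next
     case False
     then show ?thesis using s by (simp add: mollifier_eq_0)
    qed
   qed
   also have "... = e / (4 * v)" using integral_mollifier_shift[of s x] s by simp
   finally show ?thesis using True by simp
  next
   case False
   have "convolve ?k g x = 0"
   proof (rule convolve_mollifier_eq_0[where S="cball 0 R"])
    fix y :: 'a assume "y \<in> cball 0 R"
    then have "norm x <= dist x y + R" using norm_triangle_ineq2[of x y] by (simp add: dist_norm)
    then show "s <= dist x y" using False s by linarith
   qed (use s gR in auto)
   then show ?thesis using False gR[of x] by auto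
  qed
  have ig: "integrable lborel (convolve ?k g)" and iF: "integrable lborel (convolve ?k f)"
   using convolve_L1(1)[OF continuous_on_mollifier supp] gi f by blast+
  have "(LB x. \<bar>convolve ?k g x - g x\<bar>) <= (LB x. e / (4 * v) * indicator (cball (0::'a) (R + 1)) x)"
  proof (rule integral_mono)
   show "integrable lborel (%x. e / (4 * v) * indicator (cball (0::'a) (R + 1)) x)"
    by (intro integrable_mult_right integrable_indicator_cball)
  qed (use ig gi near in auto)
  also have "... = e / (4 * v) * (v - 1)" by (simp add: v_def)
  also have "... <= e / 4" using v e by (simp add: field_simps)
  finally have 1: "(LB x. \<bar>convolve ?k g x - g x\<bar>) <= e / 4" .
  have fg: "integrable lborel (%x. f x - g x)" using f gi by auto
  have cd: "convolve ?k f x - convolve ?k g x = convolve ?k (%x. f x - g x) x" for x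
   unfolding convolve_def using intf[OF f] intf[OF gi] by (simp add: right_diff_distrib)
  have "(LB x. \<bar>?k x\<bar>) = 1"
   using integral_mollifier[of s, where 'a='a] s by (simp add: mollifier_nonneg)
  then have 2: "(LB x. \<bar>convolve ?k f x - convolve ?k g x\<bar>) <= (LB x. \<bar>f x - g x\<bar>)"
   using convolve_L1(2)[OF continuous_on_mollifier supp fg] by (simp add: cd)
  have "(LB x. \<bar>convolve ?k f x - f x\<bar>) <=
   (LB x. \<bar>convolve ?k f x - convolve ?k g x\<bar> + \<bar>convolve ?k g x - g x\<bar> + \<bar>f x - g x\<bar>)"
   by (rule integral_mono) (use ig iF f gi in auto)
  also have "... = (LB x. \<bar>convolve ?k f x - convolve ?k g x\<bar>) + (LB x. \<bar>convolve ?k g x - g x\<bar>) + (LB x. \<bar>f x - g x\<bar>)"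
   using ig iF f gi by simp
  also have "... < e" using 1 2 g(3) e by linarith
  finally show "(LB x. \<bar>convolve ?k f x - f x\<bar>) < e" .
 qed (use d in auto)
qed


subsection \<open>Integration by parts\<close>

text \<open>Convolution with the indicator of a ball that exceeds the support of the kernel by 1
  gives the constant integral of the kernel at all points of norm less than 1. So the convolution of
  h is constant near 0, and its derivative there, which is the integral of the directional
  derivative of h, vanishes.\<close>

lemma integral_directional_derivative:
 fixes h :: "'a::euclidean_space => real"
 assumes C1: "Ck_on 1 UNIV h" and supp: "!!x. R < norm x ==> h x = 0"
 shows "integrable lborel (%x. Dv h x v)" "(LB x. Dv h x v) = 0"
proof -
 note sD = Dv_bounded_support[of R h, OF supp]
 have cD: "continuous_on UNIV (%x. Dv h x v)" for v using C1 by auto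
 show "integrable lborel (%x. Dv h x v)" by (rule integrable_continuous_bounded_support[OF cD sD])
 let ?f = "indicator (cball 0 (\<bar>R\<bar> + 1)) :: 'a => real"
 have conv: "convolve k ?f x = (LB y. k y)"
  if k: "continuous_on UNIV k" "!!x. R < norm x ==> k x = 0" and x: "norm x < 1" for x and k :: "'a => real"
 proof -
  have "k (x - y) *\<^sub>R ?f y = k (x - y)" for y
   using k(2)[of "x - y"] x norm_triangle_ineq2[of y x] by (auto simp: indicator_def norm_minus_commute)
  then have "convolve k ?f x = (LB y. k (x - y))" by (simp only: convolve_def)
  also have "... = (LB y. k (y + x))"
   using integral_lborel_reflect[of "%y. k (x - y)"] borel_measurable_continuous_onI[OF k(1)] by (simp add: add.commute)
  finally show ?thesis using integral_lborel_translate(2)[OF integrable_continuous_bounded_support[OF k]] by simp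
 qed
 have "(convolve h ?f has_derivative (%v. convolve (%z. Dv h z v) ?f 0)) (at 0)"
  by (rule convolve_has_derivative[OF _ supp integrable_indicator_cball]) (use C1 in simp_all)
 moreover have "(convolve h ?f has_derivative (%_. 0)) (at 0)"
  by (rule has_derivative_transform_within_open[OF has_derivative_const[of "LB y. h y"] open_ball, of 0 0 1])
   (use conv[OF Ck_on_continuous[OF C1] supp] in auto)
 ultimately have "(%v. convolve (%z. Dv h z v) ?f 0) = (%_. 0)" by (rule has_derivative_unique)
 then have "convolve (%z. Dv h z v) ?f 0 = 0" by metis
 then show "(LB x. Dv h x v) = 0" using conv[OF cD sD] by simp
qed

text \<open>The flat divergence. The Riemannian one is \<open>divg\<close> of \<rho> X, divided by
  \<rho>.\<close>

definition divg :: "('a::euclidean_space => 'a) => 'a => real" where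
 "divg Z x = (\<Sum>b\<in>Basis. Dv Z x b \<bullet> b)"

lemma sum_partial_eq_divg:
 fixes Z :: "real^'n => real^'n"
 assumes "Z differentiable (at u)"
 shows "(\<Sum>i\<in>UNIV. partial i (%v. Z v $ i) u) = divg Z u"
proof -
 have der: "(Z has_derivative Dv Z u) (at u)"
  using assms by (simp add: frechet_derivative_works)
 have "partial i (%v. Z v $ i) u = Dv Z u (axis i 1) \<bullet> axis i 1" for i
 proof -
  have "((%v. Z v $ i) has_derivative (%h. Dv Z u h $ i)) (at u)"
   by (rule bounded_linear.has_derivative[OF bounded_linear_vec_nth der])
  then show ?thesis unfolding partial_def by (simp add: frechet_derivative_at[symmetric] inner_axis)
 qed
 moreover have "(\<Sum>i\<in>UNIV. Dv Z u (axis i 1) \<bullet> axis i 1) = divg Z u"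
  unfolding divg_def
  by (rule sum.reindex_bij_witness[of _ "%b. SOME i. b = axis i 1" "%i. axis i 1"])
   (auto simp: Basis_vec_def axis_eq_axis intro: someI2)
 ultimately show ?thesis by simp
qed

lemma continuous_on_divg: "Ck_on 1 S Z ==> continuous_on S (divg Z)"
 unfolding divg_def by (auto intro!: continuous_intros)

lemma divg_eq_0: "open S ==> x \<in> S ==> (!!y. y \<in> S ==> Z y = 0) ==> divg Z x = 0"
 by (simp add: divg_def frechet_derivative_eq_0)

lemma integral_by_parts:
 fixes h :: "'a::euclidean_space => real" and Z :: "'a => 'a"
 assumes h: "Ck_on 1 UNIV h" and Z: "Ck_on 1 UNIV Z" and supp: "!!x. R < norm x ==> Z x = 0"
 shows "(LB x. h x * divg Z x) = - (LB x. Dv h x (Z x))"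
proof -
 have dh: "(h has_derivative Dv h x) (at x)" for x
  using h by (simp add: frechet_derivative_works[symmetric])
 have dZ: "(Z has_derivative Dv Z x) (at x)" for x
  using Z by (simp add: frechet_derivative_works[symmetric])
 have contD: "continuous_on UNIV (%x. Dv h x b)" for b
  using h by auto
 have ch: "continuous_on UNIV h" "continuous_on UNIV Z"
  using h Z by (auto intro: Ck_on_continuous simp del: Ck_on.simps)
 define \<phi> where "\<phi> = (%b x. h x * (Z x \<bullet> b))"
 have d\<phi>: "(\<phi> b has_derivative (%v. h x * (Dv Z x v \<bullet> b) + Dv h x v * (Z x \<bullet> b))) (at x)" for b x
  unfolding \<phi>_def by (auto intro!: derivative_eq_intros dh dZ)
 have fd: "Dv (\<phi> b) x b = h x * (Dv Z x b \<bullet> b) + Dv h x b * (Z x \<bullet> b)" for b x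
  using frechet_derivative_at[OF d\<phi>] by metis
 have C\<phi>: "Ck_on 1 UNIV (\<phi> b)" for b
  unfolding \<phi>_def by (intro Ck_on_mult Ck_on_inner Ck_on_const open_UNIV h Z)
 have s\<phi>: "\<phi> b x = 0" if "R < norm x" for b x using supp[OF that] by (simp add: \<phi>_def)
 have P: "integrable lborel (%x. Dv (\<phi> b) x b)" "(LB x. Dv (\<phi> b) x b) = 0" for b
  using integral_directional_derivative[OF C\<phi>[of b], of R] s\<phi> by blast+
 have i2: "integrable lborel (%x. Dv h x b * (Z x \<bullet> b))" for b
  by (rule integrable_continuous_bounded_support[where R=R]) (use supp contD ch in "auto intro!: continuous_intros")
 have i1: "integrable lborel (%x. h x * (Dv Z x b \<bullet> b))" for b
  using integrable_diff[OF P(1)[of b] i2[of b]] by (simp add: fd)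
 have "(LB x. h x * divg Z x) = (\<Sum>b\<in>Basis. (LB x. h x * (Dv Z x b \<bullet> b)))"
  unfolding divg_def sum_distrib_left using i1 by (intro integral_sum) auto
 also have "... = (\<Sum>b\<in>Basis. - (LB x. Dv h x b * (Z x \<bullet> b)))"
 proof (rule sum.cong[OF refl])
  fix b :: 'a
  have "0 = (LB x. h x * (Dv Z x b \<bullet> b)) + (LB x. Dv h x b * (Z x \<bullet> b))"
   using P(2)[of b] i1 i2 by (simp add: fd)
  then show "(LB x. h x * (Dv Z x b \<bullet> b)) = - (LB x. Dv h x b * (Z x \<bullet> b))" by linarith
 qed
 also have "... = - (LB x. (\<Sum>b\<in>Basis. Dv h x b * (Z x \<bullet> b)))"
  using i2 by (simp add: sum_negf)
 also have "(%x. \<Sum>b\<in>Basis. Dv h x b * (Z x \<bullet> b)) = (%x. Dv h x (Z x))"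
  by (rule ext, subst has_derivative_sum_Basis[OF dh]) (simp add: mult.commute)
 finally show ?thesis .
qed

lemma integral_convolve_adjoint:
 fixes k f z :: "'a::euclidean_space => real"
 assumes k: "continuous_on UNIV k" "!!x. R < norm x ==> k x = 0" and f: "integrable lborel f" and z: "integrable lborel z"
 shows "integrable lborel (%x. convolve k f x * z x)" "integrable lborel (%y. f y * convolve (%u. k (- u)) z y)"
  "(LB x. convolve k f x * z x) = (LB y. f y * convolve (%u. k (- u)) z y)"
proof -
 have [measurable]: "f \<in> borel_measurable borel" "z \<in> borel_measurable borel" "k \<in> borel_measurable borel"
  using f z borel_measurable_continuous_onI[OF k(1)] by auto
 obtain B where B: "0 < B" "!!x. norm (k x) <= B" using bounded_continuous_support[OF k] by blast
 let ?F = "%x y. k (x - y) * f y * z x"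
 have i: "integrable (lborel \<Otimes>\<^sub>M lborel) (%(x, y). ?F x y)"
 proof (rule integrable_bound)
  show "integrable (lborel \<Otimes>\<^sub>M lborel) (%p. (B * norm (z (fst p))) * norm (f (snd p)))"
   using f z by (intro lborel_pair.Fubini_integrable) (auto simp: abs_mult)
  show "AE p in lborel \<Otimes>\<^sub>M lborel. norm (case p of (x, y) => ?F x y) <= norm ((B * norm (z (fst p))) * norm (f (snd p)))"
  proof (rule AE_I2, clarsimp simp: abs_mult)
   fix x y
   show "\<bar>k (x - y)\<bar> * \<bar>f y\<bar> * \<bar>z x\<bar> <= \<bar>B\<bar> * \<bar>z x\<bar> * \<bar>f y\<bar>"
    using mult_right_mono[OF B(2)[of "x - y"], of "\<bar>f y\<bar> * \<bar>z x\<bar>"] B(1) by (simp add: mult_ac)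
  qed
 qed measurable
 have L: "convolve k f x * z x = (LB y. ?F x y)" and R: "f y * convolve (%u. k (- u)) z y = (LB x. ?F x y)" for x y
  by (simp add: convolve_def, simp add: convolve_def mult.assoc mult.left_commute[of "k _"])
 show "integrable lborel (%x. convolve k f x * z x)" unfolding L using lborel_pair.integrable_fst'[OF i] by simp
 show "integrable lborel (%y. f y * convolve (%u. k (- u)) z y)" unfolding R using lborel_pair.integrable_snd[OF i] by simp
 show "(LB x. convolve k f x * z x) = (LB y. f y * convolve (%u. k (- u)) z y)"
  unfolding L R by (rule lborel_pair.Fubini_integral[OF i, symmetric])
qed

text \<open>On both sides the derivative falls on the kernel. The mollifier is even, so its
  derivative is odd, and the adjoint of the convolution brings the minus sign of integration by
  parts. Z is only integrable: the upper bound uses a field that may jump where a gradient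
  vanishes.\<close>

lemma integral_mollified_derivative:
 fixes f :: "'a::euclidean_space => real" and Z :: "'a => 'a"
 assumes s: "0 < s" and f: "integrable lborel f" and Z: "integrable lborel Z"
 shows "(LB x. Dv (convolve (mollifier s) f) x (Z x)) = - (LB y. f y * divg (convolve (mollifier s) Z) y)"
proof -
 let ?k = "mollifier s :: 'a => real"
 let ?D = "%b z. Dv ?k z b"
 have C1: "Ck_on (Suc 0) UNIV ?k" by (rule Ck_on_mollifier)
 have supp: "?k x = 0" if "s < norm x" for x using s that by (simp add: mollifier_eq_0)
 have cD: "continuous_on UNIV (?D b)" for b using C1 by simp
 note sD = Dv_bounded_support[of s ?k, OF supp]
 have odd: "?D b (- z) = - ?D b z" for b z
 proof -
  have der: "(?k has_derivative Dv ?k y) (at y)" for y using Ck_on_SucD(1)[OF C1] by simp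
  have "((%z. ?k (- z)) has_derivative (%h. Dv ?k (- z) (- h))) (at z)"
   by (rule has_derivative_compose[where f=uminus, OF _ der]) (auto intro!: derivative_eq_intros)
  from frechet_derivative_at[OF this, unfolded mollifier_uminus] have "Dv ?k (- z) (- b) = Dv ?k z b" by metis
  then show ?thesis using linear_neg[OF has_derivative_linear[OF der]] by simp
 qed
 have Zb: "integrable lborel (%x. Z x \<bullet> b)" for b using Z by (rule integrable_inner_left)
 have adj: "integrable lborel (%x. convolve (?D b) f x * (Z x \<bullet> b))" "integrable lborel (%y. f y * convolve (?D b) (%x. Z x \<bullet> b) y)"
  "(LB x. convolve (?D b) f x * (Z x \<bullet> b)) = - (LB y. f y * convolve (?D b) (%x. Z x \<bullet> b) y)" for b
  using integral_convolve_adjoint[OF cD[of b] sD f Zb[of b]] by (simp_all add: odd convolve_def)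
 have L: "Dv (convolve ?k f) x (Z x) = (\<Sum>b\<in>Basis. convolve (?D b) f x * (Z x \<bullet> b))" for x
  using has_derivative_sum_Basis[OF convolve_has_derivative[OF C1 supp f, where x=x], where h="Z x"]
  by (simp add: frechet_derivative_at[OF convolve_has_derivative[OF C1 supp f], symmetric] mult.commute)
 have R: "divg (convolve ?k Z) y = (\<Sum>b\<in>Basis. convolve (?D b) (%x. Z x \<bullet> b) y)" for y
  using integrable_kernel[OF cD sD Z]
  by (simp add: divg_def frechet_derivative_at[OF convolve_has_derivative[OF C1 supp Z], symmetric] convolve_def flip: integral_inner_left)
 show ?thesis unfolding L R sum_distrib_left using adj by (simp add: integral_sum sum_negf)
qed

subsection \<open>Change of variables without a well-ordered index type\<close>

text \<open>The change of variables theorems of the library need the index type to be well-ordered.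
 The copy \<open>'n wo\<close> of a finite type carries such an order.\<close>

typedef 'n wo = "UNIV :: 'n set" by auto

definition wo_index :: "'n::finite wo => nat" where
 "wo_index x = (SOME f :: 'n => nat. inj f) (Rep_wo x)"

lemma wo_index_inj: "wo_index x = wo_index y \<longleftrightarrow> x = y"
proof -
 have "\<exists>f :: 'a => nat. inj f" using finite_imp_inj_to_nat_seg[OF finite[of UNIV]] by auto
 then have "inj (SOME f :: 'a => nat. inj f)" by (rule someI_ex)
 then show ?thesis by (auto simp: wo_index_def inj_eq Rep_wo_inject)
qed

instantiation wo :: (finite) "{finite, wellorder}"
begin

definition less_eq_wo :: "'a wo => 'a wo => bool" where "less_eq_wo x y \<longleftrightarrow> wo_index x <= wo_index y"
definition less_wo :: "'a wo => 'a wo => bool" where "less_wo x y \<longleftrightarrow> wo_index x < wo_index y"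

instance
proof
 have "finite (Rep_wo ` (UNIV :: 'a wo set))" by simp
 then show "finite (UNIV :: 'a wo set)" by (rule finite_imageD) (auto simp: inj_on_def Rep_wo_inject)
next
 fix P :: "'a wo => bool" and a
 assume step: "!!x. (!!y. y < x ==> P y) ==> P x"
 show "P a"
  by (induction a rule: measure_induct_rule[where f=wo_index]) (rule step, simp add: less_wo_def)
qed (auto simp: less_eq_wo_def less_wo_def wo_index_inj)

end

definition to_wo :: "real^'n => real^('n::finite wo)" where
 "to_wo x = (\<chi> i. x $ Rep_wo i)"

definition of_wo :: "real^('n::finite wo) => real^'n" where
 "of_wo x = (\<chi> i. x $ Abs_wo i)"

lemma of_wo_to_wo [simp]: "of_wo (to_wo x) = x"
 and to_wo_of_wo [simp]: "to_wo (of_wo y) = y"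
 for x :: "real^'n" and y :: "real^('n::finite wo)"
 by (auto simp: of_wo_def to_wo_def vec_eq_iff Abs_wo_inverse Rep_wo_inverse)

lemma bounded_linear_to_wo: "bounded_linear to_wo"
 by (auto intro!: linear_conv_bounded_linear[THEN iffD1] linearI simp: to_wo_def vec_eq_iff)

lemma bounded_linear_of_wo: "bounded_linear of_wo"
 by (auto intro!: linear_conv_bounded_linear[THEN iffD1] linearI simp: of_wo_def vec_eq_iff)

lemma continuous_to_wo: "continuous_on S to_wo"
 by (rule linear_continuous_on[OF bounded_linear_to_wo])

lemma continuous_of_wo: "continuous_on S of_wo"
 by (rule linear_continuous_on[OF bounded_linear_of_wo])

lemma measurable_of_wo [measurable]: "(of_wo :: real^('n wo) => real^'n::finite) \<in> borel_measurable borel"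
 by (intro borel_measurable_continuous_onI continuous_of_wo)

lemma bij_Abs_wo: "bij Abs_wo"
 by (rule bijI') (auto simp: Abs_wo_inject intro: Rep_wo_inverse[symmetric])

lemma prod_Basis_vec: "(\<Prod>b\<in>Basis. f b) = (\<Prod>i\<in>UNIV. f (axis i (1::real)))" for f :: "real^'n => real"
proof -
 have "bij_betw (%i. axis i (1::real)) (UNIV :: 'n set) Basis"
  by (auto simp: bij_betw_def inj_on_def axis_eq_axis Basis_vec_def)
 from prod.reindex_bij_betw[OF this, of f] show ?thesis by simp
qed

lemma sum_Basis_vec: "(\<Sum>b\<in>Basis. f b) = (\<Sum>i\<in>UNIV. f (axis i (1::real)))" for f :: "real^'n => 'b::comm_monoid_add"
proof -
 have "bij_betw (%i. axis i (1::real)) (UNIV :: 'n set) Basis"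
  by (auto simp: bij_betw_def inj_on_def axis_eq_axis Basis_vec_def)
 from sum.reindex_bij_betw[OF this, of f] show ?thesis by simp
qed

lemma distr_of_wo: "distr lborel borel of_wo = lborel"
proof (rule lborel_eqI[symmetric])
 fix l u :: "real^'n" assume lu: "!!b. b \<in> Basis ==> l \<bullet> b <= u \<bullet> b"
 have le: "l $ i <= u $ i" for i using lu[of "axis i 1"] by (auto simp: Basis_vec_def inner_axis)
 have "of_wo -` box l u = box (to_wo l) (to_wo u)"
  by (auto simp: mem_box_cart of_wo_def to_wo_def) (metis Rep_wo_inverse Abs_wo_inverse UNIV_I)+
 then have "emeasure (distr lborel borel of_wo) (box l u) = emeasure lborel (box (to_wo l) (to_wo u))"
  by (simp add: emeasure_distr)
 also have "... = ennreal (\<Prod>b\<in>Basis. (to_wo u - to_wo l) \<bullet> b)"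
  by (rule emeasure_lborel_box) (use le in "auto simp: Basis_vec_def inner_axis to_wo_def")
 also have "(\<Prod>b\<in>Basis. (to_wo u - to_wo l) \<bullet> b) = (\<Prod>i\<in>UNIV. u $ Rep_wo i - l $ Rep_wo i)"
  by (simp add: prod_Basis_vec inner_axis to_wo_def)
 also have "... = (\<Prod>i\<in>UNIV. u $ i - l $ i)"
  using prod.reindex_bij_betw[OF bij_Abs_wo, of "%i. u $ Rep_wo i - l $ Rep_wo i"]
  by (simp add: Abs_wo_inverse)
 also have "... = (\<Prod>b\<in>Basis. (u - l) \<bullet> b)" by (simp add: prod_Basis_vec inner_axis)
 finally show "emeasure (distr lborel borel of_wo) (box l u) = (\<Prod>b\<in>Basis. (u - l) \<bullet> b)" .
qed simp

text \<open>The Leibniz sum is reindexed by carrying permutations over to the copy of the index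
  type, which keeps their signs.\<close>

lemma det_wo: "det (\<chi> i j. A $ Rep_wo i $ Rep_wo j) = det A" for A :: "real^'n^'n"
proof -
 let ?m = "map_permutation UNIV (Abs_wo :: 'n => 'n wo)"
 have bij: "bij_betw ?m {p. p permutes UNIV} {p. p permutes UNIV}"
 proof (rule bij_betw_byWitness[where f'="map_permutation UNIV (Rep_wo :: 'n wo => 'n)"])
  have bR: "bij (Rep_wo :: 'n wo => 'n)"
   by (rule bijI') (auto simp: Rep_wo_inject intro: Abs_wo_inverse[OF UNIV_I, symmetric])
  show "\<forall>p\<in>{p. p permutes UNIV}. map_permutation UNIV (Rep_wo :: 'n wo => 'n) (?m p) = p"
   using map_permutation_compose_inv[OF bij_Abs_wo, where g=Rep_wo] by (auto simp: Abs_wo_inverse)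
  show "\<forall>p\<in>{p. p permutes UNIV}. ?m (map_permutation UNIV (Rep_wo :: 'n wo => 'n) p) = p"
   using map_permutation_compose_inv[OF bR, where g=Abs_wo] by (auto simp: Rep_wo_inverse)
  show "?m ` {p. p permutes UNIV} \<subseteq> {p. p permutes UNIV}"
   using map_permutation_permutes[OF bij_Abs_wo] by auto
  show "map_permutation UNIV (Rep_wo :: 'n wo => 'n) ` {p. p permutes UNIV} \<subseteq> {p. p permutes UNIV}"
   using map_permutation_permutes[OF bR] by auto
 qed
 have "det (\<chi> i j. A $ Rep_wo i $ Rep_wo j)
  = (\<Sum>p | p permutes (UNIV :: 'n set). of_int (sign (?m p)) * (\<Prod>i\<in>UNIV. A $ Rep_wo i $ Rep_wo (?m p i)))"
  unfolding det_def by (subst sum.reindex_bij_betw[OF bij, symmetric]) simp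
 also have "... = det A"
  unfolding det_def
 proof (rule sum.cong[OF refl])
  fix p :: "'n => 'n" assume p: "p \<in> {p. p permutes UNIV}"
  have "(\<Prod>i\<in>UNIV. A $ Rep_wo i $ Rep_wo (?m p i)) = (\<Prod>i\<in>UNIV. A $ Rep_wo (Abs_wo i) $ Rep_wo (?m p (Abs_wo i)))"
   using prod.reindex_bij_betw[OF bij_Abs_wo, of "%i. A $ Rep_wo i $ Rep_wo (?m p i)"] by simp
  also have "... = (\<Prod>i\<in>UNIV. A $ i $ p i)"
   by (simp add: map_permutation_apply[OF bij_is_inj[OF bij_Abs_wo] UNIV_I] Abs_wo_inverse)
  finally show "of_int (sign (?m p)) * (\<Prod>i\<in>UNIV. A $ Rep_wo i $ Rep_wo (?m p i)) = of_int (sign p) * (\<Prod>i\<in>UNIV. A $ i $ p i)"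
   using sign_map_permutation[of "Abs_wo :: 'n => 'n wo" UNIV p] p bij_Abs_wo bij_is_inj by auto
 qed
 finally show ?thesis .
qed

text \<open>\<open>has_measure_differentiable_image\<close> characterises a finite measure of the
  image. The infinite case follows, because a finite measure of the image would in turn make the
  Jacobian integrable.\<close>

lemma emeasure_image_wellorder:
 fixes g :: "real^'m::{finite,wellorder} => real^'m::_"
 assumes B: "B \<in> sets borel" "g ` B \<in> sets borel"
  and der: "!!x. x \<in> B ==> (g has_derivative g' x) (at x)" and inj: "inj_on g B"
  and meas: "(%x. \<bar>det (matrix (g' x))\<bar> * indicator B x) \<in> borel_measurable borel"
 shows "emeasure lborel (g ` B) = (NN x. ennreal (\<bar>det (matrix (g' x))\<bar> * indicator B x))"
proof -
 let ?J = "%x. \<bar>det (matrix (g' x))\<bar>"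
 have der': "(g has_derivative g' x) (at x within B)" if "x \<in> B" for x
  using der[OF that] by (rule has_derivative_at_withinI)
 have BL: "B \<in> sets lebesgue" using B by simp
 note iff = has_measure_differentiable_image[OF BL der' inj]
 have ind: "((%x. ?J x * indicator B x) has_integral m) UNIV \<longleftrightarrow> (?J has_integral m) B" for m
 proof -
  have "(%x. ?J x * indicator B x) = (%x. if x \<in> B then ?J x else 0)" by (auto simp: indicator_def)
  then show ?thesis using has_integral_restrict_UNIV[of B ?J m] by simp
 qed
 show ?thesis
 proof (cases "(NN x. ennreal (?J x * indicator B x)) < \<infinity>")
  case True
  then obtain m where m: "m >= 0" "(NN x. ennreal (?J x * indicator B x)) = ennreal m"
   by (cases "(NN x. ennreal (?J x * indicator B x))") auto
  have "((%x. ?J x * indicator B x) has_integral m) UNIV"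
   by (rule nn_integral_has_integral[OF meas _ m(2,1)]) auto
  then have "g ` B \<in> lmeasurable \<and> measure lebesgue (g ` B) = m" using iff ind by blast
  then have "emeasure lebesgue (g ` B) = ennreal m" using emeasure_eq_measure2 by blast
  then show ?thesis using m B(2) by (simp add: emeasure_completion)
 next
  case False
  have "emeasure lborel (g ` B) = \<infinity>"
  proof (rule ccontr)
   assume "emeasure lborel (g ` B) ~= \<infinity>"
   then have "g ` B \<in> lmeasurable" using B(2) by (auto simp: fmeasurable_def less_top)
   then have "(?J has_integral measure lebesgue (g ` B)) B" using iff by blast
   then have "((%x. ?J x * indicator B x) has_integral measure lebesgue (g ` B)) UNIV" using ind by blast
   from nn_integral_has_integral_lborel[OF meas _ this] False show False by auto
  qed
  with False show ?thesis by (simp add: less_top[symmetric])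
 qed
qed

lemma emeasure_image_change_of_variables:
 fixes g :: "real^'n => real^'n"
 assumes B: "B \<in> sets borel" "g ` B \<in> sets borel"
  and der: "!!x. x \<in> B ==> (g has_derivative g' x) (at x)" and inj: "inj_on g B"
  and meas: "(%x. \<bar>det (matrix (g' x))\<bar> * indicator B x) \<in> borel_measurable borel"
 shows "emeasure lborel (g ` B) = (NN x. ennreal (\<bar>det (matrix (g' x))\<bar> * indicator B x))"
proof -
 define G where "G = (%y. to_wo (g (of_wo y)))"
 define G' where "G' = (%y h. to_wo (g' (of_wo y) (of_wo h)))"
 define C where "C = to_wo ` B"
 have img: "to_wo ` X = of_wo -` X" for X :: "(real^'n) set" by (auto simp: image_iff) (metis to_wo_of_wo)
 have C: "C = of_wo -` B" by (simp add: C_def img)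
 have Cm: "C \<in> sets borel" unfolding C using measurable_sets_borel[OF measurable_of_wo B(1)] by simp
 have GC: "G ` C = of_wo -` (g ` B)"
  by (simp add: G_def C_def image_image flip: img)
 have GCm: "G ` C \<in> sets borel" unfolding GC using measurable_sets_borel[OF measurable_of_wo B(2)] by simp
 have derG: "(G has_derivative G' y) (at y)" if "y \<in> C" for y
  unfolding G_def G'_def
  by (rule has_derivative_compose[where f=of_wo and g="%x. to_wo (g x)", OF bounded_linear_imp_has_derivative[OF bounded_linear_of_wo]])
   (use that in "auto simp: C intro!: bounded_linear.has_derivative[OF bounded_linear_to_wo] der")
 have injG: "inj_on G C"
  using inj unfolding inj_on_def G_def C by (metis of_wo_to_wo to_wo_of_wo vimageE)
 have det: "det (matrix (G' y)) = det (matrix (g' (of_wo y)))" if "y \<in> C" for y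
 proof -
  have "matrix (G' y) = (\<chi> i j. matrix (g' (of_wo y)) $ Rep_wo i $ Rep_wo j)"
  proof -
   have "of_wo (axis j 1) = axis (Rep_wo j) 1" for j :: "'n wo"
    by (auto simp: of_wo_def vec_eq_iff axis_def Abs_wo_inverse Rep_wo_inverse)
   then show ?thesis by (simp add: matrix_def G'_def to_wo_def)
  qed
  then show ?thesis by (simp add: det_wo)
 qed
 have eqJ: "\<bar>det (matrix (G' y))\<bar> * indicator C y = \<bar>det (matrix (g' (of_wo y)))\<bar> * indicator B (of_wo y)" for y
  using det[of y] by (auto simp: indicator_def C)
 have measG: "(%y. \<bar>det (matrix (G' y))\<bar> * indicator C y) \<in> borel_measurable borel"
  unfolding eqJ using measurable_compose[OF measurable_of_wo meas] .
 have "emeasure lborel (g ` B) = emeasure (distr lborel borel of_wo) (g ` B)" by (simp add: distr_of_wo)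
 also have "... = emeasure lborel (G ` C)" using B(2) by (simp add: emeasure_distr GC)
 also have "... = (NN y. ennreal (\<bar>det (matrix (G' y))\<bar> * indicator C y))"
  by (rule emeasure_image_wellorder[OF Cm GCm derG injG measG])
 also have "... = (\<integral>\<^sup>+x. ennreal (\<bar>det (matrix (g' x))\<bar> * indicator B x) \<partial>distr lborel borel of_wo)"
  using meas by (subst nn_integral_distr) (auto simp: eqJ)
 finally show ?thesis by (simp add: distr_of_wo)
qed

text \<open>Lebesgue measure restricted to the image and the image of the measure with density |det
  g'| agree on Borel sets, hence have the same integrals.\<close>

lemma nn_integral_change_of_variables:
 fixes g :: "real^'n => real^'n" and f :: "real^'n => ennreal"
 assumes U: "open U" "open (g ` U)"
  and der: "!!x. x \<in> U ==> (g has_derivative g' x) (at x)"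
  and cont: "!!v. continuous_on U (%x. g' x v)"
  and h: "!!x. x \<in> U ==> h (g x) = x" "continuous_on (g ` U) h"
  and f: "f \<in> borel_measurable borel"
 shows "(NN y. f y * indicator (g ` U) y)
   = (NN x. ennreal \<bar>det (matrix (g' x))\<bar> * f (g x) * indicator U x)"
proof -
 let ?J = "%x. \<bar>det (matrix (g' x))\<bar>"
 have [measurable]: "U \<in> sets borel" "g ` U \<in> sets borel" using U by auto
 note [measurable] = f
 have contg: "continuous_on U g"
  using der by (meson continuous_at_imp_continuous_on has_derivative_continuous)
 \<comment> \<open>Constant continuation makes g and its Jacobian Borel on the whole space; outside
   U the density is 0, so the chosen value of g there has no weight.\<close>
 define g1 where "g1 = (%x. if x \<in> U then g x else 0)"
 have g1 [measurable]: "g1 \<in> borel_measurable borel"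
  unfolding g1_def using U(1) contg by (intro borel_measurable_continuous_on_if) auto
 define J1 where "J1 = (%x. if x \<in> U then ?J x else 0)"
 have "continuous_on U ?J"
  unfolding det_def matrix_def using cont by (auto intro!: continuous_intros)
 then have J1 [measurable]: "J1 \<in> borel_measurable borel"
  unfolding J1_def using U(1) by (intro borel_measurable_continuous_on_if) auto
 define M where "M = density lborel (indicator (g ` U))"
 define N where "N = distr (density lborel (%x. ennreal (J1 x))) borel g1"
 have inj: "inj_on g U" using h(1) by (metis inj_on_inverseI)
 have "M = N"
 proof (rule measure_eqI)
  show "sets M = sets N" by (simp add: M_def N_def)
  fix X assume "X \<in> sets M"
  then have X [measurable]: "X \<in> sets borel" by (simp add: M_def)
  define B where "B = U \<inter> g1 -` X"
  have B [measurable]: "B \<in> sets borel" unfolding B_def using measurable_sets_borel[OF g1 X] by auto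
  have gB: "g ` B = g ` U \<inter> X" by (auto simp: B_def g1_def)
  have BU: "B \<subseteq> U" by (auto simp: B_def)
  have JB: "?J x * indicator B x = J1 x * indicator B x" for x using BU by (auto simp: J1_def indicator_def)
  have "emeasure M X = emeasure lborel (g ` U \<inter> X)"
   by (simp add: M_def emeasure_density indicator_inter_arith[symmetric])
  also have "... = emeasure lborel (g ` B)" by (simp add: gB)
  also have "... = (NN x. ennreal (?J x * indicator B x))"
  proof (rule emeasure_image_change_of_variables[OF B])
   show "g ` B \<in> sets borel" by (simp add: gB)
   show "(g has_derivative g' x) (at x)" if "x \<in> B" for x using that BU der by blast
   show "inj_on g B" using inj BU inj_on_subset by blast
   show "(%x. ?J x * indicator B x) \<in> borel_measurable borel" unfolding JB by measurable
  qed
  also have "... = (NN x. ennreal (J1 x) * indicator (g1 -` X) x)"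
   unfolding JB by (intro nn_integral_cong) (auto simp: indicator_def B_def J1_def)
  also have "... = emeasure N X"
   by (simp add: N_def emeasure_distr emeasure_density measurable_sets_borel[OF g1 X])
  finally show "emeasure M X = emeasure N X" .
 qed
 have "(NN y. f y * indicator (g ` U) y) = (\<integral>\<^sup>+y. f y \<partial>M)"
  by (simp add: M_def nn_integral_density mult.commute)
 also have "... = (NN x. ennreal (J1 x) * f (g1 x))"
  unfolding \<open>M = N\<close> N_def by (simp add: nn_integral_distr nn_integral_density)
 also have "... = (NN x. ennreal (?J x) * f (g x) * indicator U x)"
  by (intro nn_integral_cong) (auto simp: J1_def g1_def indicator_def)
 finally show ?thesis .
qed

lemma matrix_inv_cancel:
 fixes E :: "real^'n^'n"
 assumes "invertible E"
 shows "matrix_inv E ** E = mat 1" "E ** matrix_inv E = mat 1"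
proof -
 have "E ** matrix_inv E = mat 1 \<and> matrix_inv E ** E = mat 1"
  unfolding matrix_inv_def using assms[unfolded invertible_def] by (rule someI_ex)
 then show "matrix_inv E ** E = mat 1" "E ** matrix_inv E = mat 1" by auto
qed

lemma nn_integral_linear_change:
 fixes E :: "real^'n^'n" and f :: "real^'n => ennreal"
 assumes E: "invertible E" and f: "f \<in> borel_measurable borel"
 shows "(NN y. f y) = ennreal \<bar>det E\<bar> * (NN x. f (E *v x))"
proof -
 have inv: "matrix_inv E *v (E *v x) = x" "E *v (matrix_inv E *v x) = x" for x
  using matrix_inv_cancel[OF E] by (simp_all add: matrix_vector_mul_assoc)
 have surj: "(*v) E ` UNIV = UNIV" using inv(2) by (metis surjI)
 note [measurable] = f
 have [measurable]: "(*v) E \<in> borel_measurable borel"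
  by (intro borel_measurable_continuous_onI matrix_vector_mult_linear_continuous_on)
 have "(NN y. f y * indicator ((*v) E ` UNIV) y)
   = (NN x. ennreal \<bar>det (matrix ((*v) E))\<bar> * f (E *v x) * indicator UNIV x)"
  by (rule nn_integral_change_of_variables[where h="(*v) (matrix_inv E)"])
   (use f in "auto simp: surj inv intro: matrix_vector_mult_linear_continuous_on bounded_linear_imp_has_derivative linear_conv_bounded_linear[THEN iffD1]")
 then show ?thesis by (simp add: surj nn_integral_cmult)
qed

subsection \<open>Radial integration\<close>

lemma nn_integral_lborel_scale:
 fixes f :: "'a::euclidean_space => ennreal"
 assumes [measurable]: "f \<in> borel_measurable borel" and c: "0 < c"
 shows "(NN x. f x) = ennreal (c ^ DIM('a)) * (NN x. f (c *\<^sub>R x))"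
 by (subst lborel_affine[of c 0])
  (use c in "simp_all add: nn_integral_density nn_integral_distr nn_integral_cmult")

lemma nn_integral_homogeneous_cball:
 fixes k :: "'a::euclidean_space => ennreal"
 assumes [measurable]: "k \<in> borel_measurable borel"
  and hom: "!!c w. 0 < c ==> k (c *\<^sub>R w) = k w" and t: "0 < t"
 shows "(NN w. k w * indicator (cball 0 t) w)
   = ennreal (t ^ DIM('a)) * (NN w. k w * indicator (cball 0 1) w)"
proof -
 have ind: "indicator (cball 0 t) (t *\<^sub>R w) = (indicator (cball 0 1) w :: ennreal)" for w :: 'a
  using t by (auto simp: indicator_def)
 have "(NN w. k w * indicator (cball 0 t) w) = ennreal (t ^ DIM('a)) * (NN w. k (t *\<^sub>R w) * indicator (cball 0 t) (t *\<^sub>R w))"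
  by (rule nn_integral_lborel_scale[OF _ t]) measurable
 then show ?thesis using hom[OF t] by (simp add: ind)
qed

text \<open>Layer cake: for |w| <= 1 the weight 1 - |w|^m is the integral of m t^(m-1) over t from
  |w| to 1, a superposition of indicators of balls. By homogeneity of degree 0 the ball of radius t
  contributes t^n times the unit ball, and the integral of m t^(n+m-1) over [0, 1] is m / (n +
  m).\<close>

lemma nn_integral_radial_weight:
 fixes k :: "'a::euclidean_space => ennreal"
 assumes k [measurable]: "k \<in> borel_measurable borel"
  and hom: "!!c w. 0 < c ==> k (c *\<^sub>R w) = k w" and m: "1 <= m"
 shows "(NN w. k w * ennreal (max 0 (1 - norm w ^ m)))
   = ennreal (real m / real (DIM('a) + m)) * (NN w. k w * indicator (cball 0 1) w)"
proof -
 let ?H = "(NN w. k w * indicator (cball 0 1) w)"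
 have layer: "ennreal (max 0 (1 - norm w ^ m)) = (NN t. ennreal (real m * t ^ (m - 1) * indicator {0..1} t) * indicator (cball 0 t) w)" for w :: 'a
 proof (cases "norm w <= 1")
  case True
  have "(NN t. ennreal (real m * t ^ (m - 1) * indicator {0..1} t) * indicator (cball 0 t) w)
   = (NN t. ennreal (real m * t ^ (m - 1)) * indicator {norm w..1} t)"
   by (intro nn_integral_cong) (auto simp: indicator_def intro: order_trans[OF norm_ge_zero])
  also have "... = ennreal (1 ^ m - norm w ^ m)"
   by (rule nn_integral_FTC_Icc) (use True in "auto intro!: derivative_eq_intros mult_nonneg_nonneg zero_le_power intro: order_trans[OF norm_ge_zero]")
  finally show ?thesis using True by (simp add: power_le_one max_def)
 next
  case False
  then have "1 <= norm w ^ m" by (simp add: one_le_power)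
  moreover have "(NN t. ennreal (real m * t ^ (m - 1) * indicator {0..1} t) * indicator (cball 0 t) w) = (NN (t::real). 0)"
   using False by (intro nn_integral_cong) (auto simp: indicator_def)
  ultimately show ?thesis by simp
 qed
 have [measurable]: "(%(w, t). indicator (cball 0 t) (w::'a) :: ennreal) \<in> borel_measurable (borel \<Otimes>\<^sub>M borel)"
  by (simp add: indicator_def) measurable
 have "(NN w. k w * ennreal (max 0 (1 - norm w ^ m)))
  = (NN w. (NN t. k w * (ennreal (real m * t ^ (m - 1) * indicator {0..1} t) * indicator (cball 0 t) w)))"
  unfolding layer by (subst nn_integral_cmult) auto
 also have "... = (NN t. (NN w. k w * (ennreal (real m * t ^ (m - 1) * indicator {0..1} t) * indicator (cball 0 t) w)))"
  by (rule lborel_pair.Fubini') measurable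
 also have "... = (NN t. ennreal (real m * t ^ (m - 1) * indicator {0..1} t) * (NN w. k w * indicator (cball 0 t) w))"
  by (intro nn_integral_cong) (subst nn_integral_cmult[symmetric], auto simp: mult_ac)
 also have "... = (NN t. ennreal (real m * t ^ (DIM('a) + m - 1) * indicator {0..1} t) * ?H)"
 proof (rule nn_integral_cong_AE, use AE_lborel_singleton[of "0::real"] in eventually_elim)
  fix t :: real assume t: "t ~= 0"
  show "ennreal (real m * t ^ (m - 1) * indicator {0..1} t) * (NN w. k w * indicator (cball 0 t) w)
   = ennreal (real m * t ^ (DIM('a) + m - 1) * indicator {0..1} t) * ?H"
  proof (cases "0 < t")
   case True
   have I: "(NN w. k w * indicator (cball 0 t) w) = ennreal (t ^ DIM('a)) * ?H"
    by (rule nn_integral_homogeneous_cball) (use hom True in auto)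
   have e: "real m * t ^ (m - 1) * indicator {0..1} t * t ^ DIM('a) = real m * t ^ (DIM('a) + m - 1) * indicator {0..1} t"
    using m by (simp add: power_add[symmetric] add.commute)
   have "ennreal (real m * t ^ (m - 1) * indicator {0..1} t) * (ennreal (t ^ DIM('a)) * ?H)
    = ennreal (real m * t ^ (m - 1) * indicator {0..1} t * t ^ DIM('a)) * ?H"
    unfolding mult.assoc[symmetric] using True by (subst ennreal_mult[symmetric]) auto
   then show ?thesis unfolding I e .
  next
   case False
   then show ?thesis using t by (simp add: indicator_def)
  qed
 qed
 also have "... = (NN t. ennreal (real m * t ^ (DIM('a) + m - 1) * indicator {0..1} t)) * ?H"
  by (rule nn_integral_multc) measurable
 also have "(NN t. ennreal (real m * t ^ (DIM('a) + m - 1) * indicator {0..1} t))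
   = (NN t. ennreal (real m * t ^ (DIM('a) + m - 1)) * indicator {0..1} t)"
  by (intro nn_integral_cong) (auto simp: indicator_def)
 also have "(NN t. ennreal (real m * t ^ (DIM('a) + m - 1)) * indicator {0..1} t)
   = ennreal (real m / real (DIM('a) + m) * 1 ^ (DIM('a) + m) - real m / real (DIM('a) + m) * 0 ^ (DIM('a) + m))"
  by (rule nn_integral_FTC_Icc) (use m in "auto intro!: derivative_eq_intros")
 finally show ?thesis using m by (simp add: power_0_left)
qed

text \<open>Slicing orthogonally to e: the slice at height y is a ball of dimension n - 1 and radius
  sqrt (1 - y^2). What remains is the integral of |y| (1 - y^2)^((n-1)/2) over [-1, 1], which has an
  explicit antiderivative on each half.\<close>

lemma nn_integral_abs_coordinate_cball:
 fixes e :: "'a::euclidean_space"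
 assumes e: "e \<in> Basis"
 shows "(NN w. ennreal \<bar>w \<bullet> e\<bar> * indicator (cball 0 1) w) = ennreal (2 * unit_ball_vol (real (DIM('a) - 1)) / real (DIM('a) + 1))"
proof -
 interpret product_sigma_finite "%_::'a. lborel :: real measure" by standard
 let ?B = "Basis - {e}" and ?m = "DIM('a) - 1" and ?w = "%x. \<Sum>b\<in>Basis. x b *\<^sub>R b :: 'a"
 have m: "?m + 2 = DIM('a) + 1" using DIM_positive[where 'a='a] by linarith
 define c where "c = unit_ball_vol (real ?m)"
 have c: "0 <= c" by (simp add: c_def unit_ball_vol_pos less_imp_le)
 define F where "F w = ennreal \<bar>w \<bullet> e\<bar> * indicator (cball 0 1) w" for w
 define f where "f y = c * (\<bar>y\<bar> * sqrt (1 - y\<^sup>2) ^ ?m)" for y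
 have [measurable]: "F \<in> borel_measurable borel" unfolding F_def by measurable
 have "(NN w. F w) = (\<integral>\<^sup>+x. F (?w x) \<partial>Pi\<^sub>M Basis (%_. lborel))"
  by (subst lborel_eq) (simp add: nn_integral_distr)
 also have "... = (NN y. \<integral>\<^sup>+x. F (?w (x(e := y))) \<partial>Pi\<^sub>M ?B (%_. lborel))"
  using e product_nn_integral_insert_rev[of ?B e "%x. F (?w x)"] by (simp add: insert_absorb)
 \<comment> \<open>The heights 1 and -1 are discarded, because the volume formula for balls is
   applied with a positive radius.\<close>
 also have "... = (NN y. ennreal (f y) * indicator {-1..1} y)"
 proof (rule nn_integral_cong_AE, use AE_lborel_singleton[of "1::real"] AE_lborel_singleton[of "-1::real"] in eventually_elim)
  case (elim y)
  let ?S = "{x. sqrt (\<Sum>i\<in>?B. (x i)\<^sup>2) <= sqrt (1 - y\<^sup>2)} \<inter> space (Pi\<^sub>M ?B (%_. lborel))"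
  have "F (?w (x(e := y))) = ennreal \<bar>y\<bar> * indicator {-1..1} y * indicator ?S x" if "x \<in> space (Pi\<^sub>M ?B (%_. lborel))" for x
  proof -
   have "(norm (?w (x(e := y))))\<^sup>2 = (\<Sum>b\<in>Basis. ((x(e := y)) b)\<^sup>2)"
    unfolding power2_norm_eq_inner by (subst euclidean_inner) (simp add: power2_eq_square)
   also have "... = y\<^sup>2 + (\<Sum>b\<in>?B. (x b)\<^sup>2)" using e by (simp add: sum.remove)
   finally have "norm (?w (x(e := y))) <= 1 \<longleftrightarrow> y\<^sup>2 + (\<Sum>b\<in>?B. (x b)\<^sup>2) <= 1"
    using abs_square_le_1[of "norm (?w (x(e := y)))"] by simp
   moreover have "0 <= (\<Sum>b\<in>?B. (x b)\<^sup>2)" by (simp add: sum_nonneg)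
   ultimately have "norm (?w (x(e := y))) <= 1 \<longleftrightarrow> y \<in> {-1..1} \<and> x \<in> ?S"
    using that abs_square_le_1[of y] by (auto simp: abs_le_iff)
   moreover have "?w (x(e := y)) \<bullet> e = y" using e by simp
   ultimately show ?thesis by (auto simp: F_def indicator_def)
  qed
  then have "(\<integral>\<^sup>+x. F (?w (x(e := y))) \<partial>Pi\<^sub>M ?B (%_. lborel)) = ennreal \<bar>y\<bar> * indicator {-1..1} y * emeasure (Pi\<^sub>M ?B (%_. lborel)) ?S"
   by (simp add: nn_integral_cmult cong: nn_integral_cong)
  also have "... = ennreal (f y) * indicator {-1..1} y"
  proof (cases "y \<in> {-1..1}")
   case True
   then have "0 < 1 - y\<^sup>2" using elim abs_square_less_1[of y] by auto
   then show ?thesis using emeasure_cball_aux[of ?B "sqrt (1 - y\<^sup>2)"] e True c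
    by (simp add: f_def c_def ennreal_mult[symmetric] mult_ac)
  qed simp
  finally show ?case .
 qed
 also have "... = ennreal (2 * (c / real (?m + 2)))"
 proof (rule nn_integral_has_integral_lebesgue')
  show "0 <= f y" if "y \<in> {-1..1}" for y using that c abs_square_le_1[of y] by (auto simp: f_def abs_le_iff)
  let ?f = "%y. c * (y * sqrt (1 - y\<^sup>2) ^ ?m)" and ?P = "%y. - (c / real (?m + 2)) * sqrt (1 - y\<^sup>2) ^ (?m + 2)"
  have "(?f has_integral ?P 1 - ?P 0) {0..1}"
  proof (rule fundamental_theorem_of_calculus_interior)
   fix y :: real assume y: "y \<in> {0<..<1}"
   define s where "s = sqrt (1 - y\<^sup>2)"
   have s: "0 < s" "0 < 1 - y\<^sup>2" using y abs_square_less_1[of y] by (auto simp: s_def)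
   have D: "((%y. sqrt (1 - y\<^sup>2)) has_field_derivative - y / s) (at y)"
    using s by (auto intro!: derivative_eq_intros simp: s_def divide_simps)
   have P: "((%y. sqrt (1 - y\<^sup>2) ^ (k + 2)) has_field_derivative - real (k + 2) * (y * s ^ k)) (at y)" for k
    using DERIV_power[OF D, of "k + 2"] s(1) by (simp add: s_def[symmetric] field_simps)
   have "((%y. - (c / real (k + 2)) * sqrt (1 - y\<^sup>2) ^ (k + 2)) has_field_derivative c * (y * s ^ k)) (at y)" for k
    by (rule DERIV_cong[OF DERIV_cmult[OF P]]) (simp add: divide_simps, simp add: algebra_simps)
   from this[of ?m] show "(?P has_vector_derivative ?f y) (at y)"
    by (simp only: has_real_derivative_iff_has_vector_derivative s_def)
  qed (auto intro!: continuous_intros)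
  then have "(f has_integral c / real (?m + 2)) {0..1}"
   by (rule has_integral_eq_rhs[OF has_integral_eq, rotated]) (auto simp: f_def)
  moreover from this have "((%x. f (- x)) has_integral c / real (?m + 2)) {-1..-0}"
   unfolding has_integral_reflect_real .
  moreover have "(%x. f (- x)) = f" by (simp add: f_def fun_eq_iff)
  ultimately show "(f has_integral 2 * (c / real (?m + 2))) {-1..1}"
   using has_integral_combine[of "-1" 0 1 f] by fastforce
 qed
 finally show ?thesis by (simp add: F_def c_def m)
qed

text \<open>On the unit ball the homogeneous function k0 = |w . e| / |w| satisfies k0 = k0 (1 - |w|)
  + |w . e|. By \<open>nn_integral_radial_weight\<close> with m = 1 the first summand integrates to
  H0 / (n + 1), so H0 is determined by the integral of |w . e|.\<close>

lemma nn_integral_abs_direction_cball: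
 fixes e :: "'a::euclidean_space"
 assumes e: "e \<in> Basis" and n: "2 <= DIM('a)"
 shows "(NN w. ennreal (\<bar>w \<bullet> e\<bar> / norm w) * indicator (cball 0 1) w)
  = ennreal (variation_const DIM('a) * unit_ball_vol DIM('a))"
proof -
 let ?n = "DIM('a)"
 let ?k0 = "%w::'a. ennreal (\<bar>w \<bullet> e\<bar> / norm w)"
 define H0 where "H0 = (NN w. ?k0 w * indicator (cball 0 1) w)"
 define H1 where "H1 = (\<integral>\<^sup>+w. ennreal \<bar>w \<bullet> e\<bar> * indicator (cball 0 1) w \<partial>(lborel :: 'a measure))"
 have le1: "\<bar>w \<bullet> e\<bar> / norm w <= 1" for w :: 'a
  using Basis_le_norm[OF e, of w] by (cases "w = 0") (auto simp: divide_le_eq)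
 have "H0 <= (NN w. indicator (cball (0::'a) 1) w)"
  unfolding H0_def using le1 by (intro nn_integral_mono) (auto simp: indicator_def)
 also have "... < \<infinity>" using emeasure_lborel_cball_finite[of "0::'a" 1] by simp
 finally obtain h0 where h0: "0 <= h0" "H0 = ennreal h0" by (cases H0) auto
 have split: "H0 = (NN w. ?k0 w * ennreal (max 0 (1 - norm w ^ 1))) + H1"
  unfolding H0_def H1_def
 proof (subst nn_integral_add[symmetric]; (intro nn_integral_cong)?)
  fix w :: 'a
  show "?k0 w * indicator (cball 0 1) w = ?k0 w * ennreal (max 0 (1 - norm w ^ 1)) + ennreal \<bar>w \<bullet> e\<bar> * indicator (cball 0 1) w"
  proof (cases "norm w <= 1")
   case True
   define a where "a = \<bar>w \<bullet> e\<bar> / norm w"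
   have "a = a * (1 - norm w) + \<bar>w \<bullet> e\<bar>" "0 <= a" by (cases "w = 0"; simp add: a_def field_simps)+
   then have "ennreal a = ennreal a * ennreal (1 - norm w) + ennreal \<bar>w \<bullet> e\<bar>"
    using True by (metis abs_ge_zero diff_ge_0_iff_ge ennreal_mult ennreal_plus mult_nonneg_nonneg)
   then show ?thesis using True by (simp add: a_def)
  qed auto
 qed auto
 have r: "(NN w. ?k0 w * ennreal (max 0 (1 - norm w ^ 1))) = ennreal (real 1 / real (?n + 1)) * H0"
  unfolding H0_def by (rule nn_integral_radial_weight) (auto simp: abs_mult)
 have h1: "H1 = ennreal (2 * unit_ball_vol (real ?n - 1) / real (?n + 1))"
  unfolding H1_def using nn_integral_abs_coordinate_cball[OF e] n by (simp add: of_nat_diff)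
 have rn: "2 <= real ?n" using n by linarith
 then have "0 <= 2 * unit_ball_vol (real ?n - 1) / real (?n + 1)" using unit_ball_vol_pos[of "real ?n - 1"] by simp
 then have "h0 = h0 / (1 + real ?n) + 2 * unit_ball_vol (real ?n - 1) / real (?n + 1)"
  using split h0 unfolding r h1 by (simp add: ennreal_mult[symmetric] ennreal_plus[symmetric] del: ennreal_plus)
 then have "h0 = (h0 + 2 * unit_ball_vol (real ?n - 1)) / (1 + real ?n)" by (simp add: add_divide_distrib)
 then have "h0 * real ?n = 2 * unit_ball_vol (real ?n - 1)"
  by (subst (asm) nonzero_eq_divide_eq) (simp_all add: distrib_left)
 \<comment> \<open>With the cone formula, sigma_{n-2} = (n-1) omega_{n-1} and sigma_{n-1} = n
   omega_n, where omega_k is the volume of the unit ball of dimension k; the factor n - 1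
   cancels.\<close>
 moreover have "variation_const ?n * unit_ball_vol ?n = 2 * unit_ball_vol (real ?n - 1) / real ?n"
 proof -
  have r: "real (?n - 2 + 1) = real ?n - 1" "real (?n - 1 + 1) = real ?n" using n by (auto simp: of_nat_diff)
  have o: "unit_ball_vol (real ?n) ~= 0" using unit_ball_vol_pos[of "real ?n"] by linarith
  have "variation_const ?n * unit_ball_vol ?n =
   2 / (real ?n - 1) * ((real ?n - 1) * unit_ball_vol (real ?n - 1) / (real ?n * unit_ball_vol (real ?n))) * unit_ball_vol (real ?n)"
   unfolding variation_const_def sphere_vol_def r ..
  also have "... = 2 * unit_ball_vol (real ?n - 1) / real ?n" using o rn by (simp add: divide_simps)
  finally show ?thesis .
 qed
 moreover have "h0 = h0 * real ?n / real ?n" using rn by simp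
 ultimately have "h0 = variation_const ?n * unit_ball_vol ?n" by simp
 then show ?thesis using h0 by (simp add: H0_def)
qed

subsection \<open>Averages over the unit sphere of an inner product\<close>

definition qform :: "real^'n^'n => real^'n => real^'n => real" where
 "qform G v w = v \<bullet> (G *v w)"

definition qn :: "real^'n^'n => real^'n => real" where
 "qn G w = sqrt (qform G w w)"

definition pos_def :: "real^'n^'n => bool" where
 "pos_def G \<longleftrightarrow> transpose G = G \<and> (\<forall>w. w ~= 0 --> 0 < qform G w w)"

lemma qform_add: "qform G (v + v') w = qform G v w + qform G v' w" "qform G v (w + w') = qform G v w + qform G v w'"
 and qform_diff: "qform G (v - v') w = qform G v w - qform G v' w" "qform G v (w - w') = qform G v w - qform G v w'"
 and qform_scale: "qform G (c *\<^sub>R v) w = c * qform G v w" "qform G v (c *\<^sub>R w) = c * qform G v w"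
 and qform_zero: "qform G 0 w = 0" "qform G v 0 = 0"
 by (simp_all add: qform_def inner_simps matrix_vector_right_distrib matrix_vector_mult_diff_distrib matrix_vector_mult_scaleR)

lemma qform_sum: "qform G (\<Sum>i\<in>I. v i) w = (\<Sum>i\<in>I. qform G (v i) w)" "qform G w (\<Sum>i\<in>I. v i) = (\<Sum>i\<in>I. qform G w (v i))"
 by (induction I rule: infinite_finite_induct; simp add: qform_add qform_zero)+

lemma qform_commute: "pos_def G ==> qform G v w = qform G w v"
 by (metis dot_lmul_matrix inner_commute pos_def_def qform_def vector_transpose_matrix)

lemma pos_defD: "pos_def G ==> w ~= 0 ==> 0 < qform G w w"
 by (simp add: pos_def_def)

lemma qform_nonneg: "pos_def G ==> 0 <= qform G w w"
 using pos_defD[of G w] by (cases "w = 0") (auto simp: qform_zero)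

lemma qn_power2: "pos_def G ==> (qn G w)\<^sup>2 = qform G w w"
 by (simp add: qn_def qform_nonneg)

lemma qn_nonneg [simp]: "pos_def G ==> 0 <= qn G w"
 by (simp add: qn_def qform_nonneg)

lemma qn_pos_iff: "pos_def G ==> 0 < qn G w \<longleftrightarrow> w ~= 0"
 using pos_defD[of G w] by (auto simp: qn_def qform_zero)

lemma qn_scale: "qn G (c *\<^sub>R w) = \<bar>c\<bar> * qn G w"
proof -
 have "qform G (c *\<^sub>R w) (c *\<^sub>R w) = c\<^sup>2 * qform G w w" by (simp add: qform_scale power2_eq_square)
 then show ?thesis by (simp add: qn_def real_sqrt_mult)
qed

text \<open>An orthonormal set of maximal cardinality spans, since otherwise a Gram-Schmidt step
  would enlarge it.\<close>

lemma qform_orthonormal_basis: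
 fixes G :: "real^'n^'n"
 assumes G: "pos_def G"
 obtains \<beta> :: "'n => real^'n" where "!!i j. qform G (\<beta> i) (\<beta> j) = (if i = j then 1 else 0)" "span (range \<beta>) = UNIV"
proof -
 define ON where "ON = (%S. (\<forall>s\<in>S. \<forall>t\<in>S. qform G s t = (if s = t then 1 else 0)))"
 have ind: "independent S" if "ON S" for S
  unfolding dependent_def
 proof (intro notI, elim bexE)
  fix a assume a: "a \<in> S" "a \<in> span (S - {a})"
  have "subspace {x. qform G a x = 0}"
   by (auto simp: subspace_def qform_add qform_scale qform_zero)
  moreover have "S - {a} \<subseteq> {x. qform G a x = 0}" using that a by (auto simp: ON_def)
  ultimately have "span (S - {a}) \<subseteq> {x. qform G a x = 0}" by (rule span_minimal[rotated])
  with a that show False by (auto simp: ON_def)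
 qed
 have bd: "finite S \<and> card S <= DIM(real^'n)" if "ON S" for S
  using independent_bound[OF ind[OF that]] .
 have "\<exists>S. ON S \<and> (\<forall>T. ON T --> card T <= card S)"
  by (rule ex_has_greatest_nat[of ON "{}" card "Suc DIM(real^'n)"])
   (use bd in "auto simp: ON_def less_Suc_eq_le")
 then obtain S where S: "ON S" "!!T. ON T ==> card T <= card S" by blast
 have fin: "finite S" using bd S by blast
 have span: "span S = UNIV"
 proof (rule ccontr)
  assume "span S ~= UNIV"
  then obtain v where v: "v \<notin> span S" by blast
  define v' where "v' = v - (\<Sum>s\<in>S. qform G v s *\<^sub>R s)"
  have "(\<Sum>s\<in>S. qform G v s *\<^sub>R s) \<in> span S" by (intro span_sum span_scale span_base)
  then have v'0: "v' ~= 0" using v by (auto simp: v'_def)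
  have orth: "qform G v' t = 0" if "t \<in> S" for t
  proof -
   have "(\<Sum>s\<in>S. qform G v s * qform G s t) = (\<Sum>s\<in>S. if s = t then qform G v t else 0)"
    using S(1) that by (intro sum.cong) (auto simp: ON_def)
   then show ?thesis using that fin by (simp add: v'_def qform_diff qform_sum qform_scale)
  qed
  define u where "u = (1 / qn G v') *\<^sub>R v'"
  have q0: "qn G v' > 0" using v'0 G by (simp add: qn_pos_iff)
  have uu: "qform G u u = 1" using q0 qn_power2[OF G, of v'] pos_defD[OF G v'0] by (simp add: u_def qform_scale power2_eq_square)
  have ut: "qform G u t = 0" "qform G t u = 0" if "t \<in> S" for t
   using orth[OF that] qform_commute[OF G, of t v'] by (auto simp: u_def qform_scale)
  have "u \<notin> S" using uu ut by force
  moreover have "ON (insert u S)" using S(1) uu ut by (auto simp: ON_def)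
  ultimately show False using S(2)[of "insert u S"] fin by auto
 qed
 have "card S = CARD('n)"
  using basis_card_eq_dim[of S UNIV] ind[OF S(1)] span by simp
 then obtain \<beta> where \<beta>: "bij_betw \<beta> (UNIV :: 'n set) S"
  using finite_same_card_bij[OF finite fin, of UNIV] by auto
 show ?thesis
 proof (rule that)
  show "qform G (\<beta> i) (\<beta> j) = (if i = j then 1 else 0)" for i j
  proof -
   have "\<beta> i \<in> S" "\<beta> j \<in> S" "\<beta> i = \<beta> j \<longleftrightarrow> i = j" using \<beta> by (auto simp: bij_betw_def inj_eq)
   then show ?thesis using S(1) by (auto simp: ON_def)
  qed
  show "span (range \<beta>) = UNIV" using \<beta> span by (simp add: bij_betw_def)
 qed
qed

text \<open>The columns of E are an orthonormal basis for G, that is, E^T G E = 1; the other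
  properties are consequences of this matrix identity. Through E every statement about G is reduced
  to the Euclidean case.\<close>

lemma pos_def_frame:
 fixes G :: "real^'n^'n"
 assumes G: "pos_def G"
 obtains E :: "real^'n^'n" where "invertible E" "!!w. qn G (E *v w) = norm w" "\<bar>det E\<bar> * sqrt (det G) = 1"
  "0 < det G" "invertible G" "matrix_inv G = E ** transpose E"
proof -
 obtain \<beta> :: "'n => real^'n" where \<beta>: "!!i j. qform G (\<beta> i) (\<beta> j) = (if i = j then 1 else 0)" "span (range \<beta>) = UNIV"
  using qform_orthonormal_basis[OF G] by blast
 define E where "E = (\<chi> i j. \<beta> j $ i)"
 have Ev: "E *v w = (\<Sum>j\<in>UNIV. w $ j *\<^sub>R \<beta> j)" for w
  by (simp add: vec_eq_iff E_def matrix_vector_mult_def sum_component mult.commute)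
 have EGE: "transpose E ** (G ** E) = mat 1"
 proof -
  have col: "column j (G ** E) = G *v \<beta> j" for j
   by (simp add: vec_eq_iff column_def matrix_matrix_mult_def matrix_vector_mult_def E_def)
  have "(transpose E ** (G ** E)) $ i $ j = qform G (\<beta> i) (\<beta> j)" for i j
   unfolding qform_def col[symmetric] by (simp add: matrix_matrix_mult_def transpose_def E_def inner_vec_def column_def)
  then show ?thesis by (simp add: vec_eq_iff \<beta> mat_def)
 qed
 then have GE1: "(transpose E ** G) ** E = mat 1" by (simp add: matrix_mul_assoc)
 then have GE2: "E ** (transpose E ** G) = mat 1" using matrix_left_right_inverse by blast
 have invE: "invertible E" unfolding invertible_def using GE1 GE2 by blast
 have I1: "(E ** transpose E) ** G = mat 1" using GE2 by (simp add: matrix_mul_assoc)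
 then have I2: "G ** (E ** transpose E) = mat 1" using matrix_left_right_inverse by blast
 have invG: "invertible G" unfolding invertible_def using I1 I2 by blast
 have mi: "matrix_inv G = E ** transpose E"
  by (metis I1 invG matrix_inv_cancel(2) matrix_mul_assoc matrix_mul_lid matrix_mul_rid)
 have "det (transpose E ** (G ** E)) = 1" by (simp add: EGE)
 then have d: "(det E)\<^sup>2 * det G = 1" by (simp add: det_mul power2_eq_square mult_ac)
 have dG: "0 < det G"
 proof -
  have "0 < (det E)\<^sup>2 * det G" using d by simp
  then show ?thesis by (simp add: zero_less_mult_iff)
 qed
 have "sqrt ((det E)\<^sup>2 * det G) = 1" using d by simp
 then have d': "\<bar>det E\<bar> * sqrt (det G) = 1" by (simp add: real_sqrt_mult)
 have q: "qn G (E *v w) = norm w" for w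
 proof -
  have "qform G (E *v w) (E *v w) = (\<Sum>i\<in>UNIV. \<Sum>j\<in>UNIV. w $ i * (w $ j * qform G (\<beta> i) (\<beta> j)))"
   by (simp add: Ev qform_sum qform_scale sum_distrib_left) (subst sum.swap, simp add: mult.left_commute)
  also have "... = (\<Sum>i\<in>UNIV. \<Sum>j\<in>UNIV. if i = j then w $ i * w $ j else 0)"
   by (intro sum.cong refl) (simp add: \<beta>)
  also have "... = w \<bullet> w" by (simp add: inner_vec_def)
  finally show ?thesis by (simp add: qn_def norm_eq_sqrt_inner)
 qed
 show ?thesis by (rule that[OF invE q d' dG invG mi])
qed

lemma qn_matrix_inv_frame:
 assumes "matrix_inv G = E ** transpose E"
 shows "qform (matrix_inv G) p q = (transpose E *v p) \<bullet> (transpose E *v q)"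
  "qn (matrix_inv G) p = norm (transpose E *v p)"
proof -
 show *: "qform (matrix_inv G) p q = (transpose E *v p) \<bullet> (transpose E *v q)" for p q
  unfolding qform_def assms
  by (simp add: matrix_vector_mul_assoc[symmetric] dot_lmul_matrix[symmetric] vector_transpose_matrix)
 show "qn (matrix_inv G) p = norm (transpose E *v p)"
  by (simp add: qn_def * norm_eq_sqrt_inner)
qed

section \<open>Integrals under linear and orthogonal maps\<close>

lemma continuous_on_matrix_vector_mult: "continuous_on S ((*v) (A :: real^'n^'m))"
 by (rule matrix_vector_mult_linear_continuous_on)

lemma measurable_matrix_vector_mult [measurable]: "(*v) (A :: real^'n^'m) \<in> borel_measurable borel"
 by (rule borel_measurable_continuous_onI[OF continuous_on_matrix_vector_mult])

lemma measurable_qform [measurable]: "(%w. qform G w w) \<in> borel_measurable borel"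
 unfolding qform_def by measurable

lemma measurable_qn [measurable]: "qn G \<in> borel_measurable borel"
 unfolding qn_def by measurable

lemma lborel_linear_change:
 fixes E :: "real^'n^'n"
 assumes E: "invertible E"
 shows "lborel = density (distr lborel borel ((*v) E)) (%_. ennreal \<bar>det E\<bar>)"
proof (rule measure_eqI)
 fix X :: "(real^'n) set" assume "X \<in> sets lborel"
 then have [measurable]: "X \<in> sets borel" by simp
 have "emeasure lborel X = (NN y. indicator X y)" by simp
 also have "... = ennreal \<bar>det E\<bar> * (NN x. indicator X (E *v x))"
  by (rule nn_integral_linear_change[OF E]) measurable
 also have "(NN x. indicator X (E *v x)) = (\<integral>\<^sup>+y. indicator X y \<partial>distr lborel borel ((*v) E))"
  by (rule nn_integral_distr[symmetric]) measurable
 also have "ennreal \<bar>det E\<bar> * ... = emeasure (density (distr lborel borel ((*v) E)) (%_. ennreal \<bar>det E\<bar>)) X"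
  by (simp add: emeasure_density nn_integral_cmult)
 finally show "emeasure lborel X = emeasure (density (distr lborel borel ((*v) E)) (%_. ennreal \<bar>det E\<bar>)) X" .
qed simp

lemma integral_linear_change:
 fixes E :: "real^'n^'n" and f :: "real^'n => real"
 assumes E: "invertible E" and [measurable]: "f \<in> borel_measurable borel"
 shows "(LB y. f y) = \<bar>det E\<bar> * (LB x. f (E *v x))"
 by (subst lborel_linear_change[OF E]) (simp add: integral_density integral_distr)

lemma orthogonal_change:
 fixes T :: "real^'n => real^'n"
 assumes T: "orthogonal_transformation T"
 shows "h \<in> borel_measurable borel ==> (NN x. h x) = (NN x. h (T x))"
  and "f \<in> borel_measurable borel ==> (LB x. f x) = (LB x. (f (T x) :: real))"
proof -
 have lin: "linear T" and om: "orthogonal_matrix (matrix T)" using T orthogonal_transformation_matrix by blast+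
 have T': "matrix T *v x = T x" for x using lin by (simp add: matrix_works)
 have inv: "invertible (matrix T)" using om by (auto simp: orthogonal_matrix_def invertible_def)
 have d: "\<bar>det (matrix T)\<bar> = 1" using det_orthogonal_matrix[OF om] by auto
 show "h \<in> borel_measurable borel ==> (NN x. h x) = (NN x. h (T x))"
  using nn_integral_linear_change[OF inv, of h] by (simp add: d T')
 show "f \<in> borel_measurable borel ==> (LB x. f x) = (LB x. f (T x))"
  using integral_linear_change[OF inv, of f] by (simp add: d T')
qed

text \<open>A rotation takes |b| e to b and so reduces b to a basis vector e; the weight with m = 2
  contributes 2 / (n + 2).\<close>

lemma nn_integral_abs_inner_direction:
 fixes b :: "real^'n"
 assumes n: "2 <= CARD('n)"
 shows "(NN w. ennreal (\<bar>w \<bullet> b\<bar> / norm w) * ennreal (max 0 (1 - (norm w)\<^sup>2)))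
  = ennreal (2 / real (CARD('n) + 2) * (variation_const CARD('n) * unit_ball_vol CARD('n)) * norm b)"
proof -
 define e :: "real^'n" where "e = axis undefined 1"
 have e: "e \<in> Basis" by (auto simp: e_def Basis_vec_def)
 have k0: "0 <= variation_const CARD('n)" using n by (simp add: variation_const_def sphere_vol_def less_imp_le)
 obtain T where T: "orthogonal_transformation T" "T (norm b *\<^sub>R e) = b"
  using orthogonal_transformation_exists[of "norm b *\<^sub>R e" b] e by auto
 have Tb: "\<bar>T w \<bullet> b\<bar> / norm (T w) = norm b * (\<bar>w \<bullet> e\<bar> / norm w)" for w
 proof -
  have "T w \<bullet> b = w \<bullet> (norm b *\<^sub>R e)" using T by (metis orthogonal_transformation_def)
  then show ?thesis using T(1) by (simp add: orthogonal_transformation_norm abs_mult)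
 qed
 have "(NN w. ennreal (\<bar>w \<bullet> b\<bar> / norm w) * ennreal (max 0 (1 - (norm w)\<^sup>2)))
  = ennreal (real 2 / real (DIM(real^'n) + 2)) * (NN w. ennreal (\<bar>w \<bullet> b\<bar> / norm w) * indicator (cball 0 1) w)"
  by (rule nn_integral_radial_weight) (auto simp: abs_mult)
 also have "(NN w. ennreal (\<bar>w \<bullet> b\<bar> / norm w) * indicator (cball 0 1) w)
  = (NN w. ennreal (\<bar>T w \<bullet> b\<bar> / norm (T w)) * indicator (cball 0 1) (T w))"
  by (rule orthogonal_change(1)[OF T(1)]) measurable
 also have "... = (NN w. ennreal (norm b) * (ennreal (\<bar>w \<bullet> e\<bar> / norm w) * indicator (cball 0 1) w))"
  unfolding Tb by (intro nn_integral_cong, subst ennreal_mult)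
   (auto simp: mult.assoc indicator_def orthogonal_transformation_norm[OF T(1)])
 also have "... = ennreal (norm b) * ennreal (variation_const CARD('n) * unit_ball_vol CARD('n))"
  using nn_integral_abs_direction_cball[OF e] n by (simp add: nn_integral_cmult)
 finally show ?thesis using k0 by (simp add: ennreal_mult[symmetric] mult_ac)
qed

text \<open>u is split into its component along b and a remainder v orthogonal to b. The first turns
  the sign into an absolute value, whose integral is known. The second contributes 0: the reflection
  in the hyperplane orthogonal to v keeps w . b and reverses w . v.\<close>

lemma integral_sign_direction:
 fixes b u :: "real^'n"
 assumes n: "2 <= CARD('n)" and b: "b ~= 0"
 shows "(LB w. max 0 (1 - (norm w)\<^sup>2) * (sgn (w \<bullet> b) * (w \<bullet> u) / norm w))
  = 2 / real (CARD('n) + 2) * (variation_const CARD('n) * unit_ball_vol CARD('n)) * (b \<bullet> u) / norm b"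
proof -
 let ?m = "%w::real^'n. max 0 (1 - (norm w)\<^sup>2)"
 let ?F = "%u w. ?m w * (sgn (w \<bullet> b) * (w \<bullet> u) / norm w)"
 define K where "K = 2 / real (CARD('n) + 2) * (variation_const CARD('n) * unit_ball_vol CARD('n))"
 have k0: "0 <= K" using n by (simp add: K_def variation_const_def sphere_vol_def less_imp_le)
 have [measurable]: "?F u \<in> borel_measurable borel" for u by measurable
 have im: "integrable lborel ?m"
 proof (rule integrable_continuous_bounded_support[where R=1])
  show "?m x = 0" if "1 < norm x" for x
  proof -
   have "1 < (norm x)\<^sup>2" using that by (simp add: one_less_power)
   then show ?thesis by simp
  qed
 qed (auto intro!: continuous_intros)
 have int: "integrable lborel (?F u)" for u
 proof (rule integrable_bound[of _ "%w. norm u * ?m w"])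
  show "AE w in lborel. norm (?F u w) <= norm (norm u * ?m w)"
  proof (rule AE_I2)
   fix w :: "real^'n"
   have "\<bar>sgn (w \<bullet> b) * (w \<bullet> u) / norm w\<bar> <= norm u"
    using Cauchy_Schwarz_ineq2[of w u] by (cases "w = 0") (auto simp: abs_mult sgn_if divide_le_eq mult.commute)
   then have "?m w * \<bar>sgn (w \<bullet> b) * (w \<bullet> u) / norm w\<bar> <= ?m w * norm u" by (intro mult_left_mono) auto
   then show "norm (?F u w) <= norm (norm u * ?m w)" by (simp add: abs_mult mult.commute)
  qed
 qed (use im in auto)
 define v where "v = u - ((b \<bullet> u) / (b \<bullet> b)) *\<^sub>R b"
 have bb: "b \<bullet> b ~= 0" using b by simp
 have vb: "v \<bullet> b = 0" "b \<bullet> v = 0" using bb by (simp_all add: v_def inner_simps inner_commute)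
 have Fu: "?F u w = ((b \<bullet> u) / (b \<bullet> b)) * ?F b w + ?F v w" for w
 proof -
  have "w \<bullet> u = ((b \<bullet> u) / (b \<bullet> b)) * (w \<bullet> b) + w \<bullet> v" by (simp add: v_def inner_simps)
  then show ?thesis by (simp add: field_simps add_divide_distrib)
 qed
 have "(LB w. ?F b w) = K * norm b"
 proof -
  have eq: "?F b w = \<bar>w \<bullet> b\<bar> / norm w * ?m w" for w by (simp add: sgn_if abs_if)
  have F0: "0 <= ?F b w" for w unfolding eq by (intro mult_nonneg_nonneg divide_nonneg_nonneg) auto
  have "ennreal (LB w. ?F b w) = (NN w. ennreal (?F b w))"
   by (rule nn_integral_eq_integral[symmetric, OF int AE_I2[OF F0]])
  also have "... = (NN w. ennreal (\<bar>w \<bullet> b\<bar> / norm w) * ennreal (?m w))"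
   unfolding eq by (intro nn_integral_cong ennreal_mult divide_nonneg_nonneg) auto
  also have "... = ennreal (K * norm b)" using nn_integral_abs_inner_direction[OF n, of b] by (simp add: K_def)
  finally show ?thesis using k0 integral_nonneg[of lborel "?F b", OF F0] by (subst (asm) ennreal_inj) auto
 qed
 moreover have "(LB w. ?F v w) = 0"
 proof (cases "v = 0")
  case False
  define T where "T = (%w. w - (2 * (w \<bullet> v) / (v \<bullet> v)) *\<^sub>R v)"
  have vv: "v \<bullet> v ~= 0" using False by simp
  have T: "orthogonal_transformation T"
   unfolding orthogonal_transformation_def
  proof (intro conjI allI)
   show "linear T" by (rule linearI) (simp_all add: T_def inner_simps algebra_simps add_divide_distrib)
   show "T x \<bullet> T y = x \<bullet> y" for x y using vv by (simp add: T_def inner_simps inner_commute field_simps)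
  qed
  have "T w \<bullet> b = w \<bullet> b" "T w \<bullet> v = - (w \<bullet> v)" for w
   using vv vb by (simp_all add: T_def inner_simps)
  then have "?F v (T w) = - ?F v w" for w by (simp add: orthogonal_transformation_norm[OF T])
  then have "(LB w. ?F v w) = (LB w. - ?F v w)"
   using orthogonal_change(2)[OF T, of "?F v"] by simp
  then show ?thesis by simp
 qed simp
 moreover have "(LB w. ?F u w) = ((b \<bullet> u) / (b \<bullet> b)) * (LB w. ?F b w) + (LB w. ?F v w)"
  unfolding Fu[abs_def]
  by (subst integral_add[OF integrable_mult_right[OF int] int], subst integral_mult_right_zero, rule refl)
 ultimately have "(LB w. ?F u w) = ((b \<bullet> u) / (b \<bullet> b)) * (K * norm b)" by simp
 moreover have "((b \<bullet> u) / (b \<bullet> b)) * (K * norm b) = K * (b \<bullet> u) / norm b"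
  using b by (simp add: dot_square_norm power2_eq_square)
 ultimately show ?thesis unfolding K_def by (simp only:)
qed

text \<open>The factor (n + 2) / (2 omega_n) gives total mass 1, where omega_n is the volume of the
  unit ball. Integrating a function that is homogeneous of degree 0 against this weight is averaging
  it over the unit sphere of G.\<close>

definition sphere_weight :: "real^'n^'n => real^'n => real" where
 "sphere_weight G w = (real CARD('n) + 2) / (2 * unit_ball_vol CARD('n)) * sqrt (det G) * max 0 (1 - qform G w w)"

lemma sphere_weight_frame:
 fixes G :: "real^'n^'n"
 assumes G: "pos_def G"
 obtains E a where "invertible E" "!!w. qn G (E *v w) = norm w" "\<bar>det E\<bar> * sqrt (det G) = 1" "0 < det G"
  "matrix_inv G = E ** transpose E" "0 <= a" "!!w. sphere_weight G (E *v w) = a * max 0 (1 - (norm w)\<^sup>2)"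
  "\<bar>det E\<bar> * a * (2 / (real CARD('n) + 2)) = 1 / unit_ball_vol CARD('n)" "unit_ball_vol (real CARD('n)) > 0"
  "sphere_weight G \<in> borel_measurable borel"
proof -
 obtain E where E: "invertible E" "!!w. qn G (E *v w) = norm w" "\<bar>det E\<bar> * sqrt (det G) = 1" "0 < det G" "matrix_inv G = E ** transpose E"
  using pos_def_frame[OF G] by metis
 let ?n = "real CARD('n)" and ?o = "unit_ball_vol CARD('n)"
 have o: "?o > 0" by (rule unit_ball_vol_pos) simp
 define a where "a = (?n + 2) / (2 * ?o) * sqrt (det G)"
 have "\<bar>det E\<bar> * a * (2 / (?n + 2)) = (\<bar>det E\<bar> * sqrt (det G)) / ?o" using o by (simp add: a_def divide_simps)
 moreover have "sphere_weight G (E *v w) = a * max 0 (1 - (norm w)\<^sup>2)" for w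
  by (simp add: sphere_weight_def qn_power2[OF G, symmetric] E(2) a_def)
 moreover have "sphere_weight G \<in> borel_measurable borel" unfolding sphere_weight_def by measurable
 moreover have "0 <= a" using o E(4) by (simp add: a_def)
 ultimately show ?thesis using o E by (intro that[of E a]) simp_all
qed

lemma sphere_weight_nonneg: "pos_def G ==> 0 <= sphere_weight G w"
proof -
 assume G: "pos_def G"
 have "0 < det G" using pos_def_frame[OF G] by metis
 moreover have "0 < unit_ball_vol (real CARD('a))" by (rule unit_ball_vol_pos) simp
 ultimately show ?thesis by (simp add: sphere_weight_def less_imp_le)
qed

text \<open>In the frame E both sides are integrals of one function of degree 0, over the radial
  weight on the left and over the unit ball on the right; \<open>nn_integral_radial_weight\<close>
  with m = 2 compares them. The punctured ball is the one through which
  \<open>sphere_measure\<close> is defined.\<close>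

lemma nn_integral_sphere_weight:
 fixes G :: "real^'n^'n" and F :: "real^'n => ennreal"
 assumes G: "pos_def G" and [measurable]: "F \<in> borel_measurable borel"
 shows "(NN w. ennreal (sphere_weight G w) * F (w /\<^sub>R qn G w))
  = ennreal (sqrt (det G) / unit_ball_vol CARD('n)) * (NN w. F (w /\<^sub>R qn G w) * indicator {w. 0 < qn G w \<and> qn G w <= 1} w)"
proof -
 let ?n = "real CARD('n)" and ?o = "unit_ball_vol CARD('n)"
 obtain E A where E: "invertible E" "!!w. qn G (E *v w) = norm w" "\<bar>det E\<bar> * sqrt (det G) = 1" "0 < det G" "matrix_inv G = E ** transpose E"
  and A0: "0 <= A" and frame: "!!w. sphere_weight G (E *v w) = A * max 0 (1 - (norm w)\<^sup>2)"
  and Ao: "\<bar>det E\<bar> * A * (2 / (?n + 2)) = 1 / ?o" and o: "?o > 0" and [measurable]: "sphere_weight G \<in> borel_measurable borel"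
  using sphere_weight_frame[OF G] by metis
 define k where "k = (%w. F ((E *v w) /\<^sub>R norm w))"
 have [measurable]: "k \<in> borel_measurable borel" unfolding k_def by measurable
 have kh: "k (c *\<^sub>R w) = k w" if "0 < c" for c w
 proof -
  have e: "inverse c * inverse (norm w) * c = inverse (norm w)" using that by (simp add: field_simps)
  have "(E *v (c *\<^sub>R w)) /\<^sub>R norm (c *\<^sub>R w) = (inverse c * inverse (norm w) * c) *\<^sub>R (E *v w)"
   using that by (simp add: matrix_vector_mult_scaleR)
  then show ?thesis unfolding k_def e by simp
 qed
 define H where "H = (NN w. k w * indicator (cball 0 1) w)"
 have "(NN w. ennreal (sphere_weight G w) * F (w /\<^sub>R qn G w))
  = ennreal \<bar>det E\<bar> * (NN w. ennreal (sphere_weight G (E *v w)) * F ((E *v w) /\<^sub>R qn G (E *v w)))"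
  by (rule nn_integral_linear_change[OF E(1)]) measurable
 also have "... = ennreal \<bar>det E\<bar> * (NN w. ennreal A * (k w * ennreal (max 0 (1 - (norm w)\<^sup>2))))"
  unfolding frame E(2) k_def using A0 by (simp add: ennreal_mult mult_ac)
 also have "... = ennreal \<bar>det E\<bar> * (ennreal A * (ennreal (2 / (?n + 2)) * H))"
  using nn_integral_radial_weight[of k 2] kh by (simp add: nn_integral_cmult H_def add.commute)
 also have "... = ennreal (\<bar>det E\<bar> * A * (2 / (?n + 2))) * H"
  using A0 by (simp only: ennreal_mult abs_ge_zero mult_nonneg_nonneg divide_nonneg_nonneg of_nat_0_le_iff add_nonneg_nonneg zero_le_numeral mult.assoc)
 also have "\<bar>det E\<bar> * A * (2 / (?n + 2)) = sqrt (det G) / ?o * \<bar>det E\<bar>"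
  using Ao E(3) by (simp add: mult.commute)
 also have "ennreal (sqrt (det G) / ?o * \<bar>det E\<bar>) * H = ennreal (sqrt (det G) / ?o) * (ennreal \<bar>det E\<bar> * H)"
  using o E(4) by (subst ennreal_mult) (auto simp: mult.assoc)
 also have "H = (NN w. F ((E *v w) /\<^sub>R qn G (E *v w)) * indicator {w. 0 < qn G w \<and> qn G w <= 1} (E *v w))"
  unfolding H_def
  by (rule nn_integral_cong_AE, use AE_lborel_singleton[of "0::real^'n"] in eventually_elim)
   (auto simp: k_def E(2) indicator_def)
 also have "ennreal \<bar>det E\<bar> * ... = (NN w. F (w /\<^sub>R qn G w) * indicator {w. 0 < qn G w \<and> qn G w <= 1} w)"
  by (rule nn_integral_linear_change[OF E(1), symmetric]) measurable
 finally show ?thesis .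
qed

text \<open>In the frame E the metric becomes Euclidean and the covector q becomes E^T q, which
  reduces the claim to \<open>integral_sign_direction\<close>. It says that the mean of sgn (w . q)
  w over the unit sphere is k_n times the unit vector dual to q.\<close>

lemma integral_sphere_weight_sign:
 fixes G :: "real^'n^'n"
 assumes n: "2 <= CARD('n)" and G: "pos_def G" and q: "q ~= 0"
 shows "(LB w. sphere_weight G w * (sgn (w \<bullet> q) * (w \<bullet> u) / qn G w))
  = variation_const CARD('n) * qform (matrix_inv G) q u / qn (matrix_inv G) q"
proof -
 let ?n = "real CARD('n)" and ?o = "unit_ball_vol CARD('n)"
 obtain E A where E: "invertible E" "!!w. qn G (E *v w) = norm w" "\<bar>det E\<bar> * sqrt (det G) = 1" "0 < det G" "matrix_inv G = E ** transpose E"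
  and A0: "0 <= A" and frame: "!!w. sphere_weight G (E *v w) = A * max 0 (1 - (norm w)\<^sup>2)"
  and Ao: "\<bar>det E\<bar> * A * (2 / (?n + 2)) = 1 / ?o" and o: "?o > 0" and [measurable]: "sphere_weight G \<in> borel_measurable borel"
  using sphere_weight_frame[OF G] by metis
 define b where "b = transpose E *v q"
 define v where "v = transpose E *v u"
 have pE: "(E *v w) \<bullet> q = w \<bullet> b" "(E *v w) \<bullet> u = w \<bullet> v" for w
  by (simp_all add: b_def v_def dot_lmul_matrix[symmetric] inner_commute)
 have b0: "b ~= 0"
 proof
  assume "b = 0"
  then have "(E *v w) \<bullet> q = 0" for w by (simp add: pE)
  then have "(E *v (matrix_inv E *v q)) \<bullet> q = 0" by blast
  then show False using q by (simp add: matrix_vector_mul_assoc matrix_inv_cancel[OF E(1)])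
 qed
 have "(LB w. sphere_weight G w * (sgn (w \<bullet> q) * (w \<bullet> u) / qn G w))
  = \<bar>det E\<bar> * (LB w. sphere_weight G (E *v w) * (sgn ((E *v w) \<bullet> q) * ((E *v w) \<bullet> u) / qn G (E *v w)))"
  by (rule integral_linear_change[OF E(1)]) measurable
 also have "... = \<bar>det E\<bar> * (LB w. A * (max 0 (1 - (norm w)\<^sup>2) * (sgn (w \<bullet> b) * (w \<bullet> v) / norm w)))"
  unfolding frame E(2) pE by (simp add: mult.assoc)
 also have "... = \<bar>det E\<bar> * (A * (2 / real (CARD('n) + 2) * (variation_const CARD('n) * ?o) * (b \<bullet> v) / norm b))"
  by (subst integral_mult_right_zero, subst integral_sign_direction[OF n b0]) (rule refl)
 also have "... = (\<bar>det E\<bar> * A * (2 / (?n + 2))) * (variation_const CARD('n) * ?o * (b \<bullet> v) / norm b)"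
  by (simp add: mult_ac add.commute)
 finally show ?thesis unfolding Ao using o by (simp add: b_def v_def qn_matrix_inv_frame[OF E(5)])
qed

subsection \<open>Local geometry in a chart\<close>

lemma qform_eq_sum: "qform M v w = (\<Sum>i\<in>UNIV. \<Sum>j\<in>UNIV. v $ i * M $ i $ j * w $ j)"
 by (simp add: qform_def inner_vec_def matrix_vector_mult_def sum_distrib_left mult.assoc)

lemma qform_bound:
 fixes M :: "real^'n^'n"
 assumes "!!i j. \<bar>M $ i $ j\<bar> <= b"
 shows "\<bar>qform M v w\<bar> <= (real CARD('n))\<^sup>2 * b * norm v * norm w"
proof -
 have "\<bar>qform M v w\<bar> <= (\<Sum>i\<in>UNIV. \<bar>\<Sum>j\<in>UNIV. v $ i * M $ i $ j * w $ j\<bar>)"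
  unfolding qform_eq_sum by (rule sum_abs)
 also have "... <= (\<Sum>i\<in>(UNIV::'n set). \<Sum>j\<in>(UNIV::'n set). norm v * b * norm w)"
 proof (intro sum_mono order_trans[OF sum_abs])
  fix i j
  show "\<bar>v $ i * M $ i $ j * w $ j\<bar> <= norm v * b * norm w"
   unfolding abs_mult using assms[of i j] order_trans[OF abs_ge_zero assms]
   by (intro mult_mono component_le_norm_cart mult_nonneg_nonneg) auto
 qed
 also have "... = (real CARD('n))\<^sup>2 * b * norm v * norm w" by (simp add: power2_eq_square)
 finally show ?thesis .
qed

lemma qform_dual_le:
 fixes G :: "real^'n^'n"
 assumes G: "pos_def G"
 shows "\<bar>p \<bullet> w\<bar> <= qn (matrix_inv G) p * qn G w"
proof -
 obtain E :: "real^'n^'n" where E: "invertible E" "!!w. qn G (E *v w) = norm w" "matrix_inv G = E ** transpose E"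
  by (rule pos_def_frame[OF G]) blast
 have w: "w = E *v (matrix_inv E *v w)" by (simp add: matrix_vector_mul_assoc matrix_inv_cancel[OF E(1)])
 have "p \<bullet> w = (transpose E *v p) \<bullet> (matrix_inv E *v w)"
  by (subst w) (simp add: dot_lmul_matrix[symmetric])
 also have "\<bar>...\<bar> <= norm (transpose E *v p) * norm (matrix_inv E *v w)" by (rule Cauchy_Schwarz_ineq2)
 finally show ?thesis using w E(2) qn_matrix_inv_frame(2)[OF E(3)] by metis
qed

lemma pos_def_matrix_inv:
 fixes G :: "real^'n^'n"
 assumes G: "pos_def G"
 shows "pos_def (matrix_inv G)" "qn G (matrix_inv G *v p) = qn (matrix_inv G) p" "G *v (matrix_inv G *v p) = p"
proof -
 obtain E :: "real^'n^'n" where E: "invertible E" "!!w. qn G (E *v w) = norm w" "invertible G" "matrix_inv G = E ** transpose E"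
  by (rule pos_def_frame[OF G]) blast
 have cancel: "G *v (matrix_inv G *v p) = p" "matrix_inv G *v (G *v p) = p" for p
  by (simp_all add: matrix_vector_mul_assoc matrix_inv_cancel[OF E(3)])
 show "G *v (matrix_inv G *v p) = p" by (rule cancel)
 have "matrix_inv G *v p = E *v (transpose E *v p)" by (simp only: E(4) matrix_vector_mul_assoc)
 then show q: "qn G (matrix_inv G *v p) = qn (matrix_inv G) p" by (simp only: E(2) qn_matrix_inv_frame(2)[OF E(4)])
 have "transpose (matrix_inv G) = matrix_inv G" by (simp add: E(4) matrix_transpose_mul)
 moreover have "0 < qform (matrix_inv G) w w" if "w ~= 0" for w
 proof -
  have "matrix_inv G *v w ~= 0" using cancel(1)[of w] that by auto
  then have "0 < qform G (matrix_inv G *v w) (matrix_inv G *v w)" by (rule pos_defD[OF G])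
  then show ?thesis by (simp add: qform_def cancel inner_commute)
 qed
 ultimately show "pos_def (matrix_inv G)" by (simp add: pos_def_def)
qed

text \<open>By duality |w|^2 is at most the product of the norms of w for the inverse of G and for
  G, so an upper bound for the entries of the inverse is a lower bound for G.\<close>

lemma qn_norm_ge:
 fixes G :: "real^'n^'n"
 assumes G: "pos_def G" and H: "!!i j. \<bar>matrix_inv G $ i $ j\<bar> <= b"
 shows "norm w <= sqrt ((real CARD('n))\<^sup>2 * b) * qn G w"
proof (cases "w = 0")
 case True
 have "0 <= b" using order_trans[OF abs_ge_zero H] .
 then show ?thesis using True by (simp add: G)
next
 case False
 have "qn (matrix_inv G) w <= sqrt ((real CARD('n))\<^sup>2 * b) * norm w"
 proof -
  have "qform (matrix_inv G) w w <= (real CARD('n))\<^sup>2 * b * norm w * norm w" using qform_bound[OF H, of w w] by linarith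
  then have "qn (matrix_inv G) w <= sqrt ((real CARD('n))\<^sup>2 * b * (norm w)\<^sup>2)" unfolding qn_def by (simp add: power2_eq_square mult.assoc)
  then show ?thesis by (simp add: real_sqrt_mult)
 qed
 then have "qn (matrix_inv G) w * qn G w <= sqrt ((real CARD('n))\<^sup>2 * b) * norm w * qn G w"
  using G by (intro mult_right_mono) auto
 moreover have "norm w * norm w <= qn (matrix_inv G) w * qn G w"
  using qform_dual_le[OF G, of w w] by (simp add: dot_square_norm power2_eq_square)
 ultimately have "norm w * norm w <= norm w * (sqrt ((real CARD('n))\<^sup>2 * b) * qn G w)" by (simp add: mult_ac)
 then show ?thesis using False by simp
qed

lemma qn_norm_le:
 fixes G :: "real^'n^'n"
 assumes "!!i j. \<bar>G $ i $ j\<bar> <= b"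
 shows "qn G w <= sqrt ((real CARD('n))\<^sup>2 * b) * norm w"
proof -
 have "qform G w w <= (real CARD('n))\<^sup>2 * b * norm w * norm w" using qform_bound[OF assms, of w w] by linarith
 then have "qn G w <= sqrt ((real CARD('n))\<^sup>2 * b * (norm w)\<^sup>2)" unfolding qn_def by (simp add: power2_eq_square mult.assoc)
 then show ?thesis by (simp add: real_sqrt_mult)
qed

text \<open>The difference of the norms is the difference of the quadratic forms divided by the sum
  of the norms; \<open>qn_norm_ge\<close> keeps this denominator away from 0.\<close>

lemma qn_lipschitz:
 fixes G H :: "real^'n^'n"
 assumes G: "pos_def G" "pos_def H" and b: "!!i j. \<bar>matrix_inv G $ i $ j\<bar> <= b" "!!i j. \<bar>G $ i $ j - H $ i $ j\<bar> <= d"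
 shows "\<bar>qn G w - qn H w\<bar> <= (real CARD('n))\<^sup>2 * sqrt ((real CARD('n))\<^sup>2 * b) * d * norm w"
proof (cases "w = 0")
 case True
 then show ?thesis by (simp add: qn_def qform_zero)
next
 case False
 let ?c = "sqrt ((real CARD('n))\<^sup>2 * b)" and ?N = "(real CARD('n))\<^sup>2"
 have b0: "0 <= b" "0 <= d" using order_trans[OF abs_ge_zero b(1)] order_trans[OF abs_ge_zero b(2)] by auto
 have nw: "norm w <= ?c * qn G w" by (rule qn_norm_ge[OF G(1) b(1)])
 have "qform G w w - qform H w w = qform (G - H) w w"
  by (simp add: qform_eq_sum sum_subtractf[symmetric] algebra_simps)
 then have "\<bar>qform G w w - qform H w w\<bar> <= ?N * d * norm w * norm w"
  using qform_bound[of "G - H" d w w] b(2) by simp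
 also have "... <= ?N * d * norm w * (?c * qn G w)" using nw b0 by (intro mult_left_mono) auto
 also have "... <= ?N * d * norm w * (?c * (qn G w + qn H w))" using b0 G by (intro mult_left_mono) auto
 finally have "\<bar>(qn G w - qn H w) * (qn G w + qn H w)\<bar> <= (?N * ?c * d * norm w) * (qn G w + qn H w)"
  by (simp add: qn_power2[OF G(1), symmetric] qn_power2[OF G(2), symmetric] power2_eq_square algebra_simps)
 moreover have "0 < qn G w + qn H w" using False G by (simp add: qn_pos_iff add_pos_pos)
 ultimately show ?thesis by (simp add: abs_mult)
qed

text \<open>Convexity of the norm of G, in the frame in which it is Euclidean. It bounds mollified
  fields.\<close>

lemma qn_integral_le:
 fixes G :: "real^'n^'n" and Z :: "real^'n => real^'n" and k :: "real^'n => real"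
 assumes G: "pos_def G" and int: "integrable lborel (%x. k x *\<^sub>R Z x)" "integrable lborel k" "(LB x. k x) = 1"
  and k: "!!x. 0 <= k x" and M: "!!x. k x ~= 0 ==> qn G (Z x) <= M"
 shows "qn G (LB x. k x *\<^sub>R Z x) <= M"
proof -
 obtain E :: "real^'n^'n" where E: "invertible E" "!!w. qn G (E *v w) = norm w" by (rule pos_def_frame[OF G]) blast
 have q: "qn G w = norm (matrix_inv E *v w)" for w
  using E(2)[of "matrix_inv E *v w"] by (simp add: matrix_vector_mul_assoc matrix_inv_cancel[OF E(1)])
 have bl: "bounded_linear ((*v) (matrix_inv E))" by (rule matrix_vector_mul_bounded_linear)
 have "matrix_inv E *v (LB x. k x *\<^sub>R Z x) = (LB x. matrix_inv E *v (k x *\<^sub>R Z x))"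
  by (rule integral_bounded_linear[OF bl int(1), symmetric])
 also have "norm ... <= (LB x. M * k x)"
 proof (rule integral_norm_bound_integral)
  show "integrable lborel (%x. matrix_inv E *v (k x *\<^sub>R Z x))" by (rule integrable_bounded_linear[OF bl int(1)])
  fix x show "norm (matrix_inv E *v (k x *\<^sub>R Z x)) <= M * k x"
   using M[of x] k[of x] mult_right_mono[of "qn G (Z x)" M "k x"]
   by (cases "k x = 0") (simp_all add: q[symmetric] qn_scale mult.commute)
 qed (use int in auto)
 finally show ?thesis using int by (simp add: q)
qed

text \<open>The data of one chart, extended to all of R^n: B bounds sizes, L is a common Lipschitz
  constant, and \<eta> is the function of the partition, supported within \<delta> of a. The
  extension by projection is merely Lipschitz, so the assumptions are of that kind.\<close>

locale local_metric =
 fixes G :: "real^'n => real^'n^'n" and \<eta> :: "real^'n => real" and a :: "real^'n" and \<delta> r0 B L :: real and d :: nat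
 assumes d: "d = CARD('n)" and n: "2 <= d" and const: "0 < \<delta>" "0 < r0" "0 < B" "0 < L"
  and pd: "pos_def (G x)"
  and Gb: "\<bar>G x $ i $ j\<bar> <= B" "\<bar>matrix_inv (G x) $ i $ j\<bar> <= B"
  and Gl: "\<bar>G x $ i $ j - G y $ i $ j\<bar> <= L * norm (x - y)"
   "\<bar>matrix_inv (G x) $ i $ j - matrix_inv (G y) $ i $ j\<bar> <= L * norm (x - y)"
  and \<rho>b: "1 / B <= sqrt (det (G x))" "sqrt (det (G x)) <= B"
  and \<rho>l: "\<bar>sqrt (det (G x)) - sqrt (det (G y))\<bar> <= L * norm (x - y)"
  and \<eta>: "0 <= \<eta> x" "\<eta> x <= 1" "\<eta> x ~= 0 ==> x \<in> cball a \<delta>" "\<bar>\<eta> x - \<eta> y\<bar> <= L * norm (x - y)"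
begin

abbreviation "N \<equiv> (real d)\<^sup>2"
abbreviation "H \<equiv> %x. matrix_inv (G x)"
abbreviation "kn \<equiv> variation_const d"

definition "\<rho> x = sqrt (det (G x))"
text \<open>c0 compares the Euclidean norm in both directions with the norms of G x and of its
  inverse; c1 is the rate at which these norms vary with x.\<close>

definition "c0 = sqrt (N * B)"
definition "c1 = N * c0 * L"

text \<open>th labels a direction independently of the point, and this is its unit representative at
  x.\<close>

definition v :: "real^'n => real^'n => real^'n" where "v th x = th /\<^sub>R qn (G x) th"

definition w :: "real^'n => real^'n => real" where "w x th = sphere_weight (G x) th"

definition A :: "real^'n => real^'n => real" where "A x th = \<eta> x * \<rho> x * w x th"

lemma kn_pos: "0 < kn"
 using n by (simp add: variation_const_def sphere_vol_def)

lemma pdH: "pos_def (H x)"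
 using pos_def_matrix_inv(1)[OF pd] .

lemma matrix_inv_inv: "matrix_inv (H x) = G x"
proof -
 have "G x ** H x = mat 1" "H x ** G x = mat 1" using pos_def_frame[OF pd] matrix_inv_cancel by metis+
 then show ?thesis
  by (metis invertible_def matrix_inv_cancel(1) matrix_mul_assoc matrix_mul_lid matrix_mul_rid)
qed

lemma c_pos: "0 < c0" "0 < c1" "0 < N"
 using const n by (auto simp: c0_def c1_def)

lemma qnG: "norm u <= c0 * qn (G x) u" "qn (G x) u <= c0 * norm u" "\<bar>qn (G x) u - qn (G y) u\<bar> <= c1 * norm (x - y) * norm u"
 using qn_norm_ge[OF pd Gb(2), of u x] qn_norm_le[OF Gb(1), of x u] qn_lipschitz[OF pd[of x] pd[of y] Gb(2) Gl(1), of u]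
 by (simp_all add: c0_def c1_def mult_ac flip: d)

lemma qnH: "norm u <= c0 * qn (H x) u" "qn (H x) u <= c0 * norm u" "\<bar>qn (H x) u - qn (H y) u\<bar> <= c1 * norm (x - y) * norm u"
 using qn_norm_ge[OF pdH, of x B u] qn_norm_le[OF Gb(2), of x u] qn_lipschitz[OF pdH pdH, of x B y "L * norm (x - y)" u] Gb Gl
 by (simp_all add: c0_def c1_def mult_ac matrix_inv_inv flip: d)

lemma \<rho>: "1 / B <= \<rho> x" "\<rho> x <= B" "\<bar>\<rho> x - \<rho> y\<bar> <= L * norm (x - y)" "0 < \<rho> x"
 using \<rho>b[of x] \<rho>l[of x y] const(3) less_le_trans[of 0 "1/B" "\<rho> x"] by (auto simp: \<rho>_def)

lemma v_bound: "norm (v th x) <= c0"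
proof (cases "th = 0")
 case True then show ?thesis using c_pos by (simp add: v_def)
next
 case False
 then have "0 < qn (G x) th" using pd qn_pos_iff by blast
 then show ?thesis using qnG(1)[of th x] pd by (simp add: v_def divide_inverse[symmetric] divide_le_eq mult.commute)
qed

lemma v_lip: "norm (v th x - v th y) <= c0 * c0 * c1 * norm (x - y)"
proof (cases "th = 0")
 case True then show ?thesis using c_pos by (simp add: v_def)
next
 case False
 then have p: "0 < qn (G x) th" "0 < qn (G y) th" using pd qn_pos_iff by blast+
 have "v th x - v th y = ((qn (G y) th - qn (G x) th) / (qn (G x) th * qn (G y) th)) *\<^sub>R th"
  using p unfolding v_def scaleR_diff_left[symmetric] by (simp add: field_simps)
 then have "norm (v th x - v th y) = \<bar>qn (G y) th - qn (G x) th\<bar> * norm th / (qn (G x) th * qn (G y) th)"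
  using p by (simp add: abs_mult)
 also have "... <= (c1 * norm (x - y) * norm th) * norm th / (qn (G x) th * qn (G y) th)"
  using qnG(3)[of y th x] p by (intro divide_right_mono mult_right_mono) (auto simp: norm_minus_commute)
 also have "... <= (c1 * norm (x - y) * (c0 * qn (G x) th)) * (c0 * qn (G y) th) / (qn (G x) th * qn (G y) th)"
  using qnG(1) p c_pos by (intro divide_right_mono mult_mono mult_left_mono mult_nonneg_nonneg) auto
 also have "... = c0 * c0 * c1 * norm (x - y)" using p by (simp add: field_simps)
 finally show ?thesis .
qed

definition "cw = (real d + 2) / (2 * unit_ball_vol d)"

lemma cw_pos: "0 < cw"
 using unit_ball_vol_pos[of "real d"] by (simp add: cw_def add_nonneg_pos)

lemma w_eq: "w x th = cw * \<rho> x * max 0 (1 - qform (G x) th th)"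
 by (simp add: w_def sphere_weight_def cw_def \<rho>_def flip: d)

lemma w_nonneg: "0 <= w x th"
 unfolding w_def by (rule sphere_weight_nonneg[OF pd])

lemma w_bound: "w x th <= cw * B"
proof -
 have "max 0 (1 - qform (G x) th th) <= 1" using qform_nonneg[OF pd] by simp
 then have "w x th <= (cw * \<rho> x) * 1" unfolding w_eq using cw_pos \<rho>(4)[of x] by (intro mult_left_mono) auto
 also have "... <= cw * B" using cw_pos \<rho>(2)[of x] by simp
 finally show ?thesis .
qed

lemma w_supp: "c0 < norm th ==> w x th = 0"
proof -
 assume "c0 < norm th"
 then have "c0 * 1 < c0 * qn (G x) th" using qnG(1)[of th x] by linarith
 then have "1 < qn (G x) th" using c_pos by simp
 then have "1 < (qn (G x) th)\<^sup>2" by (simp add: one_less_power)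
 then show "w x th = 0" by (simp add: w_eq qn_power2[OF pd])
qed

lemma w_lip: "\<exists>K\<ge>0. \<forall>x y th. \<bar>w x th - w y th\<bar> <= K * norm (x - y)"
proof (intro exI conjI allI)
 let ?K = "cw * (L + B * (N * L * (c0 * c0)))"
 show "0 <= ?K" using cw_pos const c_pos by auto
 fix x y th
 let ?m = "%x. max 0 (1 - qform (G x) th th)"
 show "\<bar>w x th - w y th\<bar> <= ?K * norm (x - y)"
 proof (cases "norm th <= c0")
  case True
  have "qform (G x) th th - qform (G y) th th = qform (G x - G y) th th"
   by (simp add: qform_eq_sum sum_subtractf[symmetric] algebra_simps)
  then have "\<bar>qform (G x) th th - qform (G y) th th\<bar> <= N * (L * norm (x - y)) * norm th * norm th"
   using qform_bound[of "G x - G y" "L * norm (x - y)" th th] Gl(1) by (simp flip: d)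
  also have "... <= N * (L * norm (x - y)) * c0 * c0" using True c_pos const by (intro mult_mono mult_left_mono) auto
  finally have m: "\<bar>?m x - ?m y\<bar> <= N * (L * norm (x - y)) * c0 * c0" by linarith
  have m1: "\<bar>?m x\<bar> <= 1" using qform_nonneg[OF pd, of x th] by simp
  have "\<rho> x * ?m x - \<rho> y * ?m y = (\<rho> x - \<rho> y) * ?m x + \<rho> y * (?m x - ?m y)" by (simp add: algebra_simps)
  then have "\<bar>\<rho> x * ?m x - \<rho> y * ?m y\<bar> <= \<bar>\<rho> x - \<rho> y\<bar> * \<bar>?m x\<bar> + \<bar>\<rho> y\<bar> * \<bar>?m x - ?m y\<bar>"
   by (metis abs_triangle_ineq abs_mult)
  also have "... <= (L * norm (x - y)) * 1 + B * (N * (L * norm (x - y)) * c0 * c0)"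
   using \<rho>(3)[of x y] \<rho>(2,4)[of y] m m1 const by (intro add_mono mult_mono) auto
  finally have "cw * \<bar>\<rho> x * ?m x - \<rho> y * ?m y\<bar> <= cw * ((L * norm (x - y)) * 1 + B * (N * (L * norm (x - y)) * c0 * c0))"
   using cw_pos by (intro mult_left_mono) auto
  moreover have e: "w x th - w y th = cw * (\<rho> x * ?m x - \<rho> y * ?m y)" by (simp add: w_eq algebra_simps)
  moreover have "\<bar>w x th - w y th\<bar> = cw * \<bar>\<rho> x * ?m x - \<rho> y * ?m y\<bar>" unfolding e abs_mult using cw_pos by simp
  ultimately show ?thesis by (simp add: algebra_simps)
 next
  case False
  then show ?thesis using w_supp[of th] cw_pos const c_pos by simp
 qed
qed

lemma A_nonneg: "0 <= A x th"
 unfolding A_def using \<eta>(1)[of x] \<rho>(4)[of x] w_nonneg by simp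

lemma A_bound: "A x th <= B * (cw * B) * indicator (cball 0 c0) th * indicator (cball a \<delta>) x"
proof (cases "\<eta> x = 0 \<or> c0 < norm th")
 case True then show ?thesis using w_supp cw_pos const by (auto simp: A_def)
next
 case False
 then have "x \<in> cball a \<delta>" "th \<in> cball 0 c0" using \<eta>(3)[of x] by auto
 moreover have "\<eta> x * \<rho> x <= 1 * B" using \<eta>[of x] \<rho>[of x] by (intro mult_mono) auto
 then have "A x th <= (1 * B) * (cw * B)" unfolding A_def using w_nonneg w_bound const by (rule_tac mult_mono) auto
 ultimately show ?thesis by simp
qed

lemma bounded_lipschitz_mult:
 fixes f g :: "'x::real_normed_vector => real"
 assumes "!!x. \<bar>f x\<bar> <= bf" "!!x. \<bar>g x\<bar> <= bg" "!!x y. \<bar>f x - f y\<bar> <= lf * norm (x - y)" "!!x y. \<bar>g x - g y\<bar> <= lg * norm (x - y)"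
 shows "\<bar>f x * g x - f y * g y\<bar> <= (lf * bg + bf * lg) * norm (x - y)"
proof -
 have "f x * g x - f y * g y = (f x - f y) * g x + f y * (g x - g y)" by (simp add: algebra_simps)
 then have "\<bar>f x * g x - f y * g y\<bar> <= \<bar>f x - f y\<bar> * \<bar>g x\<bar> + \<bar>f y\<bar> * \<bar>g x - g y\<bar>" by (metis abs_triangle_ineq abs_mult)
 also have "... <= (lf * norm (x - y)) * bg + bf * (lg * norm (x - y))"
  using assms order_trans[OF abs_ge_zero assms(1)] order_trans[OF abs_ge_zero assms(3)]
  by (intro add_mono mult_mono) auto
 finally show ?thesis by (simp add: algebra_simps)
qed

lemma \<eta>\<rho>_lip: "\<bar>\<eta> x * \<rho> x - \<eta> y * \<rho> y\<bar> <= (L * B + 1 * L) * norm (x - y)"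
 using \<eta> \<rho> less_imp_le[OF \<rho>(4)] by (intro bounded_lipschitz_mult) (auto simp: abs_of_nonneg)

lemma A_lip: "\<exists>K\<ge>0. \<forall>x y th. \<bar>A x th - A y th\<bar> <= K * norm (x - y)"
proof -
 obtain Kw where Kw: "Kw >= 0" "!!x y th. \<bar>w x th - w y th\<bar> <= Kw * norm (x - y)" using w_lip by blast
 have "\<bar>A x th - A y th\<bar> <= ((L * B + 1 * L) * (cw * B) + B * Kw) * norm (x - y)" for x y th
  unfolding A_def
 proof (rule bounded_lipschitz_mult[OF _ _ \<eta>\<rho>_lip Kw(2)])
  show "\<bar>\<eta> x * \<rho> x\<bar> <= B" for x
   using \<eta>[of x] \<rho>[of x] mult_mono[of "\<eta> x" 1 "\<rho> x" B] by (simp add: abs_mult)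
  show "\<bar>w x th\<bar> <= cw * B" for x using w_nonneg w_bound by simp
 qed
 moreover have "0 <= (L * B + 1 * L) * (cw * B) + B * Kw" using const cw_pos Kw by auto
 ultimately show ?thesis by blast
qed

lemma lipschitz_continuous:
 fixes f :: "'x::real_normed_vector => real"
 assumes "!!x y. \<bar>f x - f y\<bar> <= K * norm (x - y)"
 shows "continuous_on S f"
proof -
 have "(\<bar>K\<bar>)-lipschitz_on S f"
 proof (rule lipschitz_onI)
  fix x y
  have "\<bar>f x - f y\<bar> <= K * norm (x - y)" by (rule assms)
  also have "... <= \<bar>K\<bar> * norm (x - y)" by (intro mult_right_mono) auto
  finally show "dist (f x) (f y) <= \<bar>K\<bar> * dist x y" by (simp add: dist_norm)
 qed auto
 then show ?thesis by (rule lipschitz_on_continuous_on)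
qed

lemma continuous_G: "continuous_on S (%x. G x $ i $ j)" "continuous_on S (%x. H x $ i $ j)" "continuous_on S \<rho>" "continuous_on S \<eta>"
 by (rule lipschitz_continuous[of _ L], rule Gl \<rho>(3) \<eta>(4))+

lemma measurable_G [measurable]: "(%x. G x $ i $ j) \<in> borel_measurable borel" "(%x. H x $ i $ j) \<in> borel_measurable borel"
 "\<rho> \<in> borel_measurable borel" "\<eta> \<in> borel_measurable borel"
 using borel_measurable_continuous_onI continuous_G by blast+

lemma measurable_vec_nth [measurable]: "(%x::real^'n. x $ i) \<in> borel_measurable borel"
 by (intro borel_measurable_continuous_onI continuous_intros)

lemma measurable_qnG [measurable]:
 assumes [measurable]: "f \<in> borel_measurable M" "g \<in> borel_measurable M"
 shows "(%z. qn (G (f z)) (g z)) \<in> borel_measurable M" "(%z. qn (H (f z)) (g z)) \<in> borel_measurable M"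
  "(%z. qform (G (f z)) (g z) (g z)) \<in> borel_measurable M"
 unfolding qn_def qform_eq_sum by measurable

lemma measurable_v [measurable]:
 assumes [measurable]: "f \<in> borel_measurable M" "g \<in> borel_measurable M"
 shows "(%z. v (f z) (g z)) \<in> borel_measurable M"
 unfolding v_def by measurable

lemma measurable_w [measurable]:
 assumes [measurable]: "f \<in> borel_measurable M" "g \<in> borel_measurable M"
 shows "(%z. w (f z) (g z)) \<in> borel_measurable M" "(%z. A (f z) (g z)) \<in> borel_measurable M"
 unfolding A_def w_eq by measurable

end

text \<open>T t th x stands for the point at time t on the geodesic that leaves x with velocity v th
  x, and T' for its velocity. The geodesic equation enters only to first order: T' stays within L t
  of the unit vector v th at the current point, and T t is a perturbation of the identity with
  constant L t.\<close>

locale local_geometry = local_metric G \<eta> a \<delta> r0 B L d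
 for G :: "real^'n => real^'n^'n" and \<eta> a \<delta> r0 B L d +
 fixes T T' :: "real => real^'n => real^'n => real^'n"
 assumes T0: "T 0 th x = x"
  and T_deriv: "0 <= t ==> t <= r0 ==> ((%t. T t th x) has_vector_derivative T' t th x) (at t within {0..r0})"
  and T'_cont: "continuous_on {0..r0} (%t. T' t th x)"
  and T'_near: "0 <= t ==> t <= r0 ==> th ~= 0 ==> norm (T' t th x - th /\<^sub>R qn (G (T t th x)) th) <= L * t"
  and T_near: "0 <= t ==> t <= r0 ==> th ~= 0 ==> near_identity (L * t) (T t th)"
  and T_meas: "(%z. T (fst z) (fst (snd z)) (snd (snd z))) \<in> borel_measurable (borel \<Otimes>\<^sub>M borel \<Otimes>\<^sub>M borel)"
begin

text \<open>The share of one chart in the mean difference quotient, as \<open>local_quotient\<close>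
  shows.\<close>

definition loc :: "(real^'n => real) => real => ennreal" where
 "loc f r = (NN x. (NN th. ennreal (A x th * \<bar>f (T r th x) - f x\<bar> / r)))"

lemma measurable_T [measurable]:
 assumes [measurable]: "f \<in> borel_measurable M" "g \<in> borel_measurable M" "h \<in> borel_measurable M"
 shows "(%z. T (f z) (g z) (h z)) \<in> borel_measurable M"
proof -
 have "(%z. (f z, g z, h z)) \<in> M \<rightarrow>\<^sub>M borel \<Otimes>\<^sub>M borel \<Otimes>\<^sub>M borel" by measurable
 from measurable_compose[OF this T_meas] show ?thesis by simp
qed

text \<open>Up to time rs the constant L t satisfies the smallness condition of
  \<open>near_identity_nn_integral\<close>; CN is the resulting rate of volume distortion.\<close>

definition "rs = min r0 (1 / (L * (2 * real d)))"
definition "CN = 4 * real d * L"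

lemma rs: "0 < rs" "rs <= r0" "0 <= t ==> t <= rs ==> 2 * real DIM(real^'n) * (L * t) <= 1" "0 < CN"
proof -
 have c: "0 < real d" using n by simp
 show "0 < rs" "rs <= r0" "0 < CN" using c const by (auto simp: rs_def CN_def)
 assume t: "0 <= t" "t <= rs"
 then have "t <= 1 / (L * (2 * real d))" by (simp add: rs_def)
 then show "2 * real DIM(real^'n) * (L * t) <= 1" using c const by (simp add: d field_simps)
qed

lemma CN_eq: "4 * real DIM(real^'n) * (L * t) = CN * t"
 unfolding CN_def by (simp add: d)

lemma T_nn_integral:
 assumes "0 <= t" "t <= rs" "th ~= 0" "h \<in> borel_measurable borel"
 shows "(NN x. h (T t th x)) <= ennreal (1 + CN * t) * (NN x. h x)"
 using near_identity_nn_integral(1)[OF T_near _ rs(3)[OF assms(1,2)] assms(4), unfolded CN_eq] assms rs(2) const by simp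

lemma T_integral:
 assumes "0 <= t" "t <= rs" "th ~= 0" "integrable lborel h"
 shows "integrable lborel (%x. h (T t th x) :: real)"
  and "(LB x. \<bar>h (T t th x)\<bar>) <= (1 + CN * t) * (LB x. \<bar>h x\<bar>)"
  and "\<bar>(LB x. h (T t th x)) - (LB x. h x)\<bar> <= CN * t * (LB x. \<bar>h x\<bar>)"
 using near_identity_integral[OF T_near _ rs(3)[OF assms(1,2)] assms(4), unfolded CN_eq] assms rs(2) const by simp_all

definition "cT = c0 + L * r0"

lemma cT_pos: "0 < cT"
 using c_pos const by (simp add: cT_def add_pos_pos)

lemma T'_bound:
 assumes "0 <= t" "t <= r0" "th ~= 0"
 shows "norm (T' t th x) <= cT"
proof -
 have "norm (T' t th x) <= norm (v th (T t th x)) + norm (T' t th x - v th (T t th x))" by (rule norm_triangle_sub)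
 also have "... <= c0 + L * t" using T'_near[OF assms, of x] v_bound by (intro add_mono) (auto simp: v_def)
 also have "... <= cT" using assms const by (simp add: cT_def)
 finally show ?thesis .
qed

lemma T_move:
 assumes "0 <= t" "t <= r0" "th ~= 0"
 shows "norm (T t th x - x) <= cT * t"
proof -
 have "norm (T t th x - T 0 th x) <= cT * norm (t - 0)"
 proof (rule differentiable_bound[where S="{0..r0}"])
  fix s assume s: "s \<in> {0..r0}"
  show "((%t. T t th x) has_derivative (%h. h *\<^sub>R T' s th x)) (at s within {0..r0})"
   using T_deriv[of s th x] s by (simp add: has_vector_derivative_def)
  show "onorm (%h. h *\<^sub>R T' s th x) <= cT"
   using T'_bound[of s th x] s assms by (subst onorm_scaleR_left[OF bounded_linear_ident]) (simp add: onorm_id)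
 qed (use assms in auto)
 then show ?thesis using assms by (simp add: T0)
qed

lemma w_sign_integral:
 assumes "q ~= 0"
 shows "(LB th. w x th * (sgn (th \<bullet> q) * (v th x \<bullet> u))) = kn * qform (H x) q u / qn (H x) q"
proof -
 have "w x th * (sgn (th \<bullet> q) * (v th x \<bullet> u)) = sphere_weight (G x) th * (sgn (th \<bullet> q) * (th \<bullet> u) / qn (G x) th)" for th
  by (simp add: w_def v_def divide_inverse mult_ac)
 then show ?thesis using integral_sphere_weight_sign[OF n[unfolded d] pd[of x] assms, of u] by (simp flip: d)
qed

text \<open>|p . v| equals sgn (th . p) (v . p), because v is a positive multiple of th; so this is
  the case q = u = p of \<open>w_sign_integral\<close>.\<close>

lemma w_abs_integral: "(NN th. ennreal (w x th * \<bar>p \<bullet> v th x\<bar>)) = ennreal (kn * qn (H x) p)"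
proof (cases "p = 0")
 case False
 have i: "integrable lborel (%th. w x th * \<bar>p \<bullet> v th x\<bar>)"
 proof (rule integrable_bound[OF integrable_mult_right[OF integrable_indicator_cball[of 0 c0], of "cw * B * (norm p * c0)"]])
  show "AE th in lborel. norm (w x th * \<bar>p \<bullet> v th x\<bar>) <= norm (cw * B * (norm p * c0) * indicator (cball 0 c0) th)"
  proof (rule AE_I2)
   fix th
   have "\<bar>p \<bullet> v th x\<bar> <= norm p * c0"
    using Cauchy_Schwarz_ineq2[of p "v th x"] mult_left_mono[OF v_bound norm_ge_zero[of p]] order_trans by blast
   then have "w x th * \<bar>p \<bullet> v th x\<bar> <= cw * B * (norm p * c0)" using w_bound w_nonneg cw_pos const by (intro mult_mono) auto
   then show "norm (w x th * \<bar>p \<bullet> v th x\<bar>) <= norm (cw * B * (norm p * c0) * indicator (cball 0 c0) th)"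
    using w_supp[of th x] w_nonneg[of x th] cw_pos const c_pos by (cases "c0 < norm th") (auto simp: abs_mult)
  qed
 qed measurable
 have eq: "w x th * \<bar>p \<bullet> v th x\<bar> = w x th * (sgn (th \<bullet> p) * (v th x \<bullet> p))" for th
 proof -
  have *: "\<bar>t\<bar> = sgn (q * t) * t" if "0 < q" for q t :: real using that by (auto simp: sgn_mult abs_sgn)
  show ?thesis
  proof (cases "th = 0")
   case False
   then have q: "0 < qn (G x) th" using qn_pos_iff[OF pd] by blast
   then have "th \<bullet> p = qn (G x) th * (p \<bullet> v th x)" by (simp add: v_def inner_commute)
   then show ?thesis using *[OF q, of "p \<bullet> v th x"] by (simp add: inner_commute)
  qed (simp add: v_def)
 qed
 have "(NN th. ennreal (w x th * \<bar>p \<bullet> v th x\<bar>)) = ennreal (LB th. w x th * \<bar>p \<bullet> v th x\<bar>)"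
  by (rule nn_integral_eq_integral[OF i]) (simp add: w_nonneg)
 also have "... = ennreal (kn * qn (H x) p)"
  using qn_power2[OF pdH, of x p, symmetric] qn_pos_iff[OF pdH, of x p] False by (simp add: eq w_sign_integral power2_eq_square)
 finally show ?thesis .
qed (simp add: qn_def qform_zero)

end

section \<open>The upper bound in a chart\<close>

definition grad :: "('a::euclidean_space => real) => 'a => 'a" where
 "grad h x = (\<Sum>b\<in>Basis. Dv h x b *\<^sub>R b)"

lemma grad:
 assumes "Ck_on 1 UNIV h"
 shows "(h has_derivative (%u. grad h x \<bullet> u)) (at x)" "Dv h x u = grad h x \<bullet> u"
  "continuous_on S (grad h)"
proof -
 have der: "(h has_derivative Dv h x) (at x)" for x
  using assms by (simp add: frechet_derivative_works[symmetric])
 have eq: "Dv h x u = grad h x \<bullet> u" for x u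
  by (subst has_derivative_sum_Basis[OF der]) (simp add: grad_def inner_sum_left inner_sum_right inner_commute mult.commute)
 show "Dv h x u = grad h x \<bullet> u" by (rule eq)
 have "Dv h x = (%u. grad h x \<bullet> u)" using eq by blast
 then show "(h has_derivative (%u. grad h x \<bullet> u)) (at x)" using der[of x] by simp
 have "continuous_on UNIV (%x. Dv h x b)" for b using assms by simp
 then show "continuous_on S (grad h)"
  unfolding grad_def by (intro continuous_intros) (auto intro: continuous_on_subset)
qed

context local_geometry
begin

text \<open>A bound for the weight A, and the volume of the ball of radius c0 outside which A
  vanishes in th.\<close>

definition "Am = B * (cw * B)"
definition "Vc = unit_ball_vol (real d) * c0 ^ d"

lemma Am_pos: "0 < Am"
 using const cw_pos by (simp add: Am_def)

lemma Vc: "0 <= Vc" "emeasure lborel (cball (0::real^'n) c0) = ennreal Vc"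
 using c_pos emeasure_cball[of c0 "0::real^'n"] unit_ball_vol_pos[of "real d"]
 by (auto simp: Vc_def less_imp_le simp flip: d)

lemma A_nonzero: "A x th ~= 0 ==> x \<in> cball a \<delta> \<and> th \<in> cball 0 c0"
proof (rule ccontr)
 assume nz: "A x th ~= 0" and "\<not> (x \<in> cball a \<delta> \<and> th \<in> cball 0 c0)"
 then have "indicator (cball 0 c0) th * indicator (cball a \<delta>) x = (0::real)" by (auto simp: indicator_def)
 then have "A x th <= 0" using A_bound[of x th] by (simp only: mult.assoc mult_zero_right)
 then show False using A_nonneg[of x th] nz by linarith
qed

lemma A_le_Am: "A x th <= Am * indicator (cball 0 c0) th"
 using A_bound[of x th] Am_pos by (auto simp: Am_def indicator_def of_bool_def split: if_splits)

lemma curve_derivative: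
 assumes h: "Ck_on 1 UNIV h" and r: "r <= r0" "s \<in> {0..r}"
 shows "((%s. h (T s th x)) has_vector_derivative (grad h (T s th x) \<bullet> T' s th x)) (at s within {0..r})"
proof -
 have "((%t. T t th x) has_derivative (%k. k *\<^sub>R T' s th x)) (at s within {0..r})"
  using has_vector_derivative_within_subset[OF T_deriv[of s th x], of "{0..r}"] r
  by (auto simp: has_vector_derivative_def)
 from has_derivative_compose[OF this grad(1)[OF h]]
 show ?thesis by (simp add: has_vector_derivative_def)
qed

lemma curve_continuous: "r <= r0 ==> continuous_on {0..r} (%s. T s th x)"
proof -
 assume "r <= r0"
 have "continuous_on {0..r0} (%s. T s th x)"
  unfolding continuous_on_eq_continuous_within using has_vector_derivative_continuous[OF T_deriv] by auto
 then show ?thesis by (rule continuous_on_subset) (use \<open>r <= r0\<close> in auto)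
qed

text \<open>A majorant of A x th times the speed of h along the curve, expressed through the current
  point y = T s th x alone, so that x can be replaced by y in the integral. The extra terms pay for
  moving the weight from x to y and for replacing the velocity by v th y. The ball of radius 2
  \<delta> contains every y reached from the support of \<eta>.\<close>

definition "gmaj K r h th y = (A y th + K * r * indicator (cball 0 c0) th * indicator (cball a (2 * \<delta>)) y)
 * (\<bar>grad h y \<bullet> v th y\<bar> + L * r * norm (grad h y))"

text \<open>The fundamental theorem of calculus along the curve, with the integrand estimated at its
  current point.\<close>

lemma difference_le_gmaj:
 assumes h: "Ck_on 1 UNIV h" and KA: "0 <= KA" "!!x y th. \<bar>A x th - A y th\<bar> <= KA * norm (x - y)"
  and r: "0 < r" "r <= rs" "cT * r <= \<delta>" and th: "th ~= 0"
 shows "ennreal (A x th * \<bar>h (T r th x) - h x\<bar>) <= (NN s. indicator {0..r} s * ennreal (gmaj (KA * cT) r h th (T s th x)))"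
proof (cases "A x th = 0")
 case False
 then have xa: "x \<in> cball a \<delta>" and thc: "th \<in> cball 0 c0" using A_nonzero by blast+
 have r0: "r <= r0" using r rs by linarith
 define \<phi> where "\<phi> = (%s. grad h (T s th x) \<bullet> T' s th x)"
 have cont: "continuous_on {0..r} \<phi>"
  unfolding \<phi>_def
  by (intro continuous_intros continuous_on_compose2[OF grad(3)[OF h, of UNIV] curve_continuous[OF r0]]
    continuous_on_subset[OF T'_cont]) (use r0 in auto)
 have "(\<phi> has_integral h (T r th x) - h (T 0 th x)) {0..r}"
  by (rule fundamental_theorem_of_calculus) (use curve_derivative[OF h r0] r in "auto simp: \<phi>_def")
 then have "h (T r th x) - h x = integral {0..r} \<phi>" by (simp add: T0 integral_unique)
 also have "\<bar>...\<bar> <= integral {0..r} (%s. \<bar>\<phi> s\<bar>)"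
  unfolding real_norm_def[symmetric]
  by (rule Henstock_Kurzweil_Integration.integral_norm_bound_integral) (auto intro!: integrable_continuous_interval continuous_intros cont)
 finally have le: "A x th * \<bar>h (T r th x) - h x\<bar> <= A x th * integral {0..r} (%s. \<bar>\<phi> s\<bar>)"
  using A_nonneg by (intro mult_left_mono) auto
 have "((%s. \<bar>\<phi> s\<bar>) has_integral integral {0..r} (%s. \<bar>\<phi> s\<bar>)) {0..r}"
  by (intro integrable_integral integrable_continuous_interval continuous_intros cont)
 then have hi: "((%s. A x th * \<bar>\<phi> s\<bar>) has_integral A x th * integral {0..r} (%s. \<bar>\<phi> s\<bar>)) {0..r}"
  by (rule has_integral_mult_right)
 have "(NN s. ennreal (indicator {0..r} s * (A x th * \<bar>\<phi> s\<bar>))) = ennreal (A x th * integral {0..r} (%s. \<bar>\<phi> s\<bar>))"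
  by (rule nn_integral_has_integral_lebesgue[OF _ hi]) (simp add: A_nonneg)
 then have "ennreal (A x th * \<bar>h (T r th x) - h x\<bar>) <= (NN s. ennreal (indicator {0..r} s * (A x th * \<bar>\<phi> s\<bar>)))"
  using le by (simp add: ennreal_leI)
 also have "... <= (NN s. indicator {0..r} s * ennreal (gmaj (KA * cT) r h th (T s th x)))"
 proof (rule nn_integral_mono)
  fix s :: real
  have "A x th * \<bar>\<phi> s\<bar> <= gmaj (KA * cT) r h th (T s th x)" if s: "s \<in> {0..r}"
  proof -
   let ?y = "T s th x"
   have s': "0 <= s" "s <= r0" using s r0 by auto
   have "norm (?y - x) <= cT * s" using T_move[OF s' th] .
   also have "... <= cT * r" using s cT_pos by simp
   finally have mv: "norm (x - ?y) <= cT * r" by (simp add: norm_minus_commute)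
   have ya: "?y \<in> cball a (2 * \<delta>)"
   proof -
    have "dist a ?y <= dist a x + dist x ?y" by (rule dist_triangle)
    also have "... <= \<delta> + \<delta>" using xa mv r(3) by (intro add_mono) (auto simp: dist_norm)
    finally show ?thesis by simp
   qed
   \<comment> \<open>Moving the weight along the curve costs KA times the distance cT r; where A x
     th is nonzero, both indicators equal 1.\<close>
   have "A x th <= A ?y th + KA * (cT * r)"
    using KA(2)[of x th ?y] mult_left_mono[OF mv KA(1)] by linarith
   then have A1: "A x th <= A ?y th + KA * cT * r * indicator (cball 0 c0) th * indicator (cball a (2 * \<delta>)) ?y"
    using thc ya by (simp add: mult.assoc)
   have "\<phi> s = grad h ?y \<bullet> v th ?y + grad h ?y \<bullet> (T' s th x - v th ?y)" by (simp add: \<phi>_def inner_diff_right)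
   then have "\<bar>\<phi> s\<bar> <= \<bar>grad h ?y \<bullet> v th ?y\<bar> + \<bar>grad h ?y \<bullet> (T' s th x - v th ?y)\<bar>" by linarith
   also have "\<bar>grad h ?y \<bullet> (T' s th x - v th ?y)\<bar> <= norm (grad h ?y) * (L * r)"
   proof -
    have "norm (T' s th x - v th ?y) <= L * s" using T'_near[OF s' th, of x] by (simp add: v_def)
    also have "... <= L * r" using s const by simp
    finally have "norm (grad h ?y) * norm (T' s th x - v th ?y) <= norm (grad h ?y) * (L * r)" by (rule mult_left_mono) simp
    then show ?thesis using Cauchy_Schwarz_ineq2 order_trans by blast
   qed
   finally have P1: "\<bar>\<phi> s\<bar> <= \<bar>grad h ?y \<bullet> v th ?y\<bar> + L * r * norm (grad h ?y)" by (simp add: mult_ac)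
   show ?thesis unfolding gmaj_def
    by (rule mult_mono[OF A1 P1]) (use A_nonneg KA cT_pos r const in auto)
  qed
  then show "ennreal (indicator {0..r} s * (A x th * \<bar>\<phi> s\<bar>)) <= indicator {0..r} s * ennreal (gmaj (KA * cT) r h th (T s th x))"
   by (cases "s \<in> {0..r}") (auto intro: ennreal_leI)
 qed
 finally show ?thesis .
qed simp

text \<open>For a fixed time and direction the majorant is a function of T s th x, and removing T
  costs the factor 1 + CN r. The time integral over [0, r] cancels the denominator r of the
  quotient.\<close>

lemma loc_le_gmaj:
 assumes h: "Ck_on 1 UNIV h" and KA: "0 <= KA" "!!x y th. \<bar>A x th - A y th\<bar> <= KA * norm (x - y)"
  and r: "0 < r" "r <= rs" "cT * r <= \<delta>"
 shows "loc h r <= ennreal (1 + CN * r) * (NN y. (NN th. ennreal (gmaj (KA * cT) r h th y)))"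
proof -
 define g where "g = gmaj (KA * cT) r h"
 have [measurable]: "h \<in> borel_measurable borel"
  using Ck_on_continuous[OF h] by (rule borel_measurable_continuous_onI)
 have [measurable]: "grad h \<in> borel_measurable borel" using grad(3)[OF h] by (rule borel_measurable_continuous_onI)
 have gm [measurable]: "(%z. g (p z) (q z)) \<in> borel_measurable M"
  if [measurable]: "p \<in> borel_measurable M" "q \<in> borel_measurable M" for p q and M :: "'z measure"
  unfolding g_def gmaj_def by measurable
 define J where "J = (NN th. (NN y. ennreal (g th y)))"
 have "loc h r <= (NN x. (NN th. (NN s. ennreal (1 / r) * (indicator {0..r} s * ennreal (g th (T s th x))))))"
  unfolding loc_def
 proof (rule nn_integral_mono, rule nn_integral_mono_AE, use AE_lborel_singleton[of "0::real^'n"] in eventually_elim)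
  fix x th :: "real^'n" assume "th ~= 0"
  have "ennreal (A x th * \<bar>h (T r th x) - h x\<bar> / r) = ennreal (1 / r) * ennreal (A x th * \<bar>h (T r th x) - h x\<bar>)"
   using r A_nonneg by (simp add: ennreal_mult[symmetric])
  also have "... <= ennreal (1 / r) * (NN s. indicator {0..r} s * ennreal (g th (T s th x)))"
   unfolding g_def by (intro mult_left_mono difference_le_gmaj[OF h KA r \<open>th ~= 0\<close>]) auto
  also have "... = (NN s. ennreal (1 / r) * (indicator {0..r} s * ennreal (g th (T s th x))))"
   by (rule nn_integral_cmult[symmetric]) measurable
  finally show "ennreal (A x th * \<bar>h (T r th x) - h x\<bar> / r) <= ..." .
 qed
 also have "... = (NN x. (NN s. (NN th. ennreal (1 / r) * (indicator {0..r} s * ennreal (g th (T s th x))))))"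
  by (intro nn_integral_cong lborel_pair.Fubini') measurable
 also have "... = (NN s. (NN x. (NN th. ennreal (1 / r) * (indicator {0..r} s * ennreal (g th (T s th x))))))"
  by (rule lborel_pair.Fubini') measurable
 also have "... = (NN s. (NN th. (NN x. ennreal (1 / r) * (indicator {0..r} s * ennreal (g th (T s th x))))))"
  by (intro nn_integral_cong lborel_pair.Fubini') measurable
 also have "... <= (NN s. ennreal (1 / r) * (ennreal (1 + CN * r) * J) * indicator {0..r} s)"
 proof (rule nn_integral_mono)
  fix s :: real
  show "(NN th. (NN x. ennreal (1 / r) * (indicator {0..r} s * ennreal (g th (T s th x)))))
   <= ennreal (1 / r) * (ennreal (1 + CN * r) * J) * indicator {0..r} s"
  proof (cases "s \<in> {0..r}")
   case True
   have "(NN th. (NN x. ennreal (1 / r) * ennreal (g th (T s th x))))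
    <= (NN th. ennreal (1 / r) * (ennreal (1 + CN * r) * (NN y. ennreal (g th y))))"
   proof (rule nn_integral_mono_AE, use AE_lborel_singleton[of "0::real^'n"] in eventually_elim)
    fix th :: "real^'n" assume th: "th ~= 0"
    have "(NN x. ennreal (g th (T s th x))) <= ennreal (1 + CN * s) * (NN y. ennreal (g th y))"
     by (rule T_nn_integral) (use True r th in auto)
    also have "... <= ennreal (1 + CN * r) * (NN y. ennreal (g th y))"
     using True rs(4) by (intro mult_right_mono ennreal_leI) auto
    finally have "ennreal (1 / r) * (NN x. ennreal (g th (T s th x))) <= ennreal (1 / r) * (ennreal (1 + CN * r) * (NN y. ennreal (g th y)))"
     by (rule mult_left_mono) simp
    then show "(NN x. ennreal (1 / r) * ennreal (g th (T s th x))) <= ennreal (1 / r) * (ennreal (1 + CN * r) * (NN y. ennreal (g th y)))"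
     by (subst nn_integral_cmult) measurable
   qed
   also have "... = ennreal (1 / r) * (ennreal (1 + CN * r) * J)"
    unfolding J_def by (simp add: nn_integral_cmult)
   finally show ?thesis using True by simp
  qed simp
 qed
 also have "... = ennreal (1 / r) * (ennreal (1 + CN * r) * J) * ennreal r"
  using r by (subst nn_integral_cmult_indicator) auto
 also have "... = (ennreal (1 / r) * ennreal r) * (ennreal (1 + CN * r) * J)" by (simp add: mult_ac)
 also have "ennreal (1 / r) * ennreal r = 1" using r by (simp add: ennreal_mult[symmetric])
 also have "J = (NN y. (NN th. ennreal (g th y)))"
  unfolding J_def by (rule lborel_pair.Fubini') measurable
 finally show ?thesis by (simp add: g_def)
qed

text \<open>The leading part integrates to kn \<eta> \<rho> times the dual norm of the gradient by
  \<open>w_abs_integral\<close>; the rest is O(r) |grad h| on the larger ball. From |p| <= c0 qn (H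
  y) p and 1 <= B \<rho> the rest is a multiple of the same dual norm, so it appears as an
  enlargement of \<eta> by O(r).\<close>

lemma gmaj_integral:
 assumes h: "Ck_on 1 UNIV h" and K: "0 <= K" and r: "0 < r" "r <= rs"
 shows "(NN th. ennreal (gmaj K r h th y))
  <= ennreal (kn * (\<rho> y * (\<eta> y + (Am * L + K * (c0 + L * rs)) * Vc * c0 * B / kn * r * indicator (cball a (2 * \<delta>)) y)) * qn (H y) (grad h y))"
proof -
 define p where "p = grad h y"
 define M where "M = Am * L + K * (c0 + L * rs)"
 define I where "I = (indicator (cball a (2 * \<delta>)) y :: real)"
 have I01: "0 <= I" "I <= 1" by (auto simp: I_def indicator_def)
 have M0: "0 <= M" using Am_pos const K c_pos rs(1) by (simp add: M_def)
 have qp: "0 <= qn (H y) p" using pdH by simp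
 have ptw: "gmaj K r h th y <= \<eta> y * \<rho> y * (w y th * \<bar>p \<bullet> v th y\<bar>) + M * r * norm p * I * indicator (cball 0 c0) th" for th
 proof -
  let ?t = "indicator (cball 0 c0) th :: real"
  have pv: "\<bar>p \<bullet> v th y\<bar> <= norm p * c0"
   using Cauchy_Schwarz_ineq2[of p "v th y"] mult_left_mono[OF v_bound norm_ge_zero[of p]] order_trans by blast
  have AI: "A y th <= Am * ?t * I"
  proof (cases "A y th = 0")
   case False
   then have "y \<in> cball a (2 * \<delta>)" "th \<in> cball 0 c0" using A_nonzero[of y th] const by auto
   then show ?thesis using A_le_Am[of y th] by (simp add: I_def)
  qed (use Am_pos I01 in auto)
  have "gmaj K r h th y = A y th * \<bar>p \<bullet> v th y\<bar> + A y th * (L * r * norm p) + K * r * ?t * I * (\<bar>p \<bullet> v th y\<bar> + L * r * norm p)"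
   by (simp add: gmaj_def p_def I_def algebra_simps)
  also have "... <= A y th * \<bar>p \<bullet> v th y\<bar> + (Am * ?t * I) * (L * r * norm p) + K * r * ?t * I * (norm p * c0 + L * rs * norm p)"
   using AI pv r const K I01 by (intro add_mono mult_left_mono mult_right_mono) auto
  also have "... = \<eta> y * \<rho> y * (w y th * \<bar>p \<bullet> v th y\<bar>) + M * r * norm p * I * ?t"
   by (simp add: A_def M_def algebra_simps)
  finally show ?thesis .
 qed
 have "(NN th. ennreal (gmaj K r h th y))
  <= (NN th. ennreal (\<eta> y * \<rho> y) * ennreal (w y th * \<bar>p \<bullet> v th y\<bar>) + ennreal (M * r * norm p * I) * indicator (cball 0 c0) th)"
 proof (rule nn_integral_mono)
  fix th
  have "ennreal (gmaj K r h th y) <= ennreal (\<eta> y * \<rho> y * (w y th * \<bar>p \<bullet> v th y\<bar>) + M * r * norm p * I * indicator (cball 0 c0) th)"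
   using ptw by (rule ennreal_leI)
  also have "... = ennreal (\<eta> y * \<rho> y) * ennreal (w y th * \<bar>p \<bullet> v th y\<bar>) + ennreal (M * r * norm p * I) * indicator (cball 0 c0) th"
   using \<eta>(1)[of y] \<rho>(4)[of y] w_nonneg[of y th] M0 r I01
   by (subst ennreal_plus) (auto simp: ennreal_mult indicator_def)
  finally show "ennreal (gmaj K r h th y) <= ..." .
 qed
 also have "... = ennreal (\<eta> y * \<rho> y) * ennreal (kn * qn (H y) p) + ennreal (M * r * norm p * I) * ennreal Vc"
  by (subst nn_integral_add) (auto simp: nn_integral_cmult w_abs_integral Vc(2))
 also have "... = ennreal (\<eta> y * \<rho> y * (kn * qn (H y) p) + M * r * norm p * I * Vc)"
  using \<eta>(1)[of y] \<rho>(4)[of y] kn_pos qp M0 r I01 Vc(1) by (simp add: ennreal_mult ennreal_plus)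
 also have "... <= ennreal (kn * (\<rho> y * (\<eta> y + M * Vc * c0 * B / kn * r * I)) * qn (H y) p)"
 proof (rule ennreal_leI)
  have "norm p <= c0 * qn (H y) p * 1" using qnH(1)[of p y] by simp
  also have "... <= c0 * qn (H y) p * (B * \<rho> y)"
  proof (rule mult_left_mono)
   have "1 / B <= \<rho> y" by (rule \<rho>)
   then show "1 <= B * \<rho> y" using const by (simp add: divide_le_eq mult.commute)
  qed (use c_pos qp in auto)
  finally have "(M * r * I * Vc) * norm p <= (M * r * I * Vc) * (c0 * qn (H y) p * (B * \<rho> y))"
   using M0 r I01 Vc(1) by (intro mult_left_mono) auto
  moreover have "kn * (\<rho> y * (\<eta> y + M * Vc * c0 * B / kn * r * I)) * qn (H y) p
   = \<eta> y * \<rho> y * (kn * qn (H y) p) + (M * r * I * Vc) * (c0 * qn (H y) p * (B * \<rho> y))"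
   using kn_pos by (simp add: field_simps)
  ultimately show "\<eta> y * \<rho> y * (kn * qn (H y) p) + M * r * norm p * I * Vc <= kn * (\<rho> y * (\<eta> y + M * Vc * c0 * B / kn * r * I)) * qn (H y) p"
   by (simp add: mult_ac)
 qed
 finally show ?thesis by (simp add: p_def M_def I_def)
qed

text \<open>A crude L^1 estimate with a constant of order 1/r. It is applied at fixed r, while the
  mollification parameter tends to 0, so the growth in 1/r is harmless.\<close>

lemma loc_perturb:
 assumes f: "integrable lborel f" and h: "integrable lborel h" and r: "0 < r" "r <= rs"
 shows "loc f r <= loc h r + ennreal (Am * Vc * (2 + CN * rs) / r * (LB x. \<bar>f x - h x\<bar>))"
proof -
 define k where "k = (%x. \<bar>f x - h x\<bar>)"
 have k: "integrable lborel k" using f h by (auto simp: k_def)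
 have [measurable]: "f \<in> borel_measurable borel" "h \<in> borel_measurable borel" "k \<in> borel_measurable borel" using f h k by auto
 have k0: "0 <= k x" for x by (simp add: k_def)
 have Ik: "0 <= (LB x. k x)" using k0 by simp
 define E where "E = (%x th. ennreal (Am / r) * indicator (cball 0 c0) th * ennreal (k (T r th x) + k x))"
 have ptw: "ennreal (A x th * \<bar>f (T r th x) - f x\<bar> / r) <= ennreal (A x th * \<bar>h (T r th x) - h x\<bar> / r) + E x th" for x th
 proof -
  have "\<bar>f (T r th x) - f x\<bar> <= \<bar>h (T r th x) - h x\<bar> + (k (T r th x) + k x)" by (simp add: k_def)
  then have "A x th * \<bar>f (T r th x) - f x\<bar> <= A x th * (\<bar>h (T r th x) - h x\<bar> + (k (T r th x) + k x))"
   using A_nonneg by (rule mult_left_mono)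
  also have "... <= A x th * \<bar>h (T r th x) - h x\<bar> + Am * indicator (cball 0 c0) th * (k (T r th x) + k x)"
   using mult_right_mono[OF A_le_Am[of x th] add_nonneg_nonneg[OF k0[of "T r th x"] k0[of x]]] by (simp add: distrib_left)
  finally have "A x th * \<bar>f (T r th x) - f x\<bar> / r <= A x th * \<bar>h (T r th x) - h x\<bar> / r + Am / r * indicator (cball 0 c0) th * (k (T r th x) + k x)"
   using r by (simp add: field_simps)
  then have "ennreal (A x th * \<bar>f (T r th x) - f x\<bar> / r) <= ennreal (A x th * \<bar>h (T r th x) - h x\<bar> / r + Am / r * indicator (cball 0 c0) th * (k (T r th x) + k x))"
   by (rule ennreal_leI)
  also have "... = ennreal (A x th * \<bar>h (T r th x) - h x\<bar> / r) + E x th"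
   unfolding E_def using A_nonneg[of x th] r Am_pos k0
   by (subst ennreal_plus) (auto simp: ennreal_mult[symmetric] ennreal_plus[symmetric] indicator_def simp del: ennreal_plus)
  finally show ?thesis .
 qed
 have "loc f r <= (NN x. (NN th. ennreal (A x th * \<bar>h (T r th x) - h x\<bar> / r) + E x th))"
  unfolding loc_def using ptw by (intro nn_integral_mono)
 also have "... = loc h r + (NN x. (NN th. E x th))"
  unfolding loc_def E_def by (simp add: nn_integral_add)
 also have "(NN x. (NN th. E x th)) = (NN th. (NN x. E x th))"
  unfolding E_def by (rule lborel_pair.Fubini') measurable
 also have "... <= (NN (th::real^'n). ennreal (Am / r * ((2 + CN * rs) * (LB x. k x))) * indicator (cball 0 c0) th)"
 proof (rule nn_integral_mono_AE, use AE_lborel_singleton[of "0::real^'n"] in eventually_elim)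
  fix th :: "real^'n" assume th: "th ~= 0"
  note Tk = T_integral[OF less_imp_le[OF r(1)] r(2) th k]
  have "(NN x. ennreal (k (T r th x) + k x)) = ennreal (LB x. k (T r th x) + k x)"
   using Tk(1) k k0 by (intro nn_integral_eq_integral) (auto intro: add_nonneg_nonneg)
  also have "... <= ennreal ((2 + CN * rs) * (LB x. k x))"
  proof (rule ennreal_leI)
   have "CN * r * (LB x. k x) <= CN * rs * (LB x. k x)" using r rs(4) Ik by (intro mult_right_mono) auto
   then show "(LB x. k (T r th x) + k x) <= (2 + CN * rs) * (LB x. k x)"
    using Tk(1,2) k k0 by (simp add: distrib_right)
  qed
  finally have "ennreal (Am / r) * indicator (cball 0 c0) th * (NN x. ennreal (k (T r th x) + k x))
   <= ennreal (Am / r) * indicator (cball 0 c0) th * ennreal ((2 + CN * rs) * (LB x. k x))" by (rule mult_left_mono) simp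
  also have "... = ennreal (Am / r * ((2 + CN * rs) * (LB x. k x))) * indicator (cball 0 c0) th"
   using Am_pos r rs(1,4) Ik by (subst (2) ennreal_mult) (auto simp: mult_ac)
  finally show "(NN x. E x th) <= ..."
   unfolding E_def by (subst nn_integral_cmult) measurable
 qed
 also have "... = ennreal (Am / r * ((2 + CN * rs) * (LB x. k x))) * ennreal Vc"
  by (subst nn_integral_cmult_indicator) (auto simp: Vc(2))
 also have "... = ennreal (Am * Vc * (2 + CN * rs) / r * (LB x. k x))"
  using Vc(1) Am_pos r rs(1,4) Ik by (subst ennreal_mult[symmetric]) (auto simp: field_simps)
 finally show ?thesis by (simp add: k_def)
qed

text \<open>A bound S for the pairings with admissible fields replaces a local variation, because
  the fields must later be added up over the charts; this is why their norm is measured against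
  \<rho> (\<eta> + K r). At fixed r, f is mollified to h. The weighted integral of the dual norm of
  grad h is a pairing with the field opposite to grad h. That field is only measurable, but shifting
  the mollifier from f to the field makes it smooth and enlarges its norm only slightly.\<close>

theorem loc_upper:
 "\<exists>K>0. \<exists>r1>0. \<forall>r f S. 0 < r --> r < r1 --> integrable lborel f --> 0 <= S -->
  (\<forall>Z. (\<forall>k. Ck_on k UNIV Z) --> (\<forall>y. y \<notin> cball a (3 * \<delta>) --> Z y = 0) -->
    (\<forall>y. qn (G y) (Z y) <= \<rho> y * (\<eta> y + K * r)) --> (LB y. f y * divg Z y) <= S) -->
  loc f r <= ennreal ((1 + K * r) * kn * S)"
proof -
 obtain KA where KA: "0 <= KA" "!!x y th. \<bar>A x th - A y th\<bar> <= KA * norm (x - y)" using A_lip by blast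
 define K1 where "K1 = (Am * L + KA * cT * (c0 + L * rs)) * Vc * c0 * B / kn"
 have K1: "0 <= K1"
  unfolding K1_def using Am_pos const KA cT_pos c_pos rs(1) Vc(1) kn_pos by (intro divide_nonneg_nonneg mult_nonneg_nonneg add_nonneg_nonneg) auto
 define K where "K = CN + K1 + 1"
 \<comment> \<open>r <= 1 keeps K1 r bounded, and cT r <= \<delta> keeps the moved points in the
   ball of radius 2 \<delta>.\<close>
 define r1 where "r1 = min (min rs 1) (\<delta> / cT)"
 have K: "0 < K" using K1 rs(4) by (simp add: K_def)
 have r1: "0 < r1" using rs(1) const cT_pos by (simp add: r1_def)
 show ?thesis
 proof (rule exI[of _ K], rule conjI[OF K], rule exI[of _ r1], rule conjI[OF r1], intro allI impI)
  fix r S :: real and f :: "real^'n => real"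
  assume r: "0 < r" "r < r1" and f: "integrable lborel f" and S: "0 <= S"
   and hyp: "\<forall>Z. (\<forall>k. Ck_on k UNIV Z) --> (\<forall>y. y \<notin> cball a (3 * \<delta>) --> Z y = 0) -->
    (\<forall>y. qn (G y) (Z y) <= \<rho> y * (\<eta> y + K * r)) --> (LB y. f y * divg Z y) <= S"
  have r': "r <= rs" "r <= 1" "cT * r <= \<delta>" using r cT_pos by (auto simp: r1_def field_simps)
  define M where "M = Am * Vc * (2 + CN * rs) / r"
  have M: "0 <= M" using Am_pos Vc(1) rs(1,4) r by (simp add: M_def)
  define I where "I = (%x. indicator (cball a (2 * \<delta>)) x :: real)"
  have I: "0 <= I x" "I x <= 1" for x by (auto simp: I_def indicator_def)
  have Im [measurable]: "I \<in> borel_measurable borel" unfolding I_def by measurable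
  define b where "b = (%x. \<rho> x * (\<eta> x + K1 * r * I x))"
  define bm where "bm = B * (1 + K1)"
  have b0: "0 <= b x" for x unfolding b_def using \<rho>(4)[of x] \<eta>(1)[of x] K1 r I by (intro mult_nonneg_nonneg add_nonneg_nonneg) auto
  have bm: "b x <= bm * I x" for x
  proof (cases "x \<in> cball a (2 * \<delta>)")
   case True
   have "K1 * (r * I x) <= K1 * (1 * 1)" using r r' I K1 by (intro mult_left_mono mult_mono) auto
   then have "\<rho> x * (\<eta> x + K1 * r * I x) <= B * (1 + K1)"
    using \<rho>[of x] \<eta>[of x] K1 r I const by (intro mult_mono add_mono) (auto simp: mult.assoc intro!: add_nonneg_nonneg mult_nonneg_nonneg)
   then show ?thesis using True by (simp add: b_def bm_def I_def)
  next
   case False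
   then have "\<eta> x = 0" using \<eta>(3)[of x] const by auto
   then show ?thesis using False by (simp add: b_def I_def)
  qed
  have bm0: "0 <= bm" using const K1 by (simp add: bm_def)
  \<comment> \<open>K5 s bounds the change of the admissible norm over a distance s: the summands
    come from \<eta> \<rho>, from \<rho> K1 r with r <= 1, and from the metric acting on a field of
    size c0 bm. The final 1 makes it positive.\<close>
  define K5 where "K5 = (L * B + 1 * L) + L * K1 + c1 * (c0 * bm) + 1"
  have K5: "0 < K5" using const K1 c_pos bm0 by (simp add: K5_def add_nonneg_pos)
  show "loc f r <= ennreal ((1 + K * r) * kn * S)"
  proof (rule ennreal_le_epsilon)
   fix e :: real assume e: "0 < e"
   obtain dd where d: "0 < dd" "!!s. 0 < s \<and> s < dd ==> (LB x. \<bar>convolve (mollifier s) f x - f x\<bar>) < e / (M + 1)"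
    using convolve_mollifier_L1[OF f, of "e / (M + 1)"] e M by auto
   \<comment> \<open>s < dd brings h close to f in L^1, s <= \<delta> keeps the mollified field
     within 3 \<delta> of a, and the last entry gives K5 s <= r / B <= \<rho> r, so the enlargement
     fits into K r.\<close>
   define s where "s = min (min (dd / 2) \<delta>) (r / (B * K5))"
   have s: "0 < s" "s < dd" "s <= \<delta>" "K5 * s <= r / B"
   proof -
    show "0 < s" unfolding s_def using d(1) const r K5 by simp
    have "s <= dd / 2" unfolding s_def by (intro min.coboundedI1 order_refl)
    moreover have "s <= \<delta>" by (simp add: s_def)
    ultimately show "s < dd" "s <= \<delta>" using d(1) by auto
    have "s <= r / (B * K5)" by (simp add: s_def)
    then have "K5 * s <= K5 * (r / (B * K5))" using K5 by (intro mult_left_mono) auto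
    then show "K5 * s <= r / B" using K5 by (simp del: divide_le_eq_1_pos)
   qed
   let ?m = "mollifier s :: real^'n => real"
   define h where "h = convolve ?m f"
   have supp: "?m x = 0" if "s < norm x" for x using s that by (intro mollifier_eq_0) auto
   have h: "Ck_on 1 UNIV h" unfolding h_def by (rule Ck_on_convolve[OF Ck_on_mollifier supp f])
   have ih: "integrable lborel h" unfolding h_def by (rule convolve_L1(1)[OF continuous_on_mollifier supp f])
   have gm [measurable]: "grad h \<in> borel_measurable borel" using grad(3)[OF h] by (rule borel_measurable_continuous_onI)
   \<comment> \<open>The field of norm b in the direction of steepest descent for the metric. Where
     the gradient vanishes, the field is 0.\<close>
   define Z where "Z = (%x. - ((b x / qn (H x) (grad h x)) *\<^sub>R (H x *v grad h x)))"
   have Zq: "qn (G x) (Z x) <= b x" for x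
   proof -
    have "qn (G x) (Z x) = qn (G x) ((- (b x / qn (H x) (grad h x))) *\<^sub>R (H x *v grad h x))" by (simp add: Z_def)
    also have "... = b x / qn (H x) (grad h x) * qn (H x) (grad h x)"
     unfolding qn_scale pos_def_matrix_inv(2)[OF pd] using b0[of x] pdH by (simp add: abs_mult)
    also have "... <= b x" using b0[of x] by simp
    finally show ?thesis .
   qed
   have Zn: "norm (Z x) <= c0 * bm * I x" for x
   proof -
    have "norm (Z x) <= c0 * qn (G x) (Z x)" by (rule qnG)
    also have "... <= c0 * (bm * I x)" using Zq[of x] bm[of x] c_pos by (intro mult_left_mono) auto
    finally show ?thesis by (simp add: mult_ac)
   qed
   have [measurable]: "b \<in> borel_measurable borel" unfolding b_def by measurable
   have Hm: "(%x. H x *v grad h x) \<in> borel_measurable borel"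
   proof (rule borel_measurable_continuous_onI)
    have "continuous_on UNIV (%x. (H x *v grad h x) $ i)" for i
     unfolding matrix_vector_mult_def vec_lambda_beta by (intro continuous_intros continuous_G(2) grad(3)[OF h])
    from continuous_on_vec_lambda[of UNIV "%i x. (H x *v grad h x) $ i", OF this]
    show "continuous_on UNIV (%x. H x *v grad h x)" by simp
   qed
   have Zm [measurable]: "Z \<in> borel_measurable borel"
    unfolding Z_def using Hm by measurable
   have iI: "integrable lborel I" unfolding I_def by (rule integrable_indicator_cball)
   have iZ: "integrable lborel Z"
    by (rule integrable_bound[OF integrable_mult_right[OF iI, of "c0 * bm"]])
     (use Zn c_pos bm0 I in "auto simp: abs_mult")
   have gZ: "grad h x \<bullet> Z x = - (b x * qn (H x) (grad h x))" for x
   proof (cases "grad h x = 0")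
    case True then show ?thesis by (simp add: qn_def qform_zero)
   next
    case False
    then have "0 < qn (H x) (grad h x)" using pdH qn_pos_iff by blast
    moreover have "grad h x \<bullet> (H x *v grad h x) = qn (H x) (grad h x) * qn (H x) (grad h x)"
     using qn_power2[OF pdH, of x "grad h x"] by (simp add: qform_def power2_eq_square)
    ultimately show ?thesis by (simp add: Z_def)
   qed
   define Z' where "Z' = convolve ?m Z"
   have LS: "(LB x. b x * qn (H x) (grad h x)) <= S"
   proof -
    have "(LB x. b x * qn (H x) (grad h x)) = - (LB x. Dv h x (Z x))"
     by (simp add: grad(2)[OF h] gZ)
    also have "... = (LB y. f y * divg Z' y)"
     unfolding h_def Z'_def by (subst integral_mollified_derivative[OF s(1) f iZ]) simp
    also have "... <= S"
    proof (rule hyp[rule_format])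
     show "Ck_on k UNIV Z'" for k unfolding Z'_def by (rule Ck_on_convolve[OF Ck_on_mollifier supp iZ])
     show "Z' y = 0" if "y \<notin> cball a (3 * \<delta>)" for y
      unfolding Z'_def
     proof (rule convolve_mollifier_eq_0[OF s(1), of "cball a (2 * \<delta>)"])
      show "Z x = 0" if "x \<notin> cball a (2 * \<delta>)" for x using Zn[of x] that by (simp add: I_def)
      show "s <= dist y x" if "x \<in> cball a (2 * \<delta>)" for x
       using dist_triangle[of a y x] that \<open>y \<notin> cball a (3 * \<delta>)\<close> s(3) by (auto simp: dist_commute)
     qed
     show "qn (G y) (Z' y) <= \<rho> y * (\<eta> y + K * r)" for y
      unfolding Z'_def convolve_def
     proof (rule qn_integral_le[OF pd])
      show "integrable lborel (%x. ?m (y - x) *\<^sub>R Z x)" by (rule integrable_kernel[OF continuous_on_mollifier supp iZ])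
      show "integrable lborel (%x. ?m (y - x))" "(LB x. ?m (y - x)) = 1" using integral_mollifier_shift[OF s(1)] by auto
      show "0 <= ?m (y - x)" for x by (rule mollifier_nonneg[OF s(1)])
      fix x assume "?m (y - x) ~= 0"
      then have "norm (y - x) < s" using mollifier_eq_0[OF s(1), of "y - x"] by (meson not_le)
      then have yx: "norm (y - x) <= s" by simp
      have "qn (G y) (Z x) <= qn (G x) (Z x) + c1 * norm (y - x) * norm (Z x)" using qnG(3)[of y "Z x" x] by linarith
      also have "... <= b x + c1 * s * (c0 * bm)"
      proof (intro add_mono mult_mono Zq)
       show "norm (Z x) <= c0 * bm"
       proof -
        have "norm (Z x) <= c0 * bm * I x" by (rule Zn)
        also have "... <= c0 * bm * 1" using I[of x] c_pos bm0 by (intro mult_left_mono) auto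
        finally show ?thesis by simp
       qed
      qed (use c_pos s yx in auto)
      also have "b x <= \<eta> x * \<rho> x + \<rho> x * (K1 * r)"
      proof -
       have "K1 * r * I x <= K1 * r * 1" using I K1 r by (intro mult_left_mono) auto
       then have "\<rho> x * (K1 * r * I x) <= \<rho> x * (K1 * r)" using \<rho>(4)[of x] by simp
       then show ?thesis by (simp add: b_def algebra_simps)
      qed
      also have "\<eta> x * \<rho> x <= \<eta> y * \<rho> y + (L * B + 1 * L) * s"
      proof -
       have "\<eta> x * \<rho> x <= \<eta> y * \<rho> y + (L * B + 1 * L) * norm (y - x)" using \<eta>\<rho>_lip[of x y] by (simp add: norm_minus_commute)
       also have "(L * B + 1 * L) * norm (y - x) <= (L * B + 1 * L) * s" using yx const by (intro mult_left_mono) auto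
       finally show ?thesis by simp
      qed
      also have "\<rho> x * (K1 * r) <= \<rho> y * (K1 * r) + L * K1 * s"
      proof -
       have "\<rho> x <= \<rho> y + L * s"
       proof -
        have "L * norm (x - y) <= L * s" using yx const by (intro mult_left_mono) (auto simp: norm_minus_commute)
        then show ?thesis using \<rho>(3)[of x y] by linarith
       qed
       then have "\<rho> x * (K1 * r) <= (\<rho> y + L * s) * (K1 * r)" using K1 r by (intro mult_right_mono) auto
       also have "... = \<rho> y * (K1 * r) + (L * s * K1) * r" by (simp add: algebra_simps)
       also have "(L * s * K1) * r <= (L * s * K1) * 1" using const s K1 r' by (intro mult_left_mono) auto
       finally show ?thesis by (simp add: mult_ac)
      qed
      finally have "qn (G y) (Z x) <= \<eta> y * \<rho> y + \<rho> y * (K1 * r) + K5 * s"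
       using s(1) by (simp add: K5_def algebra_simps)
      also have "K5 * s <= r / B" by (rule s)
      also have "r / B <= \<rho> y * r" using \<rho>(1)[of y] r mult_right_mono[of "1/B" "\<rho> y" r] by simp
      finally have "qn (G y) (Z x) <= \<rho> y * (\<eta> y + (K1 + 1) * r)" by (simp add: algebra_simps)
      also have "... <= \<rho> y * (\<eta> y + K * r)" using \<rho>(4)[of y] rs(4) r by (simp add: K_def)
      finally show "qn (G y) (Z x) <= \<rho> y * (\<eta> y + K * r)" .
     qed
    qed
    finally show ?thesis .
   qed
   have int: "integrable lborel (%x. b x * qn (H x) (grad h x))"
   proof -
    have "integrable lborel (%x. norm (grad h x) * (c0 * bm * I x))"
    proof -
     obtain gb where gb: "!!x. x \<in> cball a (2 * \<delta>) ==> norm (grad h x) <= gb"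
      using compact_imp_bounded[OF compact_continuous_image[OF grad(3)[OF h] compact_cball]] unfolding bounded_iff by blast
     have gbI: "norm (grad h x) * I x <= \<bar>gb\<bar> * I x" for x
      using gb[of x] by (auto simp: I_def indicator_def)
     show ?thesis
     proof (rule integrable_bound[OF integrable_mult_right[OF iI, of "c0 * bm * \<bar>gb\<bar>"]])
      show "AE x in lborel. norm (norm (grad h x) * (c0 * bm * I x)) <= norm (c0 * bm * \<bar>gb\<bar> * I x)"
       using mult_left_mono[OF gbI, of "c0 * bm"] c_pos bm0 I by (auto simp: abs_mult mult_ac)
     qed measurable
    qed
    then show ?thesis
    proof (rule integrable_bound)
     show "AE x in lborel. norm (b x * qn (H x) (grad h x)) <= norm (norm (grad h x) * (c0 * bm * I x))"
     proof (rule AE_I2)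
      fix x
      have "b x * qn (H x) (grad h x) <= (bm * I x) * (c0 * norm (grad h x))"
       using b0[of x] bm[of x] qnH(2)[of x "grad h x"] pdH bm0 I by (intro mult_mono) auto
      then show "norm (b x * qn (H x) (grad h x)) <= norm (norm (grad h x) * (c0 * bm * I x))"
       using b0[of x] pdH c_pos bm0 I by (simp add: abs_mult mult_ac)
     qed
    qed measurable
   qed
   have "loc h r <= ennreal (1 + CN * r) * (NN y. (NN th. ennreal (gmaj (KA * cT) r h th y)))"
    by (rule loc_le_gmaj[OF h KA r(1) r'(1,3)])
   also have "... <= ennreal (1 + CN * r) * (NN y. ennreal (kn * (b y * qn (H y) (grad h y))))"
   proof (intro mult_left_mono nn_integral_mono)
    fix y
    have "(NN th. ennreal (gmaj (KA * cT) r h th y)) <= ennreal (kn * (\<rho> y * (\<eta> y + K1 * r * indicator (cball a (2 * \<delta>)) y)) * qn (H y) (grad h y))"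
     unfolding K1_def by (rule gmaj_integral[OF h _ r(1) r'(1)]) (use KA cT_pos in auto)
    then show "(NN th. ennreal (gmaj (KA * cT) r h th y)) <= ennreal (kn * (b y * qn (H y) (grad h y)))"
     by (simp add: b_def I_def mult.assoc)
   qed simp
   also have "(NN y. ennreal (kn * (b y * qn (H y) (grad h y)))) = ennreal (kn * (LB y. b y * qn (H y) (grad h y)))"
    using int b0 pdH kn_pos by (subst nn_integral_eq_integral) auto
   also have "ennreal (1 + CN * r) * ... <= ennreal (1 + CN * r) * ennreal (kn * S)"
    using LS kn_pos by (intro mult_left_mono ennreal_leI) auto
   also have "... <= ennreal ((1 + K * r) * kn * S)"
   proof -
    have "(1 + CN * r) * (kn * S) <= (1 + K * r) * (kn * S)"
     using K1 r kn_pos S by (intro mult_right_mono) (auto simp: K_def algebra_simps)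
    then show ?thesis using rs(4) r kn_pos S unfolding mult.assoc
     by (subst ennreal_mult[symmetric]) (auto intro: ennreal_leI)
   qed
   finally have lh: "loc h r <= ennreal ((1 + K * r) * kn * S)" .
   have "(LB x. \<bar>f x - h x\<bar>) < e / (M + 1)"
    using d(2)[of s] s unfolding h_def by (simp add: abs_minus_commute)
   then have "M * (LB x. \<bar>f x - h x\<bar>) <= M * (e / (M + 1))" using M by (intro mult_left_mono) auto
   also have "... <= e" using M e by (simp add: field_simps)
   finally have "M * (LB x. \<bar>f x - h x\<bar>) <= e" .
   then have "ennreal (M * (LB x. \<bar>f x - h x\<bar>)) <= ennreal e" by (rule ennreal_leI)
   with loc_perturb[OF f ih r(1) r'(1)] lh show "loc f r <= ennreal ((1 + K * r) * kn * S) + ennreal e"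
    unfolding M_def by (meson add_mono order_trans)
  qed
 qed
qed

end

section \<open>The lower bound in a chart\<close>

lemma Ck_on_grad: "(!!k. Ck_on k UNIV h) ==> Ck_on k UNIV (grad h)"
 unfolding grad_def by (intro Ck_on_sum Ck_on_scaleR Ck_on_SucD(2) Ck_on_const) auto

lemma qn_triangle:
 fixes M :: "real^'m^'m"
 assumes "pos_def M"
 shows "qn M q <= qn M p + qn M (q - p)"
proof -
 obtain E :: "real^'m^'m" where E: "invertible E" "!!w. qn M (E *v w) = norm w" using pos_def_frame[OF assms] by metis
 have q: "qn M u = norm (matrix_inv E *v u)" for u
  using E(2)[of "matrix_inv E *v u"] by (simp add: matrix_vector_mul_assoc matrix_inv_cancel[OF E(1)])
 show ?thesis unfolding q matrix_vector_mult_diff_distrib by (rule norm_triangle_sub)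
qed

text \<open>The mollifier is even, so mollification reproduces linear functions exactly. Thanks to
  this the mollified sign still has the exact mean.\<close>

lemma mollifier_mean:
 fixes u p :: "real^'n"
 assumes s: "0 < s"
 shows "(LB q. mollifier s (q - p) * (q \<bullet> u)) = p \<bullet> u"
proof -
 let ?\<kappa> = "mollifier s :: real^'n => real"
 have c: "continuous_on UNIV (%z::real^'n. ?\<kappa> z * (z \<bullet> u))" by (intro continuous_intros continuous_on_mollifier)
 have i: "integrable lborel (%z. ?\<kappa> z * (z \<bullet> u))"
  by (rule integrable_continuous_bounded_support[OF c, of s]) (simp add: mollifier_eq_0[OF s])
 have "(LB z. ?\<kappa> z * (z \<bullet> u)) = (LB z. ?\<kappa> (- z) * (- z \<bullet> u))"
  by (rule integral_lborel_reflect[OF borel_measurable_continuous_onI[OF c], symmetric])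
 then have 0: "(LB z. ?\<kappa> z * (z \<bullet> u)) = 0" by (simp add: mollifier_uminus)
 have i': "integrable lborel (%z. ?\<kappa> z * ((z + p) \<bullet> u))"
  unfolding inner_add_left distrib_left by (intro integrable_add i integrable_mult_left integrable_mollifier[OF s])
 have "(LB q. ?\<kappa> (q - p) * (q \<bullet> u)) = (LB z. ?\<kappa> z * ((z + p) \<bullet> u))"
  using integral_lborel_translate(2)[OF i', of "- p"] by simp
 also have "... = (LB z. ?\<kappa> z * (z \<bullet> u)) + (LB z. ?\<kappa> z * (p \<bullet> u))"
  unfolding inner_add_left distrib_left by (intro integral_add i integrable_mult_left integrable_mollifier[OF s])
 also have "... = p \<bullet> u" using integral_mollifier[OF s, where 'a="real^'n"] by (simp add: 0)
 finally show ?thesis .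
qed

context local_geometry
begin

text \<open>The integral splits into the change of the integral of \<psi> k under T and the integral
  of (\<psi> - \<psi> o T) times k o T. The first is O(r) by the small volume distortion, the second
  because \<psi> is Lipschitz and T moves points by O(r). In contrast to \<open>loc_perturb\<close>
  no factor 1/r survives after division by r, so f can be replaced by a fixed smooth function for
  all small r at once.\<close>

lemma transport_difference:
 assumes \<psi>: "!!x. \<bar>\<psi> x\<bar> <= M" "!!x y. \<bar>\<psi> x - \<psi> y\<bar> <= K * norm (x - y)" "0 <= K"
  and k: "integrable lborel k" and r: "0 <= r" "r <= rs" and th: "th ~= 0"
 shows "integrable lborel (%x. \<psi> x * (k (T r th x) - k x))"
  and "\<bar>LB x. \<psi> x * (k (T r th x) - k x)\<bar> <= (CN * M + K * cT * (1 + CN * rs)) * r * (LB x. \<bar>k x\<bar>)"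
proof -
 have [measurable]: "\<psi> \<in> borel_measurable borel"
  by (rule borel_measurable_continuous_onI[OF lipschitz_continuous[OF \<psi>(2)]])
 have [measurable]: "k \<in> borel_measurable borel" using k by auto
 have M: "0 <= M" using order_trans[OF abs_ge_zero \<psi>(1)] .
 have bd: "integrable lborel (%x. \<psi> x * q x)" if q: "integrable lborel q" for q
 proof (rule integrable_bound[OF integrable_mult_right[OF q, of M]])
  have "\<bar>\<psi> x\<bar> * \<bar>q x\<bar> <= M * \<bar>q x\<bar>" for x by (rule mult_right_mono[OF \<psi>(1)]) simp
  then show "AE x in lborel. norm (\<psi> x * q x) <= norm (M * q x)" using M by (simp add: abs_mult)
  have [measurable]: "q \<in> borel_measurable borel" using q by auto
  show "(%x. \<psi> x * q x) \<in> borel_measurable lborel" by measurable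
 qed
 note Tk = T_integral[OF r th]
 have i1: "integrable lborel (%x. \<psi> x * k x)" "integrable lborel (%x. \<psi> x * k (T r th x))"
  by (rule bd[OF k], rule bd[OF Tk(1)[OF k]])
 then show "integrable lborel (%x. \<psi> x * (k (T r th x) - k x))" by (simp add: right_diff_distrib)
 note i2 = Tk(1)[OF i1(1)]
 have "(LB x. \<psi> x * (k (T r th x) - k x))
  = ((LB x. \<psi> (T r th x) * k (T r th x)) - (LB x. \<psi> x * k x)) + (LB x. (\<psi> x - \<psi> (T r th x)) * k (T r th x))"
  using i1 i2 by (simp add: right_diff_distrib left_diff_distrib)
 also have "\<bar>...\<bar> <= CN * r * (M * (LB x. \<bar>k x\<bar>)) + K * cT * r * ((1 + CN * rs) * (LB x. \<bar>k x\<bar>))"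
 proof (rule order_trans[OF abs_triangle_ineq], rule add_mono)
  have "(LB x. \<bar>\<psi> x * k x\<bar>) <= (LB x. M * \<bar>k x\<bar>)"

  proof (rule integral_mono)
   show "\<bar>\<psi> x * k x\<bar> <= M * \<bar>k x\<bar>" for x unfolding abs_mult by (rule mult_right_mono[OF \<psi>(1)]) simp
  qed (use i1 k in auto)
  then have "(LB x. \<bar>\<psi> x * k x\<bar>) <= M * (LB x. \<bar>k x\<bar>)" by simp
  then have "CN * r * (LB x. \<bar>\<psi> x * k x\<bar>) <= CN * r * (M * (LB x. \<bar>k x\<bar>))"
   using rs(4) r by (intro mult_left_mono) auto
  then show "\<bar>(LB x. \<psi> (T r th x) * k (T r th x)) - (LB x. \<psi> x * k x)\<bar> <= CN * r * (M * (LB x. \<bar>k x\<bar>))"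
   using Tk(3)[OF i1(1)] by linarith
  have "\<bar>LB x. (\<psi> x - \<psi> (T r th x)) * k (T r th x)\<bar> <= (LB x. K * cT * r * \<bar>k (T r th x)\<bar>)"
  proof (rule order_trans[OF integral_abs_bound], rule integral_mono)
   fix x
   have "\<bar>\<psi> x - \<psi> (T r th x)\<bar> <= K * norm (T r th x - x)" using \<psi>(2)[of x "T r th x"] by (simp add: norm_minus_commute)
   also have "... <= K * (cT * r)" using T_move[of r th x] r rs(2) th \<psi>(3) by (intro mult_left_mono) auto
   finally show "\<bar>(\<psi> x - \<psi> (T r th x)) * k (T r th x)\<bar> <= K * cT * r * \<bar>k (T r th x)\<bar>"
    using mult_right_mono[of "\<bar>\<psi> x - \<psi> (T r th x)\<bar>" "K * (cT * r)" "\<bar>k (T r th x)\<bar>"] by (simp add: abs_mult mult.assoc)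
  qed (use i1 i2 Tk(1)[OF k] in "auto simp: left_diff_distrib")
  also have "... = K * cT * r * (LB x. \<bar>k (T r th x)\<bar>)" by simp
  also have "... <= K * cT * r * ((1 + CN * rs) * (LB x. \<bar>k x\<bar>))"
  proof (rule mult_left_mono)
   have "(1 + CN * r) * (LB x. \<bar>k x\<bar>) <= (1 + CN * rs) * (LB x. \<bar>k x\<bar>)"
    using r rs(4) by (intro mult_right_mono) auto
   then show "(LB x. \<bar>k (T r th x)\<bar>) <= (1 + CN * rs) * (LB x. \<bar>k x\<bar>)"
    using Tk(2)[OF k] by linarith
  qed (use \<psi>(3) cT_pos r in auto)
  finally show "\<bar>LB x. (\<psi> x - \<psi> (T r th x)) * k (T r th x)\<bar> <= K * cT * r * ((1 + CN * rs) * (LB x. \<bar>k x\<bar>))" .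
 qed
 finally show "\<bar>LB x. \<psi> x * (k (T r th x) - k x)\<bar> <= (CN * M + K * cT * (1 + CN * rs)) * r * (LB x. \<bar>k x\<bar>)"
  by (simp add: algebra_simps)
qed

text \<open>The derivative of the remainder along the curve is O(s), since the gradient and the unit
  field v th are Lipschitz and the velocity stays within O(s) of v th.\<close>

lemma first_order_expansion:
 assumes h: "!!k. Ck_on k UNIV h"
 shows "\<exists>K\<ge>0. \<forall>r th x. 0 <= r --> r <= r0 --> cT * r <= \<delta> --> th ~= 0 --> x \<in> cball a \<delta> -->
  \<bar>h (T r th x) - h x - r * (grad h x \<bullet> v th x)\<bar> <= K * r * r"
proof -
 obtain K1 where K1: "0 < K1" "!!x. x \<in> cball a (2 * \<delta>) ==> norm (grad h x) <= K1"
  "!!x y. x \<in> cball a (2 * \<delta>) ==> y \<in> cball a (2 * \<delta>) ==> norm (grad h x - grad h y) <= K1 * norm (x - y)"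
  using Ck1_bounded_lipschitz[OF Ck_on_grad[OF h] compact_cball convex_cball subset_UNIV] by metis
 define K where "K = K1 * cT * cT + K1 * (L + c0 * c0 * c1 * cT)"
 have "0 <= K" using K1(1) cT_pos c_pos const by (simp add: K_def)
 moreover have "\<bar>h (T r th x) - h x - r * (grad h x \<bullet> v th x)\<bar> <= K * r * r"
  if r: "0 <= r" "r <= r0" "cT * r <= \<delta>" and th: "th ~= 0" and x: "x \<in> cball a \<delta>" for r th x
 proof -
  let ?\<phi> = "%s. h (T s th x) - s * (grad h x \<bullet> v th x)"
  have "norm (?\<phi> r - ?\<phi> 0) <= K * r * norm (r - 0)"
  proof (rule differentiable_bound[where S="{0..r}"])
   fix s assume s: "s \<in> {0..r}"
   let ?y = "T s th x" and ?D = "grad h (T s th x) \<bullet> T' s th x - grad h x \<bullet> v th x"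
   have s': "0 <= s" "s <= r0" using s r by auto
   show "(?\<phi> has_derivative (%t. t * ?D)) (at s within {0..r})"
   proof -
    have "((%s. h (T s th x)) has_real_derivative (grad h (T s th x) \<bullet> T' s th x)) (at s within {0..r})"
     using curve_derivative[OF _ r(2) s, of h th x] h by (simp add: has_real_derivative_iff_has_vector_derivative)
    then have "(?\<phi> has_real_derivative ?D) (at s within {0..r})"
     by (auto intro!: derivative_eq_intros)
    then show ?thesis by (simp add: has_field_derivative_def mult_commute_abs)
   qed
   have mv: "norm (?y - x) <= cT * s" using T_move[OF s' th] .
   also have ms: "cT * s <= cT * r" using s cT_pos by simp
   finally have "norm (?y - x) <= \<delta>" using r by simp
   then have y: "?y \<in> cball a (2 * \<delta>)" "x \<in> cball a (2 * \<delta>)"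
    using x const dist_triangle[of a ?y x] by (auto simp: dist_norm norm_minus_commute)
   have "norm (T' s th x - v th x) <= norm (T' s th x - v th ?y) + norm (v th ?y - v th x)"
    using norm_triangle_ineq[of "T' s th x - v th ?y" "v th ?y - v th x"] by simp
   also have "... <= L * s + c0 * c0 * c1 * (cT * s)"
    using T'_near[OF s' th, of x] order_trans[OF v_lip[of th ?y x] mult_left_mono[OF mv, of "c0 * c0 * c1"]] c_pos
    by (intro add_mono) (auto simp: v_def)
   finally have tv: "norm (T' s th x - v th x) <= (L + c0 * c0 * c1 * cT) * s" by (simp add: algebra_simps)
   have "?D = (grad h ?y - grad h x) \<bullet> T' s th x + grad h x \<bullet> (T' s th x - v th x)" by (simp add: algebra_simps)
   then have "\<bar>?D\<bar> <= norm (grad h ?y - grad h x) * norm (T' s th x) + norm (grad h x) * norm (T' s th x - v th x)"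
    using Cauchy_Schwarz_ineq2[of "grad h ?y - grad h x" "T' s th x"] Cauchy_Schwarz_ineq2[of "grad h x" "T' s th x - v th x"] by linarith
   also have "... <= (K1 * (cT * s)) * cT + K1 * ((L + c0 * c0 * c1 * cT) * s)"
    using order_trans[OF K1(3)[OF y] mult_left_mono[OF mv less_imp_le[OF K1(1)]]] T'_bound[OF s' th] K1(2)[OF y(2)] tv K1(1) cT_pos s
    by (intro add_mono mult_mono) auto
   also have "... = K * s" by (simp add: K_def algebra_simps)
   also have "... <= K * r" using s \<open>0 <= K\<close> by (intro mult_left_mono) auto
   finally show "onorm (%t. t * ?D) <= K * r"
    by (intro onorm_le) (simp add: abs_mult mult.commute mult_left_mono)
  qed (use r in auto)
  then show ?thesis using r by (simp add: T0 algebra_simps)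
 qed
 ultimately show ?thesis by blast
qed

text \<open>A smooth h close to f in L^1 is fixed in terms of e. Its difference quotients paired
  with \<psi> = A m converge to an integral that the mean condition on m and integration by parts
  evaluate exactly. Passing from h to f costs O(|h - f|) in L^1 uniformly in r by
  \<open>transport_difference\<close>, and the pairing for f is at most (1 + e) times the local
  quotient.\<close>

lemma loc_lower_test:
 assumes mm: "(%z. m (fst z) (snd z)) \<in> borel_measurable (borel \<Otimes>\<^sub>M borel)"
  and mb: "!!x th. \<bar>m x th\<bar> <= Mm" "!!x th. \<eta> x ~= 0 ==> \<bar>m x th\<bar> <= 1 + e"
  and ml: "!!x y th. \<bar>m x th - m y th\<bar> <= Km * norm (x - y)" "0 <= Km"
  and mw: "!!x p. (LB th. w x th * (m x th * (p \<bullet> v th x))) = kn * (p \<bullet> Q x)"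
  and Y: "Ck_on 1 UNIV (%x. (\<eta> x * \<rho> x) *\<^sub>R Q x)" (is "Ck_on 1 UNIV ?Y")
  and f: "integrable lborel f" and e: "0 < e"
 shows "\<exists>r1>0. \<forall>r. 0 < r --> r < r1 -->
  ennreal (kn * (LB x. f x * divg ?Y x) - e) <= ennreal (1 + e) * loc f r"
proof -
 define \<psi> where "\<psi> = (%x th. A x th * m x th)"
 obtain KA where KA: "0 <= KA" "!!x y th. \<bar>A x th - A y th\<bar> <= KA * norm (x - y)" using A_lip by blast
 have Mm: "0 <= Mm" using order_trans[OF abs_ge_zero mb(1)] .
 have A_abs: "\<bar>A x th\<bar> <= Am" for x th using A_le_Am[of x th] A_nonneg[of x th] Am_pos by (cases "th \<in> cball 0 c0") (simp_all add: abs_le_iff)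
 define K\<psi> where "K\<psi> = KA * Mm + Am * Km"
 have K\<psi>: "\<bar>\<psi> x th - \<psi> y th\<bar> <= K\<psi> * norm (x - y)" "0 <= K\<psi>" for x y th
  unfolding \<psi>_def K\<psi>_def using KA Mm Am_pos ml(2) by (auto intro!: bounded_lipschitz_mult[OF A_abs mb(1) KA(2) ml(1)])
 define M where "M = Am * Mm"
 have M0: "0 <= M" using Am_pos Mm by (simp add: M_def)
 have \<psi>b: "\<bar>\<psi> x th\<bar> <= M" for x th unfolding \<psi>_def M_def abs_mult using A_abs mb(1) Am_pos by (intro mult_mono) auto
 have \<psi>s: "\<bar>\<psi> x th\<bar> <= M * (indicator (cball a \<delta>) x * indicator (cball 0 c0) th)" for x th
  using \<psi>b[of x th] A_nonzero[of x th] M0 by (cases "A x th = 0") (auto simp: \<psi>_def)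
 have [measurable]: "(%z. m (p z) (q z)) \<in> borel_measurable N"
  if "p \<in> borel_measurable N" "q \<in> borel_measurable N" for p q and N :: "'z measure"
  using measurable_compose[OF measurable_Pair[OF that] mm] by simp
 have [measurable]: "(%z. \<psi> (p z) (q z)) \<in> borel_measurable N"
  if [measurable]: "p \<in> borel_measurable N" "q \<in> borel_measurable N" for p q and N :: "'z measure"
  unfolding \<psi>_def by measurable
 have [measurable]: "f \<in> borel_measurable borel" using f by auto
 define Va where "Va = (LB x. indicator (cball a \<delta>) x :: real)"
 have Va: "integrable lborel (indicator (cball a \<delta>) :: _ => real)" by (rule integrable_indicator_cball)
 have Va0: "0 <= Va" unfolding Va_def by (rule integral_nonneg) simp
 have Ysupp: "?Y x = 0" if "norm a + \<delta> < norm x" for x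
 proof -
  have "x \<notin> cball a \<delta>" using that norm_triangle_sub[of x a] by (auto simp: dist_norm norm_minus_commute)
  then show ?thesis using \<eta>(3)[of x] by auto
 qed
 have dY: "continuous_on UNIV (divg ?Y)" by (rule continuous_on_divg[OF Y])
 have dYs: "divg ?Y x = 0" if "norm a + \<delta> < norm x" for x
  by (rule divg_eq_0[of "{x. norm a + \<delta> < norm x}"]) (use that Ysupp in "auto intro!: open_Collect_less continuous_intros")
 obtain D where D: "0 < D" "!!x. norm (divg ?Y x) <= D" using bounded_continuous_support[OF dY dYs] by blast
 have [measurable]: "divg ?Y \<in> borel_measurable borel" by (rule borel_measurable_continuous_onI[OF dY])
 define K2 where "K2 = CN * M + K\<psi> * cT * (1 + CN * rs)"
 have K2: "0 <= K2" using rs(1,4) M0 K\<psi>(2) cT_pos by (simp add: K2_def)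
 \<comment> \<open>C collects the factors of the L^1 distance of h and f: K2 Vc from the quotients,
   integrated over th, and kn D from the pairing with the divergence. So e' = e / (2 C) spends half
   of e.\<close>
 define C where "C = K2 * Vc + kn * D + 1"
 have C: "0 < C" using K2 Vc(1) kn_pos D(1) by (simp add: C_def add_nonneg_pos)
 define e' where "e' = e / (2 * C)"
 have e': "0 < e'" using e C by (simp add: e'_def)
 obtain dd where dd: "0 < dd" "!!s. 0 < s \<and> s < dd ==> (LB x. \<bar>convolve (mollifier s) f x - f x\<bar>) < e'"
  using convolve_mollifier_L1[OF f e'] by blast
 define h where "h = convolve (mollifier (dd / 2)) f"
 have supp: "mollifier (dd / 2) x = 0" if "dd / 2 < norm x" for x :: "real^'n" using dd(1) that by (intro mollifier_eq_0) auto
 have h: "Ck_on k UNIV h" for k unfolding h_def by (rule Ck_on_convolve[OF Ck_on_mollifier supp f])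
 have ih: "integrable lborel h" unfolding h_def by (rule convolve_L1(1)[OF continuous_on_mollifier supp f, of "dd / 2"])
 have hf: "(LB x. \<bar>h x - f x\<bar>) <= e'" using dd(2)[of "dd / 2"] dd(1) by (simp add: h_def)
 have [measurable]: "h \<in> borel_measurable borel" using ih by auto
 have gm [measurable]: "grad h \<in> borel_measurable borel" using grad(3)[OF h] by (rule borel_measurable_continuous_onI)
 obtain K3 where K3: "0 <= K3" "!!r th x. 0 <= r ==> r <= r0 ==> cT * r <= \<delta> ==> th ~= 0 ==> x \<in> cball a \<delta> ==>
   \<bar>h (T r th x) - h x - r * (grad h x \<bullet> v th x)\<bar> <= K3 * r * r"
  using first_order_expansion[OF h] by blast
 obtain gb where gb: "!!x. x \<in> cball a \<delta> ==> norm (grad h x) <= gb"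
  using compact_imp_bounded[OF compact_continuous_image[OF grad(3)[OF h] compact_cball]] unfolding bounded_iff by blast
 define F where "F = (%x th. \<psi> x th * (grad h x \<bullet> v th x))"
 have Fb: "\<bar>F x th\<bar> <= M * (gb * c0) * (indicator (cball a \<delta>) x * indicator (cball 0 c0) th)" for x th
 proof (cases "x \<in> cball a \<delta>")
  case True
  have "\<bar>grad h x \<bullet> v th x\<bar> <= norm (grad h x) * norm (v th x)" by (rule Cauchy_Schwarz_ineq2)
  also have "... <= gb * c0" using gb[OF True] v_bound order_trans[OF norm_ge_zero gb[OF True]] by (intro mult_mono) auto
  finally have "\<bar>\<psi> x th\<bar> * \<bar>grad h x \<bullet> v th x\<bar> <= (M * (indicator (cball a \<delta>) x * indicator (cball 0 c0) th)) * (gb * c0)"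
   using M0 by (intro mult_mono \<psi>s) auto
  then show ?thesis by (simp add: F_def abs_mult mult_ac)
 next
  case False
  then show ?thesis using \<psi>s[of x th] by (simp add: F_def)
 qed
 have iprod: "integrable (lborel \<Otimes>\<^sub>M lborel) (%(x, th). F x th)"
 proof (rule integrable_bound)
  have "integrable lborel (indicator (cball a \<delta> \<times> cball (0::real^'n) c0) :: _ => real)"
   by (intro integrable_real_indicator emeasure_bounded_finite bounded_Times) (auto intro!: borel_closed closed_Times)
  then show "integrable (lborel \<Otimes>\<^sub>M lborel) (%z. M * (gb * c0) * indicator (cball a \<delta> \<times> cball (0::real^'n) c0) z)"
   unfolding lborel_prod by (rule integrable_mult_right)
  show "AE z in lborel \<Otimes>\<^sub>M lborel. norm (case z of (x, th) => F x th) <= norm (M * (gb * c0) * indicator (cball a \<delta> \<times> cball (0::real^'n) c0) z)"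
   using order_trans[OF Fb abs_ge_self] by (auto simp: indicator_times)
 qed (unfold F_def, measurable)
 define g where "g = (%th. LB x. F x th)"
 \<comment> \<open>Integration over th replaces the direction by kn times Q, and integration by
   parts moves the derivative to the field.\<close>
 have g_int: "(LB th. g th) = - (kn * (LB x. h x * divg ?Y x))"
 proof -
  have "(LB th. g th) = (LB x. (LB th. F x th))"
   unfolding g_def by (rule lborel_pair.Fubini_integral[OF iprod])
  also have "... = (LB x. kn * Dv h x (?Y x))"
  proof (rule integral_cong[OF refl])
   fix x
   have "(LB th. F x th) = (LB th. \<eta> x * \<rho> x * (w x th * (m x th * (grad h x \<bullet> v th x))))"
    by (simp add: F_def \<psi>_def A_def mult_ac)
   also have "... = \<eta> x * \<rho> x * (kn * (grad h x \<bullet> Q x))" by (simp add: mw)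
   finally show "(LB th. F x th) = kn * Dv h x (?Y x)"
    by (simp add: grad(2)[OF h])
  qed
  also have "... = - (kn * (LB x. h x * divg ?Y x))"
   using integral_by_parts[OF h Y Ysupp] by simp
  finally show ?thesis .
 qed
 define K4 where "K4 = K3 * M * Va"
 have K4: "0 <= K4" using K3 M0 Va0 by (simp add: K4_def)
 \<comment> \<open>The last entry makes the error of the first order expansion, summed over th, at
   most the other half of e.\<close>
 define r1 where "r1 = min (min rs (\<delta> / cT)) (e / (2 * (K4 * Vc + 1)))"
 have K4V: "0 < K4 * Vc + 1" using K4 Vc(1) by (simp add: add_nonneg_pos)
 have "0 < r1" using rs(1) const cT_pos e K4V by (simp add: r1_def)
 moreover have "ennreal (kn * (LB x. f x * divg ?Y x) - e) <= ennreal (1 + e) * loc f r" if r: "0 < r" "r < r1" for r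
 proof -
  have r': "r <= rs" "cT * r <= \<delta>" "r <= r0" using r cT_pos rs(2) by (auto simp: r1_def field_simps)
  have r'': "K4 * Vc * r <= e / 2"
  proof -
   have "r <= e / (2 * (K4 * Vc + 1))" using r by (simp add: r1_def)
   then have "(K4 * Vc + 1) * r <= (K4 * Vc + 1) * (e / (2 * (K4 * Vc + 1)))" using K4V by (intro mult_left_mono) auto
   also have "... = e / 2" using K4V by (simp only: times_divide_eq_right mult_divide_mult_cancel_left_if[of "K4 * Vc + 1" e 2] mult.commute[of 2]) simp
   finally show ?thesis using r by (simp add: distrib_right)
  qed
  define j where "j = (%th. LB x. \<psi> x th * (f (T r th x) - f x))"
  define b where "b = K2 * e' + K4 * r"
  have b0: "0 <= b" using K2 e' K4 r by (simp add: b_def)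
  have gj: "\<bar>g th\<bar> <= \<bar>j th\<bar> / r + b * indicator (cball 0 c0) th" if th: "th ~= 0" for th
  proof (cases "th \<in> cball 0 c0")
   case False
   then have "F x th = 0" for x using Fb[of x th] by simp
   then show ?thesis using r b0 by (simp add: g_def)
  next
   case True
   note td = transport_difference[OF \<psi>b K\<psi> _ less_imp_le[OF r(1)] r'(1) th]
   have hf': "integrable lborel (%x. h x - f x)" using ih f by simp
   note i1 = td(1)[OF f, of th] and i2 = td(1)[OF ih, of th] and i3 = td[OF hf', of th]
   have iF: "integrable lborel (%x. F x th)"
    by (rule integrable_bound[OF integrable_mult_right[OF Va, of "M * (gb * c0)"]])
     (use order_trans[OF Fb[of _ th] abs_ge_self] True in "auto simp: F_def")
   have "\<bar>r * g th - (LB x. \<psi> x th * (h (T r th x) - h x))\<bar> = \<bar>LB x. r * F x th - \<psi> x th * (h (T r th x) - h x)\<bar>"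
    using iF i2 by (simp add: g_def)
   also have "... <= (LB x. M * (K3 * r * r) * indicator (cball a \<delta>) x)"
   proof (rule order_trans[OF integral_abs_bound], rule integral_mono)
    fix x
    show "\<bar>r * F x th - \<psi> x th * (h (T r th x) - h x)\<bar> <= M * (K3 * r * r) * indicator (cball a \<delta>) x"
    proof (cases "x \<in> cball a \<delta>")
     case xa: True
     have "r * F x th - \<psi> x th * (h (T r th x) - h x) = - (\<psi> x th * (h (T r th x) - h x - r * (grad h x \<bullet> v th x)))"
      by (simp add: F_def algebra_simps)
     also have "\<bar>...\<bar> <= M * (K3 * r * r)"
      unfolding abs_minus_cancel abs_mult using K3(2)[OF less_imp_le[OF r(1)] r'(3,2) th xa] \<psi>b M0 by (intro mult_mono) auto
     finally show ?thesis using xa by simp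
    next
     case False
     then show ?thesis using \<psi>s[of x th] by (simp add: F_def)
    qed
   qed (use iF i2 Va in auto)
   also have "... = r * (K4 * r)" by (simp add: K4_def Va_def)
   finally have 1: "\<bar>r * g th - (LB x. \<psi> x th * (h (T r th x) - h x))\<bar> <= r * (K4 * r)" .
   have "(LB x. \<psi> x th * (h (T r th x) - h x)) - j th = (LB x. \<psi> x th * ((h (T r th x) - f (T r th x)) - (h x - f x)))"
    unfolding j_def using i1 i2 by (subst integral_diff[symmetric]) (auto simp: algebra_simps)
   also have "\<bar>...\<bar> <= K2 * r * (LB x. \<bar>h x - f x\<bar>)" using i3(2) by (simp add: K2_def)
   also have "... <= K2 * r * e'" using hf K2 r by (intro mult_left_mono) auto
   finally have "\<bar>r * g th\<bar> <= \<bar>j th\<bar> + r * b" using 1 by (simp add: b_def algebra_simps)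
   then have "r * \<bar>g th\<bar> <= r * (\<bar>j th\<bar> / r + b)" using r by (simp add: abs_mult distrib_left)
   then show ?thesis using r True by simp
  qed
  have j_le: "ennreal (\<bar>j th\<bar> / r) <= (NN x. ennreal (\<bar>\<psi> x th\<bar> * \<bar>f (T r th x) - f x\<bar> / r))" if th: "th ~= 0" for th
  proof -
   have "integrable lborel (%x. \<psi> x th * (f (T r th x) - f x) / r)"
    using transport_difference(1)[OF \<psi>b K\<psi> f less_imp_le[OF r(1)] r'(1) th] by simp
   from integral_norm_bound_ennreal[OF this] show ?thesis using r by (simp add: j_def abs_mult)
  qed
  \<comment> \<open>A g that is not integrable has integral 0 by convention, so the inequality holds
    in that case too.\<close>
  have "ennreal \<bar>LB th. g th\<bar> <= (NN th. ennreal \<bar>g th\<bar>)"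
   using integral_norm_bound_ennreal[of lborel g] by (cases "integrable lborel g") (simp_all add: not_integrable_integral_eq)
  also have "... <= (NN (th::real^'n). (NN x. ennreal (\<bar>\<psi> x th\<bar> * \<bar>f (T r th x) - f x\<bar> / r)) + ennreal b * indicator (cball 0 c0) th)"
  proof (rule nn_integral_mono_AE, use AE_lborel_singleton[of "0::real^'n"] in eventually_elim)
   fix th :: "real^'n" assume th: "th ~= 0"
   have "ennreal \<bar>g th\<bar> <= ennreal (\<bar>j th\<bar> / r + b * indicator (cball 0 c0) th)" using gj[OF th] by (rule ennreal_leI)
   also have "... = ennreal (\<bar>j th\<bar> / r) + ennreal b * indicator (cball 0 c0) th"
    using r b0 by (subst ennreal_plus) (auto simp: indicator_def)
   finally show "ennreal \<bar>g th\<bar> <= (NN x. ennreal (\<bar>\<psi> x th\<bar> * \<bar>f (T r th x) - f x\<bar> / r)) + ennreal b * indicator (cball 0 c0) th"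
    using j_le[OF th] by (meson add_right_mono order_trans)
  qed
  also have "... = (NN (th::real^'n). (NN x. ennreal (\<bar>\<psi> x th\<bar> * \<bar>f (T r th x) - f x\<bar> / r))) + ennreal b * ennreal Vc"
   by (subst nn_integral_add) (simp_all add: nn_integral_cmult_indicator Vc(2))
  also have "(NN (th::real^'n). (NN x. ennreal (\<bar>\<psi> x th\<bar> * \<bar>f (T r th x) - f x\<bar> / r)))
   = (NN x. (NN th. ennreal (\<bar>\<psi> x th\<bar> * \<bar>f (T r th x) - f x\<bar> / r)))"
   by (rule lborel_pair.Fubini') measurable
  also have "... <= (NN x. (NN th. ennreal (1 + e) * ennreal (A x th * \<bar>f (T r th x) - f x\<bar> / r)))"
  proof (intro nn_integral_mono)
   fix x th :: "real^'n"
   have "\<bar>\<psi> x th\<bar> <= (1 + e) * A x th"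
   proof (cases "\<eta> x = 0")
    case True then show ?thesis by (simp add: \<psi>_def A_def)
   next
    case False
    from mult_right_mono[OF mb(2)[OF False] A_nonneg] show ?thesis by (simp add: \<psi>_def abs_mult A_nonneg mult.commute)
   qed
   then have "\<bar>\<psi> x th\<bar> * (\<bar>f (T r th x) - f x\<bar> / r) <= ((1 + e) * A x th) * (\<bar>f (T r th x) - f x\<bar> / r)"
    using r by (intro mult_right_mono) auto
   then have "\<bar>\<psi> x th\<bar> * \<bar>f (T r th x) - f x\<bar> / r <= (1 + e) * (A x th * \<bar>f (T r th x) - f x\<bar> / r)" by (simp add: mult.assoc)
   from ennreal_leI[OF this] show "ennreal (\<bar>\<psi> x th\<bar> * \<bar>f (T r th x) - f x\<bar> / r) <= ennreal (1 + e) * ennreal (A x th * \<bar>f (T r th x) - f x\<bar> / r)"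
    using e r A_nonneg by (subst ennreal_mult[symmetric]) auto
  qed
  also have "... = ennreal (1 + e) * loc f r"
   unfolding loc_def by (simp add: nn_integral_cmult)
  finally have main: "ennreal \<bar>LB th. g th\<bar> <= ennreal (1 + e) * loc f r + ennreal (b * Vc)"
   using b0 Vc(1) by (simp add: ennreal_mult)
  have idY: "integrable lborel (%x. q x * divg ?Y x)" if q: "integrable lborel q" for q
  proof (rule integrable_bound[OF integrable_mult_right[OF q, of D]])
   have "\<bar>q x\<bar> * \<bar>divg ?Y x\<bar> <= \<bar>q x\<bar> * D" for x using D(2)[of x] by (intro mult_left_mono) auto
   then show "AE x in lborel. norm (q x * divg ?Y x) <= norm (D * q x)" using D(1) by (simp add: abs_mult mult.commute)
   have [measurable]: "q \<in> borel_measurable borel" using q by auto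
   show "(%x. q x * divg ?Y x) \<in> borel_measurable lborel" by measurable
  qed
  have "(LB x. f x * divg ?Y x) - (LB x. h x * divg ?Y x) = (LB x. f x * divg ?Y x - h x * divg ?Y x)"
   using idY[OF f] idY[OF ih] by simp
  also have "... <= (LB x. D * \<bar>h x - f x\<bar>)"
  proof (rule integral_mono)
   fix x
   have "f x * divg ?Y x - h x * divg ?Y x <= \<bar>divg ?Y x * (h x - f x)\<bar>" by (simp add: algebra_simps)
   also have "... <= D * \<bar>h x - f x\<bar>" unfolding abs_mult using D(2)[of x] by (intro mult_right_mono) auto
   finally show "f x * divg ?Y x - h x * divg ?Y x <= D * \<bar>h x - f x\<bar>" .
  qed (use idY[OF f] idY[OF ih] ih f in auto)
  also have "... <= D * e'" using hf D(1) by simp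
  finally have "kn * ((LB x. f x * divg ?Y x) - (LB x. h x * divg ?Y x)) <= kn * (D * e')"
   using kn_pos by (intro mult_left_mono) auto
  then have fh: "kn * (LB x. f x * divg ?Y x) <= \<bar>LB th. g th\<bar> + kn * D * e'"
   unfolding g_int by (simp add: algebra_simps)
  have "b * Vc + kn * D * e' <= e"
  proof -
   have "b * Vc + kn * D * e' = (C - 1) * e' + K4 * Vc * r" by (simp add: b_def C_def algebra_simps)
   moreover have "(C - 1) * e' <= C * e'" using e' by (simp add: left_diff_distrib)
   moreover have "C * e' = e / 2" using C by (simp add: e'_def)
   ultimately show ?thesis using r'' by linarith
  qed
  show ?thesis
  proof (cases "ennreal (1 + e) * loc f r")
   case (real l)
   then have "ennreal \<bar>LB th. g th\<bar> <= ennreal (l + b * Vc)" using main b0 Vc(1) by (simp add: ennreal_plus[symmetric] del: ennreal_plus)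
   then have "\<bar>LB th. g th\<bar> <= l + b * Vc" using real b0 Vc(1) by (subst (asm) ennreal_le_iff) auto
   then show ?thesis using fh \<open>b * Vc + kn * D * e' <= e\<close> real by (auto intro: ennreal_leI)
  qed (use top_greatest in simp)
 qed
 ultimately show ?thesis by blast
qed

text \<open>m is the mean of qn (H x) q sgn (th . q) over covectors q close to P x. By
  \<open>w_sign_integral\<close> the mean of sgn (th . q) v is kn H q / qn (H x) q; the factor qn (H
  x) q cancels the denominator, so the mean is linear in q and averages exactly to kn H P. Since x
  enters through the norm and the smooth mollifier but not through the sign, m is Lipschitz in x,
  even where P vanishes. The radius \<tau> = e / c0 lets the norm of q exceed that of P by at most
  e, whence |m| <= 1 + e.\<close>

theorem loc_lower:
 assumes P: "!!x y. norm (P x - P y) <= KP * norm (x - y)" "0 <= KP" "!!x. norm (P x) <= BP" "!!x. \<eta> x ~= 0 ==> qn (H x) (P x) <= 1"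
  and Y: "Ck_on 1 UNIV (%x. (\<eta> x * \<rho> x) *\<^sub>R (H x *v P x))" (is "Ck_on 1 UNIV ?Y")
  and f: "integrable lborel f" and e: "0 < e"
 shows "\<exists>r1>0. \<forall>r. 0 < r --> r < r1 -->
  ennreal (kn * (LB x. f x * divg ?Y x) - e) <= ennreal (1 + e) * loc f r"
proof -
 define \<tau> where "\<tau> = e / c0"
 have \<tau>: "0 < \<tau>" "c0 * \<tau> = e" using e c_pos by (auto simp: \<tau>_def)
 let ?\<kappa> = "mollifier \<tau> :: real^'n => real"
 define R where "R = BP + \<tau>"
 have BP: "0 <= BP" using order_trans[OF norm_ge_zero P(3)] .
 have R: "0 < R" using BP \<tau> by (simp add: R_def)
 have "KP-lipschitz_on UNIV P" using P(1,2) by (intro lipschitz_onI) (auto simp: dist_norm)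
 then have cP: "continuous_on UNIV P" by (rule lipschitz_on_continuous_on)
 have [measurable]: "P \<in> borel_measurable borel" by (rule borel_measurable_continuous_onI[OF cP])
 have [measurable]: "?\<kappa> \<in> borel_measurable borel" by (rule borel_measurable_continuous_onI[OF continuous_on_mollifier])
 have \<kappa>0: "?\<kappa> (q - P x) = 0" if "R < norm q" for q x
 proof -
  have "norm q <= norm (P x) + norm (q - P x)" by (rule norm_triangle_sub)
  then have "\<tau> <= norm (q - P x)" using P(3)[of x] that by (simp add: R_def)
  then show ?thesis using \<tau> mollifier_eq_0 by blast
 qed
 obtain \<kappa>m where \<kappa>m: "0 < \<kappa>m" "!!z. norm (?\<kappa> z) <= \<kappa>m"
  using bounded_continuous_support[OF continuous_on_mollifier, where R=\<tau>] mollifier_eq_0[OF \<tau>(1)] by (metis less_imp_le)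
 obtain K\<kappa> where K\<kappa>: "0 <= K\<kappa>" "!!x y. x \<in> cball 0 (R + BP) ==> y \<in> cball 0 (R + BP) ==> \<bar>?\<kappa> x - ?\<kappa> y\<bar> <= K\<kappa> * norm (x - y)"
  using Ck1_bounded_lipschitz[OF Ck_on_mollifier[of "Suc 0" \<tau>] compact_cball convex_cball subset_UNIV, of 0 "R + BP"] by (metis less_imp_le real_norm_def)
 define F where "F = (%x th q. qn (H x) q * ?\<kappa> (q - P x) * sgn (th \<bullet> q))"
 define m where "m = (%x th. LB q. F x th q)"
 have Fm [measurable]: "(%z. F (p1 z) (p2 z) (p3 z)) \<in> borel_measurable M"
  if [measurable]: "p1 \<in> borel_measurable M" "p2 \<in> borel_measurable M" "p3 \<in> borel_measurable M" for p1 p2 p3 and M :: "'z measure"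
  unfolding F_def by measurable
 have sgn1: "\<bar>sgn t\<bar> <= 1" for t :: real by (simp add: sgn_if)
 have i\<kappa>: "integrable lborel (%q. ?\<kappa> (q - p))" "(LB q. ?\<kappa> (q - p)) = 1" for p
  using integral_lborel_translate[OF integrable_mollifier[OF \<tau>(1)], of "- p"] integral_mollifier[OF \<tau>(1)] by auto
 have Fb: "\<bar>F x th q\<bar> <= (qn (H x) (P x) + e) * ?\<kappa> (q - P x)" for x th q
 proof (cases "?\<kappa> (q - P x) = 0")
  case False
  then have "norm (q - P x) <= \<tau>" using mollifier_eq_0[OF \<tau>(1), of "q - P x"] by linarith
  then have "c0 * norm (q - P x) <= c0 * \<tau>" using c_pos by simp
  then have "qn (H x) q <= qn (H x) (P x) + e" using qn_triangle[OF pdH, of x q "P x"] qnH(2)[of x "q - P x"] \<tau>(2) by linarith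
  then have "(qn (H x) q * ?\<kappa> (q - P x)) * \<bar>sgn (th \<bullet> q)\<bar> <= ((qn (H x) (P x) + e) * ?\<kappa> (q - P x)) * 1"
   using mollifier_nonneg[OF \<tau>(1)] sgn1 pdH e by (intro mult_mono mult_nonneg_nonneg) (auto intro: add_nonneg_nonneg)
  then show ?thesis using mollifier_nonneg[OF \<tau>(1), of "q - P x"] pdH by (simp add: F_def abs_mult)
 qed (simp add: F_def)
 have iF: "integrable lborel (F x th)" for x th
 proof (rule integrable_bound[OF integrable_mult_right[OF i\<kappa>(1)]])
  show "AE q in lborel. norm (F x th q) <= norm ((qn (H x) (P x) + e) * ?\<kappa> (q - P x))"
   using order_trans[OF Fb abs_ge_self] by auto
 qed measurable
 have mb: "\<bar>m x th\<bar> <= qn (H x) (P x) + e" for x th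
 proof -
  have "\<bar>m x th\<bar> <= (LB q. (qn (H x) (P x) + e) * ?\<kappa> (q - P x))"
   unfolding m_def by (rule order_trans[OF integral_abs_bound], rule integral_mono) (use iF i\<kappa> Fb in auto)
  then show ?thesis by (simp add: i\<kappa>)
 qed
 define Km where "Km = (c1 * R * \<kappa>m + c0 * R * (K\<kappa> * KP)) * (LB q. indicator (cball (0::real^'n) R) q)"
 have "0 <= (LB q. indicator (cball (0::real^'n) R) q :: real)" by (rule integral_nonneg) simp
 then have Km: "0 <= Km" unfolding Km_def using c_pos R \<kappa>m K\<kappa> P(2) by simp
 have mm: "(%z. m (fst z) (snd z)) \<in> borel_measurable (borel \<Otimes>\<^sub>M borel)"
  unfolding m_def by measurable
 have ml: "\<bar>m x th - m y th\<bar> <= Km * norm (x - y)" for x y th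
 proof -
  let ?c = "(c1 * R * \<kappa>m + c0 * R * (K\<kappa> * KP)) * norm (x - y)"
  have "\<bar>m x th - m y th\<bar> = \<bar>LB q. F x th q - F y th q\<bar>" using iF by (simp add: m_def)
  also have "... <= (LB q. ?c * indicator (cball (0::real^'n) R) q)"
  proof (rule order_trans[OF integral_abs_bound], rule integral_mono)
   fix q
   show "\<bar>F x th q - F y th q\<bar> <= ?c * indicator (cball 0 R) q"
   proof (cases "norm q <= R")
    case True
    have *: "\<bar>qn (H x) q * ?\<kappa> (q - P x) - qn (H y) q * ?\<kappa> (q - P y)\<bar> <= ?c"
    proof (rule bounded_lipschitz_mult)
     fix x y
     have "qn (H x) q <= c0 * norm q" by (rule qnH)
     also have "... <= c0 * R" using True c_pos by simp
     finally show "\<bar>qn (H x) q\<bar> <= c0 * R" using pdH by simp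
     show "\<bar>?\<kappa> (q - P x)\<bar> <= \<kappa>m" using \<kappa>m(2) by simp
     have "c1 * norm (x - y) * norm q <= c1 * norm (x - y) * R" using True c_pos by (intro mult_left_mono) auto
     then show "\<bar>qn (H x) q - qn (H y) q\<bar> <= c1 * R * norm (x - y)" using qnH(3)[of x q y] by (simp add: mult_ac)
     have "q - P z \<in> cball 0 (R + BP)" for z
      using norm_triangle_ineq4[of q "P z"] P(3)[of z] True by simp
     then have "\<bar>?\<kappa> (q - P x) - ?\<kappa> (q - P y)\<bar> <= K\<kappa> * norm ((q - P x) - (q - P y))" by (intro K\<kappa>(2)) blast+
     also have "... <= K\<kappa> * (KP * norm (x - y))" using P(1)[of x y] K\<kappa>(1) by (intro mult_left_mono) (auto simp: norm_minus_commute)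
     finally show "\<bar>?\<kappa> (q - P x) - ?\<kappa> (q - P y)\<bar> <= K\<kappa> * KP * norm (x - y)" by (simp add: mult.assoc)
    qed
    from mult_mono[OF * sgn1 order_trans[OF abs_ge_zero *] abs_ge_zero, of "th \<bullet> q"]
    show ?thesis using True by (simp only: F_def abs_mult[symmetric] left_diff_distrib[symmetric]) simp
   next
    case False
    then show ?thesis using \<kappa>0[of q] by (simp add: F_def)
   qed
  qed (use iF integrable_indicator_cball[of "0::real^'n" R] in auto)
  also have "... = Km * norm (x - y)" by (simp add: Km_def)
  finally show ?thesis .
 qed
 have mw: "(LB th. w x th * (m x th * (p \<bullet> v th x))) = kn * (p \<bullet> (H x *v P x))" for x p
 proof -
  define J where "J = (%th q. w x th * (F x th q * (p \<bullet> v th x)))"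
  have iJ: "integrable (lborel \<Otimes>\<^sub>M lborel) (%(th, q). J th q)"
  proof (rule integrable_bound)
   let ?c = "(cw * B) * ((c0 * R * \<kappa>m * 1) * (norm p * c0))"
   have "integrable lborel (indicator (cball (0::real^'n) c0 \<times> cball (0::real^'n) R) :: _ => real)"
    by (intro integrable_real_indicator emeasure_bounded_finite bounded_Times) (auto intro!: borel_closed closed_Times)
   then show "integrable (lborel \<Otimes>\<^sub>M lborel) (%z. ?c * indicator (cball (0::real^'n) c0 \<times> cball (0::real^'n) R) z)"
    unfolding lborel_prod by (rule integrable_mult_right)
   have "\<bar>J th q\<bar> <= ?c * indicator (cball 0 c0 \<times> cball 0 R) (th, q)" for th q
   proof (cases "th \<in> cball 0 c0 \<and> q \<in> cball 0 R")
    case True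
    have "qn (H x) q <= c0 * R" using qnH(2)[of x q] mult_left_mono[of "norm q" R c0] True c_pos by (simp add: order_trans)
    then have "\<bar>F x th q\<bar> <= c0 * R * \<kappa>m * 1"
     unfolding F_def abs_mult using \<kappa>m c_pos R sgn1 pdH[of x] by (intro mult_mono) auto
    moreover have "\<bar>p \<bullet> v th x\<bar> <= norm p * c0"
     by (rule order_trans[OF Cauchy_Schwarz_ineq2]) (intro mult_left_mono v_bound norm_ge_zero)
    ultimately have "\<bar>J th q\<bar> <= ?c"
     unfolding J_def abs_mult using w_nonneg w_bound c_pos R \<kappa>m cw_pos const by (intro mult_mono) auto
    then show ?thesis using True by simp
   next
    case False
    then have "J th q = 0" using w_supp[of th x] \<kappa>0[of q x] by (auto simp: J_def F_def)
    then show ?thesis using False by (auto simp: indicator_def)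
   qed
   from order_trans[OF this abs_ge_self] show "AE z in lborel \<Otimes>\<^sub>M lborel. norm (case z of (th, q) => J th q) <= norm (?c * indicator (cball (0::real^'n) c0 \<times> cball (0::real^'n) R) z)"
    by auto
  qed (unfold J_def, measurable)
  have "(LB th. w x th * (m x th * (p \<bullet> v th x))) = (LB th. (LB q. J th q))"
   using iF by (simp add: J_def m_def)
  also have "... = (LB q. (LB th. J th q))" by (rule lborel_pair.Fubini_integral[OF iJ, symmetric])
  also have "... = (LB q. kn * (?\<kappa> (q - P x) * (q \<bullet> (H x *v p))))"
  proof (rule integral_cong[OF refl])
   fix q
   have "(LB th. J th q) = (LB th. qn (H x) q * ?\<kappa> (q - P x) * (w x th * (sgn (th \<bullet> q) * (v th x \<bullet> p))))"
    by (simp add: J_def F_def inner_commute mult_ac)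
   also have "... = kn * (?\<kappa> (q - P x) * (q \<bullet> (H x *v p)))"
   proof (cases "q = 0")
    case False
    then have "0 < qn (H x) q" using pdH qn_pos_iff by blast
    then show ?thesis using w_sign_integral[OF False, of x p] by (simp add: qform_def)
   qed (simp add: qn_def qform_zero)
   finally show "(LB th. J th q) = kn * (?\<kappa> (q - P x) * (q \<bullet> (H x *v p)))" .
  qed
  also have "... = kn * (P x \<bullet> (H x *v p))" by (simp add: mollifier_mean[OF \<tau>(1)])
  also have "P x \<bullet> (H x *v p) = p \<bullet> (H x *v P x)" using qform_commute[OF pdH, of x "P x" p] by (simp add: qform_def)
  finally show ?thesis .
 qed
 have qb: "qn (H x) (P x) + e <= c0 * BP + e" for x
  using qnH(2)[of x "P x"] mult_left_mono[OF P(3)[of x], of c0] c_pos by linarith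
 show ?thesis
  by (rule loc_lower_test[OF mm order_trans[OF mb qb] _ ml Km mw Y f e]) (use order_trans[OF mb] P(4) in "simp add: add_right_mono")
qed

end

subsection \<open>Charts and the metric\<close>

lemma bilinear_eq_sum_axis:
 fixes b :: "real^'n => real^'n => real"
 assumes b: "bilinear b"
 shows "b v w = (\<Sum>i\<in>UNIV. \<Sum>j\<in>UNIV. v $ i * b (axis i 1) (axis j 1) * w $ j)"
proof -
 have "b v w = b (\<Sum>i\<in>UNIV. v $ i *\<^sub>R axis i 1) (\<Sum>j\<in>UNIV. w $ j *\<^sub>R axis j 1)"
  using basis_expansion[of v] basis_expansion[of w] by (simp add: scalar_mult_eq_scaleR)
 also have "... = (\<Sum>(i, j)\<in>UNIV \<times> UNIV. b (v $ i *\<^sub>R axis i 1) (w $ j *\<^sub>R axis j 1))"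
  by (rule bilinear_sum[OF b])
 finally show ?thesis
  by (simp add: sum.cartesian_product bilinear_lmul[OF b] bilinear_rmul[OF b] mult_ac)
qed

lemma qform_axis: "qform M (axis i 1) (axis j 1) = M $ i $ j"
 by (simp add: qform_def matrix_vector_mult_basis column_def inner_axis' )

lemma det_congruence:
 fixes M N :: "real^'n^'n"
 assumes "!!v w. qform M v w = qform N (J v) (J w)" "linear J"
 shows "det M = (det (matrix J))\<^sup>2 * det N"
proof -
 have "qform (transpose (matrix J) ** N ** matrix J) v w = qform N (J v) (J w)" for v w
  using assms(2) dot_lmul_matrix[of "N *v J w" "matrix J" v]
  by (simp add: qform_def matrix_works matrix_vector_mul_assoc[symmetric] inner_commute)
 then have "qform M v w = qform (transpose (matrix J) ** N ** matrix J) v w" for v w using assms(1) by simp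
 then have "M = transpose (matrix J) ** N ** matrix J" by (simp add: vec_eq_iff flip: qform_axis)
 then show ?thesis by (simp add: det_mul det_transpose power2_eq_square mult_ac)
qed

locale riemannian =
 fixes A :: "('a::{t2_space,second_countable_topology}, 'n::finite) chart set" and g :: "('a, 'n) metric_tensor"
 assumes atlas: "smooth_atlas A" and metric: "riemannian_metric A g"
begin

abbreviation U :: "('a, 'n) chart => 'a set" where "U \<equiv> fst"
abbreviation \<phi> :: "('a, 'n) chart => 'a => real^'n" where "\<phi> \<equiv> snd"
abbreviation \<psi> :: "('a, 'n) chart => real^'n => 'a" where "\<psi> \<equiv> chart_inv"
abbreviation \<tau> :: "('a, 'n) chart => ('a, 'n) chart => real^'n => real^'n" where "\<tau> \<equiv> transition"
abbreviation "K \<equiv> chart_at A"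
abbreviation "V c \<equiv> \<phi> c ` U c"
abbreviation "W c d \<equiv> \<phi> c ` (U c \<inter> U d)"
abbreviation "G \<equiv> metric_coords A g"
abbreviation "\<rho> c u \<equiv> sqrt (det (G c u))"
text \<open>Indexed by the point x instead of its coordinates, so that the chain rule composes
  derivatives at one and the same point.\<close>

abbreviation "D c d x \<equiv> Dv (\<tau> c d) (\<phi> c x)"

lemma chart:
 assumes "c \<in> A"
 shows "open (U c)" "open (V c)" "continuous_on (U c) (\<phi> c)" "continuous_on (V c) (\<psi> c)"
  "x \<in> U c ==> \<psi> c (\<phi> c x) = x" "u \<in> V c ==> \<psi> c u \<in> U c" "u \<in> V c ==> \<phi> c (\<psi> c u) = u"
proof -
 have h: "open (U c) \<and> open (V c) \<and> homeomorphism (U c) (V c) (\<phi> c) (\<psi> c)"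
  using atlas assms unfolding smooth_atlas_def by blast
 then show "open (U c)" "open (V c)" by auto
 from h show "continuous_on (U c) (\<phi> c)" "continuous_on (V c) (\<psi> c)"
  "x \<in> U c ==> \<psi> c (\<phi> c x) = x" "u \<in> V c ==> \<psi> c u \<in> U c" "u \<in> V c ==> \<phi> c (\<psi> c u) = u"
  unfolding homeomorphism_def by auto
qed

lemma chart_at: "K x \<in> A" "x \<in> U (K x)"
proof -
 have "\<exists>c. c \<in> A \<and> x \<in> U c" using atlas unfolding smooth_atlas_def by blast
 from someI_ex[OF this] show "K x \<in> A" "x \<in> U (K x)" by (auto simp: chart_at_def)
qed

lemma W_iff: "c \<in> A ==> u \<in> W c d \<longleftrightarrow> u \<in> V c \<and> \<psi> c u \<in> U d"
 using chart(5,7)[of c] by force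

lemma open_chart_vimage:
 assumes "c \<in> A" "open S"
 shows "open {u \<in> V c. \<psi> c u \<in> S}"
 using continuous_open_preimage[OF chart(4,2)[OF assms(1)] assms(2)] by (simp add: vimage_def Int_def)

lemma open_W:
 assumes "c \<in> A" "d \<in> A"
 shows "open (W c d)"
proof -
 have "W c d = {u \<in> V c. \<psi> c u \<in> U d}" using W_iff[OF assms(1)] by blast
 then show ?thesis using open_chart_vimage[OF assms(1) chart(1)[OF assms(2)]] by simp
qed

lemma tr:
 assumes "c \<in> A" "d \<in> A"
 shows "\<tau> c d u = \<phi> d (\<psi> c u)" "x \<in> U c ==> \<tau> c d (\<phi> c x) = \<phi> d x" "Ck_on k (W c d) (\<tau> c d)"
  "x \<in> U c ==> x \<in> U d ==> (\<tau> c d has_derivative D c d x) (at (\<phi> c x))"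
proof -
 show "\<tau> c d u = \<phi> d (\<psi> c u)" "x \<in> U c ==> \<tau> c d (\<phi> c x) = \<phi> d x"
  using chart(5)[OF assms(1)] by (auto simp: transition_def)
 show C: "Ck_on k (W c d) (\<tau> c d)" for k
  using atlas assms unfolding smooth_atlas_def smooth_on_def by blast
 show "x \<in> U c ==> x \<in> U d ==> (\<tau> c d has_derivative D c d x) (at (\<phi> c x))"
  using Ck_on_SucD(1)[OF C[of "Suc 0"]] by blast
qed

lemma linear_D: "c \<in> A ==> d \<in> A ==> x \<in> U c ==> x \<in> U d ==> linear (D c d x)"
 using tr(4) has_derivative_linear by blast

lemma D_chain:
 assumes "c \<in> A" "d \<in> A" "e \<in> A" "x \<in> U c" "x \<in> U d" "x \<in> U e"
 shows "D d e x (D c d x v) = D c e x v"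
proof -
 have "((%u. \<tau> d e (\<tau> c d u)) has_derivative (%v. D d e x (D c d x v))) (at (\<phi> c x))"
  using has_derivative_compose[OF tr(4)[of c d x], of "\<tau> d e" "D d e x"] tr(4)[of d e x] assms tr(2)[of c d x] by simp
 then have "(\<tau> c e has_derivative (%v. D d e x (D c d x v))) (at (\<phi> c x))"
 proof (rule has_derivative_transform_within_open[of _ _ _ _ "W c d \<inter> W c e"])
  fix u assume "u \<in> W c d \<inter> W c e"
  then show "\<tau> d e (\<tau> c d u) = \<tau> c e u" using assms by (auto simp: W_iff tr(1) chart(5))
 next
  show "open (W c d \<inter> W c e)" by (intro open_Int open_W assms)
 qed (use assms in blast)
 from has_derivative_unique[OF this tr(4)] show ?thesis using assms by metis
qed

lemma D_id:
 assumes "c \<in> A" "x \<in> U c"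
 shows "D c c x v = v"
proof -
 have "(\<tau> c c has_derivative (%v. v)) (at (\<phi> c x))"
  by (rule has_derivative_transform_within_open[OF has_derivative_ident chart(2)[OF assms(1)]])
   (use assms chart in "auto simp: tr")
 from frechet_derivative_at[OF this] show ?thesis by metis
qed

lemma D_inv:
 assumes "c \<in> A" "d \<in> A" "x \<in> U c" "x \<in> U d"
 shows "D d c x (D c d x v) = v"
 using D_chain[of c d c x v] D_id[of c x v] assms by simp

lemma gx: "bilinear (g x)" "g x v w = g x w v" "v ~= 0 ==> 0 < g x v v"
 using metric unfolding riemannian_metric_def by auto

lemma G_eq:
 assumes c: "c \<in> A" "x \<in> U c"
 shows "qform (G c (\<phi> c x)) v w = g x (D c (K x) x v) (D c (K x) x w)"
proof -
 let ?E = "D c (K x) x"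
 have lin: "linear ?E" using linear_D[OF c(1) chart_at(1) c(2) chart_at(2)] .
 have "bilinear (%v w. g x (?E v) (?E w))"
  using gx(1) lin unfolding bilinear_def by (auto intro: linear_compose[unfolded o_def])
 note b = bilinear_eq_sum_axis[OF this, of v w]
 have "G c (\<phi> c x) $ i $ j = g x (?E (axis i 1)) (?E (axis j 1))" for i j
  by (simp add: metric_coords_def tangent_of_coords_def chart(5)[OF c])
 then show ?thesis unfolding qform_eq_sum b by simp
qed

lemma G_change:
 assumes c: "c \<in> A" "d \<in> A" "x \<in> U c" "x \<in> U d"
 shows "qform (G c (\<phi> c x)) v w = qform (G d (\<phi> d x)) (D c d x v) (D c d x w)"
 using G_eq[OF c(1,3)] G_eq[OF c(2,4)] D_chain[OF c(1,2) chart_at(1) c(3,4) chart_at(2)] by simp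

lemma pos_def_G: "c \<in> A ==> u \<in> V c ==> pos_def (G c u)"
proof -
 assume c: "c \<in> A" "u \<in> V c"
 then obtain x where x: "x \<in> U c" "u = \<phi> c x" by blast
 have "transpose (G c u) = G c u"
  by (simp add: transpose_def vec_eq_iff metric_coords_def gx(2))
 moreover have "0 < qform (G c u) v v" if "v ~= 0" for v
 proof -
  have "D (K x) c x (D c (K x) x v) = v" "D (K x) c x 0 = 0"
   using D_inv[OF c(1) chart_at(1) x(1) chart_at(2)] linear_0[OF linear_D[OF chart_at(1) c(1) chart_at(2) x(1)]] by auto
  then have "D c (K x) x v ~= 0" using that by metis
  then show ?thesis by (simp add: x G_eq[OF c(1) x(1)] gx(3))
 qed
 ultimately show ?thesis by (simp add: pos_def_def)
qed

lemma Ck_G: "c \<in> A ==> Ck_on k (V c) (G c)"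
 using metric unfolding riemannian_metric_def smooth_on_def by blast

lemma det_G_pos: "c \<in> A ==> u \<in> V c ==> 0 < det (G c u)"
 using pos_def_frame[OF pos_def_G] by metis

lemma \<rho>_pos: "c \<in> A ==> u \<in> V c ==> 0 < \<rho> c u"
 using det_G_pos by simp

lemma Ck_\<rho>: "c \<in> A ==> Ck_on k (V c) (\<rho> c)"
 by (intro Ck_on_sqrt Ck_on_det Ck_G det_G_pos chart(2))

lemma \<rho>_change:
 assumes "c \<in> A" "d \<in> A" "x \<in> U c" "x \<in> U d"
 shows "\<rho> c (\<phi> c x) = \<bar>det (matrix (D c d x))\<bar> * \<rho> d (\<phi> d x)"
 using det_congruence[OF G_change[OF assms] linear_D[OF assms]] by (simp add: real_sqrt_mult)

end

subsection \<open>The Riemannian volume\<close>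

lemma measurable_if_open:
 assumes "open S" "continuous_on S f"
 shows "(%x. if x \<in> S then f x else c) \<in> borel_measurable borel"
 using assms borel_measurable_continuous_on_restrict[OF assms(2)]
 by (subst measurable_restrict_space_iff[symmetric]) auto

context riemannian
begin

text \<open>The inverse chart and the density are continued beyond the coordinate domain to be Borel
  on all of R^n. The density is 0 there, so the value \<open>undefined\<close> carries no mass, and
  \<open>\<nu> c\<close> is the volume of the chart domain as a measure on the manifold.\<close>

definition "ext c u = (if u \<in> V c then \<psi> c u else undefined)"
definition "wt c u = (if u \<in> V c then \<rho> c u else 0)"
definition "\<nu> c = distr (density lborel (%u. ennreal (wt c u))) borel (ext c)"

lemma wt_nonneg: "c \<in> A ==> 0 <= wt c u"
 using \<rho>_pos[of c u] by (auto simp: wt_def)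

lemma ext_measurable [measurable]: "c \<in> A ==> ext c \<in> borel_measurable borel"
 unfolding ext_def using chart by (intro measurable_if_open)

lemma wt_measurable [measurable]: "c \<in> A ==> wt c \<in> borel_measurable borel"
 unfolding wt_def using chart Ck_on_continuous[OF Ck_\<rho>] by (intro measurable_if_open)

lemma sets_\<nu> [measurable_cong, simp]: "sets (\<nu> c) = sets borel"
 by (simp add: \<nu>_def)

lemma nn_integral_\<nu>:
 assumes [measurable]: "c \<in> A" "F \<in> borel_measurable borel"
 shows "(\<integral>\<^sup>+x. F x \<partial>\<nu> c) = (NN u. ennreal (wt c u) * F (ext c u))"
 unfolding \<nu>_def by (subst nn_integral_distr, measurable, subst nn_integral_density) auto

lemma emeasure_\<nu>:
 assumes "c \<in> A" "B \<in> sets borel"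
 shows "emeasure (\<nu> c) B = (NN u. ennreal (wt c u) * indicator B (ext c u))"
 using nn_integral_\<nu>[of c "indicator B"] assms by simp

text \<open>By \<open>\<rho>_change\<close> the Jacobian of the transition map is the ratio of the
  densities of the two charts.\<close>

lemma \<nu>_change:
 assumes c: "c \<in> A" "d \<in> A" and B: "B \<in> sets borel" "B \<subseteq> U c \<inter> U d"
 shows "emeasure (\<nu> c) B = emeasure (\<nu> d) B"
proof -
 let ?f = "%y. ennreal (wt d y) * indicator B (ext d y)"
 have img: "\<tau> c d ` W c d = W d c" using tr(2)[OF c] by (auto simp: image_image)
 have "emeasure (\<nu> d) B = (NN y. ?f y * indicator (\<tau> c d ` W c d) y)"
  unfolding emeasure_\<nu>[OF c(2) B(1)] img using B(2) chart(6,7)[OF c(2)]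
  by (intro nn_integral_cong) (auto simp: indicator_def ext_def wt_def W_iff[OF c(2)])
 also have "... = (NN u. ennreal \<bar>det (matrix (Dv (\<tau> c d) u))\<bar> * ?f (\<tau> c d u) * indicator (W c d) u)"
 proof (rule nn_integral_change_of_variables[where h="\<tau> d c"])
  show "open (W c d)" "open (\<tau> c d ` W c d)" using open_W c img by auto
  show "(\<tau> c d has_derivative Dv (\<tau> c d) u) (at u)" if "u \<in> W c d" for u using that tr(4)[OF c] by auto
  show "continuous_on (W c d) (%u. Dv (\<tau> c d) u v)" for v
   using Ck_on_SucD(2)[OF tr(3)[OF c]] Ck_on_continuous by blast
  show "\<tau> d c (\<tau> c d u) = u" if "u \<in> W c d" for u using that tr(2)[OF c] tr(2)[OF c(2,1)] by auto
  show "continuous_on (\<tau> c d ` W c d) (\<tau> d c)" using Ck_on_continuous[OF tr(3)[OF c(2,1)]] by (simp add: img)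
  show "?f \<in> borel_measurable borel" using c B by measurable
 qed
 also have "... = (NN u. ennreal (wt c u) * indicator B (ext c u))"
 proof (rule nn_integral_cong)
  fix u
  show "ennreal \<bar>det (matrix (Dv (\<tau> c d) u))\<bar> * ?f (\<tau> c d u) * indicator (W c d) u = ennreal (wt c u) * indicator B (ext c u)"
  proof (cases "u \<in> W c d")
   case True
   then obtain x where x: "x \<in> U c" "x \<in> U d" "u = \<phi> c x" by blast
   then show ?thesis using \<rho>_pos[OF c(2) imageI[OF x(2)]] \<rho>_change[OF c x(1,2)] tr(2)[OF c x(1)] chart(5)[OF c(1) x(1)] chart(5)[OF c(2) x(2)]
    by (simp add: ext_def wt_def ennreal_mult mult_ac)
  next
   case False
   then have "wt c u = 0 \<or> ext c u \<notin> B" using B(2) W_iff[OF c(1), of u d] by (auto simp: wt_def ext_def)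
   with False show ?thesis by auto
  qed
 qed
 finally show ?thesis using emeasure_\<nu>[OF c(1) B(1)] by simp
qed

end

locale compact_riemannian = riemannian A g
 for A :: "('a::{t2_space,second_countable_topology}, 'n::finite) chart set" and g :: "('a, 'n) metric_tensor" +
 assumes compact: "compact (UNIV :: 'a set)"
begin

abbreviation "vol \<equiv> riemannian_volume A g"

lemma finite_atlas: "\<exists>cs. set cs \<subseteq> A \<and> (\<Union>i<length cs. U (cs ! i)) = UNIV"
proof -
 have "\<forall>C. Ball C open \<and> UNIV \<subseteq> \<Union>C --> (\<exists>D\<subseteq>C. finite D \<and> (UNIV::'a set) \<subseteq> \<Union>D)"
  using compact unfolding compact_eq_Heine_Borel by auto
 moreover have "Ball (U ` A) open" "UNIV \<subseteq> \<Union>(U ` A)" using chart(1) chart_at by blast+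
 ultimately obtain D where D: "D \<subseteq> U ` A" "finite D" "(UNIV::'a set) \<subseteq> \<Union>D" by meson
 then obtain C where C: "C \<subseteq> A" "finite C" "D = U ` C" by (meson finite_subset_image)
 obtain cs where "set cs = C" using finite_list[OF C(2)] by blast
 have *: "set cs = (!) cs ` {..<length cs}" using nth_image[of "length cs" cs] by (simp add: lessThan_atLeast0)
 have "(\<Union>i<length cs. U (cs ! i)) = \<Union>(U ` set cs)" by (simp only: * image_image)
 then have "set cs \<subseteq> A \<and> (\<Union>i<length cs. U (cs ! i)) = UNIV" using C(1,3) D(3) \<open>set cs = C\<close> by (simp only: top.extremum_unique)
 then show ?thesis by (rule exI)
qed

text \<open>Finitely many chart domains cover the manifold and are made disjoint; the measure is the
  sum of the chart measures on the pieces. By \<open>\<nu>_change\<close> every other chart gives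
  the same values, and additivity over the pieces gives uniqueness. This is what the definite
  description in \<open>riemannian_volume\<close> requires.\<close>

lemma volume_exists:
 "\<exists>!\<mu>. sets \<mu> = sets borel \<and> (\<forall>c\<in>A. \<forall>B\<in>sets borel. B \<subseteq> U c --> emeasure \<mu> B = emeasure (\<nu> c) B)"
proof -
 obtain cs where cs: "set cs \<subseteq> A" "(\<Union>i<length cs. U (cs ! i)) = UNIV" using finite_atlas by blast
 define E where "E = disjointed (%i. if i < length cs then U (cs ! i) else {})"
 have csA: "cs ! i \<in> A" if "i < length cs" for i using cs(1) that by auto
 have E: "E i \<in> sets borel" for i
  unfolding E_def using sets.range_disjointed_sets[of "%i. if i < length cs then U (cs ! i) else {}" borel] chart(1) csA by fastforce
 have EU: "E i \<subseteq> U (cs ! i)" if "i < length cs" for i unfolding E_def using disjointed_subset[of _ i] that by fastforce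
 have Eu: "(\<Union>i<length cs. E i) = UNIV"
  using finite_UN_disjointed_eq[of "%i. if i < length cs then U (cs ! i) else {}" "length cs"] cs(2) by (simp add: E_def lessThan_atLeast0)
 have split: "emeasure \<mu> B = (\<Sum>i<length cs. emeasure \<mu> (B \<inter> E i))" if "sets \<mu> = sets borel" "B \<in> sets borel" for \<mu> B
 proof (rule sum_emeasure_cover)
  show "disjoint_family_on E {..<length cs}" unfolding E_def by (rule disjoint_family_on_mono[OF _ disjoint_family_disjointed]) simp
 qed (use that E Eu in auto)
 define m where "m = (%B. \<Sum>i<length cs. emeasure (\<nu> (cs ! i)) (B \<inter> E i))"
 define \<mu> where "\<mu> = measure_of UNIV (sets borel) m"
 have s\<mu>: "sets \<mu> = sets borel" unfolding \<mu>_def using sets.sigma_sets_eq[of borel] by simp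
 have m: "emeasure \<mu> B = m B" if "B \<in> sets borel" for B
  unfolding \<mu>_def
 proof (rule emeasure_measure_of_sigma)
  show "sigma_algebra UNIV (sets (borel::'a measure))" using sets.sigma_algebra_axioms[of borel] by simp
  show "positive (sets borel) m" by (simp add: positive_def m_def)
  show "countably_additive (sets borel) m"
  proof (rule countably_additiveI)
   fix B :: "nat => 'a set" assume B: "range B \<subseteq> sets borel" "disjoint_family B"
   have "(\<Sum>j. m (B j)) = (\<Sum>i<length cs. \<Sum>j. emeasure (\<nu> (cs ! i)) (B j \<inter> E i))"
    unfolding m_def by (rule suminf_sum) simp
   also have "... = (\<Sum>i<length cs. emeasure (\<nu> (cs ! i)) (\<Union>j. B j \<inter> E i))"
    using B E by (intro sum.cong refl suminf_emeasure) (auto simp: disjoint_family_on_def)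
   finally show "(\<Sum>j. m (B j)) = m (\<Union>(range B))" by (simp add: m_def Int_UN_distrib2)
  qed
 qed (use that in simp)
 show ?thesis
 proof (rule ex1I[of _ \<mu>], intro conjI ballI impI s\<mu>)
  fix c B assume c: "c \<in> A" "B \<in> sets borel" "B \<subseteq> U c"
  have "emeasure (\<nu> (cs ! i)) (B \<inter> E i) = emeasure (\<nu> c) (B \<inter> E i)" if "i < length cs" for i
   using c E csA EU that by (intro \<nu>_change) blast+
  then show "emeasure \<mu> B = emeasure (\<nu> c) B" using split[OF sets_\<nu> c(2), of c] by (simp add: m c m_def)
 next
  fix \<mu>' assume *: "sets \<mu>' = sets borel \<and> (\<forall>c\<in>A. \<forall>B\<in>sets borel. B \<subseteq> U c --> emeasure \<mu>' B = emeasure (\<nu> c) B)"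
  show "\<mu>' = \<mu>"
  proof (rule measure_eqI)
   fix B assume "B \<in> sets \<mu>'"
   then have B: "B \<in> sets borel" using * by simp
   have "emeasure \<mu>' (B \<inter> E i) = emeasure (\<nu> (cs ! i)) (B \<inter> E i)" if "i < length cs" for i
   proof -
    have "B \<inter> E i \<in> sets borel" "B \<inter> E i \<subseteq> U (cs ! i)" using EU[OF that] E B by auto
    then show ?thesis using * csA[OF that] by blast
   qed
   then show "emeasure \<mu>' B = emeasure \<mu> B" using split[of \<mu>' B] * B by (simp add: m m_def)
  qed (use * s\<mu> in simp)
 qed
qed

lemma volume: "sets vol = sets borel" "c \<in> A ==> B \<in> sets borel ==> B \<subseteq> U c ==> emeasure vol B = emeasure (\<nu> c) B"
proof -
 \<comment> \<open>The definition of the volume integrates over the coordinate image of B, which is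
   the same as integrating the indicator of B along the inverse chart.\<close>
 have eq: "(\<integral>\<^sup>+u\<in>\<phi> c ` B. ennreal (\<rho> c u) \<partial>lborel) = emeasure (\<nu> c) B"
  if "c \<in> A" "B \<in> sets borel" "B \<subseteq> U c" for c B
  unfolding emeasure_\<nu>[OF that(1,2)] using chart(5,7)[OF that(1)] that(3)
  by (intro nn_integral_cong) (force simp: indicator_def ext_def wt_def)
 have "vol = (THE \<mu>. sets \<mu> = sets borel \<and> (\<forall>c\<in>A. \<forall>B\<in>sets borel. B \<subseteq> U c --> emeasure \<mu> B = emeasure (\<nu> c) B))"
  unfolding riemannian_volume_def by (simp add: eq cong: conj_cong ball_cong imp_cong)
 then show "sets vol = sets borel" "c \<in> A ==> B \<in> sets borel ==> B \<subseteq> U c ==> emeasure vol B = emeasure (\<nu> c) B"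
  using theI'[OF volume_exists] by auto
qed

lemma sets_vol [measurable_cong, simp]: "sets vol = sets borel" "space vol = UNIV"
 using volume(1) sets_eq_imp_space_eq[OF volume(1)] by auto

lemma \<nu>_eq: "c \<in> A ==> \<nu> c = density vol (indicator (U c))"
proof (rule measure_eqI)
 fix B assume c: "c \<in> A" and "B \<in> sets (\<nu> c)"
 then have B: "B \<in> sets borel" by simp
 have [measurable]: "U c \<in> sets borel" using chart(1)[OF c] by simp
 have "emeasure (\<nu> c) B = emeasure (\<nu> c) (B \<inter> U c)"
  using B c chart(6)[OF c] by (simp add: emeasure_\<nu>) (intro nn_integral_cong, auto simp: wt_def ext_def indicator_def)
 also have "... = emeasure vol (B \<inter> U c)" using B c by (intro volume(2)[symmetric]) auto
 also have "... = emeasure (density vol (indicator (U c))) B"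
  using B by (subst emeasure_density) (auto simp: indicator_inter_arith[symmetric] Int_commute)
 finally show "emeasure (\<nu> c) B = emeasure (density vol (indicator (U c))) B" .
qed simp

lemma nn_integral_chart:
 assumes c: "c \<in> A" and F [measurable]: "F \<in> borel_measurable borel" and 0: "!!x. x \<notin> U c ==> F x = 0"
 shows "(\<integral>\<^sup>+x. F x \<partial>vol) = (NN u. ennreal (wt c u) * F (\<psi> c u))"
proof -
 have [measurable]: "U c \<in> sets borel" using chart(1)[OF c] by simp
 have "(\<integral>\<^sup>+x. F x \<partial>vol) = (\<integral>\<^sup>+x. indicator (U c) x * F x \<partial>vol)"
  using 0 by (intro nn_integral_cong) (auto simp: indicator_def)
 also have "... = (\<integral>\<^sup>+x. F x \<partial>\<nu> c)" unfolding \<nu>_eq[OF c] by (rule nn_integral_density[symmetric]) auto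
 also have "... = (NN u. ennreal (wt c u) * F (\<psi> c u))"
  unfolding nn_integral_\<nu>[OF c F] by (intro nn_integral_cong) (simp add: ext_def wt_def)
 finally show ?thesis .
qed

lemma integral_chart:
 fixes F :: "'a => real"
 assumes c: "c \<in> A" and F [measurable]: "F \<in> borel_measurable borel" and 0: "!!x. x \<notin> U c ==> F x = 0"
 shows "integrable vol F \<longleftrightarrow> integrable lborel (%u. wt c u * F (\<psi> c u))"
  "(LINT x|vol. F x) = (LB u. wt c u * F (\<psi> c u))"
proof -
 have [measurable]: "U c \<in> sets borel" using chart(1)[OF c] by simp
 have e: "wt c u * F (ext c u) = wt c u * F (\<psi> c u)" for u by (simp add: ext_def wt_def)
 have i: "(%x. indicator (U c) x *\<^sub>R F x) = F" using 0 by (auto simp: fun_eq_iff indicator_def)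
 have d: "density vol (indicator (U c)) = density vol (%x. ennreal (indicator (U c) x))" by (simp add: ennreal_indicator)
 have "integrable vol F \<longleftrightarrow> integrable (\<nu> c) F"
  unfolding \<nu>_eq[OF c] d by (subst integrable_density) (auto simp: i[simplified])
 also have "... \<longleftrightarrow> integrable lborel (%u. wt c u * F (ext c u))"
  unfolding \<nu>_def using c wt_nonneg[OF c] by (subst integrable_distr_eq, measurable, subst integrable_density) auto
 finally show "integrable vol F \<longleftrightarrow> integrable lborel (%u. wt c u * F (\<psi> c u))" by (simp add: e)
 have "(LINT x|vol. F x) = (LINT x|\<nu> c. F x)"
  unfolding \<nu>_eq[OF c] d by (subst integral_density) (auto simp: i[simplified])
 also have "... = (LB u. wt c u * F (ext c u))"
  unfolding \<nu>_def using c wt_nonneg[OF c] by (subst integral_distr, measurable, subst integral_density) auto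
 finally show "(LINT x|vol. F x) = (LB u. wt c u * F (\<psi> c u))" by (simp add: e)
qed

end

subsection \<open>Divergence in arbitrary charts\<close>

lemma Ck_zero_extension:
 assumes "open S" "closed C" "C \<subseteq> S" "Ck_on k S f" "!!x. x \<notin> C ==> f x = 0"
 shows "Ck_on k UNIV f"
proof (rule Ck_on_local)
 fix x
 show "\<exists>U. open U \<and> x \<in> U \<and> Ck_on k U f"
 proof (cases "x \<in> S")
  case False
  have "Ck_on k (- C) f" by (rule Ck_on_cong[OF _ _ Ck_on_const[where c=0]]) (use assms in auto)
  then show ?thesis using assms False by (intro exI[of _ "- C"]) auto
 qed (use assms in blast)
qed

lemma divg_cong:
 assumes "open S" "x \<in> S" "!!y. y \<in> S ==> Y y = Z y" "Z differentiable (at x)"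
 shows "divg Y x = divg Z x"
proof -
 have "(Z has_derivative Dv Z x) (at x)" using assms(4) by (simp add: frechet_derivative_works)
 then have "(Y has_derivative Dv Z x) (at x)"
  by (rule has_derivative_transform_within_open[OF _ assms(1,2)]) (simp add: assms(3))
 from frechet_derivative_at[OF this] show ?thesis by (simp add: divg_def)
qed

lemma divg_sum:
 assumes "!!k. k \<in> I ==> Z k differentiable (at x)"
 shows "divg (%v. \<Sum>k\<in>I. Z k v) x = (\<Sum>k\<in>I. divg (Z k) x)"
proof -
 have "((%v. \<Sum>k\<in>I. Z k v) has_derivative (%h. \<Sum>k\<in>I. Dv (Z k) x h)) (at x)"
  using assms by (intro has_derivative_sum) (simp add: frechet_derivative_works)
 from frechet_derivative_at[OF this, symmetric] show ?thesis
  by (simp add: divg_def inner_sum_left) (rule sum.swap)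
qed

lemma divg_scale:
 assumes "Z differentiable (at x)"
 shows "divg (%v. s *\<^sub>R Z v) x = s * divg Z x"
proof -
 have "((%v. s *\<^sub>R Z v) has_derivative (%h. s *\<^sub>R Dv Z x h)) (at x)"
  using assms by (intro has_derivative_scaleR_right) (simp add: frechet_derivative_works)
 from frechet_derivative_at[OF this, symmetric] show ?thesis by (simp add: divg_def sum_distrib_left)
qed

lemma divg_scaleR:
 fixes h :: "'a::euclidean_space => real"
 assumes h: "(h has_derivative h') (at x)" and Z: "Z differentiable (at x)"
 shows "divg (%v. h v *\<^sub>R Z v) x = h x * divg Z x + h' (Z x)"
proof -
 have "((%v. h v *\<^sub>R Z v) has_derivative (%k. h x *\<^sub>R Dv Z x k + h' k *\<^sub>R Z x)) (at x)"
  using Z by (intro has_derivative_scaleR h) (simp add: frechet_derivative_works)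
 from frechet_derivative_at[OF this, symmetric]
 have "divg (%v. h v *\<^sub>R Z v) x = (\<Sum>b\<in>Basis. (h x *\<^sub>R Dv Z x b + h' b *\<^sub>R Z x) \<bullet> b)" by (simp add: divg_def)
 also have "... = h x * divg Z x + h' (Z x)"
  by (subst has_derivative_sum_Basis[OF h]) (simp add: divg_def inner_add_left sum.distrib sum_distrib_left mult.commute)
 finally show ?thesis .
qed

text \<open>Z lives on S only, but the product of h with Z extends by 0 and has a divergence of
  integral 0; the product rule then separates the two terms.\<close>

lemma local_integral_by_parts:
 fixes h :: "'a::euclidean_space => real"
 assumes S: "open S" "compact C" "C \<subseteq> S" and Z: "Ck_on 1 S Z" and h: "Ck_on 1 UNIV h" "!!x. x \<notin> C ==> h x = 0"
 shows "integrable lborel (%x. h x * divg Z x)" "(LB x. h x * divg Z x) = - (LB x. Dv h x (Z x))"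
proof -
 have oC: "open (- C)" using compact_imp_closed[OF S(2)] by auto
 have dh: "(h has_derivative Dv h x) (at x)" for x
  using h(1) by (simp add: frechet_derivative_works[symmetric])
 have d0: "Dv h x = (%_. 0)" if "x \<notin> C" for x
  using frechet_derivative_eq_0[OF oC, of x h] that h(2) by auto
 have eq: "divg (%v. h v *\<^sub>R Z v) x = h x * divg Z x + Dv h x (Z x)" for x
 proof (cases "x \<in> C")
  case True
  then show ?thesis using Z S by (intro divg_scaleR[OF dh]) auto
 next
  case False
  then have "divg (%v. h v *\<^sub>R Z v) x = 0" using h(2) by (intro divg_eq_0[OF oC]) auto
  then show ?thesis using False d0 h(2) by simp
 qed
 have hZ: "Ck_on 1 UNIV (%v. h v *\<^sub>R Z v)"
  by (rule Ck_zero_extension[OF S(1) compact_imp_closed[OF S(2)] S(3)])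
   (use h Z S in "auto intro!: Ck_on_scaleR intro: Ck_on_subset simp del: Ck_on.simps")
 obtain R where R: "!!x. x \<in> C ==> norm x <= R" using compact_imp_bounded[OF S(2)] unfolding bounded_iff by blast
 have supp: "h x *\<^sub>R Z x = 0" if "R < norm x" for x using R[of x] h(2)[of x] that by force
 have "(LB x. 1 * divg (%v. h v *\<^sub>R Z v) x) = - (LB x. Dv (%_. 1) x (h x *\<^sub>R Z x))"
  by (rule integral_by_parts[OF Ck_on_const hZ supp]) simp_all
 then have 0: "(LB x. divg (%v. h v *\<^sub>R Z v) x) = 0" by simp
 have cext: "continuous_on UNIV F" if "continuous_on S F" "!!x. x \<notin> C ==> F x = 0" for F :: "'a => real"
  using Ck_zero_extension[OF S(1) compact_imp_closed[OF S(2)] S(3), of 0 F] that by simp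
 have int: "integrable lborel F" if "continuous_on S F" "!!x. x \<notin> C ==> F x = 0" for F :: "'a => real"
  using integrable_continuous_bounded_support[OF cext[OF that], of R] that(2) R by force
 show i1: "integrable lborel (%x. h x * divg Z x)"
  by (rule int) (use h(2) continuous_on_divg[OF Z] continuous_on_subset[OF Ck_on_continuous[OF h(1)]] in "auto intro!: continuous_intros")
 have i2: "integrable lborel (%x. Dv h x (Z x))"
 proof (rule int)
  have "continuous_on S (%x. \<Sum>b\<in>Basis. (Z x \<bullet> b) *\<^sub>R Dv h x b)"
   using h(1) Ck_on_continuous[OF Z] by (auto intro!: continuous_intros intro: continuous_on_subset)
  moreover have "(%x. Dv h x (Z x)) = (%x. \<Sum>b\<in>Basis. (Z x \<bullet> b) *\<^sub>R Dv h x b)"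
   by (rule ext) (rule has_derivative_sum_Basis[OF dh])
  ultimately show "continuous_on S (%x. Dv h x (Z x))" by (simp only:)
 qed (simp add: d0)
 show "(LB x. h x * divg Z x) = - (LB x. Dv h x (Z x))"
  using 0 i1 i2 unfolding eq by simp
qed

lemma integral_pos_continuous:
 fixes f :: "'a::euclidean_space => real"
 assumes "integrable lborel f" "!!x. 0 <= f x" "0 < r" "!!x. x \<in> ball a r ==> 0 < f x"
 shows "0 < (LB x. f x)"
proof -
 have "(LB x. f x) ~= 0"
 proof
  assume "(LB x. f x) = 0"
  then have "AE x in lborel. f x = 0" using integral_nonneg_eq_0_iff_AE[OF assms(1)] assms(2) by simp
  then have "AE x in lborel. x \<notin> ball a r" by eventually_elim (use assms(4) in fastforce)
  then have "emeasure lborel (ball a r) = 0" by (subst (asm) AE_iff_measurable[of "ball a r"]) auto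
  then show False using emeasure_ball[of r a] unit_ball_vol_pos[of "real DIM('a)"] assms(3) by simp
 qed
 moreover have "0 <= (LB x. f x)" using assms(2) by (intro integral_nonneg)
 ultimately show ?thesis by simp
qed

context riemannian
begin

abbreviation "X\<^sub>c c X \<equiv> field_coords A c X"
abbreviation "\<rho>X c X \<equiv> (%v. \<rho> c v *\<^sub>R field_coords A c X v)"

lemma \<rho>_nz: "c \<in> A ==> \<forall>u\<in>V c. \<rho> c u ~= 0"
 using \<rho>_pos by (metis less_irrefl)

text \<open>The image of C is compact and hence closed in the manifold, so the domain of d is
  covered by the overlap with c and the open set on which F vanishes.\<close>

lemma Ck_extension:
 assumes c: "c \<in> A" "d \<in> A" and C: "compact C" "C \<subseteq> V c" and F: "Ck_on k (W d c) F"
  "!!u. u \<in> V d ==> \<psi> d u \<notin> \<psi> c ` C ==> F u = 0"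
 shows "Ck_on k (V d) F"
proof (rule Ck_on_local)
 fix u assume u: "u \<in> V d"
 show "\<exists>U. open U \<and> u \<in> U \<and> Ck_on k U F"
 proof (cases "u \<in> W d c")
  case False
  let ?S = "{u \<in> V d. \<psi> d u \<in> - (\<psi> c ` C)}"
  have "closed (\<psi> c ` C)"
   using C chart(4)[OF c(1)] by (intro compact_imp_closed compact_continuous_image) (auto intro: continuous_on_subset)
  then have S: "open ?S" by (intro open_chart_vimage c) auto
  have "Ck_on k ?S F" by (rule Ck_on_cong[OF S _ Ck_on_const[OF S, where c=0]]) (use F(2) in auto)
  moreover have "u \<in> ?S" using False u C(2) chart(6)[OF c(1)] W_iff[OF c(2), of u c] by auto
  ultimately show ?thesis using S by blast
 qed (use F(1) open_W[OF c(2,1)] in blast)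
qed

lemma field_coords_change:
 assumes c: "c \<in> A" "d \<in> A" "x \<in> U c" "x \<in> U d"
 shows "field_coords A d X (\<phi> d x) = D c d x (field_coords A c X (\<phi> c x))"
 using D_chain[OF chart_at(1) c(1,2) chart_at(2) c(3,4)] chart(5)[OF c(1,3)] chart(5)[OF c(2,4)]
 by (simp add: field_coords_def tangent_to_coords_def)

lemma smooth_field: "smooth_vector_field A X ==> c \<in> A ==> Ck_on k (V c) (X\<^sub>c c X)"
 by (auto simp: smooth_vector_field_def smooth_on_def)

lemma Ck_\<rho>X: "smooth_vector_field A X ==> c \<in> A ==> Ck_on k (V c) (\<rho>X c X)"
 by (intro Ck_on_scaleR chart(2) Ck_\<rho> smooth_field)

lemma \<rho>X_diff: "smooth_vector_field A X ==> c \<in> A ==> x \<in> U c ==> \<rho>X c X differentiable (at (\<phi> c x))"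
 using Ck_\<rho>X[of X c "Suc 0"] by auto

lemma divergence_eq:
 assumes "smooth_vector_field A X"
 shows "divergence A g X x = divg (\<rho>X (K x) X) (\<phi> (K x) x) / \<rho> (K x) (\<phi> (K x) x)"
 using sum_partial_eq_divg[OF \<rho>X_diff[OF assms chart_at, of x]] by (simp add: divergence_def Let_def)

end

context compact_riemannian
begin

text \<open>The purpose is the form of the right hand side: the differential of the test function
  applied to X does not depend on the chart, so neither does the weak form of the
  divergence.\<close>

lemma integral_chart_divergence:
 assumes X: "smooth_vector_field A X" and c: "c \<in> A" and C: "compact C" "C \<subseteq> V c"
  and h: "Ck_on 1 UNIV h" "!!u. u \<notin> C ==> h u = 0"
 defines "E \<equiv> %x. if x \<in> U c then h (\<phi> c x) * (divg (\<rho>X c X) (\<phi> c x) / \<rho> c (\<phi> c x)) else 0"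
 shows "integrable vol E" "(LINT x|vol. E x) = - (LINT x|vol. (if x \<in> U c then Dv h (\<phi> c x) (X\<^sub>c c X (\<phi> c x)) else 0))"
proof -
 note P = local_integral_by_parts[OF chart(2)[OF c] C Ck_\<rho>X[OF X c] h]
 have dh: "(h has_derivative Dv h u) (at u)" for u using Ck_on_SucD(1)[OF h(1)[unfolded One_nat_def]] by auto
 let ?F = "%x. if x \<in> U c then Dv h (\<phi> c x) (X\<^sub>c c X (\<phi> c x)) else 0"
 have E: "E \<in> borel_measurable borel"
  unfolding E_def
  using continuous_on_divg[OF Ck_\<rho>X[OF X c]] Ck_on_continuous[OF Ck_\<rho>[OF c]] Ck_on_continuous[OF h(1)]
  by (intro measurable_if_open chart(1)[OF c] continuous_on_compose2[OF _ chart(3)[OF c], of "V c" "%u. h u * (divg (\<rho>X c X) u / \<rho> c u)"]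
   continuous_on_mult continuous_on_divide \<rho>_nz[OF c]) (auto intro: continuous_on_subset)
 have F: "?F \<in> borel_measurable borel"
 proof (rule measurable_if_open[OF chart(1)[OF c]])
  have "continuous_on (V c) (%u. \<Sum>b\<in>Basis. (X\<^sub>c c X u \<bullet> b) *\<^sub>R Dv h u b)"
   using Ck_on_continuous[OF smooth_field[OF X c]] h(1) by (intro continuous_intros) (auto intro: continuous_on_subset)
  then have "continuous_on (V c) (%u. Dv h u (X\<^sub>c c X u))" by (simp only: has_derivative_sum_Basis[OF dh, symmetric])
  then show "continuous_on (U c) (%x. Dv h (\<phi> c x) (X\<^sub>c c X (\<phi> c x)))"
   by (rule continuous_on_compose2[OF _ chart(3)[OF c]]) auto
 qed
 have e: "wt c u * E (\<psi> c u) = h u * divg (\<rho>X c X) u" for u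
  using C(2) h(2)[of u] \<rho>_nz[OF c] chart(6,7)[OF c] by (cases "u \<in> V c") (auto simp: wt_def E_def)
 have f: "wt c u * ?F (\<psi> c u) = Dv h u (\<rho>X c X u)" for u
 proof (cases "u \<in> V c")
  case True
  then show ?thesis using chart(6,7)[OF c True] linear_scale[OF has_derivative_linear[OF dh]] by (simp add: wt_def)
 next
  case False
  then have "Dv h u = (%_. 0)" using C h(2) by (intro frechet_derivative_eq_0[of "- C"]) (auto intro: compact_imp_closed)
  then show ?thesis using False by (simp add: wt_def)
 qed
 show "integrable vol E" using integral_chart(1)[OF c E] P(1) by (simp add: e) (simp add: E_def)
 show "(LINT x|vol. E x) = - (LINT x|vol. ?F x)"
  using integral_chart(2)[OF c E] integral_chart(2)[OF c F] P(2) by (simp add: e f) (simp add: E_def)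
qed

text \<open>If the expression in c exceeded that in d at x, the difference would be positive on a
  small ball. Both expressions integrate against the same bump to the same value, by
  \<open>integral_chart_divergence\<close>, so the difference integrates to 0, a contradiction. The
  weak argument avoids differentiating the Jacobian of the transition map; the opposite inequality
  follows by exchanging the charts.\<close>

lemma divergence_le:
 assumes X: "smooth_vector_field A X" and c: "c \<in> A" "d \<in> A" "x \<in> U c" "x \<in> U d"
 shows "divg (\<rho>X c X) (\<phi> c x) / \<rho> c (\<phi> c x) <= divg (\<rho>X d X) (\<phi> d x) / \<rho> d (\<phi> d x)"
proof (rule ccontr)
 let ?q = "%c u. divg (\<rho>X c X) u / \<rho> c u"
 define \<beta> where "\<beta> = (%u. ?q c u - ?q d (\<tau> c d u))"
 assume "\<not> ?thesis"
 then have pos: "0 < \<beta> (\<phi> c x)" by (simp add: \<beta>_def tr(2)[OF c(1-3)])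
 have cq: "continuous_on (V c) (?q c)" if "c \<in> A" for c
  using continuous_on_divg[OF Ck_\<rho>X[OF X that]] Ck_on_continuous[OF Ck_\<rho>[OF that]]
  by (intro continuous_on_divide \<rho>_nz that)
 have c\<tau>: "continuous_on (W c d) (\<tau> c d)" by (rule Ck_on_continuous[OF tr(3)[OF c(1,2)]])
 have "continuous_on (W c d) \<beta>"
  unfolding \<beta>_def using cq[OF c(1)] tr(2)[OF c(1,2)]
  by (intro continuous_on_diff continuous_on_compose2[OF cq[OF c(2)] c\<tau>]) (auto intro: continuous_on_subset)
 then have "open (W c d \<inter> \<beta> -` {0<..})" using open_W[OF c(1,2)] by (intro continuous_open_preimage) auto
 then obtain r where r: "0 < r" "cball (\<phi> c x) r \<subseteq> W c d \<inter> \<beta> -` {0<..}"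
  using pos c open_contains_cball by (metis (no_types, lifting) IntI greaterThan_iff image_eqI vimageI)
 let ?a = "\<phi> c x" and ?C = "cball (\<phi> c x) r"
 have CW: "?C \<subseteq> W c d" using r by auto
 define h where "h = (%u. bump r (u - ?a))"
 have h: "Ck_on k UNIV h" for k
  unfolding h_def by (rule Ck_on_compose[OF open_UNIV open_UNIV Ck_on_diff[OF open_UNIV Ck_on_id Ck_on_const] Ck_on_bump]) auto
 have h0: "h u = 0" if "u \<notin> ?C" for u using that r(1) by (auto simp: h_def dist_norm norm_minus_commute intro!: bump_eq_0)
 have dh: "(h has_derivative Dv h u) (at u)" for u using Ck_on_SucD(1)[OF h[of "Suc 0"]] by auto
 \<comment> \<open>The same bump in the coordinates of d.\<close>
 define k where "k = (%y. if y \<in> W d c then h (\<tau> d c y) else 0)"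
 have W: "open (W c d)" "open (W d c)" using open_W c by auto
 let ?C' = "\<tau> c d ` ?C"
 have C': "compact ?C'" "?C' \<subseteq> W d c"
  using CW tr(2)[OF c(1,2)] by (auto intro!: compact_continuous_image continuous_on_subset[OF c\<tau>])
 have \<tau>\<tau>: "\<tau> c d (\<tau> d c y) = y" "\<tau> d c y \<in> W c d" if "y \<in> W d c" for y using that tr(2)[OF c(1,2)] tr(2)[OF c(2,1)] by auto
 have k0: "k y = 0" if "y \<notin> ?C'" for y using that h0[of "\<tau> d c y"] \<tau>\<tau>(1)[of y] by (force simp: k_def)
 have k: "Ck_on 1 UNIV k"
 proof (rule Ck_zero_extension[OF W(2) compact_imp_closed[OF C'(1)] C'(2) _ k0])
  have "Ck_on 1 (W d c) (%y. h (\<tau> d c y))" by (rule Ck_on_compose[OF W(2) open_UNIV tr(3)[OF c(2,1)] h]) simp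
  then show "Ck_on 1 (W d c) k" by (rule Ck_on_cong[OF W(2), rotated]) (simp add: k_def)
 qed
 have dk: "Dv h (\<phi> c p) v = Dv k (\<phi> d p) (D c d p v)" if p: "p \<in> U c" "p \<in> U d" for p v
 proof -
  have "(k has_derivative Dv k (\<phi> d p)) (at (\<phi> d p))" using Ck_on_SucD(1)[OF k[unfolded One_nat_def]] by auto
  then have "((%u. k (\<tau> c d u)) has_derivative (%v. Dv k (\<phi> d p) (D c d p v))) (at (\<phi> c p))"
   using has_derivative_compose[OF tr(4)[OF c(1,2) p]] tr(2)[OF c(1,2) p(1)] by simp
  then have "(h has_derivative (%v. Dv k (\<phi> d p) (D c d p v))) (at (\<phi> c p))"
  proof (rule has_derivative_transform_within_open[OF _ W(1)])
   fix u assume "u \<in> W c d"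
   then obtain p where "p \<in> U c" "p \<in> U d" "u = \<phi> c p" by blast
   then show "k (\<tau> c d u) = h u" using tr(2)[OF c(1,2)] tr(2)[OF c(2,1)] by (simp add: k_def)
  qed (use p in auto)
  from has_derivative_unique[OF this dh] show ?thesis by metis
 qed
 let ?E = "%c h x. if x \<in> U c then h (\<phi> c x) * ?q c (\<phi> c x) else 0"
 let ?F = "%c h x. if x \<in> U c then Dv h (\<phi> c x) (X\<^sub>c c X (\<phi> c x)) else 0"
 have F: "?F c h p = ?F d k p" for p
 proof (cases "p \<in> U c \<inter> U d")
  case True
  then show ?thesis using dk field_coords_change[OF c(1,2)] by simp
 next
  case False
  then have "p \<in> U c ==> \<phi> c p \<notin> W c d" "p \<in> U d ==> \<phi> d p \<notin> W d c"
   using False by (simp_all add: W_iff[OF c(1)] W_iff[OF c(2)] chart(5)[OF c(1)] chart(5)[OF c(2)])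
  then have "p \<in> U c ==> \<phi> c p \<notin> ?C" "p \<in> U d ==> \<phi> d p \<notin> ?C'" using CW C'(2) by blast+
  moreover have "Dv h u = (%_. 0)" if "u \<notin> ?C" for u using frechet_derivative_eq_0[of "- ?C" u h] that h0 by (simp add: open_Compl)
  moreover have "Dv k y = (%_. 0)" if "y \<notin> ?C'" for y
   using frechet_derivative_eq_0[of "- ?C'" y k] that k0 compact_imp_closed[OF C'(1)] by (simp add: open_Compl)
  ultimately show ?thesis by simp
 qed
 have CV: "?C \<subseteq> V c" "?C' \<subseteq> V d" using CW C'(2) by auto
 note E = integral_chart_divergence[OF X c(1) compact_cball CV(1) h h0] integral_chart_divergence[OF X c(2) C'(1) CV(2) k k0]
 define R where "R p = ?E c h p - ?E d k p" for p
 have R: "integrable vol R" "(LINT p|vol. R p) = 0" unfolding R_def using E F by simp_all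
 have R0: "R p = 0" if "p \<notin> U c" for p
 proof -
  have "\<phi> d p \<notin> W d c" if "p \<in> U d" using that \<open>p \<notin> U c\<close> by (simp add: W_iff[OF c(2)] chart(5)[OF c(2)])
  then show ?thesis using that by (simp add: R_def k_def)
 qed
 have f1: "wt c u * R (\<psi> c u) = h u * (\<rho> c u * \<beta> u)" for u
 proof (cases "u \<in> W c d")
  case True
  then obtain p where p: "p \<in> U c" "p \<in> U d" "u = \<phi> c p" by blast
  then show ?thesis using \<rho>_nz[OF c(1)] tr(2)[OF c(1,2) p(1)] tr(2)[OF c(2,1) p(2)] chart(5)[OF c(1) p(1)]
   by (simp add: wt_def R_def \<beta>_def k_def right_diff_distrib)
 next
  case False
  then have "h u = 0" using h0[of u] CW by blast
  moreover have "?E d k (\<psi> c u) = 0" if "u \<in> V c"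
   using W_iff[OF c(1), of u d] that False by simp
  ultimately show ?thesis using chart(7)[OF c(1)] by (cases "u \<in> V c") (auto simp: wt_def R_def split: if_splits)
 qed
 have "R \<in> borel_measurable borel" using borel_measurable_integrable[OF R(1)] by (simp add: measurable_def)
 from integral_chart[OF c(1) this R0] have i: "integrable lborel (%u. h u * (\<rho> c u * \<beta> u))" and "(LB u. h u * (\<rho> c u * \<beta> u)) = 0"
  using R by (simp_all add: f1)
 moreover have "0 < (LB u. h u * (\<rho> c u * \<beta> u))"
 proof (rule integral_pos_continuous[OF i _ r(1)])
  have p: "0 < \<rho> c u * \<beta> u" if "u \<in> ?C" for u
  proof -
   have "u \<in> V c" "0 < \<beta> u" using that r(2) CW by auto
   then show ?thesis using \<rho>_pos[OF c(1)] by simp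
  qed
  show "0 <= h u * (\<rho> c u * \<beta> u)" for u
   using p[of u] h0[of u] bump_nonneg[of r "u - ?a"] by (cases "u \<in> ?C") (auto simp: h_def intro!: mult_nonneg_nonneg less_imp_le)
  show "0 < h u * (\<rho> c u * \<beta> u)" if "u \<in> ball ?a r" for u
   by (rule mult_pos_pos[OF _ p]) (use that r(1) in "auto simp: h_def bump_pos_iff dist_norm norm_minus_commute")
 qed
 ultimately show False by simp
qed

lemma divergence_chart:
 assumes X: "smooth_vector_field A X" and c: "c \<in> A" "x \<in> U c"
 shows "divergence A g X x = divg (\<rho>X c X) (\<phi> c x) / \<rho> c (\<phi> c x)"
 unfolding divergence_eq[OF X] using divergence_le[OF X c(1) chart_at(1) c(2) chart_at(2)]
  divergence_le[OF X chart_at(1) c(1) chart_at(2) c(2)] by simp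

text \<open>The definition evaluates each point in its own preferred chart, a discontinuous choice;
  by \<open>divergence_chart\<close> the preferred chart of x serves all points near x.\<close>

lemma continuous_divergence:
 assumes X: "smooth_vector_field A X"
 shows "continuous_on UNIV (divergence A g X)"
proof (rule continuous_at_imp_continuous_on, rule ballI)
 fix x
 let ?c = "K x"
 have "continuous_on (V ?c) (%u. divg (\<rho>X ?c X) u / \<rho> ?c u)"
  using continuous_on_divg[OF Ck_\<rho>X[OF X chart_at(1)]] Ck_on_continuous[OF Ck_\<rho>[OF chart_at(1)]]
  by (intro continuous_on_divide \<rho>_nz chart_at)
 then have "continuous_on (U ?c) (%y. divg (\<rho>X ?c X) (\<phi> ?c y) / \<rho> ?c (\<phi> ?c y))"
  by (rule continuous_on_compose2[OF _ chart(3)[OF chart_at(1)]]) auto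
 then have "continuous_on (U ?c) (divergence A g X)"
  by (simp add: divergence_chart[OF X chart_at(1)] cong: continuous_on_cong)
 then show "isCont (divergence A g X) x" using chart(1)[OF chart_at(1)] chart_at(2) continuous_on_eq_continuous_at by blast
qed

section \<open>Sums and multiples of vector fields\<close>

lemma divergence_sum:
 assumes "finite I" and X: "!!k. k \<in> I ==> smooth_vector_field A (X k)" and Y: "smooth_vector_field A (%x. \<Sum>k\<in>I. X k x)"
 shows "divergence A g (%x. \<Sum>k\<in>I. X k x) x = (\<Sum>k\<in>I. divergence A g (X k) x)"
proof -
 let ?c = "K x"
 have "\<rho>X ?c (%x. \<Sum>k\<in>I. X k x) u = (\<Sum>k\<in>I. \<rho>X ?c (X k) u)" if "u \<in> V ?c" for u
  by (simp add: field_coords_def tangent_to_coords_def scaleR_sum_right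
   linear_sum[OF linear_D[OF chart_at(1) chart_at(1)[of x] chart_at(2) chart(6)[OF chart_at(1) that]]])
 then have "divg (\<rho>X ?c (%x. \<Sum>k\<in>I. X k x)) (\<phi> ?c x) = divg (%u. \<Sum>k\<in>I. \<rho>X ?c (X k) u) (\<phi> ?c x)"
  using assms(1) X by (intro divg_cong[OF chart(2)[OF chart_at(1)[of x]]] differentiable_sum) (auto intro: chart_at \<rho>X_diff)
 also have "... = (\<Sum>k\<in>I. divg (\<rho>X ?c (X k)) (\<phi> ?c x))" using X chart_at by (intro divg_sum) (auto intro: \<rho>X_diff)
 finally show ?thesis using X by (simp add: divergence_eq Y sum_divide_distrib)
qed

lemma smooth_vector_field_sum:
 assumes X: "!!k. k \<in> I ==> smooth_vector_field A (X k)"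
 shows "smooth_vector_field A (%x. \<Sum>k\<in>I. X k x)"
 unfolding smooth_vector_field_def smooth_on_def
proof (intro ballI allI)
 fix c k assume c: "c \<in> A"
 show "Ck_on k (V c) (X\<^sub>c c (%x. \<Sum>k\<in>I. X k x))"
 proof (rule Ck_on_cong[OF chart(2)[OF c]])
  show "Ck_on k (V c) (%u. \<Sum>i\<in>I. X\<^sub>c c (X i) u)" by (intro Ck_on_sum chart(2) c smooth_field X)
  fix u assume "u \<in> V c"
  then show "(\<Sum>i\<in>I. X\<^sub>c c (X i) u) = X\<^sub>c c (%x. \<Sum>k\<in>I. X k x) u"
   by (simp add: field_coords_def tangent_to_coords_def linear_sum[OF linear_D[OF chart_at(1) c chart_at(2) chart(6)[OF c]]])
 qed
qed

lemma smooth_vector_field_mult: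
 assumes X: "smooth_vector_field A X" and h: "!!c k. c \<in> A ==> Ck_on k (V c) (%u. h (\<psi> c u))"
 shows "smooth_vector_field A (%x. h x *\<^sub>R X x)"
  "c \<in> A ==> u \<in> V c ==> field_coords A c (%x. h x *\<^sub>R X x) u = h (\<psi> c u) *\<^sub>R field_coords A c X u"
proof -
 show eq: "field_coords A c (%x. h x *\<^sub>R X x) u = h (\<psi> c u) *\<^sub>R field_coords A c X u" if "c \<in> A" "u \<in> V c" for c u
  using linear_scale[OF linear_D[OF chart_at(1) that(1) chart_at(2) chart(6)[OF that]]] by (simp add: field_coords_def tangent_to_coords_def)
 show "smooth_vector_field A (%x. h x *\<^sub>R X x)"
  unfolding smooth_vector_field_def smooth_on_def
 proof (intro ballI allI)
  fix c k assume c: "c \<in> A"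
  show "Ck_on k (V c) (X\<^sub>c c (%x. h x *\<^sub>R X x))"
   by (rule Ck_on_cong[OF chart(2)[OF c] _ Ck_on_scaleR[OF chart(2)[OF c] h[OF c] smooth_field[OF X c]]]) (simp add: eq[OF c])
 qed
qed

text \<open>\<open>Z\<close> is the coordinate expression of \<open>\<rho> X\<close>, extended by zero.\<close>

lemma integral_divergence_chart:
 fixes Z :: "real^'n => real^'n"
 assumes X: "smooth_vector_field A X" and c: "c \<in> A" and C: "compact C" "C \<subseteq> V c"
  and f [measurable]: "f \<in> borel_measurable borel"
  and Z: "!!u. u \<in> V c ==> Z u = \<rho> c u *\<^sub>R field_coords A c X u" "!!u. u \<notin> C ==> Z u = 0"
  and X0: "!!x. x \<notin> \<psi> c ` C ==> X x = 0" and k: "!!u. u \<in> C ==> k u = f (\<psi> c u)"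
 shows "(LINT x|vol. f x * divergence A g X x) = (LB u. k u * divg Z u)"
proof -
 have cl: "closed (\<psi> c ` C)"
  using C chart(4)[OF c] by (intro compact_imp_closed compact_continuous_image) (auto intro: continuous_on_subset)
 have d0: "divergence A g X x = 0" if "x \<notin> \<psi> c ` C" for x
 proof -
  let ?S = "{u \<in> V (K x). \<psi> (K x) u \<in> - (\<psi> c ` C)}"
  have "divg (\<rho>X (K x) X) (\<phi> (K x) x) = 0"
  proof (rule divg_eq_0)
   show "open ?S" using cl by (intro open_chart_vimage chart_at) auto
   show "\<phi> (K x) x \<in> ?S" using that chart_at chart(5)[OF chart_at] by auto
   fix u assume u: "u \<in> ?S"
   then have "X (\<psi> (K x) u) = 0" using X0 by auto
   then show "\<rho>X (K x) X u = 0"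
    using linear_0[OF linear_D[OF chart_at(1) chart_at(1)[of x] chart_at(2) chart(6)[OF chart_at(1)]]] u
    by (simp add: field_coords_def tangent_to_coords_def)
  qed
  then show ?thesis by (simp add: divergence_eq[OF X])
 qed
 have [measurable]: "divergence A g X \<in> borel_measurable borel" by (rule borel_measurable_continuous_onI[OF continuous_divergence[OF X]])
 have "(LINT x|vol. f x * divergence A g X x) = (LB u. wt c u * (f (\<psi> c u) * divergence A g X (\<psi> c u)))"
 proof (rule integral_chart(2)[OF c])
  fix x assume "x \<notin> U c"
  then have "x \<notin> \<psi> c ` C" using C(2) chart(6)[OF c] by blast
  then show "f x * divergence A g X x = 0" by (simp add: d0)
 qed measurable
 also have "... = (LB u. k u * divg Z u)"
 proof (rule integral_cong[OF refl])
  fix u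
  show "wt c u * (f (\<psi> c u) * divergence A g X (\<psi> c u)) = k u * divg Z u"
  proof (cases "u \<in> C")
   case True
   then have u: "u \<in> V c" using C by auto
   have "divg Z u = divg (\<rho>X c X) u"
    by (rule divg_cong[OF chart(2)[OF c] u Z(1)]) (use \<rho>X_diff[OF X c] u in auto)
   then show ?thesis using True u \<rho>_pos[OF c u] chart(7)[OF c u]
    by (simp add: k wt_def divergence_chart[OF X c chart(6)[OF c u]])
  next
   case False
   then have "divg Z u = 0" using Z(2) compact_imp_closed[OF C(1)] by (intro divg_eq_0[of "- C"]) auto
   moreover have "wt c u * divergence A g X (\<psi> c u) = 0"
   proof (cases "u \<in> V c")
    case True
    have "\<psi> c u \<notin> \<psi> c ` C"
    proof
     assume "\<psi> c u \<in> \<psi> c ` C"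
     then obtain y where "y \<in> C" "\<psi> c u = \<psi> c y" by blast
     then have "u = y" using chart(7)[OF c True] chart(7)[OF c subsetD[OF C(2)], of y] by metis
     with \<open>y \<in> C\<close> False show False by simp
    qed
    then show ?thesis by (simp add: d0)
   qed (simp add: wt_def)
   ultimately show ?thesis by (metis mult.left_commute mult_zero_right)
  qed
 qed
 finally show ?thesis .
qed

end

subsection \<open>Chart invariance of the geodesic equation\<close>

text \<open>For small a and b, f (x + a v + b u) - f (x + a v) is the integral of the u-derivative
  over [0, b]. Differentiating in a at 0 under the integral expresses the increment of the
  v-derivative along u as an integral of the second derivative, and differentiating that in b at 0
  gives the symmetry.\<close>

lemma second_derivative_symmetric:
 fixes f :: "'a::real_normed_vector => 'b::euclidean_space"
 assumes S: "open S" "x \<in> S" and f: "Ck_on (Suc (Suc 0)) S f"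
 shows "Dv (%y. Dv f y u) x v = Dv (%y. Dv f y v) x u"
proof -
 let ?G = "%u v y. Dv (%y. Dv f y u) y v" and ?P = "%a b. x + a *\<^sub>R v + b *\<^sub>R u"
 have line: "((%s. k (y + s *\<^sub>R w)) has_vector_derivative Dv k (y + s *\<^sub>R w) w) (at s within T)"
  if "Ck_on (Suc m) S k" "y + s *\<^sub>R w \<in> S" for k :: "'a => 'b" and y w s m T
 proof -
  have der: "(k has_derivative Dv k (y + s *\<^sub>R w)) (at (y + s *\<^sub>R w))" by (rule Ck_on_SucD(1)[OF that])
  have "((%s. y + s *\<^sub>R w) has_derivative (%h. h *\<^sub>R w)) (at s within T)" by (auto intro!: derivative_eq_intros)
  from has_derivative_compose[OF this der] show ?thesis
   using linear_scale[OF has_derivative_linear[OF der]] by (simp add: has_vector_derivative_def)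
 qed
 obtain r where r: "0 < r" "ball x r \<subseteq> S" using S openE by blast
 \<comment> \<open>Small enough that the parallelogram spanned by t v and t u stays in the ball of
   radius r.\<close>
 define t where "t = r / 2 / (norm v + norm u + 1)"
 have nn: "0 < norm v + norm u + 1" by (intro add_nonneg_pos) auto
 have t: "0 < t" using r nn by (simp add: t_def)
 have P: "?P a b \<in> S" if "a \<in> {0..t}" "b \<in> {0..t}" for a b
 proof -
  have "dist x (?P a b) = norm (a *\<^sub>R v + b *\<^sub>R u)" by (subst dist_commute) (simp add: dist_norm add.assoc)
  also have "... <= norm (a *\<^sub>R v) + norm (b *\<^sub>R u)" by (rule norm_triangle_ineq)
  also have "... <= t * norm v + t * norm u" using that by (auto intro!: add_mono mult_right_mono)
  also have "... < t * (norm v + norm u + 1)" using t by (simp add: distrib_left)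
  also have "... = r / 2" unfolding t_def by (rule nonzero_eq_divide_eq[THEN iffD1]) (use nn in auto)
  finally show ?thesis using r by auto
 qed
 note f1 = Ck_on_SucD(2)[OF f]
 have cG: "continuous_on S (?G u v)" by (rule Ck_on_continuous[OF Ck_on_SucD(2)[OF f1]])
 have cP: "continuous_on {0..t} (%s. ?G u v (?P 0 s))"
  by (rule continuous_on_compose2[OF cG]) (use P[of 0] t in "auto intro!: continuous_intros")
 have I: "Dv f (?P 0 b) v - Dv f x v = integral {0..b} (%s. ?G u v (?P 0 s))" if b: "b \<in> {0..t}" for b
 proof -
  have FTC: "((%s. Dv f (?P a s) u) has_integral f (?P a b) - f (?P a 0)) {0..b}" if "a \<in> {0..t}" for a
   by (rule fundamental_theorem_of_calculus) (use that b P in "auto intro!: line[OF f]")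
  have "((%a. integral (cbox 0 b) (%s. Dv f (?P a s) u)) has_vector_derivative integral (cbox 0 b) (%s. ?G u v (?P 0 s))) (at 0 within {0..t})"
  proof (rule leibniz_rule_vector_derivative)
   show "((%a. Dv f (?P a s) u) has_vector_derivative ?G u v (?P a s)) (at a within {0..t})" if "a \<in> {0..t}" "s \<in> cbox 0 b" for a s
    using line[OF f1, of "x + s *\<^sub>R u" a v] P[of a s] that b by (simp add: ac_simps)
   show "continuous_on ({0..t} \<times> cbox 0 b) (%(a, s). ?G u v (?P a s))"
    unfolding split_beta by (rule continuous_on_compose2[OF cG]) (use P b in "auto intro!: continuous_intros")
  qed (use t FTC in "auto simp: integrable_on_def")
  from this[unfolded cbox_interval] have "((%a. f (?P a b) - f (?P a 0)) has_vector_derivative integral {0..b} (%s. ?G u v (?P 0 s))) (at 0 within {0..t})"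
   by (rule has_vector_derivative_transform[rotated 2]) (use t integral_unique[OF FTC] in auto)
  moreover have "((%a. f (?P a b) - f (?P a 0)) has_vector_derivative Dv f (?P 0 b) v - Dv f x v) (at 0 within {0..t})"
   using line[OF f, of "x + b *\<^sub>R u" 0 v] line[OF f, of x 0 v] P[of 0 b] b t S(2) by (intro has_vector_derivative_diff) (auto simp: ac_simps)
  ultimately show ?thesis using t by (intro vector_derivative_unique_within_closed_interval[of 0 t 0]) auto
 qed
 have "((%b. integral {0..b} (%s. ?G u v (?P 0 s))) has_vector_derivative ?G u v (?P 0 0)) (at 0 within {0..t})"
  by (rule integral_has_vector_derivative[OF cP]) (use t in simp)
 then have "((%b. Dv f (?P 0 b) v - Dv f x v) has_vector_derivative ?G u v (?P 0 0)) (at 0 within {0..t})"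
  by (rule has_vector_derivative_transform[rotated 2]) (use t I in auto)
 moreover have "((%b. Dv f (?P 0 b) v - Dv f x v) has_vector_derivative ?G v u x) (at 0 within {0..t})"
  using line[OF Ck_on_SucD(2)[OF f], of x 0 u] S(2) by (auto intro!: derivative_eq_intros)
 ultimately have "?G u v (?P 0 0) = ?G v u x" using t by (intro vector_derivative_unique_within_closed_interval[of 0 t 0]) auto
 then show ?thesis by simp
qed

lemma has_derivative_qform:
 fixes M :: "'b::real_normed_vector => real^'n^'n"
 assumes "(M has_derivative M') (at x)" "(v has_derivative v') (at x)" "(w has_derivative w') (at x)"
 shows "((%u. qform (M u) (v u) (w u)) has_derivative
  (%h. qform (M x) (v x) (w' h) + qform (M' h) (v x) (w x) + qform (M x) (v' h) (w x))) (at x)"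
proof -
 have "bilinear (%(M::real^'n^'n) w. M *v w)"
  by (auto simp: bilinear_def matrix_vector_right_distrib matrix_vector_mult_scaleR matrix_vector_mult_add_rdistrib scaleR_matrix_vector_assoc intro!: linearI)
 then have bb: "bounded_bilinear (%(M::real^'n^'n) w. M *v w)" by (simp add: bilinear_conv_bounded_bilinear)
 show ?thesis unfolding qform_def
  by (rule has_derivative_eq_rhs[OF has_derivative_inner[OF assms(2) bounded_bilinear.FDERIV[OF bb assms(1,3)]]]) (simp add: inner_add_right)
qed

context riemannian
begin

definition "\<Gamma> c u p = (\<chi> k. \<Sum>i\<in>UNIV. \<Sum>j\<in>UNIV. christoffel A g c k i j u * p $ i * p $ j)"

text \<open>The Euler-Lagrange expression of the energy G(p, p) / 2 at position u with velocity p
  and acceleration a, tested against q. It contains no inverse matrix and no index, which makes its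
  change of charts a short computation.\<close>

definition "EL c u a p q = qform (G c u) a q + qform (Dv (G c) u p) p q - qform (Dv (G c) u q) p p / 2"

lemma G_deriv: "c \<in> A ==> u \<in> V c ==> (G c has_derivative Dv (G c) u) (at u)"
 using Ck_on_SucD(1)[OF Ck_G[of c "Suc 0"]] .

text \<open>Contracted with the symmetric p_i p_j, the first two terms of the Christoffel symbol
  contribute equally and add up to \<open>qform (Dv (G c) u p) p q\<close>; the third gives the term
  with the factor 1/2.\<close>

lemma EL_\<Gamma>:
 assumes c: "c \<in> A" "u \<in> V c"
 shows "EL c u a p q = qform (G c u) (a + \<Gamma> c u p) q"
proof -
 define T where "T i j l = Dv (G c) u (axis i 1) $ j $ l" for i j l
 have part: "partial i (%v. G c v $ j $ l) u = T i j l" for i j l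
 proof -
  have "((%v. G c v $ j $ l) has_derivative (%h. Dv (G c) u h $ j $ l)) (at u)"
   by (intro bounded_linear.has_derivative[OF bounded_linear_vec_nth] G_deriv c)
  from frechet_derivative_at[OF this, symmetric] show ?thesis by (simp add: partial_def T_def)
 qed
 have DG: "Dv (G c) u h $ j $ l = (\<Sum>i\<in>UNIV. h $ i * T i j l)" for h j l
  by (subst has_derivative_sum_Basis[OF G_deriv[OF c]]) (simp add: sum_Basis_vec T_def inner_axis)
 define y where "y = (\<chi> l. (\<Sum>i\<in>UNIV. \<Sum>j\<in>UNIV. (T i j l + T j i l - T l i j) * (p $ i * p $ j)) / 2)"
 have "\<Gamma> c u p = matrix_inv (G c u) *v y"
  unfolding vec_eq_iff
 proof
  fix k
  have "\<Gamma> c u p $ k = (\<Sum>i\<in>UNIV. \<Sum>j\<in>UNIV. \<Sum>l\<in>UNIV. matrix_inv (G c u) $ k $ l * ((T i j l + T j i l - T l i j) * (p $ i * p $ j)) / 2)"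
   by (simp add: \<Gamma>_def christoffel_def part sum_distrib_left sum_distrib_right sum_divide_distrib mult_ac)
  also have "... = (\<Sum>i\<in>UNIV. \<Sum>l\<in>UNIV. \<Sum>j\<in>UNIV. matrix_inv (G c u) $ k $ l * ((T i j l + T j i l - T l i j) * (p $ i * p $ j)) / 2)"
   by (intro sum.cong refl sum.swap)
  also have "... = (matrix_inv (G c u) *v y) $ k"
   by (subst sum.swap) (simp add: matrix_vector_mult_def y_def sum_distrib_left sum_divide_distrib)
  finally show "\<Gamma> c u p $ k = (matrix_inv (G c u) *v y) $ k" .
 qed
 then have "qform (G c u) (\<Gamma> c u p) q = y \<bullet> q"
  using qform_commute[OF pos_def_G[OF c], of "\<Gamma> c u p" q] pos_def_matrix_inv(3)[OF pos_def_G[OF c], of y] by (simp add: qform_def inner_commute)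
 also have "... = (\<Sum>l\<in>UNIV. \<Sum>i\<in>UNIV. \<Sum>j\<in>UNIV. T i j l * p $ i * p $ j * q $ l) / 2 + (\<Sum>l\<in>UNIV. \<Sum>i\<in>UNIV. \<Sum>j\<in>UNIV. T j i l * p $ i * p $ j * q $ l) / 2
   - (\<Sum>l\<in>UNIV. \<Sum>i\<in>UNIV. \<Sum>j\<in>UNIV. T l i j * p $ i * p $ j * q $ l) / 2"
  by (simp add: y_def inner_vec_def sum_distrib_right sum_distrib_left sum_divide_distrib sum.distrib sum_subtractf algebra_simps add_divide_distrib diff_divide_distrib)
 also have "(\<Sum>l\<in>UNIV. \<Sum>i\<in>UNIV. \<Sum>j\<in>UNIV. T j i l * p $ i * p $ j * q $ l) = (\<Sum>l\<in>UNIV. \<Sum>i\<in>UNIV. \<Sum>j\<in>UNIV. T i j l * p $ i * p $ j * q $ l)"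
  by (subst (2) sum.swap) (simp add: mult_ac)
 also have "(\<Sum>l\<in>UNIV. \<Sum>i\<in>UNIV. \<Sum>j\<in>UNIV. T i j l * p $ i * p $ j * q $ l) = qform (Dv (G c) u p) p q"
 proof -
  have "qform (Dv (G c) u p) p q = (\<Sum>j\<in>UNIV. \<Sum>l\<in>UNIV. \<Sum>i\<in>UNIV. T i j l * p $ i * p $ j * q $ l)"
   by (simp add: qform_eq_sum DG sum_distrib_left sum_distrib_right mult_ac)
  also have "... = (\<Sum>l\<in>UNIV. \<Sum>j\<in>UNIV. \<Sum>i\<in>UNIV. T i j l * p $ i * p $ j * q $ l)" by (rule sum.swap)
  also have "... = (\<Sum>l\<in>UNIV. \<Sum>i\<in>UNIV. \<Sum>j\<in>UNIV. T i j l * p $ i * p $ j * q $ l)" by (intro sum.cong refl sum.swap)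
  finally show ?thesis ..
 qed
 also have "(\<Sum>l\<in>UNIV. \<Sum>i\<in>UNIV. \<Sum>j\<in>UNIV. T l i j * p $ i * p $ j * q $ l) = qform (Dv (G c) u q) p p"
 proof -
  have "qform (Dv (G c) u q) p p = (\<Sum>i\<in>UNIV. \<Sum>j\<in>UNIV. \<Sum>l\<in>UNIV. T l i j * p $ i * p $ j * q $ l)"
   by (simp add: qform_eq_sum DG sum_distrib_left sum_distrib_right mult_ac)
  also have "... = (\<Sum>i\<in>UNIV. \<Sum>l\<in>UNIV. \<Sum>j\<in>UNIV. T l i j * p $ i * p $ j * q $ l)" by (intro sum.cong refl sum.swap)
  also have "... = (\<Sum>l\<in>UNIV. \<Sum>i\<in>UNIV. \<Sum>j\<in>UNIV. T l i j * p $ i * p $ j * q $ l)" by (rule sum.swap)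
  finally show ?thesis ..
 qed
 finally show ?thesis by (simp add: EL_def qform_add)
qed

lemma EL_iff:
 assumes c: "c \<in> A" "u \<in> V c"
 shows "(\<forall>q. EL c u a p q = 0) \<longleftrightarrow> a + \<Gamma> c u p = 0"
 unfolding EL_\<Gamma>[OF c] using pos_defD[OF pos_def_G[OF c], of "a + \<Gamma> c u p"] by (metis less_irrefl qform_zero(1))

text \<open>Differentiating G_c = J^T G_d J produces two terms with the second derivative B of the
  transition map besides the derivative of G_d. By the symmetry of B they cancel in
  \<open>EL\<close>, apart from B p p, which is the correction to the acceleration.\<close>

lemma EL_change:
 assumes c: "c \<in> A" "d \<in> A" "x \<in> U c" "x \<in> U d"
 defines "B \<equiv> %h k. Dv (%u. Dv (\<tau> c d) u k) (\<phi> c x) h"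
 shows "EL c (\<phi> c x) a p q = EL d (\<phi> d x) (D c d x a + B p p) (D c d x p) (D c d x q)"
proof -
 let ?u = "\<phi> c x" and ?y = "\<phi> d x" and ?J = "D c d x"
 have x: "?u \<in> W c d" "?u \<in> V c" "?y \<in> V d" using c by auto
 note C2 = tr(3)[OF c(1,2), of "Suc (Suc 0)"]
 have dJ: "((%u. Dv (\<tau> c d) u k) has_derivative (%h. B h k)) (at ?u)" for k
  unfolding B_def using Ck_on_SucD(1)[OF Ck_on_SucD(2)[OF C2] x(1)] .
 have B: "B h k = B k h" for h k unfolding B_def by (rule second_derivative_symmetric[OF open_W[OF c(1,2)] x(1) C2])
 have 1: "qform (Dv (G c) ?u h) v w = qform (Dv (G d) ?y (?J h)) (?J v) (?J w) + qform (G d ?y) (B h v) (?J w) + qform (G d ?y) (?J v) (B h w)" for h v w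
 proof -
  have "((%u. G d (\<tau> c d u)) has_derivative (%h. Dv (G d) ?y (?J h))) (at ?u)"
   using has_derivative_compose[OF tr(4)[OF c] , of "G d"] G_deriv[OF c(2) x(3)] tr(2)[OF c(1-3)] by simp
  from has_derivative_qform[OF this dJ dJ, of v w]
  have "((%u. qform (G c u) v w) has_derivative (%h. qform (G d ?y) (?J v) (B h w) + qform (Dv (G d) ?y (?J h)) (?J v) (?J w) + qform (G d ?y) (B h v) (?J w))) (at ?u)"
   unfolding tr(2)[OF c(1-3)]
  proof (rule has_derivative_transform_within_open[OF _ open_W[OF c(1,2)] x(1)])
   fix u assume "u \<in> W c d"
   then obtain z where "z \<in> U c" "z \<in> U d" "u = \<phi> c z" by blast
   then show "qform (G d (\<tau> c d u)) (Dv (\<tau> c d) u v) (Dv (\<tau> c d) u w) = qform (G c u) v w"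
    using G_change[OF c(1,2)] tr(2)[OF c(1,2)] by simp
  qed
  from fun_cong[OF has_derivative_unique[OF this has_derivative_qform[OF G_deriv[OF c(1) x(2)] has_derivative_const has_derivative_const, of v w]], of h]
  show ?thesis by (simp add: qform_zero ac_simps)
 qed
 show ?thesis
  using B[of p q] qform_commute[OF pos_def_G[OF c(2) x(3)], of "?J p" "B q p"]
  by (simp add: EL_def 1 G_change[OF c] qform_add field_simps)
qed

definition "geo c \<gamma> t \<longleftrightarrow> (\<exists>u' u''. (\<forall>\<^sub>F s in nhds t. ((\<phi> c \<circ> \<gamma>) has_vector_derivative u' s) (at s)) \<and>
 (u' has_vector_derivative u'') (at t) \<and> u'' + \<Gamma> c (\<phi> c (\<gamma> t)) (u' t) = 0)"

lemma geodesic_on_iff: "geodesic_on A g I \<gamma> \<longleftrightarrow> continuous_on I \<gamma> \<and> (\<forall>c\<in>A. \<forall>t\<in>I. \<gamma> t \<in> U c --> geo c \<gamma> t)"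
 by (simp add: geodesic_on_def geo_def \<Gamma>_def vec_eq_iff)

text \<open>\<open>geodesic_on\<close> asks for the equation in every chart. In the new chart the
  acceleration is J u'' + B u' u', exactly the one in \<open>EL_change\<close>, and J carries the
  test vectors of one chart onto those of the other.\<close>

lemma geo_change:
 assumes c: "c \<in> A" "d \<in> A" and O: "open S" "t \<in> S" "!!s. s \<in> S ==> \<gamma> s \<in> U c \<inter> U d" and geo: "geo c \<gamma> t"
 shows "geo d \<gamma> t"
proof -
 obtain u' u'' where u: "\<forall>\<^sub>F s in nhds t. ((\<phi> c \<circ> \<gamma>) has_vector_derivative u' s) (at s)" "(u' has_vector_derivative u'') (at t)"
  "u'' + \<Gamma> c (\<phi> c (\<gamma> t)) (u' t) = 0" using geo unfolding geo_def by blast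
 let ?a = "\<phi> c \<circ> \<gamma>" and ?J = "%s. D c d (\<gamma> s)"
 define B where "B = (%h k. Dv (%u. Dv (\<tau> c d) u k) (?a t) h)"
 have \<gamma>t: "\<gamma> t \<in> U c" "\<gamma> t \<in> U d" using O by auto
 have "\<forall>\<^sub>F s in nhds t. s \<in> S" by (rule eventually_nhds_in_open[OF O(1,2)])
 with u(1) have ev: "\<forall>\<^sub>F s in nhds t. ((\<phi> d \<circ> \<gamma>) has_vector_derivative ?J s (u' s)) (at s)"
 proof eventually_elim
  case (elim s)
  have s: "\<gamma> s \<in> U c" "\<gamma> s \<in> U d" using O(3)[OF elim(2)] by auto
  have "((%s. \<tau> c d (?a s)) has_derivative (%k. ?J s (k *\<^sub>R u' s))) (at s)"
   using has_derivative_compose[OF elim(1)[unfolded has_vector_derivative_def], of "\<tau> c d"] tr(4)[OF c s] by simp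
  then have "((\<phi> d \<circ> \<gamma>) has_derivative (%k. ?J s (k *\<^sub>R u' s))) (at s)"
   by (rule has_derivative_transform_within_open[OF _ O(1) elim(2)]) (use O(3) tr(2)[OF c] in auto)
  then show ?case by (simp add: has_vector_derivative_def linear_scale[OF linear_D[OF c s]])
 qed
 have at: "(?a has_vector_derivative u' t) (at t)" using eventually_nhds_x_imp_x[OF u(1)] .
 have dJ: "((%u. Dv (\<tau> c d) u k) has_derivative (%h. B h k)) (at (?a t))" for k
  unfolding B_def using Ck_on_SucD(1)[OF Ck_on_SucD(2)[OF tr(3)[OF c, of "Suc (Suc 0)"]]] \<gamma>t by auto
 have JS: "Dv (\<tau> c d) (\<phi> c p) k = (\<Sum>b\<in>Basis. (k \<bullet> b) *\<^sub>R Dv (\<tau> c d) (\<phi> c p) b)" if "p \<in> U c" "p \<in> U d" for p k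
  by (rule has_derivative_sum_Basis[OF tr(4)[OF c that]])
 \<comment> \<open>The derivative of the transition map is linear in its direction at every point of
   the overlap, hence so is its own derivative.\<close>
 have Bs: "B h k = (\<Sum>b\<in>Basis. (k \<bullet> b) *\<^sub>R B h b)" for h k
 proof -
  have "((%u. \<Sum>b\<in>Basis. (k \<bullet> b) *\<^sub>R Dv (\<tau> c d) u b) has_derivative (%h. \<Sum>b\<in>Basis. (k \<bullet> b) *\<^sub>R B h b)) (at (?a t))"
   by (intro has_derivative_sum has_derivative_scaleR_right dJ)
  then have "((%u. Dv (\<tau> c d) u k) has_derivative (%h. \<Sum>b\<in>Basis. (k \<bullet> b) *\<^sub>R B h b)) (at (?a t))"
   by (rule has_derivative_transform_within_open[OF _ open_W[OF c]]) (use \<gamma>t JS in auto)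
  from has_derivative_unique[OF this dJ] show ?thesis by metis
 qed
 have d2: "((%s. ?J s (u' s)) has_vector_derivative (?J t u'' + B (u' t) (u' t))) (at t)"
 proof -
  have "((%s. \<Sum>b\<in>Basis. (u' s \<bullet> b) *\<^sub>R Dv (\<tau> c d) (?a s) b) has_vector_derivative
    (\<Sum>b\<in>Basis. (u' t \<bullet> b) *\<^sub>R B (u' t) b + (u'' \<bullet> b) *\<^sub>R Dv (\<tau> c d) (?a t) b)) (at t)"
  proof (intro has_vector_derivative_sum has_vector_derivative_scaleR)
   fix b
   show "((%s. u' s \<bullet> b) has_real_derivative u'' \<bullet> b) (at t)"
    using bounded_linear.has_vector_derivative[OF bounded_linear_inner_left u(2)] by (simp add: has_real_derivative_iff_has_vector_derivative)
   from has_derivative_compose[OF at[unfolded has_vector_derivative_def] dJ, of b]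
   show "((%s. Dv (\<tau> c d) (?a s) b) has_vector_derivative B (u' t) b) (at t)"
    by (simp add: has_vector_derivative_def linear_scale[OF has_derivative_linear[OF dJ]])
  qed
  then have "((%s. ?J s (u' s)) has_vector_derivative (\<Sum>b\<in>Basis. (u' t \<bullet> b) *\<^sub>R B (u' t) b + (u'' \<bullet> b) *\<^sub>R Dv (\<tau> c d) (?a t) b)) (at t)"
   by (rule has_vector_derivative_transform_within_open[OF _ O(1,2)]) (use O(3) JS in auto)
  moreover have "(\<Sum>b\<in>Basis. (u' t \<bullet> b) *\<^sub>R B (u' t) b + (u'' \<bullet> b) *\<^sub>R ?J t b) = ?J t u'' + B (u' t) (u' t)"
   using JS[OF \<gamma>t, of u''] Bs[of "u' t" "u' t"] by (simp add: sum.distrib add.commute)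
  ultimately show ?thesis by simp
 qed
 have "EL d (\<phi> d (\<gamma> t)) (?J t u'' + B (u' t) (u' t)) (?J t (u' t)) q = 0" for q
 proof -
  have "EL c (\<phi> c (\<gamma> t)) u'' (u' t) (D d c (\<gamma> t) q) = 0" using EL_iff[OF c(1), of "\<phi> c (\<gamma> t)"] u(3) \<gamma>t by blast
  then show ?thesis using EL_change[OF c \<gamma>t] D_inv[OF c(2,1) \<gamma>t(2,1)] by (simp add: B_def)
 qed
 then have "?J t u'' + B (u' t) (u' t) + \<Gamma> d (\<phi> d (\<gamma> t)) (?J t (u' t)) = 0" using EL_iff[OF c(2), of "\<phi> d (\<gamma> t)"] \<gamma>t by blast
 then show ?thesis unfolding geo_def
  by (intro exI[of _ "%s. ?J s (u' s)"] exI[of _ "?J t u'' + B (u' t) (u' t)"] conjI ev d2)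
qed

end

subsection \<open>The exponential map in a chart\<close>

text \<open>By Cramer's rule the entries are quotients of determinants.\<close>

lemma Ck_on_matrix_inv:
 fixes M :: "'e::real_normed_vector => real^'n^'n"
 assumes S: "open S" and M: "Ck_on k S M" and nz: "!!x. x \<in> S ==> det (M x) ~= 0"
 shows "Ck_on k S (%x. matrix_inv (M x) $ i $ j)"
proof (rule Ck_on_cong[OF S])
 let ?R = "%x. \<chi> r s. if s = i then axis j 1 $ r else M x $ r $ s"
 have "Ck_on k S (%x. if s = i then axis j 1 $ r else M x $ r $ s)" for r s
  using M S by (cases "s = i") (simp_all add: Ck_on_vec_iff Ck_on_const)
 then have "Ck_on k S ?R" using S by (simp add: Ck_on_vec_iff)
 then show "Ck_on k S (%x. det (?R x) / det (M x))" by (intro Ck_on_divide Ck_on_det S M nz)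
 fix x assume x: "x \<in> S"
 have "M x *v (matrix_inv (M x) *v axis j 1) = axis j 1"
  using matrix_inv_cancel(2)[of "M x"] nz[OF x] by (simp add: invertible_det_nz matrix_vector_mul_assoc)
 then have "matrix_inv (M x) *v axis j 1 = (\<chi> k. det (\<chi> r s. if s = k then axis j 1 $ r else M x $ r $ s) / det (M x))"
  using cramer[OF nz[OF x], of "matrix_inv (M x) *v axis j 1" "axis j 1"] by blast
 then show "det (?R x) / det (M x) = matrix_inv (M x) $ i $ j"
  by (metis (no_types, lifting) column_def matrix_vector_mult_basis vec_lambda_beta)
qed

lemma ode_unique_interval:
 fixes x y :: "real => 'e::real_inner"
 assumes "!!u v. norm (F u - F v) <= L * norm (u - v)"
  "!!t. t \<in> {0..r} ==> (x has_vector_derivative F (x t)) (at t)"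
  "!!t. t \<in> {0..r} ==> (y has_vector_derivative F (y t)) (at t)" "0 <= r" "x 0 = y 0"
 shows "x r = y r"
 using ode_dist_le[OF assms(1-4)] assms(5) by simp

lemma Ck_on_Pair:
 assumes "open S" "Ck_on k S f" "Ck_on k S h"
 shows "Ck_on k S (%x. (f x, h x))"
proof -
 have "Ck_on k S (%x. (f x, 0) + (0, h x))"
  using assms by (intro Ck_on_add Ck_on_bounded_linear[of S "%y. (y, 0)"] Ck_on_bounded_linear[of S "%y. (0, y)"] bounded_linear_Pair bounded_linear_ident bounded_linear_zero)
 then show ?thesis by simp
qed

context riemannian
begin

text \<open>The geodesic spray: the equation as a first order system for position and
  velocity.\<close>

definition "\<Phi> c z = (snd z, - \<Gamma> c (fst z) (snd z))"

lemma Ck_\<Phi>: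
 assumes c: "c \<in> A"
 shows "Ck_on k (V c \<times> UNIV) (\<Phi> c)"
proof -
 let ?S = "V c \<times> (UNIV :: (real^'n) set)"
 have S: "open ?S" using chart(2)[OF c] by (simp add: open_Times)
 have bl: "Ck_on k ?S fst" "Ck_on k ?S snd"
  using Ck_on_bounded_linear[OF S bounded_linear_fst Ck_on_id[OF S]] Ck_on_bounded_linear[OF S bounded_linear_snd Ck_on_id[OF S]] by auto
 have V: "open (V c)" by (rule chart(2)[OF c])
 have part: "Ck_on k (V c) (%u. partial i (%v. G c v $ j $ l) u)" for i j l
  unfolding partial_def by (rule Ck_on_SucD(2)[OF Ck_on_matrix_nth[OF V Ck_G[OF c]]])
 have inv: "Ck_on k (V c) (%u. matrix_inv (G c u) $ i $ j)" for i j
  by (rule Ck_on_matrix_inv[OF V Ck_G[OF c]]) (use det_G_pos[OF c] in force)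
 have "Ck_on k (V c) (christoffel A g c l i j)" for l i j
  unfolding christoffel_def Let_def by (intro Ck_on_divide Ck_on_sum Ck_on_mult Ck_on_diff Ck_on_add Ck_on_const part inv V) simp
 then have chr: "Ck_on k ?S (%z. christoffel A g c l i j (fst z))" for l i j
  by (rule Ck_on_compose[OF S V bl(1)]) auto
 have nth: "Ck_on k ?S (%z. snd z $ i)" for i using bl(2) S by (simp add: Ck_on_vec_iff)
 have "Ck_on k ?S (%z. \<Gamma> c (fst z) (snd z))"
  using S by (simp add: Ck_on_vec_iff \<Gamma>_def) (intro allI Ck_on_sum Ck_on_mult chr nth S)
 then show ?thesis unfolding \<Phi>_def by (intro Ck_on_Pair Ck_on_minus S bl)
qed

text \<open>The spray is quadratic in the velocity and defined only over the chart. Projecting the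
  position to C and the velocity to a ball makes it bounded and globally Lipschitz, without changing
  it on C and at speeds up to R.\<close>

lemma \<Phi>_cutoff:
 assumes c: "c \<in> A" and C: "compact C" "convex C" "C ~= {}" "C \<subseteq> V c" and R: "0 <= R"
 defines "\<pi> \<equiv> %z. (closest_point C (fst z), closest_point (cball 0 R) (snd z))"
 shows "\<exists>K>0. (\<forall>z w. norm (\<Phi> c (\<pi> z) - \<Phi> c (\<pi> w)) <= K * norm (z - w)) \<and> (\<forall>z. norm (\<Phi> c (\<pi> z)) <= K)"
proof -
 let ?B = "cball (0::real^'n) R"
 have P: "compact (C \<times> ?B)" "convex (C \<times> ?B)" "closed C" "?B ~= {}" using C(1,2) R by (auto simp: compact_Times convex_Times compact_imp_closed)
 obtain K where K: "K > 0" "!!z. z \<in> C \<times> ?B ==> norm (\<Phi> c z) <= K" "!!z w. z \<in> C \<times> ?B ==> w \<in> C \<times> ?B ==> norm (\<Phi> c z - \<Phi> c w) <= K * norm (z - w)"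
  using Ck1_bounded_lipschitz[OF Ck_\<Phi>[OF c] P(1,2)] C(4) by blast
 have in_C: "\<pi> z \<in> C \<times> ?B" for z
  using closest_point_in_set[OF P(3) C(3)] closest_point_in_set[OF closed_cball P(4)] by (auto simp: \<pi>_def)
 have "norm (\<Phi> c (\<pi> z) - \<Phi> c (\<pi> w)) <= K * norm (z - w)" for z w
 proof -
  have "norm (\<pi> z - \<pi> w) <= norm (z - w)"
   using closest_point_lipschitz[OF C(2) P(3) C(3), of "fst z" "fst w"] closest_point_lipschitz[OF convex_cball closed_cball P(4), of "snd z" "snd w"]
   by (cases z; cases w) (auto simp: \<pi>_def norm_Pair dist_norm intro!: add_mono power_mono)
  then have "K * norm (\<pi> z - \<pi> w) <= K * norm (z - w)" using K(1) by simp
  then show ?thesis using K(3)[OF in_C in_C, of z w] by linarith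
 qed
 then show ?thesis using K(1,2) in_C by blast
qed

text \<open>\<open>exp_map\<close> prescribes the velocity in the preferred chart of the starting
  point; this converts it to the working chart and back.\<close>

lemma initial_velocity:
 assumes c: "c \<in> A" "d \<in> A" "\<gamma> t \<in> U c" "\<gamma> t \<in> U d" and I: "open I" "t \<in> I" "continuous_on I \<gamma>"
  and w: "((\<phi> c \<circ> \<gamma>) has_vector_derivative w) (at t)"
 shows "((\<phi> d \<circ> \<gamma>) has_vector_derivative D c d (\<gamma> t) w) (at t)"
proof -
 have "((%s. \<tau> c d ((\<phi> c \<circ> \<gamma>) s)) has_derivative (%k. D c d (\<gamma> t) (k *\<^sub>R w))) (at t)"
  using has_derivative_compose[OF w[unfolded has_vector_derivative_def], of "\<tau> c d"] tr(4)[OF c] by simp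
 then have "((\<phi> d \<circ> \<gamma>) has_derivative (%k. D c d (\<gamma> t) (k *\<^sub>R w))) (at t)"
  by (rule has_derivative_transform_within_open[OF _ continuous_open_preimage[OF I(3,1) chart(1)[OF c(1)]]])
   (use I c(3) tr(2)[OF c(1,2)] in auto)
 then show ?thesis by (simp add: has_vector_derivative_def linear_scale[OF linear_D[OF c]])
qed

text \<open>The equation supplies a separate germ of the velocity for each time. The vector
  derivative p agrees with all of these germs, and with it the curve becomes a trajectory of the
  spray, of bounded speed on a compact interval.\<close>

lemma geodesic_phase_curve:
 assumes c: "c \<in> A" and r: "0 <= r" and C: "C ~= {}" and \<gamma>: "!!s. s \<in> {0..r} ==> geo c \<gamma> s" "!!s. s \<in> {0..r} ==> \<phi> c (\<gamma> s) \<in> C"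
  and w: "((\<phi> c \<circ> \<gamma>) has_vector_derivative w) (at 0)"
 shows "\<exists>p R. p 0 = w \<and> (\<forall>s\<in>{0..r}. norm (p s) <= R \<and> ((%s. (\<phi> c (\<gamma> s), p s)) has_vector_derivative \<Phi> c (\<phi> c (\<gamma> s), p s)) (at s))"
proof -
 define p where "p = (%s. vector_derivative (\<phi> c \<circ> \<gamma>) (at s))"
 have p: "((%s. \<phi> c (\<gamma> s)) has_vector_derivative p s) (at s)" "(p has_vector_derivative - \<Gamma> c (\<phi> c (\<gamma> s)) (p s)) (at s)" if s: "s \<in> {0..r}" for s
 proof -
  obtain u' u'' where u: "\<forall>\<^sub>F s in nhds s. ((\<phi> c \<circ> \<gamma>) has_vector_derivative u' s) (at s)" "(u' has_vector_derivative u'') (at s)"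
   "u'' + \<Gamma> c (\<phi> c (\<gamma> s)) (u' s) = 0" using \<gamma>(1)[OF s] unfolding geo_def by blast
  have eq: "\<forall>\<^sub>F s in nhds s. u' s = p s" using u(1) by eventually_elim (simp add: p_def vector_derivative_at)
  then have "u' s = p s" by (rule eventually_nhds_x_imp_x)
  then show "((%s. \<phi> c (\<gamma> s)) has_vector_derivative p s) (at s)" using eventually_nhds_x_imp_x[OF u(1)] by (simp add: o_def)
  have "u'' = - \<Gamma> c (\<phi> c (\<gamma> s)) (p s)" using u(3) \<open>u' s = p s\<close> by (simp add: add_eq_0_iff2)
  then show "(p has_vector_derivative - \<Gamma> c (\<phi> c (\<gamma> s)) (p s)) (at s)"
   using u(2) has_vector_derivative_cong_ev[of UNIV u' p s u''] eq \<open>u' s = p s\<close> by (simp add: eventually_mono)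
 qed
 have "continuous_on {0..r} p"
  by (rule continuous_at_imp_continuous_on) (use has_vector_derivative_continuous[OF p(2)] in blast)
 then obtain R where "!!s. s \<in> {0..r} ==> norm (p s) <= R"
  using compact_imp_bounded[OF compact_continuous_image[OF \<open>continuous_on {0..r} p\<close> compact_Icc]] unfolding bounded_iff by blast
 moreover have "p 0 = w" using w by (simp add: p_def vector_derivative_at)
 ultimately show ?thesis using has_vector_derivative_Pair[OF p] by (intro exI[of _ p] exI[of _ R]) (simp add: \<Phi>_def)
qed

text \<open>Only \<gamma> is known to stay over C; the competitor \<gamma>' might leave the chart.
  Agreement is therefore propagated: where the curves agree, \<gamma>' is over the interior of C and
  remains there a little longer by continuity, and on that longer interval both are trajectories of
  one globally Lipschitz field. At the supremum of the times of agreement continuity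
  applies.\<close>

lemma geodesic_unique:
 assumes c: "c \<in> A" and C: "compact C" "convex C" "C \<subseteq> V c"
  and \<gamma>: "open I" "{0..1} \<subseteq> I" "geodesic_on A g I \<gamma>" and \<gamma>': "open J" "{0..1} \<subseteq> J" "geodesic_on A g J \<gamma>'"
  and eq: "\<gamma> 0 = \<gamma>' 0" "((\<phi> c \<circ> \<gamma>) has_vector_derivative w) (at 0)" "((\<phi> c \<circ> \<gamma>') has_vector_derivative w) (at 0)"
  and inC: "!!t. t \<in> {0..1} ==> \<gamma> t \<in> U c \<and> \<phi> c (\<gamma> t) \<in> interior C"
 shows "\<gamma>' 1 = \<gamma> 1"
proof -
 define P where "P = {t\<in>{0..1}. \<forall>s\<in>{0..t}. \<gamma>' s = \<gamma> s}"
 have cont: "continuous_on I \<gamma>" "continuous_on J \<gamma>'" using \<gamma>(3) \<gamma>'(3) by (auto simp: geodesic_on_iff)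
 have geoc: "geo c \<gamma> t" if "t \<in> I" "\<gamma> t \<in> U c" for t using that \<gamma>(3) c unfolding geodesic_on_iff by blast
 have geoc': "geo c \<gamma>' t" if "t \<in> J" "\<gamma>' t \<in> U c" for t using that \<gamma>'(3) c unfolding geodesic_on_iff by blast
 let ?N = "U c \<inter> \<phi> c -` interior C"
 have N: "open ?N" by (rule continuous_open_preimage[OF chart(3,1)[OF c] open_interior])
 have extend: "\<exists>e>0. \<forall>t\<in>{0..1}. t < t0 + e --> t \<in> P" if t0: "t0 \<in> P" for t0
 proof -
  have t0': "t0 \<in> {0..1}" "!!s. s \<in> {0..t0} ==> \<gamma>' s = \<gamma> s" using t0 by (auto simp: P_def)
  have "open (J \<inter> \<gamma>' -` ?N)" by (rule continuous_open_preimage[OF cont(2) \<gamma>'(1) N])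
  moreover have "t0 \<in> J \<inter> \<gamma>' -` ?N" using t0' \<gamma>'(2) inC[of t0] by auto
  ultimately obtain e where e: "0 < e" "ball t0 e \<subseteq> J \<inter> \<gamma>' -` ?N" using openE by metis
  have "t \<in> P" if t: "t \<in> {0..1}" "t < t0 + e" for t
  proof -
   have in': "s \<in> J" "\<gamma>' s \<in> ?N" if "s \<in> {0..t}" for s
   proof -
    show "s \<in> J" using that t \<gamma>'(2) by auto
    show "\<gamma>' s \<in> ?N"
    proof (cases "s <= t0")
     case True
     then show ?thesis using t0'(2)[of s] inC[of s] that t by auto
    next
     case False
     then have "s \<in> ball t0 e" using that t by (auto simp: dist_real_def)
     then show ?thesis using e(2) by auto
    qed
   qed
   have Cne: "C ~= {}" using inC[of 0] interior_subset by fastforce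
   have "\<gamma>' s = \<gamma> s" if s: "s \<in> {0..t}" for s
   proof -
    have s0: "0 <= s" using s by auto
    have a: "geo c \<gamma> q" "\<phi> c (\<gamma> q) \<in> C" "geo c \<gamma>' q" "\<phi> c (\<gamma>' q) \<in> C" if "q \<in> {0..s}" for q
    proof -
     have q: "q \<in> {0..1}" "q \<in> {0..t}" using that s t by auto
     show "geo c \<gamma> q" "\<phi> c (\<gamma> q) \<in> C" using geoc[of q] inC[OF q(1)] q(1) \<gamma>(2) interior_subset[of C] by auto
     show "geo c \<gamma>' q" "\<phi> c (\<gamma>' q) \<in> C" using geoc'[of q] in'[OF q(2)] interior_subset[of C] by auto
    qed
    obtain p R where p: "p 0 = w" "!!q. q \<in> {0..s} ==> norm (p q) <= R \<and> ((%s. (\<phi> c (\<gamma> s), p s)) has_vector_derivative \<Phi> c (\<phi> c (\<gamma> q), p q)) (at q)"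
     using geodesic_phase_curve[OF c s0 Cne a(1,2) eq(2)] by blast
    obtain p' R' where p': "p' 0 = w" "!!q. q \<in> {0..s} ==> norm (p' q) <= R' \<and> ((%s. (\<phi> c (\<gamma>' s), p' s)) has_vector_derivative \<Phi> c (\<phi> c (\<gamma>' q), p' q)) (at q)"
     using geodesic_phase_curve[OF c s0 Cne a(3,4) eq(3)] by blast
    \<comment> \<open>Q dominates the speeds of both curves, so the cut-off spray agrees with the
      true one along them.\<close>
    define Q where "Q = max \<bar>R\<bar> \<bar>R'\<bar>"
    let ?F = "%z. \<Phi> c (closest_point C (fst z), closest_point (cball 0 Q) (snd z))"
    obtain K where K: "!!z w. norm (?F z - ?F w) <= K * norm (z - w)"
    proof -
     have "0 <= Q" by (simp add: Q_def)
     from \<Phi>_cutoff[OF c C(1,2) Cne C(3) this] show ?thesis using that by blast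
    qed
    have "(\<phi> c (\<gamma> s), p s) = (\<phi> c (\<gamma>' s), p' s)"
    proof (rule ode_unique_interval[OF K])
     fix q assume q: "q \<in> {0..s}"
     note a(2,4)[OF q]
     moreover have "norm (p q) <= Q" "norm (p' q) <= Q" using p(2)[OF q] p'(2)[OF q] by (auto simp: Q_def)
     ultimately show "((%s. (\<phi> c (\<gamma> s), p s)) has_vector_derivative ?F (\<phi> c (\<gamma> q), p q)) (at q)"
      "((%s. (\<phi> c (\<gamma>' s), p' s)) has_vector_derivative ?F (\<phi> c (\<gamma>' q), p' q)) (at q)"
      using p(2)[OF q] p'(2)[OF q] by (simp_all add: closest_point_self)
    qed (use s0 p p' eq(1) in auto)
    then show ?thesis using chart(5)[OF c] inC[of s] in'(2)[of s] s t by (metis IntE Pair_inject atLeastAtMost_iff order_trans)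
   qed
   then show ?thesis using t by (simp add: P_def)
  qed
  then show ?thesis using e(1) by blast
 qed
 have P0: "0 \<in> P" using eq(1) by (simp add: P_def)
 define ts where "ts = Sup P"
 have bdd: "bdd_above P" by (auto simp: P_def intro!: bdd_aboveI[of _ 1])
 have ts: "ts \<in> {0..1}" using cSup_upper[OF P0 bdd] P0 by (auto simp: ts_def P_def intro!: cSup_least)
 have lt: "\<gamma>' s = \<gamma> s" if s: "0 <= s" "s < ts" for s
 proof -
  obtain t where "t \<in> P" "s < t" using less_cSupE[of s P] s P0 by (auto simp: ts_def)
  then show ?thesis using s by (auto simp: P_def)
 qed
 have "\<gamma>' ts = \<gamma> ts"
 proof (cases "ts = 0")
  case False
  then have pos: "0 < ts" using ts by auto
  have "isCont \<gamma> ts" "isCont \<gamma>' ts" using cont \<gamma>(1,2) \<gamma>'(1,2) ts continuous_on_eq_continuous_at by blast+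
  then have l: "(\<gamma> \<longlongrightarrow> \<gamma> ts) (at_left ts)" "(\<gamma>' \<longlongrightarrow> \<gamma>' ts) (at_left ts)"
   by (auto simp: isCont_def intro: tendsto_within_subset[OF _ subset_UNIV])
  have "\<forall>\<^sub>F s in at_left ts. s \<in> {0<..<ts}" using pos eventually_at_left_real by blast
  then have "\<forall>\<^sub>F s in at_left ts. \<gamma> s = \<gamma>' s" by eventually_elim (use lt in auto)
  with l show ?thesis by (metis tendsto_cong tendsto_unique trivial_limit_at_left_real)
 qed (use eq(1) in simp)
 then have "ts \<in> P" using lt ts by (auto simp: P_def order.order_iff_strict)
 have "ts = 1"
 proof (rule ccontr)
  assume "ts ~= 1"
  then have "ts < 1" using ts by auto
  obtain e where e: "0 < e" "!!t. t \<in> {0..1} ==> t < ts + e ==> t \<in> P" using extend[OF \<open>ts \<in> P\<close>] by blast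
  have "min 1 (ts + e / 2) \<in> P" using e ts \<open>ts < 1\<close> by (intro e(2)) (auto simp: min_def)
  then have "min 1 (ts + e / 2) <= ts" unfolding ts_def by (rule cSup_upper[OF _ bdd])
  then show False using e(1) \<open>ts < 1\<close> by (auto simp: min_def split: if_splits)
 qed
 then show ?thesis using \<open>ts \<in> P\<close> by (auto simp: P_def)
qed

lemma \<Gamma>_scale: "\<Gamma> c u (r *\<^sub>R p) = (r * r) *\<^sub>R \<Gamma> c u p"
 by (simp add: \<Gamma>_def vec_eq_iff sum_distrib_left mult_ac)

text \<open>The curve t -> z (r t) is a geodesic, since \<Gamma> is quadratic in the velocity, and
  it is defined on an interval around [0, 1] because r < h. Its initial velocity is r times that of
  z, and \<open>geodesic_unique\<close> makes the definite description meaningful.\<close>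

lemma exp_map_eq:
 assumes c: "c \<in> A" and C: "compact C" "convex C" "C \<subseteq> V c" and r: "0 < r" "r < h"
  and z: "!!t. \<bar>t\<bar> < h ==> (z has_vector_derivative \<Phi> c (z t)) (at t)" "!!t. \<bar>t\<bar> < h ==> fst (z t) \<in> interior C"
 shows "exp_map A g (\<psi> c (fst (z 0))) (r *\<^sub>R D c (K (\<psi> c (fst (z 0)))) (\<psi> c (fst (z 0))) (snd (z 0))) = \<psi> c (fst (z r))"
proof -
 let ?x = "\<psi> c (fst (z 0))"
 define \<gamma> where "\<gamma> = (%t. \<psi> c (fst (z (r * t))))"
 define I where "I = {- (h / r)<..<h / r}"
 have rI: "\<bar>r * t\<bar> < h" if "t \<in> I" for t
  using that r by (auto simp: I_def abs_mult field_simps abs_if)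
 have h1: "1 < h / r" using r by simp
 have I: "open I" "is_interval I" "{0..1} \<subseteq> I" using h1 by (auto simp: I_def is_interval_oo)
 have zV: "fst (z t) \<in> V c" if "\<bar>t\<bar> < h" for t using z(2)[OF that] C(3) interior_subset by blast
 have \<gamma>U: "\<gamma> t \<in> U c" "\<phi> c (\<gamma> t) = fst (z (r * t))" if "t \<in> I" for t
  using chart(6,7)[OF c zV[OF rI[OF that]]] by (auto simp: \<gamma>_def)
 have dz: "((%t. z (r * t)) has_vector_derivative r *\<^sub>R \<Phi> c (z (r * t))) (at t)" if "t \<in> I" for t
 proof -
  have "((%t. r * t) has_vector_derivative r) (at t)"
   by (auto simp: has_real_derivative_iff_has_vector_derivative[symmetric] intro!: derivative_eq_intros)
  from vector_diff_chain_at[OF this z(1)[OF rI[OF that]]] show ?thesis by (simp add: o_def)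
 qed
 have d1: "((\<phi> c \<circ> \<gamma>) has_vector_derivative r *\<^sub>R snd (z (r * t))) (at t)" if t: "t \<in> I" for t
 proof (rule has_vector_derivative_transform_within_open[OF _ I(1) t])
  show "((%t. fst (z (r * t))) has_vector_derivative r *\<^sub>R snd (z (r * t))) (at t)"
   using bounded_linear.has_vector_derivative[OF bounded_linear_fst dz[OF t]] by (simp add: \<Phi>_def)
 qed (simp add: \<gamma>U)
 have d2: "((%t. r *\<^sub>R snd (z (r * t))) has_vector_derivative - \<Gamma> c (\<phi> c (\<gamma> t)) (r *\<^sub>R snd (z (r * t)))) (at t)" if t: "t \<in> I" for t
  using bounded_linear.has_vector_derivative[OF bounded_linear_compose[OF bounded_linear_scaleR_right bounded_linear_snd] dz[OF t], of r]
  by (simp add: \<Phi>_def \<Gamma>_scale \<gamma>U[OF t])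
 have geoc: "geo c \<gamma> t" if t: "t \<in> I" for t
  unfolding geo_def using eventually_mono[OF eventually_nhds_in_open[OF I(1) t] d1] d2[OF t] by (intro exI conjI) auto
 have cont: "continuous_on I \<gamma>"
  unfolding \<gamma>_def
 proof (rule continuous_on_compose2[OF chart(4)[OF c]])
  show "continuous_on I (%t. fst (z (r * t)))"
   by (rule continuous_at_imp_continuous_on) (use has_vector_derivative_continuous[OF dz] in "auto intro: continuous_fst")
 qed (use zV rI in auto)
 have geod: "geodesic_on A g I \<gamma>"
  unfolding geodesic_on_iff
 proof (intro conjI ballI impI cont)
  fix d t assume d: "d \<in> A" "t \<in> I" "\<gamma> t \<in> U d"
  show "geo d \<gamma> t"
   by (rule geo_change[OF c d(1) continuous_open_preimage[OF cont I(1) chart(1)[OF d(1)]] _ _ geoc[OF d(2)]]) (use d \<gamma>U in auto)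
 qed
 have \<gamma>0: "\<gamma> 0 = ?x" "0 \<in> I" using I(3) by (auto simp: \<gamma>_def)
 let ?w = "r *\<^sub>R D c (K ?x) ?x (snd (z 0))"
 have xU: "?x \<in> U c" using \<gamma>U(1)[OF \<gamma>0(2)] \<gamma>0(1) by simp
 have w: "((\<phi> (K ?x) \<circ> \<gamma>) has_vector_derivative ?w) (at 0)"
  using initial_velocity[OF c chart_at(1)[of ?x] _ _ I(1) \<gamma>0(2) cont d1[OF \<gamma>0(2)]] xU chart_at(2)[of ?x]
   linear_scale[OF linear_D[OF c chart_at(1) xU chart_at(2)]] by (simp add: \<gamma>0(1))
 show ?thesis unfolding exp_map_def
 proof (rule the_equality)
  show "\<exists>I \<gamma>. open I \<and> is_interval I \<and> {0..1} \<subseteq> I \<and> geodesic_on A g I \<gamma> \<and> \<gamma> 0 = ?x \<and>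
   ((\<phi> (K ?x) \<circ> \<gamma>) has_vector_derivative ?w) (at 0) \<and> \<gamma> 1 = \<psi> c (fst (z r))"
   using I geod \<gamma>0 w by (intro exI[of _ I] exI[of _ \<gamma>]) (simp add: \<gamma>_def)
  fix y assume "\<exists>I \<gamma>. open I \<and> is_interval I \<and> {0..1} \<subseteq> I \<and> geodesic_on A g I \<gamma> \<and> \<gamma> 0 = ?x \<and>
   ((\<phi> (K ?x) \<circ> \<gamma>) has_vector_derivative ?w) (at 0) \<and> \<gamma> 1 = y"
  then obtain J \<gamma>' where J: "open J" "{0..1} \<subseteq> J" "geodesic_on A g J \<gamma>'" "\<gamma>' 0 = ?x"
   "((\<phi> (K ?x) \<circ> \<gamma>') has_vector_derivative ?w) (at 0)" "\<gamma>' 1 = y" by blast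
  have J': "0 \<in> J" "continuous_on J \<gamma>'" using J by (auto simp: geodesic_on_iff)
  note iv = initial_velocity[OF chart_at(1) c]
  have "\<gamma>' 1 = \<gamma> 1"
  proof (rule geodesic_unique[OF c C I(1,3) geod J(1-3)])
   show "((\<phi> c \<circ> \<gamma>) has_vector_derivative D (K ?x) c ?x ?w) (at 0)"
    using iv[OF _ _ I(1) \<gamma>0(2) cont w] xU chart_at(2)[of ?x] by (simp add: \<gamma>0(1))
   show "((\<phi> c \<circ> \<gamma>') has_vector_derivative D (K ?x) c ?x ?w) (at 0)"
    using iv[OF _ _ J(1) J'(1,2) J(5)] xU chart_at(2)[of ?x] by (simp add: J(4))
   show "\<gamma> t \<in> U c \<and> \<phi> c (\<gamma> t) \<in> interior C" if "t \<in> {0..1}" for t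
    using \<gamma>U z(2)[OF rI] I(3) that by auto
  qed (simp add: \<gamma>0 J(4))
  then show "y = \<psi> c (fst (z r))" using J(6) by (simp add: \<gamma>_def)
 qed
qed

end

subsection \<open>Geodesics with cut-off data\<close>

lemma norm_nth2_le: "\<bar>(M::real^'n^'m) $ i $ j\<bar> <= norm M"
 using Finite_Cartesian_Product.norm_nth_le[of "M $ i" j] Finite_Cartesian_Product.norm_nth_le[of M i] by simp

text \<open>T is the position part of the flow of the cut-off spray started at (x, v th x). Since
  the flow is close to the identity and the initial velocity is Lipschitz in x, T t is a
  perturbation of the identity of order t. For points near a and short times the cut-offs are
  inactive, and T is the exponential map.\<close>

lemma (in riemannian) local_geometry_exists:
 assumes n: "2 <= CARD('n)" and c: "c \<in> A" and \<delta>: "0 < \<delta>" and ball: "cball a (4 * \<delta>) \<subseteq> V c"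
  and \<eta>: "Ck_on (Suc 0) UNIV \<eta>" "!!x. 0 <= \<eta> x" "!!x. \<eta> x <= 1" "!!x. \<eta> x ~= 0 ==> x \<in> cball a \<delta>"
 defines "pr \<equiv> closest_point (cball a (4 * \<delta>))"
 shows "\<exists>r0 B L T T'. local_geometry (%x. G c (pr x)) \<eta> a \<delta> r0 B L CARD('n) T T' \<and>
  (\<forall>r th x s. 0 < s --> T r (s *\<^sub>R th) x = T r th x) \<and>
  (\<forall>x\<in>cball a \<delta>. \<forall>th r. th ~= 0 --> 0 < r --> r <= r0 --> T r th x \<in> cball a (4 * \<delta>) \<and>
   exp_map A g (\<psi> c x) (r *\<^sub>R D c (K (\<psi> c x)) (\<psi> c x) (th /\<^sub>R qn (G c x) th)) = \<psi> c (T r th x))"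
proof -
 let ?S = "cball a (4 * \<delta>)"
 have S: "?S ~= {}" using \<delta> by simp
 have prS: "pr x \<in> ?S" and pr_self: "x \<in> ?S ==> pr x = x" and prl: "norm (pr x - pr y) <= norm (x - y)" for x y
  using closest_point_in_set[OF closed_cball S] closest_point_self[of x ?S] closest_point_lipschitz[OF convex_cball closed_cball S, of x y]
  by (auto simp: pr_def dist_norm)
 have V: "open (V c)" by (rule chart(2)[OF c])
 have key: "\<exists>K>0. (\<forall>x. norm (h (pr x)) <= K) \<and> (\<forall>x y. norm (h (pr x) - h (pr y)) <= K * norm (x - y))"
  if C1: "Ck_on (Suc 0) (V c) h" for h :: "real^'n => 'z::real_normed_vector"
 proof -
  obtain K where K: "K > 0" "!!x. x \<in> ?S ==> norm (h x) <= K" "!!x y. x \<in> ?S ==> y \<in> ?S ==> norm (h x - h y) <= K * norm (x - y)"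
   using Ck1_bounded_lipschitz[OF C1 compact_cball convex_cball ball] by blast
  then show ?thesis using prS order_trans[OF K(3)[OF prS prS] mult_left_mono[OF prl]] by (intro exI[of _ K]) auto
 qed
 have "Ck_on (Suc 0) (V c) (%u. matrix_inv (G c u))"
  using V by (simp only: Ck_on_vec_iff) (intro allI Ck_on_matrix_inv[OF V Ck_G[OF c]], use det_G_pos[OF c] in force)
 from key[OF this] obtain KH where KH: "0 < KH" "!!x. norm (matrix_inv (G c (pr x))) <= KH"
  "!!x y. norm (matrix_inv (G c (pr x)) - matrix_inv (G c (pr y))) <= KH * norm (x - y)" by blast
 obtain KG where KG: "0 < KG" "!!x. norm (G c (pr x)) <= KG" "!!x y. norm (G c (pr x) - G c (pr y)) <= KG * norm (x - y)"
  using key[OF Ck_G[OF c]] by blast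
 obtain Kr where Kr: "0 < Kr" "!!x. norm (\<rho> c (pr x)) <= Kr" "!!x y. norm (\<rho> c (pr x) - \<rho> c (pr y)) <= Kr * norm (x - y)"
  using key[OF Ck_\<rho>[OF c]] by blast
 have "Ck_on (Suc 0) (V c) (%u. 1 / \<rho> c u)" using V \<rho>_nz[OF c] by (intro Ck_on_divide Ck_on_const Ck_\<rho> c) auto
 from key[OF this] obtain Ki where Ki: "0 < Ki" "!!x. norm (1 / \<rho> c (pr x)) <= Ki" by blast
 obtain Ke where Ke: "0 < Ke" "!!x y. x \<in> cball a (2 * \<delta>) ==> y \<in> cball a (2 * \<delta>) ==> norm (\<eta> x - \<eta> y) <= Ke * norm (x - y)"
  using Ck1_bounded_lipschitz[OF \<eta>(1) compact_cball convex_cball subset_UNIV] by blast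
 \<comment> \<open>M serves as the bound B and as a lower limit for L. The summand 1 / \<delta>
   covers \<eta> at two points of which one lies within \<delta> of a and the other beyond 2
   \<delta>: the values differ by at most 1, and the distance is at least \<delta>.\<close>
 define M where "M = KG + KH + Kr + Ki + Ke + 1 / \<delta>"
 have M: "KG <= M" "KH <= M" "Kr <= M" "Ki <= M" "Ke <= M" "1 / \<delta> <= M" "0 < M"
  using KG(1) KH(1) Kr(1) Ki(1) Ke(1) \<delta> by (simp_all add: M_def add_pos_pos)
 have up: "x <= M * norm y" if "x <= k * norm y" "k <= M" for x k and y :: "real^'n"
  using that mult_right_mono[OF that(2) norm_ge_zero[of y]] by linarith
 have \<eta>l: "\<eta> x - \<eta> y <= M * norm (x - y)" for x y
 proof (cases "x \<in> cball a \<delta>")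
  case False
  then have "\<eta> x = 0" using \<eta>(4) by blast
  then show ?thesis using \<eta>(2)[of y] M(7) by (simp add: order_trans[of _ 0])
 next
  case x: True
  show ?thesis
  proof (cases "y \<in> cball a (2 * \<delta>)")
   case True
   then show ?thesis using up[OF Ke(2) M(5), of x y] x \<delta> by auto
  next
   case False
   then have "\<delta> <= norm (x - y)" using x dist_triangle[of a y x] by (auto simp: dist_norm)
   then have "1 / \<delta> * \<delta> <= M * norm (x - y)" using M \<delta> by (intro mult_mono) auto
   then show ?thesis using \<eta>(2)[of y] \<eta>(3)[of x] \<delta> by simp
  qed
 qed
 have LM: "local_metric (%x. G c (pr x)) \<eta> a \<delta> r0 M L CARD('n)" if L: "M <= L" "0 < r0" for L r0
 proof
  have up': "x <= L * norm y" if "x <= M * norm y" for x and y :: "real^'n"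
   using that mult_right_mono[OF L(1) norm_ge_zero[of y]] by linarith
  show "pos_def (G c (pr x))" for x using pos_def_G[OF c] prS ball by blast
  show "\<bar>G c (pr x) $ i $ j\<bar> <= M" "\<bar>matrix_inv (G c (pr x)) $ i $ j\<bar> <= M" for x i j
   using order_trans[OF norm_nth2_le KG(2), of x i j] order_trans[OF norm_nth2_le KH(2), of x i j] M by linarith+
  show "\<bar>G c (pr x) $ i $ j - G c (pr y) $ i $ j\<bar> <= L * norm (x - y)" for x y i j
   using up'[OF up[OF order_trans[OF norm_nth2_le KG(3)] M(1), of x y i j]] by simp
  show "\<bar>matrix_inv (G c (pr x)) $ i $ j - matrix_inv (G c (pr y)) $ i $ j\<bar> <= L * norm (x - y)" for x y i j
   using up'[OF up[OF order_trans[OF norm_nth2_le KH(3)] M(2), of x y i j]] by simp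
  show "1 / M <= \<rho> c (pr x)" "\<rho> c (pr x) <= M" for x
  proof -
   have p: "0 < \<rho> c (pr x)" using \<rho>_pos[OF c] prS ball by blast
   have "1 / \<rho> c (pr x) <= M" using Ki(2)[of x] M(4) abs_ge_self[of "1 / \<rho> c (pr x)"] unfolding real_norm_def by linarith
   then show "1 / M <= \<rho> c (pr x)" using p M(7) by (simp add: divide_le_eq mult.commute del: real_sqrt_gt_0_iff)
   show "\<rho> c (pr x) <= M" using Kr(2)[of x] M(3) by simp
  qed
  show "\<bar>\<rho> c (pr x) - \<rho> c (pr y)\<bar> <= L * norm (x - y)" for x y using up'[OF up[OF Kr(3) M(3), of x y]] by simp
  show "\<bar>\<eta> x - \<eta> y\<bar> <= L * norm (x - y)" for x y
   using up'[OF \<eta>l[of x y]] up'[OF \<eta>l[of y x]] by (simp add: abs_le_iff norm_minus_commute)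
 qed (use n \<delta> M L \<eta> in auto)
 \<comment> \<open>The time 1 and the Lipschitz constant M are provisional; v, c0 and c1 are needed
   to choose the final ones, and v and c0 do not depend on this choice.\<close>
 interpret m: local_metric "%x. G c (pr x)" \<eta> a \<delta> 1 M M "CARD('n)" by (rule LM) auto
 define R where "R = m.c0 + 1"
 define F where "F = (%z. \<Phi> c (pr (fst z), closest_point (cball 0 R) (snd z)))"
 have R: "0 <= R" using m.c_pos by (simp add: R_def)
 have "\<exists>k>0. (\<forall>z w. norm (F z - F w) <= k * norm (z - w)) \<and> (\<forall>z. norm (F z) <= k)"
  using \<Phi>_cutoff[OF c compact_cball convex_cball S ball R] unfolding F_def pr_def .
 then obtain k where k: "0 < k" "!!z w. norm (F z - F w) <= k * norm (z - w)" "!!z. norm (F z) <= k"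
  by blast
 \<comment> \<open>k h <= 1/8 is the condition of \<open>flow_exists\<close> and keeps speeds below
   R = c0 + 1; k h <= \<delta> keeps trajectories that start within \<delta> of a within 2 \<delta>.
   So neither cut-off acts on them.\<close>
 define h where "h = min (1 / 8) \<delta> / k"
 have kh: "k * h = min (1 / 8) \<delta>" using k(1) by (simp add: h_def)
 then have h: "0 < h" "k * h <= 1 / 8" "k * h <= \<delta>" "0 <= k" using \<delta> k(1) by (auto simp: h_def)
 obtain fl where fl: "!!z. fl 0 z = z" "!!z t. \<bar>t\<bar> < h ==> ((%t. fl t z) has_vector_derivative F (fl t z)) (at t)"
  "!!z w t. 0 <= t ==> t < h ==> norm (fl t z - fl t w - (z - w)) <= 2 * k * t * norm (z - w)"
  "!!z t. \<bar>t\<bar> < h ==> norm (fl t z - z) <= k * \<bar>t\<bar>" "continuous_on ({0..<h} \<times> UNIV) (%(t, z). fl t z)"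
  by (rule flow_exists[OF k(2,3) h(1,2,4)]) (rule that; assumption)
 define r0 where "r0 = h / 2"
 \<comment> \<open>Clamping the time to [0, r0] makes T Borel for all real times.\<close>
 define cl where "cl t = max 0 (min t r0)" for t
 have r0: "0 < r0" "r0 < h" using h(1) by (auto simp: r0_def)
 have cl: "cl t = t" if "t \<in> {0..r0}" for t using that by (auto simp: cl_def)
 define z where "z t th x = fl t (x, m.v th x)" for t th x
 define T where "T t th x = fst (z (cl t) th x)" for t th x
 define T' where "T' t th x = fst (F (z (cl t) th x))" for t th x
 define q where "q = m.c0 * m.c0 * m.c1"
 have q: "0 <= q" using m.c_pos by (simp add: q_def)
 have vl: "norm (m.v th x - m.v th y) <= q * norm (x - y)" for th x y using m.v_lip by (simp add: q_def)
 \<comment> \<open>The summands serve, in this order, the metric, the deviation of the velocity from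
   v at the moving point, and the deviation of T t from the identity.\<close>
 define L where "L = M + (k + q * k) + 2 * k * (1 + q)"
 have L: "M <= L" "k + q * k <= L" "2 * k * (1 + q) <= L" using M(7) k(1) q by (simp_all add: L_def)
 have zt: "norm (z t th x - (x, m.v th x)) <= k * t" if "t \<in> {0..r0}" for t th x
  using fl(4)[of t "(x, m.v th x)"] that r0 by (simp add: z_def)
 have cpR: "closest_point (cball 0 R) (m.v th x) = m.v th x" for th x
  using m.v_bound[of th x] by (intro closest_point_self) (simp add: R_def)
 have Fs: "fst (F y) = closest_point (cball 0 R) (snd y)" for y by (simp add: F_def \<Phi>_def)
 have nf: "norm (fst y) <= norm y" "norm (snd y) <= norm y" for y :: "(real^'n) \<times> (real^'n)"
  using norm_fst_le[of "fst y" "snd y"] norm_snd_le[of "snd y" "fst y"] by simp_all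
 have Rne: "cball (0::real^'n) R ~= {}" using R by simp
 have der: "((%t. T t th x) has_vector_derivative T' t th x) (at t within {0..r0})" if t: "0 <= t" "t <= r0" for t th x
 proof (rule has_vector_derivative_transform)
  show "((%t. fst (z t th x)) has_vector_derivative T' t th x) (at t within {0..r0})"
  proof -
   have "\<bar>t\<bar> < h" using t r0 by simp
   from has_vector_derivative_at_within[OF bounded_linear.has_vector_derivative[OF bounded_linear_fst fl(2)[OF this, of "(x, m.v th x)"]]]
   show ?thesis using cl[of t] t by (simp add: z_def T'_def)
  qed
 next
  fix s assume "s \<in> {0..r0}"
  then show "T s th x = fst (z s th x)" by (simp add: T_def cl)
 qed (use t in simp)
 have "local_geometry (%x. G c (pr x)) \<eta> a \<delta> r0 M L CARD('n) T T'"
 proof (rule local_geometry.intro[OF LM[OF L(1) r0(1)]], unfold_locales)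
  show "T 0 th x = x" for th x using r0 by (simp add: T_def cl_def z_def fl(1))
  show "((%t. T t th x) has_vector_derivative T' t th x) (at t within {0..r0})" if "0 <= t" "t <= r0" for t th x
   by (rule der[OF that])
  have cF: "continuous_on UNIV F"
   by (rule lipschitz_on_continuous_on[OF lipschitz_onI[of _ _ k]]) (use k in "auto simp: dist_norm")
  show "continuous_on {0..r0} (%t. T' t th x)" for th x
  proof -
   have "continuous_on {0..r0} (%t. fl t (x, m.v th x))"
    by (rule continuous_at_imp_continuous_on) (use has_vector_derivative_continuous[OF fl(2)] r0 in auto)
   then have "continuous_on {0..r0} (%t. fst (F (fl t (x, m.v th x))))"
    by (intro continuous_on_fst continuous_on_compose2[OF cF]) auto
   then show ?thesis by (rule continuous_on_eq) (simp add: T'_def z_def cl)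
  qed
  show "norm (T' t th x - th /\<^sub>R qn (G c (pr (T t th x))) th) <= L * t" if t: "0 <= t" "t <= r0" for t th x
  proof -
   have t': "t \<in> {0..r0}" using t by simp
   have e: "T' t th x - m.v th x = closest_point (cball 0 R) (snd (z t th x)) - closest_point (cball 0 R) (m.v th x)"
    by (simp add: T'_def cl[OF t'] Fs cpR)
   have "norm (T' t th x - m.v th x) <= norm (snd (z t th x) - m.v th x)"
    unfolding e using closest_point_lipschitz[OF convex_cball closed_cball Rne] by (simp add: dist_norm)
   also have "... <= k * t" using order_trans[OF nf(2) zt[OF t', of th x]] by (simp add: snd_diff)
   finally have 1: "norm (T' t th x - m.v th x) <= k * t" .
   have "norm (m.v th x - m.v th (T t th x)) <= q * norm (T t th x - x)" using vl[of th x "T t th x"] by (simp add: norm_minus_commute)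
   also have "... <= q * (k * t)"
    using order_trans[OF nf(1) zt[OF t', of th x]] q by (intro mult_left_mono) (auto simp: T_def cl[OF t'])
   finally have "norm (T' t th x - m.v th (T t th x)) <= (k + q * k) * t"
    using 1 norm_triangle_ineq[of "T' t th x - m.v th x" "m.v th x - m.v th (T t th x)"] by (simp add: algebra_simps)
   also have "... <= L * t" using L(2) t by (intro mult_right_mono)
   finally show ?thesis by (simp add: m.v_def)
  qed
  show "near_identity (L * t) (T t th)" if t: "0 <= t" "t <= r0" for t th
   unfolding near_identity_def
  proof (intro allI)
   fix x y
   let ?x = "(x, m.v th x)" and ?y = "(y, m.v th y)"
   have "norm (T t th x - T t th y - (x - y)) <= norm (fl t ?x - fl t ?y - (?x - ?y))"
    using nf(1)[of "fl t ?x - fl t ?y - (?x - ?y)"] t by (simp add: T_def z_def cl)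
   also have "... <= 2 * k * t * norm (?x - ?y)" using fl(3)[of t ?x ?y] t r0 by simp
   also have "norm (?x - ?y) <= norm (x - y) + norm (m.v th x - m.v th y)" using norm_Pair_le[of "x - y"] by simp
   also have "... <= (1 + q) * norm (x - y)" using vl[of th x y] by (simp add: algebra_simps)
   also have "2 * k * t * ((1 + q) * norm (x - y)) = (2 * k * (1 + q)) * (t * norm (x - y))" by simp
   also have "... <= L * (t * norm (x - y))" using L(3) t by (intro mult_right_mono) auto
   finally show "norm (T t th x - T t th y - (x - y)) <= L * t * norm (x - y)" using t k(1) by (simp add: mult.assoc mult_left_mono)
  qed
  show "(%p. T (fst p) (fst (snd p)) (snd (snd p))) \<in> borel_measurable (borel \<Otimes>\<^sub>M borel \<Otimes>\<^sub>M borel)"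
  proof -
   have "continuous_on UNIV (%(t, y). fl (cl t) y)"
   proof -
    have 1: "continuous_on UNIV (%p::real \<times> (real^'n) \<times> (real^'n). (max 0 (min (fst p) r0), snd p))" by (intro continuous_intros)
    have "range (%p::real \<times> (real^'n) \<times> (real^'n). (max 0 (min (fst p) r0), snd p)) \<subseteq> {0..<h} \<times> UNIV" using r0 by auto
    from continuous_on_compose2[OF fl(5) 1 this] show ?thesis by (simp add: case_prod_unfold cl_def)
   qed
   from borel_measurable_continuous_onI[OF this]
   have fm: "(%(t, y). fl (cl t) y) \<in> borel_measurable (borel \<Otimes>\<^sub>M borel)" by (simp add: borel_prod)
   have "(%p. (fst p, (snd (snd p), m.v (fst (snd p)) (snd (snd p))))) \<in> borel \<Otimes>\<^sub>M borel \<Otimes>\<^sub>M borel \<rightarrow>\<^sub>M borel \<Otimes>\<^sub>M (borel :: ((real^'n) \<times> (real^'n)) measure)"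
    unfolding borel_prod[symmetric, where ?'a="real^'n" and ?'b="real^'n"] by measurable
   from measurable_compose[OF this fm] have "(%p. z (cl (fst p)) (fst (snd p)) (snd (snd p))) \<in> borel_measurable (borel \<Otimes>\<^sub>M borel \<Otimes>\<^sub>M borel)"
    by (simp add: z_def)
   from measurable_compose[OF this borel_measurable_continuous_onI[OF continuous_on_fst[OF continuous_on_id]]]
   show ?thesis by (simp add: T_def)
  qed
 qed
 moreover have "T r (s *\<^sub>R th) x = T r th x" if "0 < s" for r th x s
 proof -
  have "m.v (s *\<^sub>R th) x = m.v th x" using that by (simp add: m.v_def qn_scale)
  then show ?thesis by (simp add: T_def z_def)
 qed
 moreover have "T r th x \<in> ?S \<and> exp_map A g (\<psi> c x) (r *\<^sub>R D c (K (\<psi> c x)) (\<psi> c x) (th /\<^sub>R qn (G c x) th)) = \<psi> c (T r th x)"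
  if x: "x \<in> cball a \<delta>" and r: "0 < r" "r <= r0" for x th r
 proof -
  have zb: "fst (z t th x) \<in> ball a (4 * \<delta>)" "norm (snd (z t th x)) <= R" if t: "\<bar>t\<bar> < h" for t
  proof -
   have "norm (z t th x - (x, m.v th x)) <= k * \<bar>t\<bar>" using fl(4)[OF t] by (simp add: z_def)
   also have "... <= k * h" using t k(1) by simp
   finally have n: "norm (z t th x - (x, m.v th x)) <= k * h" .
   have "norm (fst (z t th x) - x) <= \<delta>" using order_trans[OF nf(1) n] h(3) by simp
   then show "fst (z t th x) \<in> ball a (4 * \<delta>)" using x \<delta> dist_triangle[of a "fst (z t th x)" x] by (auto simp: dist_norm norm_minus_commute)
   have "norm (snd (z t th x) - m.v th x) <= 1" using order_trans[OF nf(2) n] h(2) by simp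
   then show "norm (snd (z t th x)) <= R" using norm_triangle_sub[of "snd (z t th x)" "m.v th x"] m.v_bound[of th x] by (simp add: R_def)
  qed
  have z0: "z 0 th x = (x, m.v th x)" by (simp add: z_def fl(1))
  have xS: "pr x = x" using x \<delta> by (intro pr_self) auto
  have "exp_map A g (\<psi> c (fst (z 0 th x))) (r *\<^sub>R D c (K (\<psi> c (fst (z 0 th x)))) (\<psi> c (fst (z 0 th x))) (snd (z 0 th x))) = \<psi> c (fst (z r th x))"
  proof (rule exp_map_eq[OF c compact_cball convex_cball ball r(1)])
   show "r < h" using r r0 by simp
   fix t assume t: "\<bar>t\<bar> < h"
   show "fst (z t th x) \<in> interior ?S" using zb[OF t] by (simp add: interior_cball)
   have "F (z t th x) = \<Phi> c (z t th x)"
    using zb[OF t] pr_self[of "fst (z t th x)"] closest_point_self[of "snd (z t th x)" "cball 0 R"] by (simp add: F_def)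
   then show "((%t. z t th x) has_vector_derivative \<Phi> c (z t th x)) (at t)" using fl(2)[OF t] unfolding z_def by metis
  qed
  moreover have "T r th x = fst (z r th x)" using r by (simp add: T_def cl)
  ultimately show ?thesis using zb(1)[of r] r r0 by (simp add: z0 m.v_def xS)
 qed
 ultimately show ?thesis by blast
qed

subsection \<open>Localisation of the mean quotient\<close>

context riemannian
begin

text \<open>The cone formula behind \<open>sphere_measure\<close> lives in the preferred chart.
  \<open>nn_integral_sphere_weight\<close> replaces the ball by the weight, and the linear change of
  variables by the derivative of the transition map leads to the chart c. F has to agree with a
  Borel function on the unit sphere only, as the exponential map is under control only
  there.\<close>

lemma sphere_measure_chart:
 assumes c: "c \<in> A" "x \<in> U c" and [measurable]: "F' \<in> borel_measurable borel"
  and F: "!!w. tangent_norm g x w = 1 ==> F w = F' w"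
 shows "ennreal (1 / sphere_vol (CARD('n) - 1)) * (\<integral>\<^sup>+w. F w \<partial>sphere_measure g x)
  = (NN th. ennreal (sphere_weight (G c (\<phi> c x)) th) * F' (D c (K x) x (th /\<^sub>R qn (G c (\<phi> c x)) th)))"
proof -
 define M where "M = (\<chi> i j. g x (axis i 1) (axis j 1))"
 define n where "n = real CARD('n)"
 let ?\<omega> = "unit_ball_vol n" and ?S = "{w. 0 < qn M w \<and> qn M w <= 1}" and ?E = "matrix (D c (K x) x)"
 have gM: "qform M v w = g x v w" for v w
  using bilinear_eq_sum_axis[OF gx(1), of x v w] by (simp add: qform_eq_sum M_def)
 have MG: "M = G (K x) (\<phi> (K x) x)"
  by (simp add: vec_eq_iff G_eq[OF chart_at] D_id[OF chart_at] gM flip: qform_axis)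
 have pd: "pos_def M" unfolding MG using pos_def_G[OF chart_at(1)] chart_at(2) by blast
 have tn: "tangent_norm g x w = qn M w" for w by (simp add: tangent_norm_def qn_def gM)
 have n: "0 < n" "0 < ?\<omega>" by (simp_all add: n_def)
 have sv: "sphere_vol (CARD('n) - 1) = n * ?\<omega>" using zero_less_card_finite[where 'a='n] by (simp add: sphere_vol_def n_def)
 have [measurable]: "?S \<in> sets borel" by measurable
 have dM: "0 <= sqrt (det M)" using pos_def_frame[OF pd] by (metis less_imp_le real_sqrt_ge_0_iff)
 define m where "m = density lborel (%w. ennreal (n * sqrt (det M)) * indicator ?S w)"
 have [measurable_cong]: "sets m = sets borel" by (simp add: m_def)
 have sm: "sphere_measure g x = distr m borel (%w. w /\<^sub>R qn M w)"
  by (simp add: sphere_measure_def tn m_def n_def flip: M_def)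
 have "AE w in m. qn M (w /\<^sub>R qn M w) = 1"
  unfolding m_def by (subst AE_density, measurable) (auto simp: qn_scale indicator_def intro!: AE_I2)
 then have "AE w in distr m borel (%w. w /\<^sub>R qn M w). qn M w = 1"
  by (subst AE_distr_iff) auto
 then have "(\<integral>\<^sup>+w. F w \<partial>sphere_measure g x) = (\<integral>\<^sup>+w. F' w \<partial>distr m borel (%w. w /\<^sub>R qn M w))"
  unfolding sm by (intro nn_integral_cong_AE) (auto elim!: eventually_mono simp: F tn)
 also have "... = (NN w. ennreal (n * sqrt (det M)) * (F' (w /\<^sub>R qn M w) * indicator ?S w))"
  unfolding m_def by (subst nn_integral_distr, measurable, subst nn_integral_density) (auto simp: mult_ac)
 also have "... = ennreal (n * sqrt (det M)) * (NN w. F' (w /\<^sub>R qn M w) * indicator ?S w)"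
  by (rule nn_integral_cmult) measurable
 finally have "ennreal (1 / sphere_vol (CARD('n) - 1)) * (\<integral>\<^sup>+w. F w \<partial>sphere_measure g x)
  = ennreal (1 / (n * ?\<omega>)) * ennreal (n * sqrt (det M)) * (NN w. F' (w /\<^sub>R qn M w) * indicator ?S w)"
  by (simp only: sv mult.assoc)
 also have "ennreal (1 / (n * ?\<omega>)) * ennreal (n * sqrt (det M)) = ennreal (sqrt (det M) / ?\<omega>)"
  using n dM by (subst ennreal_mult[symmetric]) auto
 also have "ennreal (sqrt (det M) / ?\<omega>) * (NN w. F' (w /\<^sub>R qn M w) * indicator ?S w)
  = (NN w. ennreal (sphere_weight M w) * F' (w /\<^sub>R qn M w))"
  unfolding n_def by (rule nn_integral_sphere_weight[OF pd, symmetric]) simp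
 also have "... = ennreal \<bar>det ?E\<bar> * (NN th. ennreal (sphere_weight M (?E *v th)) * F' ((?E *v th) /\<^sub>R qn M (?E *v th)))"
 proof (rule nn_integral_linear_change)
  have "inj ((*v) ?E)"
   using D_inv[OF c(1) chart_at(1) c(2) chart_at(2)] linear_D[OF c(1) chart_at(1) c(2) chart_at(2)]
   by (intro inj_on_inverseI[of _ "D (K x) c x"]) (simp add: matrix_works)
  then show "invertible ?E" using invertible_left_inverse matrix_left_invertible_injective by blast
  have "(%w. sphere_weight M w) \<in> borel_measurable borel"
   unfolding sphere_weight_def qform_eq_sum by (intro borel_measurable_continuous_onI continuous_intros)
  then show "(%w. ennreal (sphere_weight M w) * F' (w /\<^sub>R qn M w)) \<in> borel_measurable borel" by measurable
 qed
 also have "... = (NN th. ennreal (sphere_weight (G c (\<phi> c x)) th) * F' (D c (K x) x (th /\<^sub>R qn (G c (\<phi> c x)) th)))"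
 proof -
  have lin: "linear (D c (K x) x)" by (rule linear_D[OF c(1) chart_at(1) c(2) chart_at(2)])
  have q: "qform M (?E *v th) (?E *v th) = qform (G c (\<phi> c x)) th th" for th using lin by (simp add: matrix_works gM G_eq[OF c])
  have d: "\<bar>det ?E\<bar> * sqrt (det M) = \<rho> c (\<phi> c x)"
   using \<rho>_change[OF c(1) chart_at(1) c(2) chart_at(2)] by (simp add: MG)
  have e: "ennreal \<bar>det ?E\<bar> * (ennreal (sphere_weight M (?E *v th)) * F' ((?E *v th) /\<^sub>R qn M (?E *v th)))
   = ennreal (sphere_weight (G c (\<phi> c x)) th) * F' (D c (K x) x (th /\<^sub>R qn (G c (\<phi> c x)) th))" for th
  proof -
   have "\<bar>det ?E\<bar> * sphere_weight M (?E *v th) = sphere_weight (G c (\<phi> c x)) th"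
    unfolding sphere_weight_def q d[symmetric] by simp
   moreover have "D c (K x) x (th /\<^sub>R qn (G c (\<phi> c x)) th) = (?E *v th) /\<^sub>R qn M (?E *v th)"
    using lin by (simp only: qn_def q linear_scale[OF lin]) (simp add: matrix_works)
   ultimately show ?thesis using sphere_weight_nonneg[OF pd] by (simp add: ennreal_mult[symmetric] mult.assoc[symmetric])
  qed
  have "(%w. sphere_weight M w) \<in> borel_measurable borel"
   unfolding sphere_weight_def qform_eq_sum by (intro borel_measurable_continuous_onI continuous_intros)
  moreover have "(%th. ?E *v th) \<in> borel_measurable borel"
   by (intro borel_measurable_continuous_onI linear_continuous_on matrix_vector_mul_bounded_linear)
  ultimately have [measurable]: "(%th. ?E *v th) \<in> borel_measurable borel" "(%th. sphere_weight M (?E *v th)) \<in> borel_measurable borel"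
   by (auto intro: measurable_compose)
  show ?thesis by (subst nn_integral_cmult[symmetric], measurable) (simp add: e)
 qed
 finally show ?thesis .
qed

end

context compact_riemannian
begin

definition "inner_mean f r x = ennreal (1 / sphere_vol (CARD('n) - 1)) *
 (\<integral>\<^sup>+w. ennreal \<bar>(f (exp_map A g x (r *\<^sub>R w)) - f x) / r\<bar> \<partial>sphere_measure g x)"

text \<open>On the support of \<eta> the exponential map is T in coordinates and stays in S, so f
  enters only through its coordinate expression k on S. The scaling invariance of T in th removes
  the normalisation of the direction. Measurability of the spherical mean is obtained in the same
  way, after multiplication by the function of the partition.\<close>

lemma local_quotient:
 fixes a \<delta> defines "S \<equiv> cball a (4 * \<delta>)"
 assumes c: "c \<in> A" and ball: "S \<subseteq> V c" and r: "0 < r" "r <= r0" and f [measurable]: "f \<in> borel_measurable borel"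
  and lg: "local_geometry (%x. G c (closest_point S x)) \<eta> a \<delta> r0 B L CARD('n) T T'"
  and hom: "!!th x s. 0 < s ==> T r (s *\<^sub>R th) x = T r th x"
  and ex: "!!x th. x \<in> cball a \<delta> ==> th ~= 0 ==> T r th x \<in> S \<and>
   exp_map A g (\<psi> c x) (r *\<^sub>R D c (K (\<psi> c x)) (\<psi> c x) (th /\<^sub>R qn (G c x) th)) = \<psi> c (T r th x)"
 defines "e \<equiv> %x. ennreal (if x \<in> U c then \<eta> (\<phi> c x) else 0)" and "k \<equiv> %u. if u \<in> S then f (\<psi> c u) else 0"
 shows "(%x. e x * inner_mean f r x) \<in> borel_measurable borel" (is ?m)
  and "(\<integral>\<^sup>+x. e x * inner_mean f r x \<partial>vol) = local_geometry.loc (%x. G c (closest_point S x)) \<eta> T k r" (is ?i)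
proof -
 interpret l: local_geometry "%x. G c (closest_point S x)" \<eta> a \<delta> r0 B L "CARD('n)" T T' by (rule lg)
 have [measurable]: "S \<in> sets borel" by (simp add: S_def)
 have km [measurable]: "k \<in> borel_measurable borel"
 proof -
  have "\<psi> c u = ext c u" if "u \<in> S" for u using ball that by (auto simp: ext_def)
  then have "k = (%u. if u \<in> S then f (ext c u) else 0)" by (simp add: k_def cong: if_cong)
  then show ?thesis using c by simp
 qed
 define J where "J u = ennreal (\<eta> u) * (NN th. ennreal (l.w u th) * ennreal (\<bar>k (T r th u) - k u\<bar> / r))" for u
 have [measurable]: "J \<in> borel_measurable borel" unfolding J_def by measurable
 have eJ: "e x * inner_mean f r x = (if x \<in> U c then J (\<phi> c x) else 0)" for x
 proof (cases "x \<in> U c \<and> \<eta> (\<phi> c x) ~= 0")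
  case False then show ?thesis by (auto simp: e_def J_def)
 next
  case True
  let ?u = "\<phi> c x"
  have x: "x \<in> U c" and u: "?u \<in> cball a \<delta>" using True l.\<eta>(3) by auto
  have uS: "?u \<in> S" using u l.const(1) by (auto simp: S_def)
  have Gu: "G c (closest_point S ?u) = G c ?u" using uS by (simp add: closest_point_self)
  have \<psi>u: "\<psi> c ?u = x" by (rule chart(5)[OF c x])
  note lD = linear_D[OF chart_at(1) c chart_at(2) x]
  define F' where "F' w = ennreal (\<bar>k (T r (D (K x) c x w) ?u) - k ?u\<bar> / r)" for w
  have [measurable]: "D (K x) c x \<in> borel_measurable borel"
   by (intro borel_measurable_continuous_onI linear_continuous_on) (use lD linear_conv_bounded_linear in blast)
  have "inner_mean f r x = (NN th. ennreal (sphere_weight (G c ?u) th) * F' (D c (K x) x (th /\<^sub>R qn (G c ?u) th)))"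
   unfolding inner_mean_def
  proof (rule sphere_measure_chart[OF c x])
   show "F' \<in> borel_measurable borel" unfolding F'_def by measurable
   fix w assume w: "tangent_norm g x w = 1"
   let ?th = "D (K x) c x w"
   have Dw: "D c (K x) x ?th = w" by (rule D_inv[OF chart_at(1) c chart_at(2) x])
   have q1: "qn (G c ?u) ?th = 1" using w by (simp add: qn_def tangent_norm_def G_eq[OF c x] Dw)
   then have "?th ~= 0" by (auto simp: qn_def qform_zero)
   from ex[OF u this] show "ennreal \<bar>(f (exp_map A g x (r *\<^sub>R w)) - f x) / r\<bar> = F' w"
    using uS r by (simp add: F'_def k_def \<psi>u q1 Dw)
  qed
  also have "... = (NN th. ennreal (l.w ?u th) * ennreal (\<bar>k (T r th ?u) - k ?u\<bar> / r))"
  proof (rule nn_integral_cong)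
   fix th
   have "T r (th /\<^sub>R qn (G c ?u) th) ?u = T r th ?u"
   proof (cases "th = 0")
    case False
    then have "0 < qn (G c ?u) th" using pos_def_G[OF c imageI[OF x]] qn_pos_iff by blast
    then show ?thesis by (intro hom) simp
   qed simp
   then show "ennreal (sphere_weight (G c ?u) th) * F' (D c (K x) x (th /\<^sub>R qn (G c ?u) th)) = ennreal (l.w ?u th) * ennreal (\<bar>k (T r th ?u) - k ?u\<bar> / r)"
    by (simp add: F'_def l.w_def Gu D_inv[OF c chart_at(1) x chart_at(2)])
  qed
  finally show ?thesis using x by (simp add: e_def J_def)
 qed
 have "(%x. if x \<in> U c then \<phi> c x else undefined) \<in> borel_measurable borel"
  using chart[OF c] by (intro measurable_if_open)
 moreover have [measurable]: "U c \<in> sets borel" using chart(1)[OF c] by simp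
 ultimately have "(%x. if x \<in> U c then J (if x \<in> U c then \<phi> c x else undefined) else 0) \<in> borel_measurable borel" by measurable
 also have "(%x. if x \<in> U c then J (if x \<in> U c then \<phi> c x else undefined) else 0) = (%x. e x * inner_mean f r x)"
  by (auto simp: eJ)
 finally show m: ?m .
 have "(\<integral>\<^sup>+x. e x * inner_mean f r x \<partial>vol) = (NN u. ennreal (wt c u) * (e (\<psi> c u) * inner_mean f r (\<psi> c u)))"
  by (rule nn_integral_chart[OF c m]) (simp add: e_def)
 also have "... = l.loc k r"
  unfolding l.loc_def
 proof (rule nn_integral_cong)
  fix u
  show "ennreal (wt c u) * (e (\<psi> c u) * inner_mean f r (\<psi> c u)) = (NN th. ennreal (l.A u th * \<bar>k (T r th u) - k u\<bar> / r))"
  proof (cases "u \<in> cball a \<delta>")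
   case True
   then have u: "u \<in> S" "u \<in> V c" using ball l.const(1) by (auto simp: S_def)
   have "l.\<rho> u = wt c u" using u by (simp add: l.\<rho>_def wt_def closest_point_self)
   then have "(NN th. ennreal (l.A u th * \<bar>k (T r th u) - k u\<bar> / r))
    = (NN th. (ennreal (wt c u) * ennreal (\<eta> u)) * (ennreal (l.w u th) * ennreal (\<bar>k (T r th u) - k u\<bar> / r)))"
    using l.\<eta>(1)[of u] l.w_nonneg r wt_nonneg[OF c] by (intro nn_integral_cong) (simp add: l.A_def ennreal_mult[symmetric] mult_ac)
   also have "... = ennreal (wt c u) * J u" by (subst nn_integral_cmult) (auto simp: J_def mult.assoc)
   finally show ?thesis using chart(6,7)[OF c u(2)] by (simp add: eJ)
  next
   case False
   then have "\<eta> u = 0" using l.\<eta>(3) by blast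
   then show ?thesis using chart(7)[OF c, of u] by (cases "u \<in> V c") (simp_all add: eJ J_def l.A_def wt_def)
  qed
 qed
 finally show ?i .
qed

text \<open>The volume density is bounded below on the compact S, so integrability for the
  Riemannian volume passes to Lebesgue measure.\<close>

lemma integrable_chart_ball:
 assumes c: "c \<in> A" and S: "compact S" "convex S" "S \<subseteq> V c" and f: "integrable vol f"
 shows "integrable lborel (%u. if u \<in> S then f (\<psi> c u) else (0::real))"
proof -
 have [measurable]: "f \<in> borel_measurable borel" using borel_measurable_integrable[OF f] by (simp add: measurable_def)
 have "closed (\<psi> c ` S)"
  using S chart(4)[OF c] by (intro compact_imp_closed compact_continuous_image) (auto intro: continuous_on_subset)
 then have [measurable]: "\<psi> c ` S \<in> sets borel" "S \<in> sets borel" using compact_imp_closed[OF S(1)] by auto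
 have "Ck_on (Suc 0) (V c) (%u. 1 / \<rho> c u)" using chart(2)[OF c] \<rho>_nz[OF c] by (intro Ck_on_divide Ck_on_const Ck_\<rho> c) auto
 from Ck1_bounded_lipschitz[OF this S] obtain B where B: "!!u. u \<in> S ==> norm (1 / \<rho> c u) <= B" by blast
 have "integrable vol (%x. indicator (\<psi> c ` S) x *\<^sub>R f x)" by (rule integrable_mult_indicator[OF _ f]) simp
 then have "integrable lborel (%u. wt c u * (indicator (\<psi> c ` S) (\<psi> c u) *\<^sub>R f (\<psi> c u)))"
  using S(3) chart(6)[OF c] by (subst (asm) integral_chart(1)[OF c]) (auto simp: indicator_def)
 from integrable_mult_right[OF this, of B] show ?thesis
 proof (rule integrable_bound)
  have "(%u. if u \<in> S then f (ext c u) else 0) \<in> borel_measurable borel" using c by measurable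
  then show "(%u. if u \<in> S then f (\<psi> c u) else 0) \<in> borel_measurable lborel"
   using S(3) by (simp add: ext_def subset_iff cong: if_cong)
  show "AE u in lborel. norm (if u \<in> S then f (\<psi> c u) else 0) <= norm (B * (wt c u * (indicator (\<psi> c ` S) (\<psi> c u) *\<^sub>R f (\<psi> c u))))"
  proof (rule AE_I2)
   fix u
   show "norm (if u \<in> S then f (\<psi> c u) else 0) <= norm (B * (wt c u * (indicator (\<psi> c ` S) (\<psi> c u) *\<^sub>R f (\<psi> c u))))"
   proof (cases "u \<in> S")
    case True
    then have u: "u \<in> V c" using S by auto
    have p: "0 < \<rho> c u" by (rule \<rho>_pos[OF c u])
    have "1 / \<rho> c u <= B" using B[OF True] abs_ge_self[of "1 / \<rho> c u"] unfolding real_norm_def by linarith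
    then have "1 <= B * \<rho> c u" using p by (simp add: divide_le_eq del: real_sqrt_gt_0_iff)
    then have "1 * \<bar>f (\<psi> c u)\<bar> <= \<bar>B * \<rho> c u\<bar> * \<bar>f (\<psi> c u)\<bar>" by (intro mult_right_mono) auto
    then show ?thesis using True u by (simp add: wt_def abs_mult mult.assoc)
   qed simp
  qed
 qed
qed

text \<open>Indexed by points: x contributes its preferred chart and a bump of radius \<delta> x,
  while the ball of radius 4 \<delta> x in the chart leaves room for geodesics and for
  mollification. Finitely many bumps cover the manifold and are divided by their sum.\<close>

lemma partition_of_unity:
 obtains P :: "'a set" and \<delta> :: "'a => real" and \<zeta> :: "'a => 'a => real" where "finite P" "!!x. 0 < \<delta> x" "!!x. cball (\<phi> (K x) x) (4 * \<delta> x) \<subseteq> V (K x)"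
  "!!x y. x \<in> P ==> 0 <= \<zeta> x y" "!!x y. x \<in> P ==> \<zeta> x y <= 1" "!!x d k. d \<in> A ==> Ck_on k (V d) (%u. \<zeta> x (\<psi> d u))"
  "!!x y. \<zeta> x y ~= 0 ==> y \<in> \<psi> (K x) ` cball (\<phi> (K x) x) (\<delta> x)" "!!y. (\<Sum>x\<in>P. \<zeta> x y) = 1"
proof -
 have "\<exists>e>0. cball (\<phi> (K x) x) (4 * e) \<subseteq> V (K x)" for x
 proof -
  obtain e where "0 < e" "cball (\<phi> (K x) x) e \<subseteq> V (K x)"
   using chart(2)[OF chart_at(1)] chart_at(2) unfolding open_contains_cball by blast
  then show ?thesis by (intro exI[of _ "e / 4"]) simp
 qed
 then obtain \<delta> where \<delta>: "!!x. 0 < \<delta> x" "!!x. cball (\<phi> (K x) x) (4 * \<delta> x) \<subseteq> V (K x)" by metis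
 define b where "b x y = (if y \<in> U (K x) then bump (\<delta> x) (\<phi> (K x) y - \<phi> (K x) x) else 0)" for x y
 have b0: "0 <= b x y" for x y by (simp add: b_def bump_nonneg)
 define N where "N x = U (K x) \<inter> \<phi> (K x) -` ball (\<phi> (K x) x) (\<delta> x)" for x
 have N: "open (N x)" "x \<in> N x" for x
  unfolding N_def using chart_at[of x] \<delta>(1)[of x] continuous_open_preimage[OF chart(3,1)[OF chart_at(1)] open_ball] by auto
 obtain P where P: "finite P" "(\<Union>x\<in>P. N x) = UNIV"
  using compactE_image[OF compact, of UNIV N] N by (metis UNIV_I UN_I subsetI top.extremum_unique)
 have bpos: "0 < (\<Sum>x\<in>P. b x y)" for y
 proof -
  obtain x where x: "x \<in> P" "y \<in> N x" using P(2) by blast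
  then have "0 < b x y" by (auto simp: b_def N_def bump_pos_iff[OF \<delta>(1)] dist_norm norm_minus_commute)
  then show ?thesis using x(1) P(1) b0 by (intro sum_pos2[of _ x]) auto
 qed
 have bs: "y \<in> \<psi> (K x) ` cball (\<phi> (K x) x) (\<delta> x)" if "b x y ~= 0" for x y
 proof -
  have y: "y \<in> U (K x)" "norm (\<phi> (K x) y - \<phi> (K x) x) < \<delta> x"
   using that bump_eq_0[OF \<delta>(1)] by (auto simp: b_def not_le[symmetric] split: if_splits)
  then show ?thesis using chart(5)[OF chart_at(1) y(1)] by (intro image_eqI[of _ _ "\<phi> (K x) y"]) (auto simp: dist_norm norm_minus_commute)
 qed
 have Cb: "Ck_on k (V d) (%u. b x (\<psi> d u))" if d: "d \<in> A" for x d k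
 proof (rule Ck_extension[OF chart_at(1) d compact_cball])
  show "cball (\<phi> (K x) x) (\<delta> x) \<subseteq> V (K x)" using \<delta>[of x] by (auto intro!: subset_trans[OF _ \<delta>(2)])
  have "Ck_on k (W d (K x)) (%u. bump (\<delta> x) (\<tau> d (K x) u - \<phi> (K x) x))"
   by (rule Ck_on_compose[OF open_W[OF d chart_at(1)] open_UNIV Ck_on_diff[OF open_W[OF d chart_at(1)] tr(3)[OF d chart_at(1)] Ck_on_const[OF open_W[OF d chart_at(1)]]] Ck_on_bump]) auto
  then show "Ck_on k (W d (K x)) (%u. b x (\<psi> d u))"
   by (rule Ck_on_cong[OF open_W[OF d chart_at(1)], rotated]) (auto simp: b_def W_iff[OF d] tr(1)[OF d chart_at(1)])
  show "b x (\<psi> d u) = 0" if "\<psi> d u \<notin> \<psi> (K x) ` cball (\<phi> (K x) x) (\<delta> x)" for u using bs[of x "\<psi> d u"] that by blast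
 qed
 define \<zeta> where "\<zeta> x y = b x y / (\<Sum>x\<in>P. b x y)" for x y
 show thesis
 proof (rule that[of P \<delta> \<zeta>, OF P(1) \<delta>])
  fix x y
  show "\<zeta> x y ~= 0 ==> y \<in> \<psi> (K x) ` cball (\<phi> (K x) x) (\<delta> x)" using bs[of x y] by (auto simp: \<zeta>_def)
  show "0 <= \<zeta> x y" using b0 bpos[of y] by (simp add: \<zeta>_def)
  assume "x \<in> P"
  from member_le_sum[OF this, of "%x. b x y"] show "\<zeta> x y <= 1" using bpos[of y] b0 P(1) by (simp add: \<zeta>_def)
 next
  fix x d k assume "d \<in> A"
  then show "Ck_on k (V d) (%u. \<zeta> x (\<psi> d u))"
   unfolding \<zeta>_def using less_imp_neq[OF bpos, symmetric] by (intro Ck_on_divide Ck_on_sum Cb chart(2))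
 next
  show "(\<Sum>x\<in>P. \<zeta> x y) = 1" for y using bpos[of y] by (simp add: \<zeta>_def sum_divide_distrib[symmetric])
 qed
qed

end

subsection \<open>Proof of the theorem\<close>

text \<open>The choices in the sets C x are independent, so near-optimal elements can be taken in
  all of them at once. Each set is bounded because the other choices can be frozen at g0.\<close>

lemma sum_Sup_le:
 fixes C :: "'k => real set"
 assumes P: "finite P" and ne: "!!x. x \<in> P ==> C x ~= {}" and b: "!!g. (!!x. x \<in> P ==> g x \<in> C x) ==> (\<Sum>x\<in>P. g x) <= b"
 shows "x \<in> P ==> bdd_above (C x)" "(\<Sum>x\<in>P. Sup (C x)) <= b"
proof -
 obtain g0 where g0: "!!x. x \<in> P ==> g0 x \<in> C x" using bchoice[of P "%x y. y \<in> C x"] ne by blast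
 show bdd: "bdd_above (C x)" if x: "x \<in> P" for x
 proof (rule bdd_aboveI)
  fix s assume "s \<in> C x"
  then have "(\<Sum>y\<in>P. if y = x then s else g0 y) <= b" using g0 by (intro b) auto
  then show "s <= b - (\<Sum>y\<in>P - {x}. g0 y)" using P x by (simp add: sum.remove[of P x])
 qed
 show "(\<Sum>x\<in>P. Sup (C x)) <= b"
 proof (rule field_le_epsilon)
  fix e :: real assume e: "0 < e"
  define e' where "e' = e / (real (card P) + 1)"
  have e': "0 < e'" "real (card P) * e' <= e" using e by (auto simp: e'_def field_simps)
  have "\<exists>s\<in>C x. Sup (C x) - e' < s" if "x \<in> P" for x
   using less_cSup_iff[OF ne[OF that] bdd[OF that], of "Sup (C x) - e'"] e'(1) by auto
  then obtain g where g: "!!x. x \<in> P ==> g x \<in> C x" "!!x. x \<in> P ==> Sup (C x) - e' < g x" by metis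
  have "(\<Sum>x\<in>P. Sup (C x)) <= (\<Sum>x\<in>P. g x + e')" using g(2) by (intro sum_mono) (force intro: less_imp_le)
  also have "... <= b + e" using b[OF g(1)] e'(2) by (simp add: sum.distrib)
  finally show "(\<Sum>x\<in>P. Sup (C x)) <= b + e" .
 qed
qed

lemma qn_sum_le: "pos_def M ==> qn M (\<Sum>x\<in>P. v x) <= (\<Sum>x\<in>P. qn M (v x))" for M :: "real^'n^'n"
proof (induction P rule: infinite_finite_induct)
 case (insert x F)
 then show ?case using qn_triangle[of M "v x + sum v F" "v x"] by simp
qed (simp_all add: qn_def qform_zero)

section \<open>Vector fields supported in one chart\<close>

context riemannian
begin

lemma tangent_norm_coords:
 assumes c: "c \<in> A" "x \<in> U c"
 shows "tangent_norm g x (D c (K x) x v) = qn (G c (\<phi> c x)) v" "tangent_norm g x w = qn (G c (\<phi> c x)) (D (K x) c x w)"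
proof -
 show 1: "tangent_norm g x (D c (K x) x v) = qn (G c (\<phi> c x)) v" for v by (simp add: tangent_norm_def qn_def G_eq[OF c])
 show "tangent_norm g x w = qn (G c (\<phi> c x)) (D (K x) c x w)"
  using 1[of "D (K x) c x w"] D_inv[OF chart_at(1) c(1) chart_at(2) c(2)] by simp
qed

definition "field_of c Z x = (if x \<in> U c then D c (K x) x (Z (\<phi> c x)) else 0)"

lemma field_of_coords: "c \<in> A ==> u \<in> V c ==> field_coords A c (field_of c Z) u = Z u"
 using chart(6,7)[of c u] D_inv[of c "K (\<psi> c u)" "\<psi> c u"] chart_at[of "\<psi> c u"]
 by (simp add: field_coords_def tangent_to_coords_def field_of_def)

lemma smooth_field_of:
 assumes c: "c \<in> A" and C: "compact C" "C \<subseteq> V c" and Z: "!!k. Ck_on k (V c) Z" "!!u. u \<notin> C ==> Z u = 0"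
 shows "smooth_vector_field A (field_of c Z)"
 unfolding smooth_vector_field_def smooth_on_def
proof (intro ballI allI)
 fix d k assume d: "d \<in> A"
 have W: "open (W d c)" "open (W c d)" by (rule open_W[OF d c], rule open_W[OF c d])
 have sub: "\<tau> d c ` W d c \<subseteq> V c" "\<tau> d c ` W d c \<subseteq> W c d" using tr(2)[OF d c] by auto
 show "Ck_on k (V d) (X\<^sub>c d (field_of c Z))"
 proof (rule Ck_extension[OF c d C])
  have "Ck_on k (W d c) (%u. \<Sum>b\<in>Basis. (Z (\<tau> d c u) \<bullet> b) *\<^sub>R Dv (\<tau> c d) (\<tau> d c u) b)"
   by (intro Ck_on_sum Ck_on_scaleR Ck_on_inner Ck_on_const W Ck_on_compose[OF W(1) chart(2)[OF c] tr(3)[OF d c] Z(1) sub(1)]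
    Ck_on_compose[OF W(1) W(2) tr(3)[OF d c] Ck_on_SucD(2)[OF tr(3)[OF c d]] sub(2)])
  then show "Ck_on k (W d c) (X\<^sub>c d (field_of c Z))"
  proof (rule Ck_on_cong[OF W(1), rotated])
   fix u assume "u \<in> W d c"
   then obtain x where x: "x \<in> U d" "x \<in> U c" "u = \<phi> d x" by blast
   have "X\<^sub>c d (field_of c Z) u = D c d x (Z (\<phi> c x))"
    using D_chain[OF c chart_at(1) d x(2) chart_at(2) x(1)] chart(5)[OF d x(1)] x
    by (simp add: field_coords_def tangent_to_coords_def field_of_def)
   then show "(\<Sum>b\<in>Basis. (Z (\<tau> d c u) \<bullet> b) *\<^sub>R Dv (\<tau> c d) (\<tau> d c u) b) = X\<^sub>c d (field_of c Z) u"
    using has_derivative_sum_Basis[OF tr(4)[OF c d x(2,1)], of "Z (\<phi> c x)"] tr(2)[OF d c x(1)] x(3) by simp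
  qed
  fix u assume u: "u \<in> V d" "\<psi> d u \<notin> \<psi> c ` C"
  let ?x = "\<psi> d u"
  have "field_of c Z ?x = 0"
  proof (cases "?x \<in> U c")
   case True
   then have "\<phi> c ?x \<notin> C" using u(2) chart(5)[OF c True] by (metis imageI)
   then show ?thesis using linear_0[OF linear_D[OF c chart_at(1) True chart_at(2)]] by (simp add: field_of_def Z(2))
  qed (simp add: field_of_def)
  then show "X\<^sub>c d (field_of c Z) u = 0"
   using linear_0[OF linear_D[OF chart_at(1) d chart_at(2) chart(6)[OF d u(1)]]] by (simp add: field_coords_def tangent_to_coords_def)
 qed
qed

end

text \<open>The partition and the local geometries, obtained by choice, become parameters shared by
  the two halves of the proof.\<close>

locale variation = compact_riemannian A g
 for A :: "('a::{t2_space,second_countable_topology}, 'n::finite) chart set" and g :: "('a, 'n) metric_tensor" +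
 fixes f :: "'a => real" and P :: "'a set" and \<delta> :: "'a => real" and \<zeta> :: "'a => 'a => real"
  and \<eta> r0 B L T T' and kn :: real
 assumes kn: "kn = variation_const CARD('n)" and n: "2 <= CARD('n)" and f: "integrable vol f" and P: "finite P"
  and \<delta>: "x \<in> P ==> 0 < \<delta> x" "x \<in> P ==> cball (\<phi> (K x) x) (4 * \<delta> x) \<subseteq> V (K x)"
  and \<zeta>: "x \<in> P ==> 0 <= \<zeta> x y" "x \<in> P ==> d \<in> A ==> Ck_on k (V d) (%u. \<zeta> x (\<psi> d u))"
   "x \<in> P ==> \<zeta> x y ~= 0 ==> y \<in> \<psi> (K x) ` cball (\<phi> (K x) x) (\<delta> x)" "(\<Sum>x\<in>P. \<zeta> x y) = 1"
  and \<eta>: "\<eta> x u = (if u \<in> V (K x) then \<zeta> x (\<psi> (K x) u) else 0)"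
  and lg: "x \<in> P ==> local_geometry (%u. G (K x) (closest_point (cball (\<phi> (K x) x) (4 * \<delta> x)) u)) (\<eta> x) (\<phi> (K x) x) (\<delta> x)
   (r0 x) (B x) (L x) CARD('n) (T x) (T' x)"
  and hom: "x \<in> P ==> 0 < s ==> T x r (s *\<^sub>R th) u = T x r th u"
  and ex: "x \<in> P ==> u \<in> cball (\<phi> (K x) x) (\<delta> x) ==> th ~= 0 ==> 0 < r ==> r <= r0 x ==>
   T x r th u \<in> cball (\<phi> (K x) x) (4 * \<delta> x) \<and>
   exp_map A g (\<psi> (K x) u) (r *\<^sub>R D (K x) (K (\<psi> (K x) u)) (\<psi> (K x) u) (th /\<^sub>R qn (G (K x) u) th)) = \<psi> (K x) (T x r th u)"
begin

definition "S x = cball (\<phi> (K x) x) (4 * \<delta> x)"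
definition "Gx x u = G (K x) (closest_point (S x) u)"
definition "k x u = (if u \<in> S x then f (\<psi> (K x) u) else 0)"
definition "lc x r = local_geometry.loc (Gx x) (\<eta> x) (T x) (k x) r"
abbreviation "Q r \<equiv> mean_geodesic_quotient A g f r"
definition "J X = (LINT x|vol. f x * divergence A g X x)"

lemma geometry: "x \<in> P ==> local_geometry (Gx x) (\<eta> x) (\<phi> (K x) x) (\<delta> x) (r0 x) (B x) (L x) CARD('n) (T x) (T' x)"
 using lg unfolding Gx_def S_def .

lemma SV: "x \<in> P ==> S x \<subseteq> V (K x)"
 using \<delta>(2) by (simp add: S_def)

lemma ballS: "x \<in> P ==> s <= 4 ==> cball (\<phi> (K x) x) (s * \<delta> x) \<subseteq> S x"
 unfolding S_def using \<delta>(1)[of x] by (intro subset_cball mult_right_mono) auto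

lemma kn_pos: "0 < kn"
 using n by (simp add: kn variation_const_def sphere_vol_def)

lemma f_meas [measurable]: "f \<in> borel_measurable borel"
 using borel_measurable_integrable[OF f] by (simp add: measurable_def)

lemma k_int: "x \<in> P ==> integrable lborel (k x)"
 unfolding k_def using SV by (intro integrable_chart_ball chart_at f) (auto simp: S_def)

lemma fdiv_int:
 assumes "smooth_vector_field A X"
 shows "integrable vol (%x. f x * divergence A g X x)"
proof -
 note c = continuous_divergence[OF assms]
 obtain M where M: "!!x. \<bar>divergence A g X x\<bar> <= M"
  using compact_imp_bounded[OF compact_continuous_image[OF c compact]] unfolding bounded_iff by auto
 have [measurable]: "divergence A g X \<in> borel_measurable borel" by (rule borel_measurable_continuous_onI[OF c])
 show ?thesis
 proof (rule integrable_bound[OF integrable_mult_right[OF f, of M]])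
  have "\<bar>f x\<bar> * \<bar>divergence A g X x\<bar> <= \<bar>f x\<bar> * \<bar>M\<bar>" for x using M[of x] by (intro mult_left_mono) auto
  then show "AE x in vol. norm (f x * divergence A g X x) <= norm (M * f x)" by (simp add: abs_mult mult.commute)
 qed measurable
qed

text \<open>The functions of the partition sum to 1 under the outer integral; each piece is Borel by
  \<open>local_quotient\<close>, so the finite sum can be taken out.\<close>

lemma quotient_eq:
 assumes r: "0 < r" "!!x. x \<in> P ==> r <= r0 x"
 shows "Q r = (\<Sum>x\<in>P. lc x r)"
proof -
 let ?e = "%x y. ennreal (if y \<in> U (K x) then \<eta> x (\<phi> (K x) y) else 0)"
 have e: "?e x y = ennreal (\<zeta> x y)" if "x \<in> P" for x y
 proof (cases "y \<in> U (K x)")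
  case True then show ?thesis using chart(5)[OF chart_at(1) True] by (simp add: \<eta>)
 next
  case False
  have "\<psi> (K x) ` cball (\<phi> (K x) x) (\<delta> x) \<subseteq> U (K x)"
   using ballS[OF that, of 1] SV[OF that] chart(6)[OF chart_at(1), of _ x] by auto
  then have "\<zeta> x y = 0" using \<zeta>(3)[OF that, of y] False by blast
  then show ?thesis using False by simp
 qed
 have lq: "(%y. ?e x y * inner_mean f r y) \<in> borel_measurable borel" "(\<integral>\<^sup>+y. ?e x y * inner_mean f r y \<partial>vol) = lc x r" if x: "x \<in> P" for x
  unfolding lc_def Gx_def k_def S_def
  by (rule local_quotient[OF chart_at(1) \<delta>(2)[OF x] r(1) r(2)[OF x] f_meas lg[OF x] hom[OF x] ex[OF x _ _ r(1) r(2)[OF x]]]; assumption?)+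
 have "inner_mean f r y = (\<Sum>x\<in>P. ?e x y * inner_mean f r y)" for y
 proof -
  have "(\<Sum>x\<in>P. ?e x y) = (\<Sum>x\<in>P. ennreal (\<zeta> x y))" by (rule sum.cong[OF refl e])
  also have "... = ennreal (\<Sum>x\<in>P. \<zeta> x y)" by (rule sum_ennreal[OF \<zeta>(1)])
  finally have "(\<Sum>x\<in>P. ?e x y) = ennreal (\<Sum>x\<in>P. \<zeta> x y)" .
  then show ?thesis by (simp add: sum_distrib_right[symmetric] \<zeta>(4))
 qed
 then have "Q r = (\<integral>\<^sup>+y. (\<Sum>x\<in>P. ?e x y * inner_mean f r y) \<partial>vol)"
  unfolding mean_geodesic_quotient_def inner_mean_def[symmetric] by (rule nn_integral_cong)
 also have "... = (\<Sum>x\<in>P. lc x r)" using lq by (subst nn_integral_sum) (auto cong: measurable_cong_sets)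
 finally show ?thesis .
qed

text \<open>Z x / \<rho> has norm at most \<zeta> x + \<kappa> x at each point. Summed over the
  partition this is at most 1 plus the sum of the \<kappa> x, whatever fields are chosen in the
  single charts, so division by that number yields one admissible global field.\<close>

lemma upper_fields:
 assumes v: "!!X. smooth_vector_field A X ==> (!!x. tangent_norm g x (X x) <= 1) ==> J X <= v"
  and \<kappa>: "!!x. x \<in> P ==> 0 <= \<kappa> x"
  and Z: "!!x k. x \<in> P ==> Ck_on k UNIV (Z x)" "!!x u. x \<in> P ==> u \<notin> cball (\<phi> (K x) x) (3 * \<delta> x) ==> Z x u = 0"
   "!!x u. x \<in> P ==> qn (Gx x u) (Z x u) <= sqrt (det (Gx x u)) * (\<eta> x u + \<kappa> x)"
 shows "(\<Sum>x\<in>P. LB u. k x u * divg (Z x) u) <= (1 + (\<Sum>x\<in>P. \<kappa> x)) * v"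
proof -
 define s where "s = inverse (1 + (\<Sum>x\<in>P. \<kappa> x))"
 have s1: "0 < 1 + (\<Sum>x\<in>P. \<kappa> x)" using sum_nonneg[of P \<kappa>] \<kappa> by (simp add: add_pos_nonneg)
 then have s: "0 < s" by (simp add: s_def)
 define Y where "Y x u = (s / \<rho> (K x) u) *\<^sub>R Z x u" for x u
 let ?C = "%x. cball (\<phi> (K x) x) (3 * \<delta> x)"
 have C: "?C x \<subseteq> V (K x)" "?C x \<subseteq> S x" if "x \<in> P" for x using ballS[OF that, of 3] SV[OF that] by auto
 define X where "X x = field_of (K x) (Y x)" for x
 have sX: "smooth_vector_field A (X x)" if x: "x \<in> P" for x
  unfolding X_def
 proof (rule smooth_field_of[OF chart_at(1) compact_cball C(1)[OF x]])
  show "Ck_on j (V (K x)) (Y x)" for j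
   unfolding Y_def using chart(2)[OF chart_at(1)] \<rho>_nz[OF chart_at(1)]
   by (intro Ck_on_scaleR Ck_on_divide Ck_on_const Ck_\<rho> chart_at Ck_on_subset[OF Z(1)[OF x]]) auto
 qed (simp add: Y_def Z(2)[OF x])
 have sS: "smooth_vector_field A (%y. \<Sum>x\<in>P. X x y)" by (rule smooth_vector_field_sum[OF sX])
 have bd: "tangent_norm g y (X x y) <= s * (\<zeta> x y + \<kappa> x)" if x: "x \<in> P" for x y
 proof (cases "y \<in> U (K x) \<and> \<phi> (K x) y \<in> ?C x")
  case True
  let ?u = "\<phi> (K x) y"
  have u: "?u \<in> S x" using True C(2)[OF x] by blast
  then have G: "Gx x ?u = G (K x) ?u" by (simp add: Gx_def closest_point_self)
  have p: "0 < \<rho> (K x) ?u" using True by (intro \<rho>_pos chart_at) auto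
  have "tangent_norm g y (X x y) = (s / \<rho> (K x) ?u) * qn (G (K x) ?u) (Z x ?u)"
   using tangent_norm_coords(1)[OF chart_at(1)] True s p by (simp add: X_def field_of_def Y_def qn_scale abs_of_pos del: real_sqrt_gt_0_iff)
  also have "... <= (s / \<rho> (K x) ?u) * (\<rho> (K x) ?u * (\<zeta> x y + \<kappa> x))"
   by (rule mult_left_mono[OF _ less_imp_le[OF divide_pos_pos[OF s p]]]) (use Z(3)[OF x, of ?u] True chart(5)[OF chart_at(1), of y x] in "auto simp: G \<eta>")
  also have "... = s * (\<zeta> x y + \<kappa> x)"
  proof -
   have "s / q * (q * t) = s * t" if "0 < q" for q t using that by simp
   from this[OF p] show ?thesis .
  qed
  finally show ?thesis .
 next
  case False
  then have "X x y = 0"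
   using linear_0[OF linear_D[OF chart_at(1) chart_at(1) _ chart_at(2)], of y x] by (auto simp: X_def field_of_def Y_def Z(2)[OF x])
  then show ?thesis using s \<zeta>(1)[OF x] \<kappa>[OF x] bilinear_lzero[OF gx(1)] by (simp add: tangent_norm_def)
 qed
 have "tangent_norm g y (\<Sum>x\<in>P. X x y) <= 1" for y
 proof -
  have t: "tangent_norm g y w = qn (G (K y) (\<phi> (K y) y)) w" for w
   using tangent_norm_coords(2)[OF chart_at] D_id[OF chart_at] by simp
  have "tangent_norm g y (\<Sum>x\<in>P. X x y) <= (\<Sum>x\<in>P. tangent_norm g y (X x y))"
   unfolding t by (rule qn_sum_le[OF pos_def_G[OF chart_at(1)]]) (use chart_at(2) in auto)
  also have "... <= (\<Sum>x\<in>P. s * (\<zeta> x y + \<kappa> x))" using bd by (intro sum_mono)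
  also have "... = 1" using s1 by (simp add: sum_distrib_left[symmetric] sum.distrib \<zeta>(4) s_def)
  finally show ?thesis .
 qed
 then have "J (%y. \<Sum>x\<in>P. X x y) <= v" by (rule v[OF sS])
 also have "J (%y. \<Sum>x\<in>P. X x y) = (\<Sum>x\<in>P. J (X x))"
  unfolding J_def using fdiv_int[OF sX] by (simp add: divergence_sum[OF P sX sS] sum_distrib_left integral_sum)
 also have "... = (\<Sum>x\<in>P. s * (LB u. k x u * divg (Z x) u))"
 proof (rule sum.cong[OF refl])
  fix x assume x: "x \<in> P"
  have "J (X x) = (LB u. k x u * divg (%u. s *\<^sub>R Z x u) u)"
   unfolding J_def
  proof (rule integral_divergence_chart[OF sX[OF x] chart_at(1) compact_cball C(1)[OF x] f_meas])
   show "s *\<^sub>R Z x u = \<rho> (K x) u *\<^sub>R field_coords A (K x) (X x) u" if "u \<in> V (K x)" for u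
    using \<rho>_pos[OF chart_at(1) that] by (simp add: X_def field_of_coords[OF chart_at(1) that] Y_def)
   show "X x y = 0" if "y \<notin> \<psi> (K x) ` ?C x" for y
   proof (cases "y \<in> U (K x)")
    case True
    then have "\<phi> (K x) y \<notin> ?C x" using that chart(5)[OF chart_at(1) True] by (metis imageI)
    then have "Z x (\<phi> (K x) y) = 0" by (rule Z(2)[OF x])
    then show ?thesis using linear_0[OF linear_D[OF chart_at(1) chart_at(1) True chart_at(2)]]
     by (simp add: X_def field_of_def Y_def)
   qed (simp add: X_def field_of_def)
  qed (use Z(2)[OF x] C(2)[OF x] in "auto simp: k_def")
  also have "... = (LB u. s * (k x u * divg (Z x) u))"
   using Z(1)[OF x, of "Suc 0"] by (simp add: divg_scale mult.left_commute)
  finally show "J (X x) = s * (LB u. k x u * divg (Z x) u)" by simp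
 qed
 also have "... = s * (\<Sum>x\<in>P. LB u. k x u * divg (Z x) u)" by (simp add: sum_distrib_left)
 finally have "(1 + (\<Sum>x\<in>P. \<kappa> x)) * (s * (\<Sum>x\<in>P. LB u. k x u * divg (Z x) u)) <= (1 + (\<Sum>x\<in>P. \<kappa> x)) * v"
  using s1 by (intro mult_left_mono) auto
 moreover have "(1 + (\<Sum>x\<in>P. \<kappa> x)) * (s * (\<Sum>x\<in>P. LB u. k x u * divg (Z x) u)) = (\<Sum>x\<in>P. LB u. k x u * divg (Z x) u)"
  using s1 by (simp add: s_def mult.assoc[symmetric])
 ultimately show ?thesis by simp
qed

text \<open>\<open>loc_upper\<close> bounds each local quotient by the supremum over its own
  admissible fields, and \<open>upper_fields\<close> with \<open>sum_Sup_le\<close> bounds the sum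
  of these suprema. Each of the two steps contributes one factor 1 + \<kappa> r.\<close>

lemma upper:
 assumes v: "!!X. smooth_vector_field A X ==> (!!x. tangent_norm g x (X x) <= 1) ==> J X <= v"
 shows "\<exists>\<kappa>. \<forall>\<^sub>F r in at_right 0. Q r <= ennreal ((1 + \<kappa> * r) * kn * ((1 + \<kappa> * r) * v))"
proof -
 define \<Psi> where "\<Psi> x \<kappa> r1 \<longleftrightarrow> (\<forall>r h S. 0 < r --> r < r1 --> integrable lborel h --> 0 <= S -->
  (\<forall>Z. (\<forall>j. Ck_on j UNIV Z) --> (\<forall>u. u \<notin> cball (\<phi> (K x) x) (3 * \<delta> x) --> Z u = 0) -->
    (\<forall>u. qn (Gx x u) (Z u) <= sqrt (det (Gx x u)) * (\<eta> x u + \<kappa> * r)) --> (LB u. h u * divg Z u) <= S) -->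
  local_geometry.loc (Gx x) (\<eta> x) (T x) h r <= ennreal ((1 + \<kappa> * r) * kn * S))" for x \<kappa> r1
 have "\<exists>\<kappa>>0. \<exists>r1>0. \<Psi> x \<kappa> r1" if x: "x \<in> P" for x
 proof -
  interpret l: local_geometry "Gx x" "\<eta> x" "\<phi> (K x) x" "\<delta> x" "r0 x" "B x" "L x" "CARD('n)" "T x" "T' x" by (rule geometry[OF x])
  show ?thesis using l.loc_upper unfolding \<Psi>_def l.\<rho>_def kn .
 qed
 then obtain \<kappa> r1 where \<kappa>: "!!x. x \<in> P ==> 0 < \<kappa> x" "!!x. x \<in> P ==> 0 < r1 x" and up: "!!x. x \<in> P ==> \<Psi> x (\<kappa> x) (r1 x)" by metis
 define \<Lambda> where "\<Lambda> = (\<Sum>x\<in>P. \<kappa> x)"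
 have \<Lambda>: "\<kappa> x <= \<Lambda>" if "x \<in> P" for x unfolding \<Lambda>_def using P that \<kappa>(1) by (intro member_le_sum) (auto intro: less_imp_le)
 have "\<forall>\<^sub>F r in at_right (0::real). 0 < r \<and> (\<forall>x\<in>P. r < min (r1 x) (r0 x))"
 proof (intro eventually_conj eventually_at_right_less eventually_ball_finite P ballI)
  fix x assume x: "x \<in> P"
  interpret l: local_geometry "Gx x" "\<eta> x" "\<phi> (K x) x" "\<delta> x" "r0 x" "B x" "L x" "CARD('n)" "T x" "T' x" by (rule geometry[OF x])
  have "0 < min (r1 x) (r0 x)" using \<kappa>(2)[OF x] l.const(2) by simp
  then show "\<forall>\<^sub>F r in at_right (0::real). r < min (r1 x) (r0 x)" by (rule order_tendstoD(2)[OF tendsto_ident_at])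
 qed
 then have "\<forall>\<^sub>F r in at_right 0. Q r <= ennreal ((1 + \<Lambda> * r) * kn * ((1 + \<Lambda> * r) * v))"
 proof eventually_elim
  case (elim r)
  define adm where "adm x Z \<longleftrightarrow> (\<forall>j. Ck_on j UNIV Z) \<and> (\<forall>u. u \<notin> cball (\<phi> (K x) x) (3 * \<delta> x) --> Z u = 0) \<and>
   (\<forall>u. qn (Gx x u) (Z u) <= sqrt (det (Gx x u)) * (\<eta> x u + \<kappa> x * r))" for x Z
  define C where "C x = {LB u. k x u * divg Z u | Z. adm x Z}" for x
  \<comment> \<open>The zero field makes C x nonempty and its supremum nonnegative, as
    \<open>loc_upper\<close> demands of the bound.\<close>
  have C0: "0 \<in> C x" if x: "x \<in> P" for x
  proof -
   interpret l: local_geometry "Gx x" "\<eta> x" "\<phi> (K x) x" "\<delta> x" "r0 x" "B x" "L x" "CARD('n)" "T x" "T' x" by (rule geometry[OF x])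
   have "0 <= sqrt (det (Gx x u)) * (\<eta> x u + \<kappa> x * r)" for u
    using l.\<rho>(4)[of u] l.\<eta>(1)[of u] \<kappa>(1)[OF x] elim by (simp add: l.\<rho>_def)
   then have "adm x (%_. 0)" unfolding adm_def by (auto intro: Ck_on_const simp: qn_def qform_zero)
   moreover have "divg (%_::real^'n. 0) u = 0" for u by (rule divg_eq_0[OF open_UNIV]) auto
   ultimately show ?thesis unfolding C_def by (intro CollectI exI[of _ "%_. 0"]) simp
  qed
  have sum_le: "(\<Sum>x\<in>P. h x) <= (1 + \<Lambda> * r) * v" if h: "!!x. x \<in> P ==> h x \<in> C x" for h
  proof -
   have "\<forall>x\<in>P. \<exists>Z. adm x Z \<and> h x = (LB u. k x u * divg Z u)" using h by (auto simp: C_def)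
   then obtain Z where Z: "!!x. x \<in> P ==> adm x (Z x)" "!!x. x \<in> P ==> h x = (LB u. k x u * divg (Z x) u)" by metis
   have "(\<Sum>x\<in>P. h x) = (\<Sum>x\<in>P. LB u. k x u * divg (Z x) u)" by (rule sum.cong[OF refl Z(2)])
   also have "... <= (1 + (\<Sum>x\<in>P. \<kappa> x * r)) * v"
    by (rule upper_fields[OF v]) (use Z(1) \<kappa>(1) elim in "auto simp: adm_def intro: less_imp_le")
   finally show ?thesis by (simp add: \<Lambda>_def sum_distrib_right)
  qed
  have ne: "C x ~= {}" if "x \<in> P" for x using C0[OF that] by blast
  have Sup: "bdd_above (C x)" if "x \<in> P" for x
   by (rule sum_Sup_le(1)[OF P _ _ that]) (use ne sum_le in auto)
  have Sup2: "(\<Sum>x\<in>P. Sup (C x)) <= (1 + \<Lambda> * r) * v" by (rule sum_Sup_le(2)[OF P]) (use ne sum_le in auto)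
  have S0: "0 <= Sup (C x)" if "x \<in> P" for x by (rule cSup_upper[OF C0[OF that] Sup[OF that]])
  have \<Lambda>r: "0 <= \<Lambda> * r" using elim sum_nonneg[OF less_imp_le[OF \<kappa>(1)]] unfolding \<Lambda>_def by (intro mult_nonneg_nonneg) auto
  have "lc x r <= ennreal ((1 + \<Lambda> * r) * kn * Sup (C x))" if x: "x \<in> P" for x
  proof -
   have "lc x r <= ennreal ((1 + \<kappa> x * r) * kn * Sup (C x))"
    unfolding lc_def
   proof (rule up[OF x, unfolded \<Psi>_def, rule_format])
    fix Z assume "!!j. Ck_on j UNIV Z" "!!u. u \<notin> cball (\<phi> (K x) x) (3 * \<delta> x) ==> Z u = 0"
     "!!u. qn (Gx x u) (Z u) <= sqrt (det (Gx x u)) * (\<eta> x u + \<kappa> x * r)"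
    then have "(LB u. k x u * divg Z u) \<in> C x" unfolding C_def adm_def by blast
    then show "(LB u. k x u * divg Z u) <= Sup (C x)" by (rule cSup_upper[OF _ Sup[OF x]])
   qed (use elim x S0 k_int in auto)
   also have "... <= ennreal ((1 + \<Lambda> * r) * kn * Sup (C x))"
    using \<Lambda>[OF x] elim kn_pos S0[OF x] by (intro ennreal_leI mult_right_mono) (auto intro: mult_right_mono)
   finally show ?thesis .
  qed
  then have "Q r <= (\<Sum>x\<in>P. ennreal ((1 + \<Lambda> * r) * kn * Sup (C x)))"
   using elim by (subst quotient_eq) (auto intro: sum_mono)
  also have "... = ennreal ((1 + \<Lambda> * r) * kn * (\<Sum>x\<in>P. Sup (C x)))"
   unfolding sum_distrib_left using S0 kn_pos \<Lambda>r by (intro sum_ennreal) auto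
  also have "... <= ennreal ((1 + \<Lambda> * r) * kn * ((1 + \<Lambda> * r) * v))"
   using Sup2 kn_pos \<Lambda>r by (intro ennreal_leI mult_left_mono) auto
  finally show ?case .
 qed
 then show ?thesis by blast
qed

text \<open>The test field is split into the pieces \<zeta> X, whose divergences add up to that of
  X. In a chart \<open>loc_lower\<close> takes a covector, so X is lowered with the metric; it is
  then composed with the nearest point map to be Lipschitz on all of R^n.\<close>

lemma lower:
 assumes X: "smooth_vector_field A X" "!!x. tangent_norm g x (X x) <= 1" and e: "0 < e"
 shows "\<forall>\<^sub>F r in at_right 0. ennreal (kn * J X - real (card P) * e) <= ennreal (1 + e) * Q r"
proof -
 define Xx where "Xx x y = \<zeta> x y *\<^sub>R X y" for x y
 have sX: "smooth_vector_field A (Xx x)" "!!c u. c \<in> A ==> u \<in> V c ==> X\<^sub>c c (Xx x) u = \<zeta> x (\<psi> c u) *\<^sub>R X\<^sub>c c X u" if "x \<in> P" for x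
  unfolding Xx_def using smooth_vector_field_mult[OF X(1) \<zeta>(2)[OF that]] by blast+
 have sum: "(%y. \<Sum>x\<in>P. Xx x y) = X" by (simp add: Xx_def scaleR_sum_left[symmetric] \<zeta>(4))
 have JX: "J X = (\<Sum>x\<in>P. J (Xx x))"
 proof -
  have "divergence A g X y = (\<Sum>x\<in>P. divergence A g (Xx x) y)" for y
   using divergence_sum[OF P sX(1), of "%x. x"] X(1) by (simp add: sum)
  then show ?thesis unfolding J_def using fdiv_int[OF sX(1)] by (simp add: sum_distrib_left integral_sum)
 qed
 have "\<forall>\<^sub>F r in at_right 0. ennreal (kn * J (Xx x) - e) <= ennreal (1 + e) * lc x r" if x: "x \<in> P" for x
 proof -
  interpret l: local_geometry "Gx x" "\<eta> x" "\<phi> (K x) x" "\<delta> x" "r0 x" "B x" "L x" "CARD('n)" "T x" "T' x" by (rule geometry[OF x])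
  let ?c = "K x" and ?a = "\<phi> (K x) x"
  let ?p = "closest_point (S x)"
  have S: "compact (S x)" "convex (S x)" "S x ~= {}" using \<delta>(1)[OF x] by (auto simp: S_def)
  have C: "cball ?a (\<delta> x) \<subseteq> S x" "cball ?a (\<delta> x) \<subseteq> V ?c" using ballS[OF x, of 1] SV[OF x] by auto
  have V: "open (V ?c)" by (rule chart(2)[OF chart_at(1)])
  \<comment> \<open>The covector of X; applying the inverse metric to it returns the coordinates of
    X.\<close>
  define p where "p u = G ?c u *v X\<^sub>c ?c X u" for u
  have "Ck_on (Suc 0) (V ?c) p"
  proof -
   have "Ck_on (Suc 0) (V ?c) (%u. p u $ i)" for i
    unfolding p_def matrix_vector_mult_def vec_lambda_beta
    using smooth_field[OF X(1) chart_at(1), of "Suc 0" x] V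
    by (intro Ck_on_sum Ck_on_mult Ck_on_matrix_nth Ck_G chart_at) (auto simp: Ck_on_vec_iff simp del: Ck_on.simps)
   then show ?thesis using V by (simp only: Ck_on_vec_iff) simp
  qed
  from Ck1_cutoff[OF this S(1,2) SV[OF x] S(3)] obtain M where M: "0 < M" "!!u. norm (p (?p u)) <= M" "!!u w. norm (p (?p u) - p (?p w)) <= M * norm (u - w)" by blast
  have self: "?p u = u" if "\<eta> x u ~= 0" for u using l.\<eta>(3)[OF that] C(1) by (intro closest_point_self) auto
  have cancel: "matrix_inv (Gx x u) *v (Gx x u *v y) = y" for u y
   using pos_def_frame[OF l.pd] matrix_inv_cancel(1)[of "Gx x u"] by (metis matrix_vector_mul_assoc matrix_vector_mul_lid)
  have Hp: "matrix_inv (Gx x u) *v p (?p u) = X\<^sub>c ?c X (?p u)" for u using cancel[of u "X\<^sub>c ?c X (?p u)"] by (simp add: p_def Gx_def)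
  have P1: "qn (matrix_inv (Gx x u)) (p (?p u)) <= 1" if u: "\<eta> x u ~= 0" for u
  proof -
   have uV: "u \<in> V ?c" using l.\<eta>(3)[OF u] C(2) by blast
   have "qn (matrix_inv (Gx x u)) (p (?p u)) = qn (Gx x u) (X\<^sub>c ?c X u)"
    using pos_def_matrix_inv(2)[OF l.pd, of u "p (?p u)"] unfolding Hp by (simp add: self[OF u])
   also have "... = tangent_norm g (\<psi> ?c u) (X (\<psi> ?c u))"
    using tangent_norm_coords(2)[OF chart_at(1) chart(6)[OF chart_at(1) uV]] chart(7)[OF chart_at(1) uV] self[OF u]
    by (simp add: Gx_def field_coords_def tangent_to_coords_def)
   finally show ?thesis using X(2) by simp
  qed
  define Y where "Y u = (\<eta> x u * l.\<rho> u) *\<^sub>R (matrix_inv (Gx x u) *v p (?p u))" for u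
  have Y: "Y u = \<rho> ?c u *\<^sub>R X\<^sub>c ?c (Xx x) u" if "u \<in> V ?c" for u
  proof (cases "\<eta> x u = 0")
   case True then show ?thesis using that by (simp add: Y_def sX(2)[OF x chart_at(1) that] \<eta>)
  next
   case False
   then show ?thesis unfolding Y_def Hp using that self[OF False]
    by (simp add: sX(2)[OF x chart_at(1) that] \<eta> l.\<rho>_def Gx_def mult.commute)
  qed
  have Y0: "Y u = 0" if "u \<notin> cball ?a (\<delta> x)" for u using l.\<eta>(3)[of u] that by (auto simp: Y_def)
  have CY: "Ck_on 1 UNIV Y"
   by (rule Ck_zero_extension[OF V closed_cball C(2) _ Y0])
    (rule Ck_on_cong[OF V _ Ck_\<rho>X[OF sX(1)[OF x] chart_at(1)]], use Y in auto)
  have "J (Xx x) = (LB u. k x u * divg Y u)"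
   unfolding J_def
   by (rule integral_divergence_chart[OF sX(1)[OF x] chart_at(1) compact_cball C(2) f_meas Y Y0])
    (use \<zeta>(3)[OF x] C(1) in "auto simp: Xx_def k_def")
  moreover have "\<exists>r1>0. \<forall>r. 0 < r --> r < r1 --> ennreal (kn * (LB u. k x u * divg Y u) - e) <= ennreal (1 + e) * lc x r"
   using l.loc_lower[of "%u. p (?p u)" M M, OF M(3) less_imp_le[OF M(1)] M(2) P1 CY[unfolded Y_def] k_int[OF x] e] unfolding lc_def Y_def kn .
  ultimately show ?thesis by (auto simp: eventually_at_right_field)
 qed
 then have "\<forall>\<^sub>F r in at_right 0. \<forall>x\<in>P. ennreal (kn * J (Xx x) - e) <= ennreal (1 + e) * lc x r"
  using P by (simp add: eventually_ball_finite)
 moreover have "\<forall>\<^sub>F r in at_right (0::real). 0 < r \<and> (\<forall>x\<in>P. r < r0 x)"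
 proof (intro eventually_conj eventually_at_right_less eventually_ball_finite P ballI)
  fix x assume x: "x \<in> P"
  interpret l: local_geometry "Gx x" "\<eta> x" "\<phi> (K x) x" "\<delta> x" "r0 x" "B x" "L x" "CARD('n)" "T x" "T' x" by (rule geometry[OF x])
  show "\<forall>\<^sub>F r in at_right (0::real). r < r0 x" by (rule order_tendstoD(2)[OF tendsto_ident_at l.const(2)])
 qed
 ultimately show ?thesis
 proof eventually_elim
  case (elim r)
  \<comment> \<open>\<open>ennreal\<close> sends negative numbers to 0, so the local bounds are
    replaced by their positive parts before they are added.\<close>
  have "kn * J X - real (card P) * e <= (\<Sum>x\<in>P. max 0 (kn * J (Xx x) - e))"
  proof -
   have "kn * J X - real (card P) * e = (\<Sum>x\<in>P. kn * J (Xx x) - e)" by (simp add: JX sum_distrib_left sum_subtractf)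
   also have "... <= (\<Sum>x\<in>P. max 0 (kn * J (Xx x) - e))" by (intro sum_mono) simp
   finally show ?thesis .
  qed
  then have "ennreal (kn * J X - real (card P) * e) <= (\<Sum>x\<in>P. ennreal (max 0 (kn * J (Xx x) - e)))"
   by (subst sum_ennreal) (auto intro: ennreal_leI)
  also have "... <= (\<Sum>x\<in>P. ennreal (1 + e) * lc x r)" using elim(1) by (intro sum_mono) (simp add: ennreal_max_0)
  also have "... = ennreal (1 + e) * Q r" using elim(2) by (subst quotient_eq) (auto simp: sum_distrib_left intro: less_imp_le)
  finally show ?case .
 qed
qed

text \<open>Order form of the limit: values below the claimed limit are exceeded through
  \<open>lower\<close> for a nearly optimal field, and values above it through \<open>upper\<close>.
  This treats a finite and an infinite variation alike.\<close>

lemma limit: "((%r. enn2ereal (Q r)) \<longlongrightarrow> ereal kn * total_variation A g f) (at_right 0)"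
proof -
 let ?V = "total_variation A g f"
 define \<X> where "\<X> = {X. smooth_vector_field A X \<and> (\<forall>x. tangent_norm g x (X x) <= 1)}"
 have V: "?V = (SUP X\<in>\<X>. ereal (J X))" by (simp add: total_variation_def \<X>_def J_def)
 have ne: "(%x. 0) \<in> \<X>"
  using smooth_vector_field_sum[of "{}" "%_ _. 0"] bilinear_lzero[OF gx(1)] by (simp add: \<X>_def tangent_norm_def)
 have Vge: "ereal (J X) <= ?V" if "X \<in> \<X>" for X unfolding V by (rule SUP_upper[OF that])
 have Vni: "?V ~= - \<infinity>" using Vge[OF ne] by auto
 show ?thesis
 proof (rule order_tendstoI)
  fix a assume a: "a < ereal kn * ?V"
  show "\<forall>\<^sub>F r in at_right 0. a < enn2ereal (Q r)"
  proof (cases "a < 0")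
   case True
   then show ?thesis by (intro always_eventually allI) (rule less_le_trans[OF _ enn2ereal_nonneg])
  next
   case False
   with a obtain b where b: "a = ereal b" "0 <= b" by (cases a) auto
   have "ereal (b / kn) < ?V" using a kn_pos Vni by (cases ?V) (auto simp: b field_simps)
   then obtain X where X: "X \<in> \<X>" "b / kn < J X" unfolding V less_SUP_iff by auto
   define d where "d = kn * J X - b"
   have d: "0 < d" using X(2) kn_pos by (simp add: d_def field_simps)
   \<comment> \<open>e (card P + b) <= d / 2 pays for the loss \<open>card P * e\<close> and for the
     factor 1 + e in front of the quotient.\<close>
   define e where "e = d / 2 / (real (card P) + b + 1)"
   have m: "0 < real (card P) + b + 1" using b by simp
   have e: "0 < e" using d m by (simp add: e_def)
   have "e * (real (card P) + b) <= e * (real (card P) + b + 1)" using e by simp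
   also have "... = d / 2" unfolding e_def by (rule nonzero_eq_divide_eq[THEN iffD1]) (use m in auto)
   finally have ed: "b * (1 + e) < kn * J X - real (card P) * e" using d by (simp add: d_def algebra_simps)
   have "\<forall>\<^sub>F r in at_right 0. ennreal (kn * J X - real (card P) * e) <= ennreal (1 + e) * Q r"
    using X(1) e by (intro lower) (auto simp: \<X>_def)
   then show ?thesis
   proof eventually_elim
    case (elim r)
    show ?case
    proof (cases "Q r")
     case (real q)
     then have "ennreal (kn * J X - real (card P) * e) <= ennreal ((1 + e) * q)" using elim e by (simp add: ennreal_mult)
     then have "kn * J X - real (card P) * e <= (1 + e) * q" using e real by (subst (asm) ennreal_le_iff) auto
     then have "b * (1 + e) < q * (1 + e)" using ed by (simp add: mult.commute)
     then show ?thesis using e real b by simp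
    qed (simp add: b)
   qed
  qed
 next
  fix a assume a: "ereal kn * ?V < a"
  \<comment> \<open>An a above the limit exists only if the variation is finite; for an infinite one
    the lower half is the whole claim.\<close>
  have "?V ~= \<infinity>" using a kn_pos by (cases a) auto
  with Vni obtain v where v: "?V = ereal v" by (cases ?V) auto
  obtain \<kappa> where \<kappa>: "\<forall>\<^sub>F r in at_right 0. Q r <= ennreal ((1 + \<kappa> * r) * kn * ((1 + \<kappa> * r) * v))"
   using upper[of v] Vge v by (auto simp: \<X>_def)
  have "((%r. ereal ((1 + \<kappa> * r) * kn * ((1 + \<kappa> * r) * v))) \<longlongrightarrow> ereal ((1 + \<kappa> * 0) * kn * ((1 + \<kappa> * 0) * v))) (at_right 0)"
   by (intro tendsto_intros)
  then have 1: "\<forall>\<^sub>F r in at_right 0. ereal ((1 + \<kappa> * r) * kn * ((1 + \<kappa> * r) * v)) < a"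
   by (rule order_tendstoD(2)) (use a v in simp)
  have "0 <= v"
  proof -
   have "divergence A g (%x. 0) x = 0" for x
    using divergence_sum[of "{}" "%_ _. 0" x] ne by (simp add: \<X>_def)
   then show ?thesis using Vge[OF ne] v by (simp add: J_def)
  qed
  \<comment> \<open>Positivity of a absorbs the truncation at 0 in \<open>ennreal\<close>.\<close>
  then have "0 < a" using a v kn_pos by (intro le_less_trans[OF _ a]) simp
  from \<kappa> 1 show "\<forall>\<^sub>F r in at_right 0. enn2ereal (Q r) < a"
  proof eventually_elim
   case (elim r)
   let ?b = "(1 + \<kappa> * r) * kn * ((1 + \<kappa> * r) * v)"
   have "enn2ereal (Q r) <= enn2ereal (ennreal ?b)" using elim(1) by (simp add: less_eq_ennreal.rep_eq)
   also have "... = max 0 (ereal ?b)" by (simp add: ennreal.rep_eq max_def zero_ereal_def)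
   also have "... < a" using elim(2) \<open>0 < a\<close> by simp
   finally show ?case .
  qed
 qed
qed

end

theorem theorem3p13:
  fixes A :: "('a::{t2_space, second_countable_topology}, 'n::finite) chart set"
    and g :: "('a, 'n) metric_tensor"
    and f :: "'a \<Rightarrow> real"
  assumes "CARD('n) \<ge> 2"
    and "compact (UNIV :: 'a set)"
    and "connected (UNIV :: 'a set)"
    and "oriented_atlas A"
    and "riemannian_metric A g"
    and "integrable (riemannian_volume A g) f"
  shows "((\<lambda>r. enn2ereal (mean_geodesic_quotient A g f r)) \<longlongrightarrow>
           ereal (variation_const CARD('n)) * total_variation A g f) (at_right 0)"
proof -
 interpret compact_riemannian A g
  using assms by unfold_locales (auto simp: oriented_atlas_def)
 obtain P \<delta> \<zeta> where P: "finite P" and p: "!!x. x \<in> P ==> 0 < \<delta> x" "!!x. x \<in> P ==> cball (\<phi> (K x) x) (4 * \<delta> x) \<subseteq> V (K x)"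
  "!!x y. x \<in> P ==> 0 <= \<zeta> x y" "!!x y. x \<in> P ==> \<zeta> x y <= (1::real)" "!!x d k. x \<in> P ==> d \<in> A ==> Ck_on k (V d) (%u. \<zeta> x (\<psi> d u))"
  "!!x y. x \<in> P ==> \<zeta> x y ~= 0 ==> y \<in> \<psi> (K x) ` cball (\<phi> (K x) x) (\<delta> x)" "!!y. (\<Sum>x\<in>P. \<zeta> x y) = 1"
  by (rule partition_of_unity) (rule that; assumption?; blast)
 define \<eta> where "\<eta> x u = (if u \<in> V (K x) then \<zeta> x (\<psi> (K x) u) else 0)" for x u
 have ball: "cball (\<phi> (K x) x) (\<delta> x) \<subseteq> V (K x)" if "x \<in> P" for x
  using p(1)[OF that] by (intro subset_trans[OF _ p(2)[OF that]]) auto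
 have \<eta>s: "u \<in> cball (\<phi> (K x) x) (\<delta> x)" if x: "x \<in> P" and "\<eta> x u ~= 0" for x u
 proof -
  have u: "u \<in> V (K x)" "\<zeta> x (\<psi> (K x) u) ~= 0" using that(2) by (auto simp: \<eta>_def split: if_splits)
  then obtain w where w: "w \<in> cball (\<phi> (K x) x) (\<delta> x)" "\<psi> (K x) u = \<psi> (K x) w" using p(6)[OF x] by blast
  then have "u = w" using chart(7)[OF chart_at(1) u(1)] chart(7)[OF chart_at(1) subsetD[OF ball[OF x] w(1)]] by metis
  then show ?thesis using w by simp
 qed
 \<comment> \<open>One predicate holds all local data of a point, so that a single choice over P
   yields the parameters of \<open>variation\<close>.\<close>
 define \<Psi> where "\<Psi> x r0 B L T T' \<longleftrightarrow> local_geometry (%u. G (K x) (closest_point (cball (\<phi> (K x) x) (4 * \<delta> x)) u)) (\<eta> x) (\<phi> (K x) x) (\<delta> x) r0 B L CARD('n) T T' \<and>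
  (\<forall>r th u s. 0 < s --> T r (s *\<^sub>R th) u = T r th u) \<and>
  (\<forall>u\<in>cball (\<phi> (K x) x) (\<delta> x). \<forall>th r. th ~= 0 --> 0 < r --> r <= r0 --> T r th u \<in> cball (\<phi> (K x) x) (4 * \<delta> x) \<and>
   exp_map A g (\<psi> (K x) u) (r *\<^sub>R D (K x) (K (\<psi> (K x) u)) (\<psi> (K x) u) (th /\<^sub>R qn (G (K x) u) th)) = \<psi> (K x) (T r th u))" for x r0 B L T T'
 have "\<exists>r0 B L T T'. \<Psi> x r0 B L T T'" if x: "x \<in> P" for x
  unfolding \<Psi>_def
 proof (rule local_geometry_exists[OF assms(1) chart_at(1) p(1)[OF x] p(2)[OF x] _ _ _ \<eta>s[OF x]])
  show "Ck_on (Suc 0) UNIV (\<eta> x)"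
  proof (rule Ck_zero_extension[OF chart(2)[OF chart_at(1)] closed_cball ball[OF x]])
   show "Ck_on (Suc 0) (V (K x)) (\<eta> x)"
    by (rule Ck_on_cong[OF chart(2)[OF chart_at(1)] _ p(5)[OF x chart_at(1)]]) (simp add: \<eta>_def)
  qed (use \<eta>s[OF x] in blast)
  show "0 <= \<eta> x u" "\<eta> x u <= 1" for u using p(3,4)[OF x] by (auto simp: \<eta>_def)
 qed
 then obtain r0 B L T T' where "!!x. x \<in> P ==> \<Psi> x (r0 x) (B x) (L x) (T x) (T' x)" by metis
 interpret variation A g f P \<delta> \<zeta> \<eta> r0 B L T T' "variation_const CARD('n)"
  by (rule variation.intro[OF compact_riemannian_axioms], rule variation_axioms.intro)
   (use assms(1,6) P p \<open>!!x. x \<in> P ==> \<Psi> x (r0 x) (B x) (L x) (T x) (T' x)\<close> in "simp_all add: \<eta>_def \<Psi>_def")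
 show ?thesis by (rule limit)
qed

end
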